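(* Let $K$ be an arbitrary fixed non-negative integer, and let $\lambda>0$ be a fixed real number. Suppose that $|\arg a|\le\max(\omega+\pi,2\pi-\delta)<2\pi$ with an arbitrary fixed small positive $\delta$, $|a|$ is large and $N=|a(\lambda+\log\lambda+1+\pi i)|+\rho$ is a positive integer with $\rho$ being bounded. Define $R_{N,K}(a,\lambda)$ by \[ \begin{aligned} R_N(a,\lambda)=&-ie^{a(\lambda+\log\lambda+1-\pi i)}\sqrt{\frac{2\pi}{a}}\sum_{k=0}^{K-1}\frac{\gamma_k}{a^k}\widehat T_{N-k+\frac12}\bigl(a(\lambda+\log\lambda+1-\pi i)\bigr)\\ &+ie^{a(\lambda+\log\lambda+1+\pi i)}\sqrt{\frac{2\pi}{a}}\sum_{k=0}^{K-1}\frac{\gamma_k}{a^k}\widehat T_{N-k+\frac12}\bigl(a(\lambda+\log\lambda+1+\pi i)\bigr)+R_{N,K}(a,\lambda). \end{aligned} \] Then \[ R_{N,K}(a,\lambda)=\mathcal{O}_{\lambda,K,\rho}\left(\frac{e^{-|a(\lambda+\log\lambda+1+\pi i)|}}{|a|^{K+\frac12}}\right) \] for $|\arg a|\le-\omega+\pi$, and \[ R_{N,K}(a,\lambda)=\mathcal{O}_{\lambda,K,\rho,\delta}\left(\frac{e^{|a(\lambda+\log\lambda+1+\pi i)|\cos(\arg a\pm\omega)}}{|a|^{K+\frac12}}\right) \] for $-\omega+\pi\le\pm\arg a\le\max(\omega+\pi,2\pi-\delta)$ (upper signs taken together, respectively lower signs taken together).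
   Context: For $\lambda>0$, $\omega=\omega(\lambda)=\arg(\lambda+\log\lambda+1+\pi i)\in(0,\pi)$. For a positive integer $N$ and $z=\lambda a$, the remainder $R_N(a,\lambda)$ is defined by \[ \Gamma(-a,z)=z^{-a}e^{-z}\left(\sum_{n=0}^{N-1}\frac{a^n b_n(-\lambda)}{(z+a)^{2n+1}}+R_N(a,\lambda)\right) \] for $|\arg a|<-\omega+\pi$ (principal values; $\Gamma(\cdot,\cdot)$ is the upper incomplete gamma function), and is extended in $a$ to the wider region (on the Riemann surface of the logarithm) by analytic continuation. Here \[ b_n(-\lambda)=(\lambda+1)^n\left[\frac{d^n}{dt^n}\left(\frac{(\lambda+1)t}{\lambda e^t+t-\lambda}\right)^{n+1}\right]_{t=0}, \] where the function in the bracket takes the value $1$ at its removable singularity $t=0$. The Stirling coefficients $\gamma_n$ are defined by the asymptotic expansion $\Gamma^\ast(z)\sim\sum_{n=0}^\infty(-1)^n\gamma_n z^{-n}$ as $z\to+\infty$, where $\Gamma^\ast(z)=\Gamma(z)/(\sqrt{2\pi}\,z^{z-\frac12}e^{-z})$ is the scaled gamma function. The (scaled) terminant function is \[ \widehat T_p(w)=\frac{e^{\pi ip}\Gamma(p)}{2\pi i}\Gamma(1-p,w)=\frac{e^{\pi ip}w^{1-p}e^{-w}}{2\pi i}\int_0^{+\infty}\frac{t^{p-1}e^{-t}}{w+t}\,dt\qquad(p>0,\ |\arg w|<\pi), \] and is defined by analytic continuation in $w$ elsewhere (on the Riemann surface of the logarithm). In $\widehat T_p(a(\lambda+\log\lambda+1\pm\pi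 i))$ the argument of $w=a(\lambda+\log\lambda+1\pm\pi i)$ is $\arg a\pm\omega$, and $\sqrt{2\pi/a}$ is continued analytically in $a$ from its principal value. Subscripts in the $\mathcal{O}$ notation indicate the dependence of the implied constant on parameters (for $\rho$: on a bound for $|\rho|$); the estimates hold as $|a|\to\infty$ in the indicated sectors. Empty sums are zero. *)

theory Defs
  imports "HOL-Complex_Analysis.Complex_Analysis" "HOL-Library.Landau_Symbols"
begin

text \<open>
  A point \<open>a\<close> of the Riemann surface of the logarithm is represented by its logarithm \<open>s\<close>:
  \<open>a = exp s\<close>, \<open>\<bar>a\<bar> = norm (exp s)\<close>, and the (unrestricted) argument of \<open>a\<close> is \<open>Im s\<close>.
  Holomorphic functions on the whole surface are thus entire functions of \<open>s\<close>, and principal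
  values are the ones with \<open>\<bar>Im s\<bar> < pi\<close>.
\<close>

text \<open>
  The analytic continuation to the whole Riemann surface of a function given (in the coordinate
  \<open>s\<close>) on a set \<open>S\<close>.  It is unique by the identity theorem for the open strips \<open>S\<close> used below.
\<close>

definition analytic_continuation :: "(complex \<Rightarrow> complex) \<Rightarrow> complex set \<Rightarrow> complex \<Rightarrow> complex" where
  "analytic_continuation f S = (THE g. g holomorphic_on UNIV \<and> (\<forall>s\<in>S. g s = f s))"

text \<open>
  The principal value of the upper incomplete gamma function, for \<open>z\<close> not in \<open>(-\<infinity>, 0]\<close>.  The path
  of integration from \<open>z\<close> to \<open>+\<infinity>\<close> is the horizontal ray, which avoids the branch cut.
\<close>

definition upper_Gamma :: "complex \<Rightarrow> complex \<Rightarrow> complex" where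
  "upper_Gamma p z =
     integral {0..} (\<lambda>t::real. (z + of_real t) powr (p - 1) * exp (- (z + of_real t)))"

definition xi :: "real \<Rightarrow> complex" where
  "xi lam = of_real (lam + ln lam + 1) + of_real pi * \<i>"

definition omega :: "real \<Rightarrow> real" where
  "omega lam = Arg (xi lam)"

text \<open>The number \<open>b_coeff n \<lambda>\<close> is \<open>b\<^sub>n(-\<lambda>)\<close>.\<close>

definition b_coeff :: "nat \<Rightarrow> real \<Rightarrow> complex" where
  "b_coeff n lam = of_real (lam + 1) ^ n *
     (deriv ^^ n) (\<lambda>t. (if t = 0 then 1
        else of_real (lam + 1) * t / (of_real lam * exp t + t - of_real lam)) ^ (n + 1)) 0"

definition remainder_principal :: "nat \<Rightarrow> real \<Rightarrow> complex \<Rightarrow> complex" where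
  "remainder_principal N lam a = (let z = of_real lam * a in
     upper_Gamma (- a) z / (z powr (- a) * exp (- z))
       - (\<Sum>n<N. a ^ n * b_coeff n lam / (z + a) ^ (2 * n + 1)))"

text \<open>\<open>R\<^sub>N(a,\<lambda>)\<close> at the point \<open>a = exp s\<close> of the Riemann surface.\<close>

definition remainder :: "nat \<Rightarrow> real \<Rightarrow> complex \<Rightarrow> complex" where
  "remainder N lam = analytic_continuation (\<lambda>s. remainder_principal N lam (exp s))
     {s. \<bar>Im s\<bar> < - omega lam + pi}"

definition scaled_Gamma :: "real \<Rightarrow> real" where
  "scaled_Gamma x = Gamma x / (sqrt (2 * pi) * x powr (x - 1 / 2) * exp (- x))"

definition stirling_coeff :: "nat \<Rightarrow> real" where
  "stirling_coeff = (THE c. \<forall>M::nat.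
     (\<lambda>x::real. scaled_Gamma x - (\<Sum>n<M. (- 1) ^ n * c n / x ^ n)) \<in> O[at_top](\<lambda>x. 1 / x ^ M))"

definition terminant_principal :: "real \<Rightarrow> complex \<Rightarrow> complex" where
  "terminant_principal p w =
     exp (of_real pi * \<i> * of_real p) * of_real (Gamma p) / (2 * of_real pi * \<i>)
       * upper_Gamma (1 - of_real p) w"

text \<open>The scaled terminant function at the point \<open>w = exp s\<close> of the Riemann surface.\<close>

definition terminant :: "real \<Rightarrow> complex \<Rightarrow> complex" where
  "terminant p = analytic_continuation (\<lambda>s. terminant_principal p (exp s)) {s. \<bar>Im s\<bar> < pi}"

text \<open>
  The remainder \<open>R\<^sub>N\<^sub>,\<^sub>K(a,\<lambda>)\<close> of the re-expansion at \<open>a = exp s\<close>.  As \<open>Ln (xi lam)\<close> and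
  \<open>Ln (cnj (xi lam))\<close> have imaginary parts \<open>omega lam\<close> and \<open>- omega lam\<close>, the arguments of the
  terminants have the prescribed phases \<open>Im s \<plusminus> omega lam\<close>; the factor \<open>exp (- s / 2)\<close> is the
  continuation of \<open>a\<^sup>-\<^sup>1\<^sup>/\<^sup>2\<close>.
\<close>

definition reexp_remainder :: "nat \<Rightarrow> nat \<Rightarrow> real \<Rightarrow> complex \<Rightarrow> complex" where
  "reexp_remainder N K lam s = (let a = exp s; sq = of_real (sqrt (2 * pi)) * exp (- s / 2) in
     remainder N lam s -
     (- \<i> * exp (a * cnj (xi lam)) * sq *
        (\<Sum>k<K. of_real (stirling_coeff k) / a ^ k *
           terminant (real N - real k + 1 / 2) (s + Ln (cnj (xi lam))))
      + \<i> * exp (a * xi lam) * sq *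
        (\<Sum>k<K. of_real (stirling_coeff k) / a ^ k *
           terminant (real N - real k + 1 / 2) (s + Ln (xi lam)))))"

end

theory Submission imports Defs "HOL-Real_Asymp.Real_Asymp" begin

text \<open>
  Taking the phase \<open>lam * (exp v - 1) + v\<close> as integration variable makes the incomplete gamma function
  a Laplace integral. Cauchy's formula for the Taylor remainder of its integrand, with the contour
  moved to the steepest descent lines through the saddle points where the phase is \<open>- xi lam\<close> and
  \<open>- cnj (xi lam)\<close>, represents \<open>R\<^sub>N\<close> as a difference of two Mellin-Stieltjes transforms whose densities
  contain the gamma function. Inserting Stirling's series there produces the terminants, and the
  remainder of the re-expansion is the same transform of the Stirling remainder. After rotating the path by an angle of order \<open>1 / sqrt N\<close>,
  absolute values give \<open>exp (- W) / W ^ K\<close> with \<open>W = norm (a * xi lam)\<close>, because \<open>N\<close> is within a bounded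
  distance of \<open>W\<close>: the loss \<open>sqrt N\<close> at the pole is compensated by the factor \<open>W powr (- 1/2)\<close> of Stirling's formula for \<open>Gamma N\<close>.
  Beyond \<open>\<bar>arg a\<bar> = pi - omega lam\<close> the pole of the kernel crosses the path; its residue is
  the Stirling remainder at \<open>a * exp (- pi * \<i>)\<close>, which gives the larger bound. Negative phases follow by conjugation.
\<close>

section \<open>Identity theorem, parametric integrals and residues in strips\<close>

text \<open>All integrals use a logarithmic variable: a ray arg t = b becomes the line Im = b,
  continuation in the phase becomes continuation in \<open>Im sg\<close>, and one residue theorem
  for horizontal strips serves both the Cauchy remainder and the rotation of paths. The exchanges of
  integrals are done with real parameters, where the integrands are nonnegative, and the identity
  theorem carries the result into strips. For this the logarithm \<open>L\<close> of the saddle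
  value is kept as a free variable; \<open>L = Ln (xi lam)\<close> is inserted only afterwards. The
  obstacle is uniformity: \<open>N\<close> grows with the modulus of a, and the phase may come
  arbitrarily close to pi - omega, where the pole of the kernel meets the path. A fixed rotation
  angle b costs the exponentially large factor cos b powr - N, no rotation leaves the denominator
  unbounded from below; hence the shrinking angle. Stirling's series is needed for |arg| <= pi - d
  with every d > 0, since the argument of the density has phase close to -omega or omega and the
  residue sits at phase up to pi - delta. Near z = 0 the Stirling remainder blows up;
  \<open>N >= K + 1\<close> restores convergence there and holds for large |a|.\<close>

lemma islimpt_complex_reals: "(of_real x :: complex) islimpt range complex_of_real"
proof -
  have "complex_of_real x islimpt \<real>"
    unfolding islimpt_approachable
  proof safe
    fix e :: real assume "e > 0"
    then show "\<exists>x'\<in>\<real>. x' \<noteq> complex_of_real x \<and> dist x' (complex_of_real x) < e"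
      by (intro bexI[of _ "of_real (x + e/2)"]) (auto simp: dist_norm simp flip: of_real_diff)
  qed
  then show ?thesis by (simp add: Reals_def)
qed

text \<open>The real axis consists of limit points of itself. Formulas are verified for real
  parameters and carried into a region containing the axis by this.\<close>

lemma holomorphic_eq_of_eq_on_reals:
  assumes "f holomorphic_on S" "g holomorphic_on S" "open S" "connected S"
    and "range complex_of_real \<subseteq> S" "\<And>x::real. f (of_real x) = g (of_real x)" "z \<in> S"
  shows "f z = g z"
proof -
  have "f z - g z = 0"
    by (rule analytic_continuation[of "\<lambda>z. f z - g z" S "range of_real" "of_real 0"])
       (use assms islimpt_complex_reals[of 0] in \<open>auto intro!: holomorphic_intros\<close>)
  then show ?thesis by simp
qed

text \<open>The real axis alone determines an entire function, so the definite description denotes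
  as soon as one entire candidate agrees with the given function on \<open>S\<close>.\<close>

lemma analytic_continuation_eqI:
  assumes "g holomorphic_on UNIV" "range complex_of_real \<subseteq> S" "\<And>s. s \<in> S \<Longrightarrow> g s = f s"
  shows "Defs.analytic_continuation f S = g"
  unfolding Defs.analytic_continuation_def
proof (rule the_equality)
  fix h assume h: "h holomorphic_on UNIV \<and> (\<forall>s\<in>S. h s = f s)"
  show "h = g"
  proof
    fix z show "h z = g z"
      by (rule holomorphic_eq_of_eq_on_reals[where S = UNIV]) (use assms h in \<open>auto simp: subset_eq\<close>)
  qed
qed (use assms in auto)

lemma open_strip: "open {z. a < Im z \<and> Im z < b}"
  by (intro open_Collect_conj open_Collect_less continuous_intros)

lemma convex_strip: "convex {z. a < Im z \<and> Im z < b}"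
proof -
  have "{z. a < Im z \<and> Im z < b} = {z. Im z > a} \<inter> {z. Im z < b}" by auto
  then show ?thesis by (simp add: convex_Int convex_halfspace_Im_gt convex_halfspace_Im_lt)
qed

lemma connected_strip: "connected {z. a < Im z \<and> Im z < b}"
  by (rule convex_connected[OF convex_strip])

text \<open>Cauchy's inequality on small discs turns a local dominating function of \<open>f\<close>
  into one of its derivative in \<open>z\<close>, hence of the difference quotients; dominated
  convergence then differentiates under the integral. Later uses therefore have to bound
  \<open>f\<close> only, never its derivative.\<close>

lemma holomorphic_parametric_integral:
  fixes f :: "complex \<Rightarrow> 'a \<Rightarrow> complex"
  assumes "open U"
    and hol: "\<And>x. x \<in> space M \<Longrightarrow> (\<lambda>z. f z x) holomorphic_on U"
    and meas: "\<And>z. z \<in> U \<Longrightarrow> f z \<in> borel_measurable M"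
    and dom: "\<And>z0. z0 \<in> U \<Longrightarrow> \<exists>r>0. \<exists>w. integrable M w \<and> 
                 (\<forall>z\<in>ball z0 r \<inter> U. \<forall>x\<in>space M. norm (f z x) \<le> w x)"
  shows "(\<lambda>z. integral\<^sup>L M (f z)) holomorphic_on U"
proof -
  have "\<exists>D. ((\<lambda>z. integral\<^sup>L M (f z)) has_field_derivative D) (at z0)" if z0: "z0 \<in> U" for z0
  proof -
    obtain r w where r: "r > 0" and w: "integrable M w"
      and bd: "\<And>z x. z \<in> ball z0 r \<inter> U \<Longrightarrow> x \<in> space M \<Longrightarrow> norm (f z x) \<le> w x"
      using dom[OF z0] by blast
    obtain r' where r': "r' > 0" "ball z0 r' \<subseteq> U" using \<open>open U\<close> z0 openE by blast
    \<comment> \<open>Halving leaves room: discs of radius \<open>e\<close> about points of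
      \<open>ball z0 e\<close> stay in \<open>ball z0 (2*e)\<close>, where both the domination and
      holomorphy are available.\<close>
    define e where "e = min r r' / 2"
    have e: "e > 0" "ball z0 (2*e) \<subseteq> U" "ball z0 (2*e) \<subseteq> ball z0 r" "cball z0 e \<subseteq> ball z0 (2*e)"
      using r r' unfolding e_def by (auto simp: subset_eq)
    have e2: "ball z e \<subseteq> ball z0 (2*e)" if "z \<in> ball z0 e" for z
    proof
      fix y assume "y \<in> ball z e"
      with that show "y \<in> ball z0 (2*e)"
        using dist_triangle[of z0 y z] by (simp add: mem_ball)
    qed
    have bd': "norm (f z x) \<le> w x" if "z \<in> ball z0 (2*e)" "x \<in> space M" for z x
      using bd[of z x] that e by blast
    have w0: "w x \<ge> 0" if "x \<in> space M" for x
      using bd'[of z0 x] that e(1) norm_ge_zero[of "f z0 x"] by (meson centre_in_ball mult_pos_pos order_trans zero_less_numeral)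
    have db: "norm (deriv (\<lambda>z. f z x) z) \<le> 2 * w x / e" if z: "z \<in> ball z0 e" and x: "x \<in> space M" for z x
    proof -
      have sub: "cball z (e/2) \<subseteq> ball z0 (2*e)"
        using e2[OF z] e(1) by (auto simp: subset_eq)
      have h: "(\<lambda>z. f z x) holomorphic_on cball z (e/2)"
        by (rule holomorphic_on_subset[OF hol[OF x]]) (use sub e in auto)
      have "norm ((deriv ^^ 1) (\<lambda>z. f z x) z) \<le> fact 1 * w x / (e/2)^1"
      proof (rule Cauchy_inequality)
        show "(\<lambda>z. f z x) holomorphic_on ball z (e/2)"
          using h holomorphic_on_subset ball_subset_cball by blast
        show "continuous_on (cball z (e/2)) (\<lambda>z. f z x)" 
          using h holomorphic_on_imp_continuous_on by blast
        fix y assume "norm (z - y) = e/2"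
        then have "y \<in> cball z (e/2)" by (simp add: dist_norm)
        then show "norm (f y x) \<le> w x" using bd'[of y x] x sub by blast
      qed (use e in auto)
      then show ?thesis by (simp add: field_simps)
    qed
    have lip: "norm (f z x - f z0 x) \<le> 2 * w x / e * norm (z - z0)" if z: "z \<in> ball z0 e" and x: "x \<in> space M" for z x
    proof (rule field_differentiable_bound[where S = "ball z0 e" and f' = "\<lambda>z. deriv (\<lambda>z. f z x) z"])
      fix y assume y: "y \<in> ball z0 e"
      then have "y \<in> U" using e by (meson ball_subset_cball subsetD)
      then show "((\<lambda>z. f z x) has_field_derivative deriv (\<lambda>z. f z x) y) (at y within ball z0 e)"
        using hol[OF x] \<open>open U\<close> holomorphic_derivI by blast
      show "norm (deriv (\<lambda>z. f z x) y) \<le> 2 * w x / e" using db y x by blast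
    qed (use z e in auto)
    have ev: "\<forall>\<^sub>F n in sequentially. X n \<in> ball z0 e" if "X \<longlonglongrightarrow> z0" for X
      using that e(1) by (intro topological_tendstoD[OF that]) auto
    have "((\<lambda>z. integral\<^sup>L M (f z)) has_field_derivative integral\<^sup>L M (\<lambda>x. deriv (\<lambda>z. f z x) z0)) (at z0)"
      unfolding has_field_derivative_iff tendsto_at_iff_sequentially comp_def
    proof (intro allI impI)
      fix X assume X: "\<forall>i. X i \<in> UNIV - {z0}" "X \<longlonglongrightarrow> z0"
      obtain n0 where n0: "\<And>n. n \<ge> n0 \<Longrightarrow> X n \<in> ball z0 e"
        using ev[OF X(2)] unfolding eventually_sequentially by blast
      define Y where "Y n = X (n + n0)" for n
      have Y: "Y n \<in> ball z0 e" "Y n \<noteq> z0" "Y n \<in> U" for n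
        using n0[of "n+n0"] X(1) e by (auto simp: Y_def intro: subsetD[OF e(2)])
      have YL: "Y \<longlonglongrightarrow> z0" unfolding Y_def using LIMSEQ_ignore_initial_segment[OF X(2)] .
      have mY: "(\<lambda>x. (f (Y n) x - f z0 x) / (Y n - z0)) \<in> borel_measurable M" for n
        using meas[OF Y(3)] meas[OF z0] by simp
      have lim: "(\<lambda>n. (f (Y n) x - f z0 x) / (Y n - z0)) \<longlonglongrightarrow> deriv (\<lambda>z. f z x) z0" if x: "x \<in> space M" for x
      proof -
        have "((\<lambda>z. f z x) has_field_derivative deriv (\<lambda>z. f z x) z0) (at z0)"
          using hol[OF x] \<open>open U\<close> holomorphic_derivI z0 by blast
        then show ?thesis
          unfolding has_field_derivative_iff tendsto_at_iff_sequentially comp_def using Y YL by blast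
      qed
      have mD: "(\<lambda>x. deriv (\<lambda>z. f z x) z0) \<in> borel_measurable M"
        by (rule borel_measurable_LIMSEQ_metric[OF mY lim])
      have L: "(\<lambda>n. integral\<^sup>L M (\<lambda>x. (f (Y n) x - f z0 x) / (Y n - z0))) \<longlonglongrightarrow> integral\<^sup>L M (\<lambda>x. deriv (\<lambda>z. f z x) z0)"
      proof (rule integral_dominated_convergence[where w = "\<lambda>x. 2 * w x / e"])
        show "AE x in M. norm ((f (Y n) x - f z0 x) / (Y n - z0)) \<le> 2 * w x / e" for n
        proof (rule AE_I2)
          fix x assume x: "x \<in> space M"
          show "norm ((f (Y n) x - f z0 x) / (Y n - z0)) \<le> 2 * w x / e"
            using lip[OF Y(1)[of n] x] Y(2)[of n] by (simp add: norm_divide divide_le_eq)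
        qed
      qed (use mD mY w lim in auto)
      have int: "integrable M (f z)" if "z \<in> ball z0 e" for z
      proof (rule Bochner_Integration.integrable_bound[OF w])
        show "f z \<in> borel_measurable M" using meas[of z] that e by (meson ball_subset_cball subsetD)
        show "AE x in M. norm (f z x) \<le> norm (w x)"
        proof (rule AE_I2)
          fix x assume x: "x \<in> space M"
          have "z \<in> ball z0 (2*e)" using that e by (meson ball_subset_cball subsetD)
          then show "norm (f z x) \<le> norm (w x)"
            using bd'[of z x] w0[OF x] x by simp
        qed
      qed
      have D: "integral\<^sup>L M (\<lambda>x. (f (Y n) x - f z0 x) / (Y n - z0)) = (integral\<^sup>L M (f (Y n)) - integral\<^sup>L M (f z0)) / (Y n - z0)" for n
      proof -
        have "integral\<^sup>L M (\<lambda>x. f (Y n) x - f z0 x) = integral\<^sup>L M (f (Y n)) - integral\<^sup>L M (f z0)"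
          by (rule Bochner_Integration.integral_diff[OF int[OF Y(1)] int]) (use e(1) in simp)
        then show ?thesis by simp
      qed
      have "(\<lambda>n. (integral\<^sup>L M (f (Y n)) - integral\<^sup>L M (f z0)) / (Y n - z0)) \<longlonglongrightarrow> integral\<^sup>L M (\<lambda>x. deriv (\<lambda>z. f z x) z0)"
        using L unfolding D .
      then show "(\<lambda>n. (integral\<^sup>L M (f (X n)) - integral\<^sup>L M (f z0)) / (X n - z0)) \<longlonglongrightarrow> integral\<^sup>L M (\<lambda>x. deriv (\<lambda>z. f z x) z0)"
        unfolding Y_def by (rule LIMSEQ_offset)
    qed
    then show ?thesis by blast
  qed
  then show ?thesis
    using \<open>open U\<close> by (simp add: holomorphic_on_open)
qed

section \<open>Nonnegative integrals and substitutions on the real line\<close>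

text \<open>Finite inner integrals make both iterated Bochner integrals equal to
  \<open>enn2real\<close> of the same nonnegative double integral, so Tonelli's theorem applies even
  if that value is infinite.\<close>

lemma integral_swap_nonneg:
  fixes f :: "real \<Rightarrow> real \<Rightarrow> real"
  assumes m: "(\<lambda>(x,y). f x y) \<in> borel_measurable (lborel \<Otimes>\<^sub>M lborel)"
    and nn: "\<And>x y. f x y \<ge> 0"
    and i1: "\<And>x. integrable lborel (f x)" and i2: "\<And>y. integrable lborel (\<lambda>x. f x y)"
  shows "(LBINT x. LBINT y. f x y) = (LBINT y. LBINT x. f x y)"
proof -
  have m1: "(\<lambda>x. LBINT y. f x y) \<in> borel_measurable lborel"
    by (rule lborel.borel_measurable_lebesgue_integral) (use m in simp)
  have m': "(\<lambda>(y,x). f x y) \<in> borel_measurable (lborel \<Otimes>\<^sub>M lborel)"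
    using measurable_compose[OF measurable_pair_swap'[of lborel lborel] m] by (simp add: case_prod_beta)
  have m2: "(\<lambda>y. LBINT x. f x y) \<in> borel_measurable lborel"
    by (rule lborel.borel_measurable_lebesgue_integral) (use m' in simp)
  have "(LBINT x. LBINT y. f x y) = enn2real (\<integral>\<^sup>+x. ennreal (LBINT y. f x y) \<partial>lborel)"
    by (rule integral_eq_nn_integral) (use m1 nn in auto)
  also have "(\<integral>\<^sup>+x. ennreal (LBINT y. f x y) \<partial>lborel) = (\<integral>\<^sup>+x. (\<integral>\<^sup>+y. ennreal (f x y) \<partial>lborel) \<partial>lborel)"
    using nn_integral_eq_integral[OF i1] nn by simp
  also have "\<dots> = (\<integral>\<^sup>+y. (\<integral>\<^sup>+x. ennreal (f x y) \<partial>lborel) \<partial>lborel)"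
    by (rule lborel_pair.Fubini') (use m in \<open>simp add: case_prod_beta\<close>)
  also have "\<dots> = (\<integral>\<^sup>+y. ennreal (LBINT x. f x y) \<partial>lborel)"
    using nn_integral_eq_integral[OF i2] nn by simp
  also have "enn2real \<dots> = (LBINT y. LBINT x. f x y)"
    by (rule integral_eq_nn_integral[symmetric]) (use m2 nn in auto)
  finally show ?thesis .
qed


lemma abs_integrable_lborel:
  fixes f :: "real \<Rightarrow> real"
  assumes "f absolutely_integrable_on UNIV" "f \<in> borel_measurable borel"
  shows "integrable lborel f" "integral UNIV f = integral\<^sup>L lborel f"
proof -
  have 1: "integrable lebesgue f" using assms(1) by (simp add: set_integrable_def)
  then show "integrable lborel f" using assms(2) integrable_completion[of f lborel] by simp
  then show "integral UNIV f = integral\<^sup>L lborel f"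
    using integral_lborel by blast
qed

lemma real_substitution:
  fixes f g :: "real \<Rightarrow> real"
  assumes "\<And>x. (g has_field_derivative g' x) (at x)" "\<And>x. g' x > 0" "range g = S"
    "f absolutely_integrable_on S" "(\<lambda>x. g' x * f (g x)) \<in> borel_measurable borel"
  shows "integrable lborel (\<lambda>x. g' x * f (g x))" "(LBINT x. g' x * f (g x)) = integral S f"
proof -
  have "strict_mono g"
    using assms(1,2) by (intro strict_monoI) (meson DERIV_pos_imp_increasing)
  then have "inj g" by (rule strict_mono_imp_inj_on)
  then have "(\<lambda>x. \<bar>g' x\<bar> * f(g x)) absolutely_integrable_on UNIV \<and>
           integral UNIV (\<lambda>x. \<bar>g' x\<bar> * f (g x)) = integral S f"
    using has_absolute_integral_change_of_variables_1'[of UNIV g g' f "integral S f"] assms by auto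
  moreover have "(\<lambda>x. \<bar>g' x\<bar> * f(g x)) = (\<lambda>x. g' x * f (g x))" using assms(2) by (auto simp: abs_of_pos)
  ultimately have *: "(\<lambda>x. g' x * f(g x)) absolutely_integrable_on UNIV" "integral UNIV (\<lambda>x. g' x * f (g x)) = integral S f"
    by auto
  show "integrable lborel (\<lambda>x. g' x * f (g x))" by (rule abs_integrable_lborel(1)[OF *(1) assms(5)])
  show "(LBINT x. g' x * f (g x)) = integral S f" using abs_integrable_lborel(2)[OF *(1) assms(5)] *(2) by simp
qed

lemma integrable_inverse_square: "integrable lborel (\<lambda>x::real. 1 / (1 + x\<^sup>2))"
proof -
  have "range arctan = {-(pi/2)<..<pi/2}"
  proof safe
    fix x assume "x \<in> {-(pi/2)<..<pi/2}"
    then have "arctan (tan x) = x" by (intro arctan_unique) auto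
    then show "x \<in> range arctan" by (metis rangeI)
  qed (use arctan_bounded in auto)
  moreover have "(\<lambda>x::real. 1::real) absolutely_integrable_on {-(pi/2)<..<pi/2}"
    by (rule nonnegative_absolutely_integrable_1) (auto intro!: integrable_on_const)
  ultimately have "integrable lborel (\<lambda>x. inverse (1 + x\<^sup>2) * (1::real))"
    by (intro real_substitution(1)[of arctan _ "{-(pi/2)<..<pi/2}" "\<lambda>_. 1"]) 
       (auto intro!: derivative_eq_intros add_pos_nonneg)
  then show ?thesis by (simp add: inverse_eq_divide)
qed

text \<open>Euler's integral with t = c * exp x; the scale \<open>c\<close> is a translation of
  \<open>x\<close> by \<open>ln c\<close>. All gamma factors of the final estimates enter through
  this formula.\<close>

lemma gamma_log_integral:
  assumes q: "q > 0" and c: "c > (0::real)"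
  shows "integrable lborel (\<lambda>x. exp (q * x) * exp (- c * exp x))"
    and "(LBINT x. exp (q * x) * exp (- c * exp x)) = Gamma q * c powr (- q)"
proof -
  define f :: "real \<Rightarrow> real" where "f t = t powr (q - 1) / exp t" for t
  have i0: "(f has_integral Gamma q) {0..}" unfolding f_def by (rule Gamma_integral_real[OF q])
  have i1: "(f has_integral Gamma q) {0<..}"
  proof -
    have "{x \<in> {0..} - {0<..}. f x \<noteq> 0} = {}" "{x \<in> {0<..} - {0..}. f x \<noteq> 0} = {}" by (auto simp: f_def)
    then have "negligible {x \<in> {0..} - {0<..}. f x \<noteq> 0}" "negligible {x \<in> {0<..} - {0..}. f x \<noteq> 0}" by (metis negligible_empty)+
    then show ?thesis using i0 has_integral_spike_set_eq by blast
  qed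
  have i2: "f absolutely_integrable_on {0<..}"
    by (rule nonnegative_absolutely_integrable_1) (use i1 in \<open>auto simp: f_def\<close>)
  have r: "range exp = {0::real<..}"
    by (auto, metis exp_ln rangeI)
  have eq: "exp x * f (exp x) = exp (q * x) * exp (- exp x)" for x
    by (simp add: f_def powr_def left_diff_distrib exp_diff exp_minus divide_inverse)
  have m: "(\<lambda>x. exp x * f (exp x)) \<in> borel_measurable borel" unfolding eq
    by (intro borel_measurable_continuous_onI continuous_intros)
  have 1: "integrable lborel (\<lambda>x. exp x * f (exp x))" 
    by (rule real_substitution(1)[OF _ _ r i2 m]) (auto intro!: derivative_eq_intros)
  have 2: "(LBINT x. exp x * f (exp x)) = integral {0<..} f" 
    by (rule real_substitution(2)[OF _ _ r i2 m]) (auto intro!: derivative_eq_intros)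
  have 3: "integral {0<..} f = Gamma q" using i1 by blast
  have eq2: "exp (q * x) * exp (- c * exp x) = c powr (- q) * (exp (q * (ln c + 1 * x)) * exp (- exp (ln c + 1 * x)))" for x
    using c by (simp add: powr_def exp_add ring_distribs exp_minus)
  show "integrable lborel (\<lambda>x. exp (q * x) * exp (- c * exp x))"
    unfolding eq2 using lborel_integrable_real_affine[OF 1[unfolded eq], of 1 "ln c"] by simp
  have "(LBINT x. exp (q * x) * exp (- c * exp x)) = c powr (- q) * (LBINT x. exp (q * (ln c + 1 * x)) * exp (- exp (ln c + 1 * x)))"
    unfolding eq2 by simp
  also have "(LBINT x. exp (q * (ln c + 1 * x)) * exp (- exp (ln c + 1 * x))) = (LBINT x. exp (q * x) * exp (- exp x))"
    using lborel_integral_real_affine[of 1 "\<lambda>x. exp (q * x) * exp (- exp x)" "ln c"] by simp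
  finally show "(LBINT x. exp (q * x) * exp (- c * exp x)) = Gamma q * c powr (- q)"
    using 2 3 eq by simp
qed

lemma lborel_integral_shift:
  fixes f :: "real \<Rightarrow> complex"
  shows "(LBINT x. f (x + t)) = integral\<^sup>L lborel f"
  using lborel_integral_real_affine[of 1 f t] by (simp add: add.commute)

section \<open>Residue theorem in horizontal strips\<close>

lemma contour_integral_linepath_horizontal:
  assumes "Im z = c" "Im z' = c" "Re z = a" "Re z' = b" "a < b"
  shows   "contour_integral (linepath z z') f = integral {a..b} (\<lambda>x. f (Complex x c))"
proof -
  have zz': "z = Complex a c" "z' = Complex b c"
    using assms by (auto simp: complex_eq_iff)
  have "contour_integral (linepath z z') f =
         (z' - z) * integral {0..1} (\<lambda>x. f (linepath z z' x))"
    by (simp add: contour_integral_integral)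
  also have "z' - z = of_real (b - a)"
    by (simp add: zz' Complex_eq algebra_simps)
  also have "integral {0..1} (\<lambda>x. f (linepath z z' x)) =
             integral {0..1} (\<lambda>x. f (Complex (linepath a b x) c))"
    by (simp add: linepath_def Complex_eq scaleR_conv_of_real algebra_simps zz')
  also have "\<dots> = integral {0..(b - a) / (b - a)} (\<lambda>x. f (Complex (a + (b - a) * x) c))"
    using \<open>a < b\<close> by (simp add: algebra_simps linepath_def)
  also have "{0..(b - a) / (b - a)} = (\<lambda>x. x / (b - a)) ` {0..b - a}"
    using \<open>a < b\<close> by simp
  also have "integral \<dots> (\<lambda>x. f (Complex (a + (b - a) * x) c)) =
             integral {a-a..b-a} (\<lambda>x. f (Complex (x + a) c)) / of_real (b - a)"
    using \<open>a < b\<close> by (subst integral_stretch_real) (auto simp: scaleR_conv_of_real add_ac)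
  also have "\<dots> = integral {a..b} (\<lambda>x. f (Complex x c)) / of_real (b - a)"
    by (subst integral_shift_real_ivl) (rule refl)
  finally show ?thesis
    using \<open>a < b\<close> by simp
qed

lemma integral_symmetric_limit:
  fixes f :: "real \<Rightarrow> complex"
  assumes "integrable lborel f"
  shows "(\<lambda>n. integral {- real n..real n} f) \<longlonglongrightarrow> integral\<^sup>L lborel f"
proof -
  have "(\<lambda>n. LBINT x. indicator {- real n..real n} x *\<^sub>R f x) \<longlonglongrightarrow> integral\<^sup>L lborel f"
  proof (rule integral_dominated_convergence[where w = "\<lambda>x. norm (f x)"])
    show "AE x in lborel. (\<lambda>n. indicator {- real n..real n} x *\<^sub>R f x) \<longlonglongrightarrow> f x"
    proof (rule AE_I2, rule tendsto_eventually)
      fix x :: real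
      obtain m :: nat where m: "\<bar>x\<bar> \<le> real m" using real_arch_simple by blast
      show "\<forall>\<^sub>F n in sequentially. indicator {- real n..real n} x *\<^sub>R f x = f x"
        using eventually_ge_at_top[of m]
      proof eventually_elim
        case (elim n)
        then have "\<bar>x\<bar> \<le> real n" using m by simp
        then show ?case by (auto simp: indicator_def)
      qed
    qed
    show "f \<in> borel_measurable lborel" using assms by auto
    then show "(\<lambda>x. indicator {- real n..real n} x *\<^sub>R f x) \<in> borel_measurable lborel" for n by measurable
  qed (use assms in \<open>auto simp: indicator_def\<close>)
  moreover have "(LBINT x. indicator {- real n..real n} x *\<^sub>R f x) = integral {- real n..real n} f" for n
  proof -
    have "set_integrable lborel {- real n..real n} f"
      unfolding set_integrable_def by (rule integrable_mult_indicator[OF _ assms]) auto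
    from set_borel_integral_eq_integral(2)[OF this] show ?thesis by (simp add: set_lebesgue_integral_def)
  qed
  ultimately show ?thesis by simp
qed

text \<open>The residue theorem on rectangles of half-width n; the vertical sides are bounded by
  \<open>w\<close> and vanish as n grows. Counterclockwise orientation makes the lower line count
  positively and the upper one negatively.\<close>

lemma strip_residue:
  fixes q :: "complex \<Rightarrow> complex"
  assumes ab: "a' < a" "a < b" "b < b'" and fin: "finite pts" and pts: "pts \<subseteq> {z. a < Im z \<and> Im z < b}"
    and hol: "q holomorphic_on {z. a' < Im z \<and> Im z < b'} - pts"
    and inta: "integrable lborel (\<lambda>x. q (Complex x a))" and intb: "integrable lborel (\<lambda>x. q (Complex x b))"
    and dec: "\<And>x y. a \<le> y \<Longrightarrow> y \<le> b \<Longrightarrow> \<bar>x\<bar> \<ge> X0 \<Longrightarrow> norm (q (Complex x y)) \<le> w x"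
    and w: "(w \<longlongrightarrow> 0) at_top" "(w \<longlongrightarrow> 0) at_bot"
  shows "(LBINT x. q (Complex x a)) - (LBINT x. q (Complex x b)) = 2 * pi * \<i> * (\<Sum>p\<in>pts. residue q p)"
proof -
  define I where "I n = integral {- real n..real n} (\<lambda>x. q (Complex x a)) - integral {- real n..real n} (\<lambda>x. q (Complex x b))" for n
  define V where "V n = 2 * pi * \<i> * (\<Sum>p\<in>pts. residue q p) - I n" for n
  have I: "I \<longlonglongrightarrow> (LBINT x. q (Complex x a)) - (LBINT x. q (Complex x b))"
    unfolding I_def by (intro tendsto_diff integral_symmetric_limit inta intb)
  \<comment> \<open>Beyond \<open>X1\<close> all poles lie inside the rectangle and the decay
    hypothesis holds on its vertical sides.\<close>
  define X1 where "X1 = Max (insert (max 1 X0) ((\<lambda>p. \<bar>Re p\<bar> + 1) ` pts))"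
  have X1: "X1 \<ge> 1" "X1 \<ge> X0" "\<And>p. p \<in> pts \<Longrightarrow> \<bar>Re p\<bar> < X1"
  proof -
    have m: "y \<le> X1" if "y \<in> insert (max 1 X0) ((\<lambda>p. \<bar>Re p\<bar> + 1) ` pts)" for y
      unfolding X1_def using that fin by (intro Max_ge) auto
    show "X1 \<ge> 1" "X1 \<ge> X0" using m[of "max 1 X0"] by auto
    show "\<bar>Re p\<bar> < X1" if "p \<in> pts" for p using m[of "\<bar>Re p\<bar> + 1"] that by auto
  qed
  have V: "norm (V n) \<le> (w (real n) + w (- real n)) * (b - a)" if n: "real n \<ge> X1" for n
  proof -
    define A B where "A = Complex (- real n) a" and "B = Complex (real n) b"
    have n0: "real n > 0" using n X1(1) by linarith
    define l1 l2 l3 l4 where "l1 = linepath A (Complex (real n) a)" and "l2 = linepath (Complex (real n) a) B"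
      and "l3 = linepath B (Complex (- real n) b)" and "l4 = linepath (Complex (- real n) b) A"
    have rp: "rectpath A B = l1 +++ l2 +++ l3 +++ l4"
      by (simp add: rectpath_def A_def B_def l1_def l2_def l3_def l4_def Let_def)
    have pimg: "path_image (rectpath A B) \<subseteq> {z. a' < Im z \<and> Im z < b'} - pts"
    proof
      fix z assume "z \<in> path_image (rectpath A B)"
      then have "z \<in> {z. Re z \<in> {- real n, real n} \<and> Im z \<in> {a..b} \<or> Im z \<in> {a, b} \<and> Re z \<in> {- real n..real n}}"
        using path_image_rectpath[of A B] n0 ab by (simp add: A_def B_def)
      moreover have "z \<notin> pts" if "Re z = - real n \<or> Re z = real n"
        using X1(3)[of z] n that by auto
      moreover have "z \<notin> pts" if "Im z = a \<or> Im z = b"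
        using pts that by auto
      ultimately show "z \<in> {z. a' < Im z \<and> Im z < b'} - pts" using ab by auto
    qed
    have "contour_integral (rectpath A B) q = 2 * pi * \<i> * (\<Sum>p\<in>pts. winding_number (rectpath A B) p * residue q p)"
    proof (rule Residue_theorem[OF open_strip connected_strip fin hol _ _ pimg])
      show "\<forall>z. z \<notin> {z. a' < Im z \<and> Im z < b'} \<longrightarrow> winding_number (rectpath A B) z = 0"
        using ab n0 by (intro allI impI winding_number_rectpath_outside) (auto simp: A_def B_def in_cbox_complex_iff)
    qed auto
    also have "(\<Sum>p\<in>pts. winding_number (rectpath A B) p * residue q p) = (\<Sum>p\<in>pts. residue q p)"
    proof (rule sum.cong)
      fix p assume p: "p \<in> pts"
      have "p \<in> box A B" using p pts X1(3)[OF p] n by (auto simp: A_def B_def in_box_complex_iff)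
      then show "winding_number (rectpath A B) p * residue q p = residue q p" by (simp add: winding_number_rectpath)
    qed simp
    finally have R: "contour_integral (rectpath A B) q = 2 * pi * \<i> * (\<Sum>p\<in>pts. residue q p)" .
    have cont: "continuous_on ({z. a' < Im z \<and> Im z < b'} - pts) q" using hol holomorphic_on_imp_continuous_on by blast
    have ci: "q contour_integrable_on l1" "q contour_integrable_on l2" "q contour_integrable_on l3" "q contour_integrable_on l4"
      using pimg path_image_rectpath[of A B]
      unfolding rp l1_def l2_def l3_def l4_def 
      by (intro contour_integrable_continuous_linepath continuous_on_subset[OF cont]; auto simp: path_image_join A_def B_def)+
    have "contour_integral (rectpath A B) q = contour_integral l1 q + contour_integral l2 q + contour_integral l3 q + contour_integral l4 q"
      unfolding rp using ci unfolding l1_def l2_def l3_def l4_def 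
      by (simp add: contour_integrable_joinI valid_path_join)
    moreover have "contour_integral l1 q = integral {- real n..real n} (\<lambda>x. q (Complex x a))"
      unfolding l1_def by (rule contour_integral_linepath_horizontal) (use n0 in \<open>auto simp: A_def\<close>)
    moreover have "contour_integral l3 q = - integral {- real n..real n} (\<lambda>x. q (Complex x b))"
    proof -
      have "contour_integral l3 q = - contour_integral (linepath (Complex (- real n) b) B) q"
        unfolding l3_def using contour_integral_reversepath[of "linepath (Complex (- real n) b) B" q] by simp
      also have "contour_integral (linepath (Complex (- real n) b) B) q = integral {- real n..real n} (\<lambda>x. q (Complex x b))"
        by (rule contour_integral_linepath_horizontal) (use n0 in \<open>auto simp: B_def\<close>)
      finally show ?thesis .
    qed
    ultimately have "V n = contour_integral l2 q + contour_integral l4 q"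
      unfolding V_def I_def R[symmetric] by simp
    moreover have "norm (contour_integral l2 q) \<le> w (real n) * norm (B - Complex (real n) a)"
      unfolding l2_def
    proof (rule contour_integral_bound_linepath)
      show "q contour_integrable_on linepath (Complex (real n) a) B" using ci(2) by (simp add: l2_def)
      show "0 \<le> w (real n)" using dec[of a "real n"] ab n X1(2) norm_ge_zero[of "q (Complex (real n) a)"] by linarith
      fix z assume "z \<in> closed_segment (Complex (real n) a) B"
      then have "Re z = real n" "a \<le> Im z" "Im z \<le> b"
        using ab by (auto simp: B_def closed_segment_same_Re closed_segment_eq_real_ivl)
      then show "norm (q z) \<le> w (real n)" using dec[of "Im z" "real n"] n X1(2) complex_surj[of z] by simp
    qed
    moreover have "norm (contour_integral l4 q) \<le> w (- real n) * norm (A - Complex (- real n) b)"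
      unfolding l4_def
    proof (rule contour_integral_bound_linepath)
      show "q contour_integrable_on linepath (Complex (- real n) b) A" using ci(4) by (simp add: l4_def)
      show "0 \<le> w (- real n)" using dec[of a "- real n"] ab n X1(2) norm_ge_zero[of "q (Complex (- real n) a)"] by linarith
      fix z assume "z \<in> closed_segment (Complex (- real n) b) A"
      then have "Re z = - real n" "a \<le> Im z" "Im z \<le> b"
        using ab by (auto simp: A_def closed_segment_same_Re closed_segment_eq_real_ivl)
      then show "norm (q z) \<le> w (- real n)" using dec[of "Im z" "- real n"] n X1(2) complex_surj[of z] by simp
    qed
    moreover have "norm (B - Complex (real n) a) = b - a" "norm (A - Complex (- real n) b) = b - a"
      using ab by (auto simp: A_def B_def cmod_def)
    ultimately show ?thesis
      using norm_triangle_ineq[of "contour_integral l2 q" "contour_integral l4 q"] by (simp add: algebra_simps)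
  qed
  have lim: "(\<lambda>n. (w (real n) + w (- real n)) * (b - a)) \<longlonglongrightarrow> (0 + 0) * (b - a)"
  proof (intro tendsto_intros)
    show "(\<lambda>n. w (real n)) \<longlonglongrightarrow> 0" using filterlim_compose[OF w(1) filterlim_real_sequentially] .
    have "filterlim (\<lambda>n. - real n) at_bot sequentially" 
      using filterlim_real_sequentially by (simp add: filterlim_uminus_at_bot)
    then show "(\<lambda>n. w (- real n)) \<longlonglongrightarrow> 0" using filterlim_compose[OF w(2)] by blast
  qed
  have "V \<longlonglongrightarrow> 0"
  proof (rule Lim_null_comparison)
    obtain m :: nat where m: "X1 \<le> real m" using real_arch_simple by blast
    show "\<forall>\<^sub>F n in sequentially. norm (V n) \<le> (w (real n) + w (- real n)) * (b - a)"
      using eventually_ge_at_top[of m] by eventually_elim (use V m in force)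
  qed (use lim in simp)
  then have "(\<lambda>n. V n + I n) \<longlonglongrightarrow> 0 + ((LBINT x. q (Complex x a)) - (LBINT x. q (Complex x b)))"
    by (intro tendsto_add I)
  moreover have "(\<lambda>n. V n + I n) = (\<lambda>n. 2 * pi * \<i> * (\<Sum>p\<in>pts. residue q p))" by (simp add: V_def)
  ultimately have "(\<lambda>n::nat. 2 * pi * \<i> * (\<Sum>p\<in>pts. residue q p)) \<longlonglongrightarrow> (LBINT x. q (Complex x a)) - (LBINT x. q (Complex x b))"
    by simp
  from LIMSEQ_unique[OF tendsto_const this] show ?thesis by simp
qed

section \<open>Stirling's series in sectors\<close>

definition cscaled_Gamma :: "complex \<Rightarrow> complex" where
  "cscaled_Gamma z = Gamma z * exp (z - (z - 1/2) * Ln z) / of_real (sqrt (2 * pi))"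

text \<open>Since \<open>q\<close> is literally the quotient away from 0, the factorization holds
  for every \<open>u\<close>, also outside the disc; only the holomorphy of \<open>q\<close> is
  local.\<close>

lemma holomorphic_factor_zero:
  assumes "f holomorphic_on ball 0 1" "f (0::complex) = 0"
  obtains q where "q holomorphic_on ball 0 1" "\<And>u. f u = u * q u" "q 0 = deriv f 0"
proof -
  define q where "q z = (if z = 0 then deriv f 0 else (f z - f 0) / (z - 0))" for z
  have "q holomorphic_on ball 0 1"
    unfolding q_def by (rule pole_lemma[OF assms(1)]) simp
  then show ?thesis using assms(2) that[of q] by (auto simp: q_def)
qed

lemma holomorphic_Taylor_split:
  assumes "f holomorphic_on ball 0 1"
  shows "\<exists>d q. q holomorphic_on ball 0 1 \<and> (\<forall>u. f u = (\<Sum>k<m. d k * u ^ k) + u ^ m * (q u :: complex))"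
proof (induction m)
  case 0
  then show ?case using assms by auto
next
  case (Suc m)
  then obtain d q where q: "q holomorphic_on ball 0 1" "\<And>u. f u = (\<Sum>k<m. d k * u ^ k) + u ^ m * q u" by blast
  obtain r where r: "r holomorphic_on ball 0 1" "\<And>u. q u - q 0 = u * r u"
    by (rule holomorphic_factor_zero[of "\<lambda>u. q u - q 0"]) (use q in \<open>auto intro!: holomorphic_intros\<close>)
  define d' where "d' = d(m := q 0)"
  have "f u = (\<Sum>k<Suc m. d' k * u ^ k) + u ^ Suc m * r u" for u
  proof -
    have "f u = (\<Sum>k<m. d k * u ^ k) + u ^ m * (q 0 + u * r u)" using q(2)[of u] r(2)[of u] by (simp add: algebra_simps)
    also have "(\<Sum>k<m. d k * u ^ k) = (\<Sum>k<m. d' k * u ^ k)" by (intro sum.cong) (auto simp: d'_def)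
    finally show ?thesis by (simp add: d'_def algebra_simps)
  qed
  then show ?case using r(1) by blast
qed

text \<open>The factor \<open>1 + u/2\<close> cancels the quadratic term of
  \<open>Ln (1 + u)\<close>. In the proof, \<open>F\<close> has derivative \<open>G\<close>, and F,
  G and G' all vanish at 0, which allows a zero to be split off three times.\<close>

lemma Ln_plus1_expansion:
  obtains q where "q holomorphic_on ball 0 1" "\<And>u. (1 + u/2) * Ln (1 + u) - u = u ^ 3 * q u"
proof -
  define F where "F u = (1 + u/2) * Ln (1 + u) - u" for u :: complex
  define G where "G u = 1/2 * Ln (1 + u) + 1/2 * inverse (1 + u) - 1/2" for u :: complex
  have nz: "1 + u \<notin> \<real>\<^sub>\<le>\<^sub>0" if "u \<in> ball 0 1" for u :: complex
  proof
    assume "1 + u \<in> \<real>\<^sub>\<le>\<^sub>0"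
    then have "Re u \<le> -1" by (auto simp: complex_nonpos_Reals_iff)
    then show False using that abs_Re_le_cmod[of u] by simp
  qed
  have nz': "1 + u \<noteq> 0" if "u \<in> ball 0 1" for u :: complex using nz[OF that] by auto
  have L: "((\<lambda>u. Ln (1 + u)) has_field_derivative inverse (1 + u)) (at u)" if "u \<in> ball 0 1" for u
    using nz[OF that] by (auto intro!: derivative_eq_intros)
  have dF: "(F has_field_derivative G u) (at u)" if "u \<in> ball 0 1" for u
  proof -
    have A: "((\<lambda>u. 1 + u/2) has_field_derivative 1/2) (at u)" by (auto intro!: derivative_eq_intros)
    have B: "(F has_field_derivative (1/2 * Ln (1 + u) + inverse (1 + u) * (1 + u/2) - 1)) (at u)"
      unfolding F_def by (intro DERIV_diff DERIV_mult A L[OF that] DERIV_ident)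
    show ?thesis
    proof (rule DERIV_cong[OF B])
      have "i * (1/2 * y + 1/2) = 1/2 * (i * y) + 1/2 * i" for i y :: complex by (simp add: algebra_simps)
      moreover have "1 + u/2 = 1/2 * (1 + u) + 1/2" by (simp add: field_simps)
      ultimately have "inverse (1 + u) * (1 + u/2) = 1/2 * (inverse (1 + u) * (1 + u)) + 1/2 * inverse (1 + u)"
        by (simp only:)
      then show "1/2 * Ln (1 + u) + inverse (1 + u) * (1 + u/2) - 1 = G u"
        using nz'[OF that] by (simp add: G_def)
    qed
  qed
  have dG: "(G has_field_derivative 0) (at 0)"
  proof -
    have "((\<lambda>u. inverse (1 + u)) has_field_derivative (- 1)) (at (0::complex))"
      by (auto intro!: derivative_eq_intros)
    then have "(G has_field_derivative (1/2 * inverse (1 + 0) + 1/2 * (-1) - 0)) (at 0)"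
      unfolding G_def by (intro DERIV_diff DERIV_add DERIV_cmult L DERIV_const) auto
    then show ?thesis by simp
  qed
  have hF: "F holomorphic_on ball 0 1" using dF by (meson holomorphic_onI field_differentiable_at_within field_differentiable_def)
  obtain q1 where q1: "q1 holomorphic_on ball 0 1" "\<And>u. F u = u * q1 u" "q1 0 = deriv F 0"
    by (rule holomorphic_factor_zero[OF hF]) (auto simp: F_def)
  have "deriv F 0 = 0" using DERIV_imp_deriv[OF dF[of 0]] by (simp add: G_def)
  then obtain q2 where q2: "q2 holomorphic_on ball 0 1" "\<And>u. q1 u = u * q2 u"
    using holomorphic_factor_zero[OF q1(1)] q1(3) by metis
  have F2: "F u = u^2 * q2 u" for u using q1(2)[of u] q2(2)[of u] by (simp add: power2_eq_square)
  \<comment> \<open>Differentiating the factorization gives G u / u = 2 q2 u + u q2' u; its limit at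
    0 is G'(0) = 0, whence q2 0 = 0.\<close>
  have G2: "G u = 2 * u * q2 u + u^2 * deriv q2 u" if "u \<in> ball 0 1" for u
  proof -
    have "((\<lambda>u. u^2 * q2 u) has_field_derivative (2 * u * q2 u + u^2 * deriv q2 u)) (at u)"
      using holomorphic_derivI[OF q2(1) open_ball that] by (auto intro!: derivative_eq_intros)
    then have "(F has_field_derivative (2 * u * q2 u + u^2 * deriv q2 u)) (at u)" using F2 by presburger
    then show ?thesis using dF[OF that] DERIV_unique by blast
  qed
  have dq2: "continuous_on (ball 0 1) (deriv q2)" 
    using holomorphic_deriv[OF q2(1)] holomorphic_on_imp_continuous_on by blast
  have "((\<lambda>u. 2 * q2 u + u * deriv q2 u) \<longlongrightarrow> 2 * q2 0 + 0 * deriv q2 0) (at 0)"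
  proof (intro tendsto_intros)
    show "(q2 \<longlongrightarrow> q2 0) (at 0)" using holomorphic_on_imp_continuous_on[OF q2(1)]
      by (simp add: continuous_on_eq_continuous_at isCont_def)
    show "(deriv q2 \<longlongrightarrow> deriv q2 0) (at 0)" using dq2
      by (simp add: continuous_on_eq_continuous_at isCont_def)
  qed
  moreover have "((\<lambda>u. 2 * q2 u + u * deriv q2 u) \<longlongrightarrow> 0) (at 0)"
  proof (rule Lim_transform_eventually)
    show "((\<lambda>u. (G u - G 0) / (u - 0)) \<longlongrightarrow> 0) (at 0)" using dG unfolding has_field_derivative_iff .
    have "\<forall>\<^sub>F u in at 0. u \<in> ball 0 (1::real) - {0::complex}" by (intro eventually_at_in_open) auto
    then show "\<forall>\<^sub>F u in at 0. (G u - G 0) / (u - 0) = 2 * q2 u + u * deriv q2 u"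
    proof eventually_elim
      case (elim u)
      then have "G u = 2 * u * q2 u + u^2 * deriv q2 u" using G2 by blast
      moreover have "G 0 = 0" by (simp add: G_def)
      ultimately show ?case using elim by (simp add: field_simps power2_eq_square)
    qed
  qed
  ultimately have "q2 0 = 0" using tendsto_unique[of "at (0::complex)"] by fastforce
  then obtain q3 where q3: "q3 holomorphic_on ball 0 1" "\<And>u. q2 u = u * q3 u"
    using holomorphic_factor_zero[OF q2(1)] by metis
  have "(1 + u/2) * Ln (1 + u) - u = u ^ 3 * q3 u" for u
    using F2[of u] q3(2)[of u] unfolding F_def by (simp add: power2_eq_square power3_eq_cube)
  then show ?thesis using q3(1) that by blast
qed

text \<open>With u = 1/z, \<open>u / (1 + u)\<close> is 1/(z + 1), and the first quotient is the
  logarithm of the ratio of scaled gamma values at z and z + 1. Thus \<open>p\<close> solves the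
  corresponding difference equation up to order m + 2. Each induction step removes the leading
  coefficient of the error by one more monomial.\<close>

lemma Stirling_poly:
  "\<exists>p q. poly p 0 = 0 \<and> q holomorphic_on ball 0 1 \<and>
     (\<forall>u\<in>ball 0 1. ((1 + u/2) * Ln (1 + u) - u) / u - poly p u + poly p (u / (1 + u)) = u ^ (m + 2) * (q u :: complex))"
proof (induction m)
  case 0
  obtain q where q: "q holomorphic_on ball 0 1" "\<And>u. (1 + u/2) * Ln (1 + u) - u = u ^ 3 * q u"
    by (rule Ln_plus1_expansion) blast
  show ?case
    by (rule exI[of _ 0], rule exI[of _ q]) (use q in \<open>auto simp: power3_eq_cube power2_eq_square\<close>)
next
  case (Suc m)
  then obtain p q where pq: "poly p 0 = 0" "q holomorphic_on ball 0 1"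
    "\<And>u. u \<in> ball 0 1 \<Longrightarrow> ((1 + u/2) * Ln (1 + u) - u) / u - poly p u + poly p (u / (1 + u)) = u ^ (m + 2) * q u" by blast
  obtain q' where q': "q' holomorphic_on ball 0 1" "\<And>u. q u - q 0 = u * q' u"
    by (rule holomorphic_factor_zero[of "\<lambda>u. q u - q 0"]) (use pq in \<open>auto intro!: holomorphic_intros\<close>)
  have nz: "1 + u \<noteq> 0" if "u \<in> ball 0 1" for u :: complex 
  proof
    assume "1 + u = 0"
    then have "u = -1" by (simp add: add_eq_0_iff)
    then show False using that by simp
  qed
  define r where "r u = 1 - 1 / (1 + u) ^ (m + 1)" for u :: complex
  have hr: "r holomorphic_on ball 0 1" unfolding r_def by (intro holomorphic_intros) (use nz in auto)
  have "(r has_field_derivative of_nat (m + 1)) (at 0)"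
    unfolding r_def by (auto intro!: derivative_eq_intros)
  then have dr: "deriv r 0 = of_nat (m + 1)" by (rule DERIV_imp_deriv)
  obtain r1 where r1: "r1 holomorphic_on ball 0 1" "\<And>u. r u = u * r1 u" "r1 0 = deriv r 0"
    by (rule holomorphic_factor_zero[OF hr]) (auto simp: r_def)
  obtain r2 where r2: "r2 holomorphic_on ball 0 1" "\<And>u. r1 u - r1 0 = u * r2 u"
    by (rule holomorphic_factor_zero[of "\<lambda>u. r1 u - r1 0"]) (use r1 in \<open>auto intro!: holomorphic_intros\<close>)
  \<comment> \<open>The monomial c u^(m+1) changes the left-hand side by -c (u^(m+1) -
    (u/(1+u))^(m+1)), whose leading term is -c (m+1) u^(m+2); this must cancel q 0 u^(m+2).\<close>
  define c where "c = q 0 / of_nat (m + 1)"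
  have c: "c * r1 0 = q 0" unfolding c_def r1(3) dr by (simp del: of_nat_Suc)
  define p' where "p' = p + monom c (m + 1)"
  have "((1 + u/2) * Ln (1 + u) - u) / u - poly p' u + poly p' (u / (1 + u)) = u ^ (Suc m + 2) * (q' u - c * r2 u)"
    if u: "u \<in> ball 0 1" for u
  proof -
    have "((1 + u/2) * Ln (1 + u) - u) / u - poly p' u + poly p' (u / (1 + u)) = 
        u ^ (m + 2) * q u - c * (u ^ (m + 1) - (u / (1 + u)) ^ (m + 1))"
      unfolding pq(3)[OF u, symmetric] p'_def by (simp add: poly_monom algebra_simps)
    also have "u ^ (m + 1) - (u / (1 + u)) ^ (m + 1) = u ^ (m + 1) * r u"
      by (simp add: r_def power_divide algebra_simps)
    also have "u ^ (m + 2) * q u - c * (u ^ (m + 1) * r u) = u ^ (m + 2) * (q u - c * r1 u)"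
      unfolding r1(2) by (simp add: algebra_simps)
    also have "q u - c * r1 u = (q 0 + u * q' u) - c * (r1 0 + u * r2 u)"
      using q'(2)[of u] r2(2)[of u] by (simp add: algebra_simps)
    also have "\<dots> = u * (q' u - c * r2 u)" using c by (simp add: algebra_simps)
    finally show ?thesis by simp
  qed
  moreover have "poly p' 0 = 0" using pq(1) by (simp add: p'_def poly_monom)
  moreover have "(\<lambda>u. q' u - c * r2 u) holomorphic_on ball 0 1" using q' r2 by (intro holomorphic_intros)
  ultimately show ?case by blast
qed

text \<open>No branch jump occurs: the imaginary parts of \<open>Ln z\<close> and
  \<open>Ln (z + 1)\<close> have the same sign and modulus below pi, so their difference stays in
  the principal strip.\<close>

lemma Ln_plus1_diff:
  assumes "z \<notin> \<real>\<^sub>\<le>\<^sub>0"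
  shows "Ln (z + 1) - Ln z = Ln (1 + 1 / z)"
proof -
  have z: "z \<noteq> 0" "z + 1 \<noteq> 0" using assms by (auto simp: add_eq_0_iff2)
  have "Ln (z + 1) - Ln z = Ln (exp (Ln (z + 1) - Ln z))"
  proof (rule Ln_exp[symmetric])
    have b: "- pi < Im (Ln z)" "Im (Ln z) < pi" "- pi < Im (Ln (z+1))" "Im (Ln (z+1)) < pi"
      using z mpi_less_Im_Ln Im_Ln_le_pi Im_Ln_eq_pi[of z] Im_Ln_eq_pi[of "z + 1"] assms
      by (auto simp: complex_nonpos_Reals_iff less_le)
    have s: "Im (Ln z) > 0 \<longleftrightarrow> Im z > 0" "Im (Ln (z + 1)) > 0 \<longleftrightarrow> Im z > 0" "Im (Ln z) = 0 \<longleftrightarrow> Im z = 0"  "Im (Ln (z+1)) = 0 \<longleftrightarrow> Im z = 0"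
      using Im_Ln_pos_lt[of z] Im_Ln_pos_lt[of "z+1"] Im_Ln_eq_0[of z] Im_Ln_eq_0[of "z+1"] z b assms
      by (auto simp: complex_nonpos_Reals_iff)
    show "- pi < Im (Ln (z + 1) - Ln z)" "Im (Ln (z + 1) - Ln z) \<le> pi" using s b by (simp; linarith)+
  qed
  also have "exp (Ln (z + 1) - Ln z) = 1 + 1 / z"
    using z by (simp add: exp_diff field_simps)
  finally show ?thesis .
qed

lemma cscaled_Gamma_plus1:
  assumes "z \<notin> \<real>\<^sub>\<le>\<^sub>0"
  shows "cscaled_Gamma z = cscaled_Gamma (z + 1) * exp ((z + 1/2) * Ln (1 + 1/z) - 1)"
proof -
  have z: "z \<noteq> 0" "z \<notin> \<int>\<^sub>\<le>\<^sub>0" using assms nonpos_Ints_subset_nonpos_Reals by auto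
  have "cscaled_Gamma (z + 1) * exp ((z + 1/2) * Ln (1 + 1/z) - 1) = 
     Gamma z * (z * exp (z + 1 - (z + 1/2) * Ln (z + 1) + ((z + 1/2) * (Ln (z + 1) - Ln z) - 1))) / of_real (sqrt (2 * pi))"
    unfolding cscaled_Gamma_def Gamma_plus1[OF z(2)] Ln_plus1_diff[OF assms, symmetric] exp_add[of "z + 1 - _"]
    by (simp add: add_diff_eq[symmetric])
  also have "z + 1 - (z + 1/2) * Ln (z + 1) + ((z + 1/2) * (Ln (z + 1) - Ln z) - 1) = (z - (z - 1/2) * Ln z) - Ln z"
    by (simp add: algebra_simps)
  also have "z * exp ((z - (z - 1/2) * Ln z) - Ln z) = exp (z - (z - 1/2) * Ln z)"
    using z by (subst exp_diff) simp
  finally show ?thesis by (simp add: cscaled_Gamma_def)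
qed

text \<open>The law of cosines with \<open>k\<close> bounding minus the cosine of the angle: |z+t|^2
  >= |z|^2 + t^2 - 2k|z|t >= (1-k)(|z|^2 + t^2) >= (1-k)/2 (|z|+t)^2.\<close>

lemma sector_norm_bound:
  assumes "0 \<le> k" "k < 1" "Re z \<ge> - k * norm z" "t \<ge> 0"
  shows "norm (z + of_real t) \<ge> sqrt ((1 - k) / 2) * (norm z + t)"
proof -
  have "(1 - k) / 2 * (norm z + t)\<^sup>2 \<le> (1 - k) * ((norm z)\<^sup>2 + t\<^sup>2)"
  proof -
    have "(norm z + t)\<^sup>2 \<le> 2 * ((norm z)\<^sup>2 + t\<^sup>2)" 
      using zero_le_power2[of "norm z - t"] by (simp add: power2_eq_square algebra_simps)
    then have "(1 - k) / 2 * (norm z + t)\<^sup>2 \<le> (1 - k) / 2 * (2 * ((norm z)\<^sup>2 + t\<^sup>2))" using assms by (intro mult_left_mono) auto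
    then show ?thesis by (simp add: field_simps)
  qed
  also have "\<dots> \<le> (norm z)\<^sup>2 + t\<^sup>2 - 2 * k * norm z * t"
  proof -
    have "k * (norm z - t)\<^sup>2 \<ge> 0" using assms by simp
    then show ?thesis by (simp add: power2_eq_square algebra_simps)
  qed
  also have "\<dots> \<le> (norm z)\<^sup>2 + t\<^sup>2 + 2 * Re z * t"
    using mult_right_mono[OF assms(3) assms(4)] by (simp add: algebra_simps)
  also have "\<dots> = (norm (z + of_real t))\<^sup>2"
    unfolding cmod_power2 by (simp add: power2_eq_square algebra_simps)
  finally have "sqrt ((1 - k) / 2 * (norm z + t)\<^sup>2) \<le> norm (z + of_real t)"
    by (simp add: real_le_lsqrt)
  moreover have "sqrt ((1 - k) / 2 * (norm z + t)\<^sup>2) = sqrt ((1 - k) / 2) * (norm z + t)"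
    using assms by (simp only: real_sqrt_mult) simp
  ultimately show ?thesis by simp
qed

text \<open>Euler's limit \<open>Gamma_series\<close> says that Gamma(z+n)/Gamma(n) behaves like
  n^z, and the elementary factors of the scaling cancel this power. Hence the limit of the scaled
  gamma function along z + n does not depend on z.\<close>

lemma cscaled_Gamma_ratio:
  assumes z: "z \<notin> \<real>\<^sub>\<le>\<^sub>0"
  shows "(\<lambda>n. cscaled_Gamma (z + of_nat (Suc n)) / cscaled_Gamma (of_nat (Suc n))) \<longlonglongrightarrow> 1"
proof -
  have z0: "z \<noteq> 0" "z \<notin> \<int>\<^sub>\<le>\<^sub>0" using z nonpos_Ints_subset_nonpos_Reals by auto
  define A where "A n = Gamma_series z n / Gamma z" for n
  have "A \<longlonglongrightarrow> Gamma z / Gamma z"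
    unfolding A_def using z0 by (intro tendsto_divide Gamma_series_LIMSEQ tendsto_const) (auto simp: Gamma_eq_zero_iff)
  then have A: "A \<longlonglongrightarrow> 1" using z0 by (simp add: Gamma_eq_zero_iff)
  define w where "w n = z / of_nat (Suc n)" for n
  have w0: "w \<longlonglongrightarrow> 0"
    unfolding w_def by (rule LIMSEQ_Suc[OF lim_const_over_n])
  have L0: "(\<lambda>n. Ln (1 + w n)) \<longlonglongrightarrow> Ln (1 + 0)"
    by (intro tendsto_intros w0) auto
  \<comment> \<open>N Ln(1 + z/N) tends to z because Ln(1 + u) has derivative 1 at u = 0.\<close>
  have L1: "(\<lambda>n. of_nat (Suc n) * Ln (1 + w n)) \<longlonglongrightarrow> z"
  proof -
    have d: "((\<lambda>u. Ln (1 + u)) has_field_derivative 1) (at 0)"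
      by (auto intro!: derivative_eq_intros)
    have wn: "w n \<noteq> 0" for n using z0 by (simp add: w_def del: of_nat_Suc)
    have "((\<lambda>h. (Ln (1 + h) - Ln (1 + 0)) / (h - 0)) \<longlongrightarrow> 1) (at 0)"
      using d unfolding has_field_derivative_iff .
    then have "(\<lambda>n. (Ln (1 + w n) - Ln (1 + 0)) / (w n - 0)) \<longlonglongrightarrow> 1"
      unfolding tendsto_at_iff_sequentially comp_def using wn w0 by auto
    then have "(\<lambda>n. z * ((Ln (1 + w n) - Ln (1 + 0)) / (w n - 0))) \<longlonglongrightarrow> z * 1" by (intro tendsto_intros)
    moreover have "z * ((Ln (1 + w n) - Ln (1 + 0)) / (w n - 0)) = of_nat (Suc n) * Ln (1 + w n)" for n
      using z0 by (simp add: w_def del: of_nat_Suc)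
    ultimately show ?thesis by simp
  qed
  \<comment> \<open>Off by one: \<open>Gamma_series\<close> at n contains the power n^z, whereas the
    product has n + 1 factors and leads to \<open>of_nat (Suc n)\<close>.\<close>
  have L2: "(\<lambda>n. of_real (ln (real n) - ln (real (Suc n))) :: complex) \<longlonglongrightarrow> of_real 0"
  proof (rule tendsto_of_real)
    have "(\<lambda>n. ln (real n / real (Suc n))) \<longlonglongrightarrow> ln 1" 
      by (intro tendsto_ln LIMSEQ_n_over_Suc_n) simp
    moreover have "\<forall>\<^sub>F n in sequentially. ln (real n / real (Suc n)) = ln (real n) - ln (real (Suc n))"
      using eventually_gt_at_top[of 0] by eventually_elim (simp add: ln_div del: of_nat_Suc)
    ultimately show "(\<lambda>n. ln (real n) - ln (real (Suc n))) \<longlonglongrightarrow> 0"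
      using Lim_transform_eventually by fastforce
  qed
  have "(\<lambda>n. exp (z + z * of_real (ln (real n) - ln (real (Suc n))) - of_nat (Suc n) * Ln (1 + w n) - (z - 1/2) * Ln (1 + w n)) / A n) 
      \<longlonglongrightarrow> exp (z + z * of_real 0 - z - (z - 1/2) * Ln (1 + 0)) / 1"
    by (intro tendsto_intros A L0 L1 L2) auto
  then have lim: "(\<lambda>n. exp (z + z * of_real (ln (real n) - ln (real (Suc n))) - of_nat (Suc n) * Ln (1 + w n) - (z - 1/2) * Ln (1 + w n)) / A n) 
      \<longlonglongrightarrow> 1" by simp
  show ?thesis
  proof (rule Lim_transform_eventually[OF lim], rule eventuallyI)
    fix n
    define N :: complex where "N = of_nat (Suc n)"
    have N: "N \<noteq> 0" unfolding N_def by (simp del: of_nat_Suc)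
    have LnN: "Ln N = of_real (ln (real (Suc n)))" unfolding N_def by (subst Ln_of_nat) auto
    have "1 + w n \<noteq> 0"
    proof
      assume "1 + w n = 0"
      then have "z = of_real (- real (Suc n))" using N by (simp add: w_def N_def[symmetric] field_simps add_eq_0_iff2 del: of_nat_Suc)
      with z show False by (metis neg_le_0_iff_le of_nat_0_le_iff nonpos_Reals_of_real_iff)
    qed
    then have "Ln (of_real (real (Suc n)) * (1 + w n)) = of_real (ln (real (Suc n))) + Ln (1 + w n)"
      by (subst Ln_times_of_real) (auto simp del: of_nat_Suc)
    moreover have "of_real (real (Suc n)) * (1 + w n) = z + N"
      using N by (simp add: w_def N_def[symmetric] field_simps del: of_nat_Suc)
    ultimately have Lz: "Ln (z + N) = of_real (ln (real (Suc n))) + Ln (1 + w n)" by simp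
    have G: "Gamma (z + N) = pochhammer z (Suc n) * Gamma z"
      using pochhammer_Gamma[OF z0(2), of "Suc n"] z0 by (simp add: N_def Gamma_eq_zero_iff)
    have GN: "Gamma N = fact n" unfolding N_def by (simp add: Gamma_fact)
    have pz: "pochhammer z (Suc n) \<noteq> 0" using z0 by (auto simp: pochhammer_eq_0_iff)
    have "cscaled_Gamma (z + N) / cscaled_Gamma N = (pochhammer z (Suc n) * Gamma z / fact n) * 
       (exp (z + N - (z + N - 1/2) * Ln (z + N)) / exp (N - (N - 1/2) * Ln N))"
      by (simp add: cscaled_Gamma_def G GN)
    also have "pochhammer z (Suc n) * Gamma z / fact n = exp (z * of_real (ln (real n))) / A n"
      using pz by (simp add: A_def Gamma_series_def)
    also have "exp (z + N - (z + N - 1/2) * Ln (z + N)) / exp (N - (N - 1/2) * Ln N) = 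
        exp (z - (z + N - 1/2) * Ln (z + N) + (N - 1/2) * Ln N)"
      by (simp flip: exp_diff) (simp add: algebra_simps)
    also have "exp (z * of_real (ln (real n))) / A n * exp (z - (z + N - 1/2) * Ln (z + N) + (N - 1/2) * Ln N) =
        exp (z * of_real (ln (real n)) + (z - (z + N - 1/2) * Ln (z + N) + (N - 1/2) * Ln N)) / A n"
      by (simp only: exp_add times_divide_eq_left)
    also have "z * of_real (ln (real n)) + (z - (z + N - 1/2) * Ln (z + N) + (N - 1/2) * Ln N) = 
        z + z * of_real (ln (real n) - ln (real (Suc n))) - N * Ln (1 + w n) - (z - 1/2) * Ln (1 + w n)"
      unfolding Lz LnN by (simp add: algebra_simps)
    finally show "exp (z + z * of_real (ln (real n) - ln (real (Suc n))) - of_nat (Suc n) * Ln (1 + w n) - (z - 1/2) * Ln (1 + w n)) / A n =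
       cscaled_Gamma (z + of_nat (Suc n)) / cscaled_Gamma (of_nat (Suc n))"
      unfolding N_def by simp
  qed
qed

lemma sector_not_nonpos:
  assumes "0 \<le> k" "k < 1" "Re z \<ge> - k * norm z" "z \<noteq> 0"
  shows "z \<notin> \<real>\<^sub>\<le>\<^sub>0"
proof
  assume "z \<in> \<real>\<^sub>\<le>\<^sub>0"
  then obtain x where x: "z = of_real x" "x \<le> 0" by (auto elim: nonpos_Reals_cases)
  with assms have "x \<ge> k * x" "x < 0" by auto
  then have "x * (1 - k) \<ge> 0" by (simp add: algebra_simps)
  with \<open>x < 0\<close> \<open>k < 1\<close> show False by (simp add: zero_le_mult_iff)
qed

lemma nonpos_Reals_add_nat:
  assumes "(z::complex) \<notin> \<real>\<^sub>\<le>\<^sub>0" shows "z + of_nat n \<notin> \<real>\<^sub>\<le>\<^sub>0"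
  using assms by (auto simp: complex_nonpos_Reals_iff)

lemma norm_exp_minus1: "norm (exp z - 1) \<le> norm z * exp (norm (z::complex))"
proof -
  have "norm (exp z - (\<Sum>k\<le>0. z ^ k / fact k)) \<le> exp \<bar>Re z\<bar> * (norm z ^ Suc 0) / fact 0"
    by (rule Taylor_exp)
  also have "\<dots> \<le> exp (norm z) * norm z"
    using abs_Re_le_cmod[of z] by (simp add: mult_right_mono)
  finally show ?thesis by (simp add: mult.commute)
qed

text \<open>The polynomial \<open>p\<close> cancels the leading terms of the logarithm of the quotient of scaled gamma
  functions at \<open>z\<close> and \<open>z + 1\<close>, so that what remains to be telescoped is of size \<open>z\<close> to the power \<open>- m - 1\<close>.\<close>

lemma Stirling_telescoped:
  obtains p :: "complex poly" where "poly p 0 = 0"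
    "\<And>k. 0 \<le> k \<Longrightarrow> k < 1 \<Longrightarrow> \<exists>R B. R \<ge> 1 \<and> (\<forall>z. Re z \<ge> - k * norm z \<longrightarrow> norm z \<ge> R \<longrightarrow>
       (\<exists>t. summable t \<and> norm (suminf t) \<le> B / norm z ^ m \<and> (\<forall>n. cscaled_Gamma z = cscaled_Gamma (z + of_nat n) * 
          exp (poly p (1/z) - poly p (1 / (z + of_nat n)) + (\<Sum>i<n. t i)))))"
proof -
  obtain p q where pq: "poly p 0 = 0" "q holomorphic_on ball 0 1"
     "\<And>u. u \<in> ball 0 1 \<Longrightarrow> ((1 + u/2) * Ln (1 + u) - u) / u - poly p u + poly p (u / (1 + u)) = u ^ (m + 2) * (q u :: complex)"
    using Stirling_poly[of m] by blast
  have "bounded (q ` cball 0 (1/2))"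
    by (intro compact_imp_bounded compact_continuous_image holomorphic_on_imp_continuous_on holomorphic_on_subset[OF pq(2)]) auto
  then obtain B where B: "B > 0" "\<And>u. norm u \<le> 1/2 \<Longrightarrow> norm (q u) \<le> B"
    unfolding bounded_pos by auto
  have main: "\<exists>R B. R \<ge> 1 \<and> (\<forall>z. Re z \<ge> - k * norm z \<longrightarrow> norm z \<ge> R \<longrightarrow>
       (\<exists>t. summable t \<and> norm (suminf t) \<le> B / norm z ^ m \<and> (\<forall>n. cscaled_Gamma z = cscaled_Gamma (z + of_nat n) * 
          exp (poly p (1/z) - poly p (1 / (z + of_nat n)) + (\<Sum>i<n. t i)))))" if k: "0 \<le> k" "k < 1" for k
  proof -
    define d where "d = sqrt ((1 - k) / 2)"
    have d: "d > 0" "d \<le> 1" using k by (auto simp: d_def)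
    define S where "S = (\<Sum>n. 1 / (real n + 1)^2)"
    have sS: "summable (\<lambda>n. 1 / (real n + 1)^2)"
      using summable_Suc_iff[of "\<lambda>n. inverse (real n ^ 2)"] inverse_power_summable[of 2, where 'a = real]
      by (simp add: inverse_eq_divide add.commute)
    define B' where "B' = B / d ^ (m + 2)"
    have B': "B' > 0" using B d by (simp add: B'_def)
    \<comment> \<open>This radius gives |z + n| >= d (|z| + n) >= 2, so u = 1/(z+n) lies in the disc
      of radius 1/2 on which \<open>q\<close> is bounded by \<open>B\<close>.\<close>
    define R where "R = 2 / d"
    have R: "R \<ge> 1" using d by (simp add: R_def field_simps)
    have "\<exists>t. summable t \<and> norm (suminf t) \<le> (B' * S) / norm z ^ m \<and> (\<forall>n. cscaled_Gamma z = cscaled_Gamma (z + of_nat n) * 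
          exp (poly p (1/z) - poly p (1 / (z + of_nat n)) + (\<Sum>i<n. t i)))"
      if z: "Re z \<ge> - k * norm z" "norm z \<ge> R" for z
    proof -
      define h where "h w = (w + 1/2) * Ln (1 + 1/w) - 1" for w :: complex
      define t where "t n = h (z + of_nat n) - poly p (1 / (z + of_nat n)) + poly p (1 / (z + of_nat (Suc n)))" for n
      have z0: "z \<noteq> 0" "norm z \<ge> 1" using z(2) R by auto
      note zn = nonpos_Reals_add_nat[OF sector_not_nonpos[OF k z(1) z0(1)]]
      have zge: "norm (z + of_nat n) \<ge> d * (norm z + n)" for n
        using sector_norm_bound[OF k z(1), of "real n"] by (simp add: d_def)
      have tb: "norm (t n) \<le> (B' / norm z ^ m) * (1 / (real n + 1)^2)" for n
      proof -
        define u where "u = 1 / (z + of_nat n)"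
        have zz: "z + of_nat n \<noteq> 0" "z + of_nat n + 1 \<noteq> 0" using zn[of n] zn[of "Suc n"] by (auto simp: add_ac)
        have "2 \<le> d * norm z" using z(2) d by (simp add: R_def field_simps)
        also have "\<dots> \<le> d * (norm z + n)" using d by simp
        also note zge[of n]
        finally have n2: "norm (z + of_nat n) \<ge> 2" .
        then have u: "norm u \<le> 1/2" using frac_le[of 1 1 2 "norm (z + of_nat n)"] by (simp add: u_def norm_divide)
        have t: "t n = u ^ (m + 2) * q u"
        proof -
          have "u \<in> ball 0 1" using u by simp
          from pq(3)[OF this] have "u ^ (m + 2) * q u = ((1 + u/2) * Ln (1 + u) - u) / u - poly p u + poly p (u / (1 + u))" by simp
          also have "((1 + u/2) * Ln (1 + u) - u) / u = h (z + of_nat n)"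
          proof -
            have "((1 + u/2) * L - u) / u = (1 / u + 1/2) * L - 1" if "u \<noteq> 0" for L u :: complex
              using that by (simp add: field_simps)
            from this[of u "Ln (1 + u)"] show ?thesis using zz by (simp add: u_def h_def)
          qed
          also have "u / (1 + u) = 1 / (z + of_nat (Suc n))"
            using zz by (simp add: u_def field_simps)
          finally show ?thesis by (simp add: t_def u_def)
        qed
        have "norm (t n) \<le> norm u ^ (m + 2) * B"
          unfolding t norm_mult norm_power using B(2)[OF u] by (intro mult_left_mono) auto
        also have "norm u ^ (m + 2) \<le> (1 / (d * (norm z + n))) ^ (m + 2)"
          unfolding u_def norm_divide using zge[of n] d z0 by (intro power_mono frac_le) (auto intro!: mult_pos_pos add_pos_nonneg)
        also have "(1 / (d * (norm z + n))) ^ (m + 2) = 1 / d ^ (m + 2) * ((1 / (norm z + n)) ^ m * (1 / (norm z + n)) ^ 2)"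
          by (simp add: power_divide power_mult_distrib power_add power2_eq_square)
        \<comment> \<open>Of the m + 2 factors 1/(|z|+n), m keep the modulus of z and supply the
          rate, while two are replaced by 1/(n+1) and make the series converge.\<close>
        also have "\<dots> \<le> 1 / d ^ (m + 2) * ((1 / norm z) ^ m * (1 / (real n + 1)) ^ 2)"
          using z0 d by (intro mult_left_mono mult_mono power_mono divide_left_mono) (auto intro!: mult_pos_pos add_pos_nonneg)
        finally show ?thesis using B by (simp add: B'_def power_divide field_simps)
      qed
      have st: "summable (\<lambda>n. (B' / norm z ^ m) * (1 / (real n + 1)^2))" by (intro summable_mult sS)
      have sn: "summable (\<lambda>n. norm (t n))" by (rule summable_comparison_test'[OF st, of 0]) (use tb in simp)
      have "norm (suminf t) \<le> (\<Sum>n. norm (t n))" by (rule summable_norm[OF sn])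
      also have "\<dots> \<le> (\<Sum>n. (B' / norm z ^ m) * (1 / (real n + 1)^2))" by (rule suminf_le[OF tb sn st])
      also have "\<dots> = (B' / norm z ^ m) * S" unfolding S_def by (rule suminf_mult[OF sS])
      finally have 1: "norm (suminf t) \<le> (B' * S) / norm z ^ m" by simp
      have 2: "cscaled_Gamma z = cscaled_Gamma (z + of_nat n) * 
          exp (poly p (1/z) - poly p (1 / (z + of_nat n)) + (\<Sum>i<n. t i))" for n
      proof (induction n)
        case (Suc n)
        have "poly p (1/z) - poly p (1 / (z + of_nat (Suc n))) + (\<Sum>i<Suc n. t i) = 
          h (z + of_nat n) + (poly p (1/z) - poly p (1 / (z + of_nat n)) + (\<Sum>i<n. t i))" by (simp add: t_def)
        moreover have "cscaled_Gamma (z + of_nat n) = cscaled_Gamma (z + of_nat (Suc n)) * exp (h (z + of_nat n))"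
          using cscaled_Gamma_plus1[OF zn[of n]] by (simp add: h_def add_ac)
        ultimately show ?case using Suc by (simp only: exp_add mult.assoc)
      qed simp
      show ?thesis using summable_norm_cancel[OF sn] 1 2 by blast
    qed
    then show ?thesis using R by blast
  qed
  show ?thesis by (rule that[OF pq(1) main])
qed

text \<open>Telescoping with m = 0 yields a limit along one sequence of integers, and the ratio
  lemma transfers it to every other start. The constant \<open>c\<close> enters the expansion
  through its coefficients, which are identified later by uniqueness.\<close>

lemma cscaled_Gamma_limit:
  obtains c where "\<And>z. z \<notin> \<real>\<^sub>\<le>\<^sub>0 \<Longrightarrow> (\<lambda>n. cscaled_Gamma (z + of_nat n)) \<longlonglongrightarrow> c"
proof -
  obtain p :: "complex poly" where p: "poly p 0 = 0"
    "\<And>k. 0 \<le> k \<Longrightarrow> k < 1 \<Longrightarrow> \<exists>R B. R \<ge> 1 \<and> (\<forall>z. Re z \<ge> - k * norm z \<longrightarrow> norm z \<ge> R \<longrightarrow>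
       (\<exists>t. summable t \<and> norm (suminf t) \<le> B / norm z ^ 0 \<and> (\<forall>n. cscaled_Gamma z = cscaled_Gamma (z + of_nat n) * 
          exp (poly p (1/z) - poly p (1 / (z + of_nat n)) + (\<Sum>i<n. t i)))))"
    by (rule Stirling_telescoped[of 0]) blast
  obtain R B where R: "R \<ge> 1" "\<And>z. Re z \<ge> - 0 * norm z \<Longrightarrow> norm z \<ge> R \<Longrightarrow>
       (\<exists>t. summable t \<and> norm (suminf t) \<le> B / norm z ^ 0 \<and> (\<forall>n. cscaled_Gamma z = cscaled_Gamma (z + of_nat n) * 
          exp (poly p (1/z) - poly p (1 / (z + of_nat n)) + (\<Sum>i<n. t i))))"
    using p(2)[of 0] by auto
  obtain m :: nat where m: "R \<le> real m" using real_arch_simple by blast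
  define z :: complex where "z = of_nat m"
  obtain t where t: "summable t" "\<And>n. cscaled_Gamma z = cscaled_Gamma (z + of_nat n) * 
          exp (poly p (1/z) - poly p (1 / (z + of_nat n)) + (\<Sum>i<n. t i))"
    using R(2)[of z] m by (auto simp: z_def)
  have e: "cscaled_Gamma (z + of_nat n) = cscaled_Gamma z * exp (- (poly p (1/z) - poly p (1 / (z + of_nat n)) + (\<Sum>i<n. t i)))" for n
    unfolding t(2)[of n] mult.assoc exp_add[symmetric] by simp
  have inv0: "(\<lambda>n. 1 / (w + of_nat n)) \<longlonglongrightarrow> 0" for w :: complex
    by (intro tendsto_divide_0[OF tendsto_const] tendsto_add_filterlim_at_infinity[OF tendsto_const] tendsto_of_nat)
  have "(\<lambda>n. cscaled_Gamma z * exp (- (poly p (1/z) - poly p (1 / (z + of_nat n)) + (\<Sum>i<n. t i)))) \<longlonglongrightarrow> 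
       cscaled_Gamma z * exp (- (poly p (1/z) - poly p 0 + suminf t))"
    by (intro tendsto_intros inv0 summable_LIMSEQ t(1))
  then obtain c where c: "(\<lambda>n. cscaled_Gamma (z + of_nat n)) \<longlonglongrightarrow> c" unfolding e[symmetric] by blast
  then have "(\<lambda>n. cscaled_Gamma (of_nat (n + m))) \<longlonglongrightarrow> c" by (simp add: z_def add.commute)
  then have "(\<lambda>n. cscaled_Gamma (of_nat n)) \<longlonglongrightarrow> c" by (rule LIMSEQ_offset)
  then have c1: "(\<lambda>n. cscaled_Gamma (of_nat (Suc n))) \<longlonglongrightarrow> c" by (rule LIMSEQ_Suc)
  show ?thesis
  proof (rule that)
    fix z :: complex assume z: "z \<notin> \<real>\<^sub>\<le>\<^sub>0"
    have nz: "cscaled_Gamma (of_nat (Suc n)) \<noteq> 0" for n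
      unfolding cscaled_Gamma_def using of_nat_in_nonpos_Ints_iff by (auto simp: Gamma_eq_zero_iff simp del: of_nat_Suc)
    have "(\<lambda>n. cscaled_Gamma (z + of_nat (Suc n)) / cscaled_Gamma (of_nat (Suc n)) * cscaled_Gamma (of_nat (Suc n))) \<longlonglongrightarrow> 1 * c"
      by (intro tendsto_mult cscaled_Gamma_ratio z c1)
    then have "(\<lambda>n. cscaled_Gamma (z + of_nat (Suc n))) \<longlonglongrightarrow> c" using nz by simp
    then show "(\<lambda>n. cscaled_Gamma (z + of_nat n)) \<longlonglongrightarrow> c" by (rule LIMSEQ_imp_Suc)
  qed
qed

text \<open>Letting n tend to infinity in the telescoped identity gives c exp(p(1/z) + T) with T of
  order |z|^-m; the coefficients are those of the Taylor polynomial of c exp(p u). Since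
  \<open>p\<close> was chosen before the sector, \<open>d\<close> is the same for all
  \<open>k\<close>.\<close>

lemma cscaled_Gamma_expansion:
  "\<exists>d. \<forall>k. 0 \<le> k \<longrightarrow> k < 1 \<longrightarrow> (\<exists>R\<ge>1. \<exists>B. \<forall>z. Re z \<ge> - k * norm z \<longrightarrow> norm z \<ge> R \<longrightarrow>
     norm (cscaled_Gamma z - (\<Sum>j<m. d j / z ^ j)) \<le> B / norm z ^ m)"
proof -
  obtain c where c: "\<And>z. z \<notin> \<real>\<^sub>\<le>\<^sub>0 \<Longrightarrow> (\<lambda>n. cscaled_Gamma (z + of_nat n)) \<longlonglongrightarrow> c"
    using cscaled_Gamma_limit by blast
  obtain p :: "complex poly" where p: "poly p 0 = 0"
    "\<And>k. 0 \<le> k \<Longrightarrow> k < 1 \<Longrightarrow> \<exists>R B. R \<ge> 1 \<and> (\<forall>z. Re z \<ge> - k * norm z \<longrightarrow> norm z \<ge> R \<longrightarrow>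
       (\<exists>t. summable t \<and> norm (suminf t) \<le> B / norm z ^ m \<and> (\<forall>n. cscaled_Gamma z = cscaled_Gamma (z + of_nat n) * 
          exp (poly p (1/z) - poly p (1 / (z + of_nat n)) + (\<Sum>i<n. t i)))))"
    by (rule Stirling_telescoped[of m]) blast
  define f where "f u = c * exp (poly p u)" for u
  have hf: "f holomorphic_on UNIV" unfolding f_def by (intro holomorphic_intros)
  obtain d q where q: "q holomorphic_on ball 0 1" "\<And>u. f u = (\<Sum>k<m. d k * u ^ k) + u ^ m * q u"
    using holomorphic_Taylor_split[of f m] hf holomorphic_on_subset by blast
  have "bounded (q ` cball 0 (1/2))"
    by (intro compact_imp_bounded compact_continuous_image holomorphic_on_imp_continuous_on holomorphic_on_subset[OF q(1)]) auto
  then obtain B1 where B1: "B1 > 0" "\<And>u. norm u \<le> 1/2 \<Longrightarrow> norm (q u) \<le> B1"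
    unfolding bounded_pos by auto
  have "bounded (f ` cball 0 1)"
    by (intro compact_imp_bounded compact_continuous_image holomorphic_on_imp_continuous_on holomorphic_on_subset[OF hf]) auto
  then obtain B2 where B2: "B2 > 0" "\<And>u. norm u \<le> 1 \<Longrightarrow> norm (f u) \<le> B2"
    unfolding bounded_pos by auto
  have "\<exists>R\<ge>1. \<exists>B. \<forall>z. Re z \<ge> - k * norm z \<longrightarrow> norm z \<ge> R \<longrightarrow>
     norm (cscaled_Gamma z - (\<Sum>j<m. d j / z ^ j)) \<le> B / norm z ^ m" if k: "0 \<le> k" "k < 1" for k
  proof -
    obtain R B where R: "R \<ge> 1" "\<And>z. Re z \<ge> - k * norm z \<Longrightarrow> norm z \<ge> R \<Longrightarrow>
       (\<exists>t. summable t \<and> norm (suminf t) \<le> B / norm z ^ m \<and> (\<forall>n. cscaled_Gamma z = cscaled_Gamma (z + of_nat n) * 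
          exp (poly p (1/z) - poly p (1 / (z + of_nat n)) + (\<Sum>i<n. t i))))"
      using p(2)[OF k] by auto
    define C where "C = B2 * (\<bar>B\<bar> * exp \<bar>B\<bar>) + B1"
    have "norm (cscaled_Gamma z - (\<Sum>j<m. d j / z ^ j)) \<le> C / norm z ^ m"
      if z: "Re z \<ge> - k * norm z" "norm z \<ge> max R 2" for z
    proof -
      have z0: "z \<noteq> 0" "norm z \<ge> 1" "norm z \<ge> 2" using z(2) R(1) by auto
      obtain t where t: "summable t" "norm (suminf t) \<le> B / norm z ^ m" "\<And>n. cscaled_Gamma z = cscaled_Gamma (z + of_nat n) * 
          exp (poly p (1/z) - poly p (1 / (z + of_nat n)) + (\<Sum>i<n. t i))"
        using R(2)[OF z(1)] z(2) by auto
      define T where "T = suminf t"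
      have inv0: "(\<lambda>n. 1 / (z + of_nat n)) \<longlonglongrightarrow> 0"
        by (intro tendsto_divide_0[OF tendsto_const] tendsto_add_filterlim_at_infinity[OF tendsto_const] tendsto_of_nat)
      have "(\<lambda>n. cscaled_Gamma (z + of_nat n) * exp (poly p (1/z) - poly p (1 / (z + of_nat n)) + (\<Sum>i<n. t i))) \<longlonglongrightarrow>
           c * exp (poly p (1/z) - poly p 0 + T)"
        unfolding T_def by (intro tendsto_intros inv0 summable_LIMSEQ t(1) c sector_not_nonpos[OF k z(1) z0(1)])
      then have "cscaled_Gamma z = c * exp (poly p (1/z) - poly p 0 + T)"
        unfolding t(3)[symmetric] by (simp add: LIMSEQ_const_iff)
      then have S: "cscaled_Gamma z = f (1/z) * exp T" using p(1) by (simp add: f_def exp_add)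
      have nT: "norm T \<le> \<bar>B\<bar> / norm z ^ m" using t(2) unfolding T_def by (rule order_trans) (simp add: divide_right_mono)
      also have "\<dots> \<le> \<bar>B\<bar> / 1" using z0 by (intro divide_left_mono) (auto simp: one_le_power)
      finally have nT': "norm T \<le> \<bar>B\<bar>" by simp
      have fz: "norm (f (1/z)) \<le> B2" using z0 by (intro B2(2)) (simp add: norm_divide)
      have qz: "norm (q (1/z)) \<le> B1" using z0 by (intro B1(2)) (simp add: norm_divide)
      have "cscaled_Gamma z - (\<Sum>j<m. d j / z ^ j) = f (1/z) * (exp T - 1) + (1/z) ^ m * q (1/z)"
      proof -
        have "(\<Sum>j<m. d j / z ^ j) = f (1/z) - (1/z) ^ m * q (1/z)"
          using q(2)[of "1/z"] by (simp add: power_one_over)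
        then show ?thesis unfolding S by (simp add: algebra_simps)
      qed
      also have "norm \<dots> \<le> norm (f (1/z)) * norm (exp T - 1) + norm ((1/z) ^ m) * norm (q (1/z))"
        by (metis norm_mult norm_triangle_ineq)
      also have "norm (f (1/z)) * norm (exp T - 1) \<le> B2 * (\<bar>B\<bar> / norm z ^ m * exp \<bar>B\<bar>)"
      proof (intro mult_mono fz)
        show "norm (exp T - 1) \<le> \<bar>B\<bar> / norm z ^ m * exp \<bar>B\<bar>"
          by (rule order_trans[OF norm_exp_minus1]) (intro mult_mono nT, use nT' in auto)
      qed (use B2 in auto)
      also have "norm ((1/z) ^ m) * norm (q (1/z)) \<le> (1 / norm z ^ m) * B1"
        using qz by (intro mult_mono) (auto simp: norm_power norm_divide power_one_over)
      finally show ?thesis by (simp add: C_def add_divide_distrib mult.assoc)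
    qed
    then show ?thesis using R(1) by (intro exI[of _ "max R 2"] conjI exI[of _ C]) auto
  qed
  then show ?thesis by blast
qed

section \<open>Uniqueness of the expansion and the Stirling coefficients\<close>

text \<open>Once the earlier coefficients vanish, multiplication by x^j isolates \<open>e j\<close>
  as x tends to infinity, while the bound becomes B x^(j-m) and tends to 0.\<close>

lemma asymptotic_coeffs_zero:
  fixes e :: "nat \<Rightarrow> complex"
  assumes "\<And>x::real. x \<ge> R \<Longrightarrow> norm (\<Sum>j<m. e j / of_real x ^ j) \<le> B / x ^ m" "j < m"
  shows "e j = 0"
  using assms(2)
proof (induction j rule: less_induct)
  case (less j)
  have lim: "((\<lambda>x::real. (\<Sum>i<m. e i / of_real x ^ i) * of_real x ^ j) \<longlongrightarrow> e j) at_top"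
  proof (rule Lim_transform_eventually)
    have "((\<lambda>x::real. (\<Sum>i\<in>{j<..<m}. e i * (inverse (of_real x)) ^ (i - j)) + e j) \<longlongrightarrow> (\<Sum>i\<in>{j<..<m}. e i * 0 ^ (i - j)) + e j) at_top"
    proof (intro tendsto_intros)
      show "((\<lambda>x. inverse (complex_of_real x)) \<longlongrightarrow> 0) at_top"
        using tendsto_of_real[OF tendsto_inverse_0_at_top[OF filterlim_ident], where 'a = complex] by (simp add: of_real_inverse)
    qed
    also have "(\<Sum>i\<in>{j<..<m}. e i * 0 ^ (i - j)) = 0" by (intro sum.neutral) auto
    also have "0 + e j = e j" by simp
    finally show "((\<lambda>x::real. (\<Sum>i\<in>{j<..<m}. e i * (inverse (of_real x)) ^ (i - j)) + e j) \<longlongrightarrow> e j) at_top" .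
    show "\<forall>\<^sub>F x::real in at_top. (\<Sum>i\<in>{j<..<m}. e i * (inverse (of_real x)) ^ (i - j)) + e j = (\<Sum>i<m. e i / of_real x ^ i) * of_real x ^ j"
      using eventually_gt_at_top[of 0]
    proof eventually_elim
      case (elim x)
      have "{..<m} = {..<j} \<union> insert j {j<..<m}" using less.prems by auto
      then have "(\<Sum>i<m. e i / of_real x ^ i) = (\<Sum>i<j. e i / of_real x ^ i) + (\<Sum>i\<in>insert j {j<..<m}. e i / of_real x ^ i)"
        by (simp add: sum.union_disjoint disjoint_iff)
      also have "(\<Sum>i<j. e i / of_real x ^ i) = 0" using less by (intro sum.neutral) auto
      finally have "(\<Sum>i<m. e i / of_real x ^ i) = e j / of_real x ^ j + (\<Sum>i\<in>{j<..<m}. e i / of_real x ^ i)" by simp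
      moreover have "(\<Sum>i\<in>{j<..<m}. e i / of_real x ^ i) * of_real x ^ j = (\<Sum>i\<in>{j<..<m}. e i * (inverse (of_real x)) ^ (i - j))"
        unfolding sum_distrib_right
        using elim by (intro sum.cong) (auto simp: power_diff field_simps)
      ultimately show ?case using elim by (simp add: algebra_simps)
    qed
  qed
  moreover have "((\<lambda>x::real. (\<Sum>i<m. e i / of_real x ^ i) * of_real x ^ j) \<longlongrightarrow> 0) at_top"
  proof (rule Lim_null_comparison)
    show "\<forall>\<^sub>F x::real in at_top. norm ((\<Sum>i<m. e i / of_real x ^ i) * of_real x ^ j) \<le> B * (inverse x) ^ (m - j)"
      using eventually_ge_at_top[of "max R 1"]
    proof eventually_elim
      case (elim x)
      have "norm ((\<Sum>i<m. e i / of_real x ^ i) * of_real x ^ j) \<le> (B / x ^ m) * x ^ j"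
        unfolding norm_mult using assms(1)[of x] order_trans[OF norm_ge_zero assms(1)[of x]] elim by (intro mult_mono) (auto simp: norm_power)
      also have "\<dots> = B * (inverse x) ^ (m - j)" using elim less.prems by (simp add: power_diff field_simps)
      finally show ?case .
    qed
    have "((\<lambda>x::real. B * (inverse x) ^ (m - j)) \<longlongrightarrow> B * 0 ^ (m - j)) at_top"
      by (intro tendsto_intros tendsto_inverse_0_at_top filterlim_ident)
    then show "((\<lambda>x::real. B * (inverse x) ^ (m - j)) \<longlongrightarrow> 0) at_top" using less.prems by (simp add: power_0_left)
  qed
  ultimately show ?case using tendsto_unique trivial_limit_at_top_linorder by blast
qed

lemma of_real_scaled_Gamma:
  assumes "x > 0" shows "of_real (scaled_Gamma x) = cscaled_Gamma (of_real x)"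
proof -
  have "x powr (x - 1/2) = exp ((x - 1/2) * ln x)" using assms by (simp add: powr_def)
  moreover have "g / (c * exp X * exp (- x)) = g * exp (x - X) / c" for g c X
    by (simp add: exp_diff exp_minus divide_inverse)
  ultimately have "scaled_Gamma x = Gamma x * exp (x - (x - 1/2) * ln x) / sqrt (2 * pi)"
    unfolding scaled_Gamma_def by (simp only:)
  then show ?thesis
    using assms by (simp add: cscaled_Gamma_def Gamma_complex_of_real[symmetric] Ln_of_real exp_of_real[symmetric])
qed

text \<open>The condition \<open>Re z >= - k * norm z\<close> is |arg z| <= pi - arccos k, stated
  without an argument function. Only the radius and the constant depend on the sector, not
  \<open>d\<close>.\<close>

definition has_sector_expansion :: "(complex \<Rightarrow> complex) \<Rightarrow> (nat \<Rightarrow> complex) \<Rightarrow> nat \<Rightarrow> bool" where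
  "has_sector_expansion f d m \<longleftrightarrow> (\<forall>k. 0 \<le> k \<longrightarrow> k < 1 \<longrightarrow> (\<exists>R\<ge>1. \<exists>B. \<forall>z. Re z \<ge> - k * norm z \<longrightarrow> norm z \<ge> R \<longrightarrow>
     norm (f z - (\<Sum>j<m. d j / z ^ j)) \<le> B / norm z ^ m))"

lemma has_sector_expansion_truncate:
  assumes "has_sector_expansion f d m" "n \<le> m"
  shows "has_sector_expansion f d n"
  unfolding has_sector_expansion_def
proof (intro allI impI)
  fix k :: real assume "0 \<le> k" "k < 1"
  then obtain R B where R: "R \<ge> 1" "\<And>z. Re z \<ge> - k * norm z \<Longrightarrow> norm z \<ge> R \<Longrightarrow>
     norm (f z - (\<Sum>j<m. d j / z ^ j)) \<le> B / norm z ^ m"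
    using assms(1) unfolding has_sector_expansion_def by blast
  define C where "C = \<bar>B\<bar> + (\<Sum>j\<in>{n..<m}. norm (d j))"
  have "norm (f z - (\<Sum>j<n. d j / z ^ j)) \<le> C / norm z ^ n" if z: "Re z \<ge> - k * norm z" "norm z \<ge> R" for z
  proof -
    have z1: "norm z \<ge> 1" using z R(1) by simp
    then have z0: "z \<noteq> 0" by auto
    have "(\<Sum>j<m. d j / z ^ j) = (\<Sum>j<n. d j / z ^ j) + (\<Sum>j\<in>{n..<m}. d j / z ^ j)"
      using assms(2) by (metis lessThan_atLeast0 sum.atLeastLessThan_concat zero_le)
    then have "f z - (\<Sum>j<n. d j / z ^ j) = (f z - (\<Sum>j<m. d j / z ^ j)) + (\<Sum>j\<in>{n..<m}. d j / z ^ j)" by simp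
    also have "norm \<dots> \<le> B / norm z ^ m + (\<Sum>j\<in>{n..<m}. norm (d j) / norm z ^ j)"
      by (intro norm_triangle_le add_mono R z sum_norm_le) (simp add: norm_divide norm_power)
    also have "B / norm z ^ m \<le> \<bar>B\<bar> / norm z ^ n"
      using z1 assms(2) by (intro frac_le) (auto intro: power_increasing simp: z0)
    also have "(\<Sum>j\<in>{n..<m}. norm (d j) / norm z ^ j) \<le> (\<Sum>j\<in>{n..<m}. norm (d j) / norm z ^ n)"
      using z1 by (intro sum_mono frac_le) (auto intro: power_increasing simp: z0)
    finally show ?thesis by (simp add: C_def add_divide_distrib sum_divide_distrib)
  qed
  then show "\<exists>R\<ge>1. \<exists>B. \<forall>z. Re z \<ge> - k * norm z \<longrightarrow> norm z \<ge> R \<longrightarrow> norm (f z - (\<Sum>j<n. d j / z ^ j)) \<le> B / norm z ^ n"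
    using R(1) by blast
qed

lemma has_sector_expansion_real:
  assumes "has_sector_expansion f d m"
  obtains R B where "R \<ge> 1" "\<And>x::real. x \<ge> R \<Longrightarrow> norm (f (of_real x) - (\<Sum>j<m. d j / of_real x ^ j)) \<le> B / x ^ m"
proof -
  obtain R B where R: "R \<ge> 1" "\<And>z. Re z \<ge> - 0 * norm z \<Longrightarrow> norm z \<ge> R \<Longrightarrow>
     norm (f z - (\<Sum>j<m. d j / z ^ j)) \<le> B / norm z ^ m"
    using assms unfolding has_sector_expansion_def by (metis order_refl zero_less_one)
  show ?thesis
  proof (rule that[OF R(1)])
    fix x :: real assume "x \<ge> R"
    then show "norm (f (of_real x) - (\<Sum>j<m. d j / of_real x ^ j)) \<le> B / x ^ m"
      using R(1) R(2)[of "of_real x"] by simp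
  qed
qed

lemma has_sector_expansion_unique:
  assumes "has_sector_expansion f d m" "has_sector_expansion f d' m" "j < m"
  shows "d j = d' j"
proof -
  obtain R B where 1: "R \<ge> 1" "\<And>x::real. x \<ge> R \<Longrightarrow> norm (f (of_real x) - (\<Sum>j<m. d j / of_real x ^ j)) \<le> B / x ^ m"
    by (rule has_sector_expansion_real[OF assms(1)]) blast
  obtain R' B' where 2: "R' \<ge> 1" "\<And>x::real. x \<ge> R' \<Longrightarrow> norm (f (of_real x) - (\<Sum>j<m. d' j / of_real x ^ j)) \<le> B' / x ^ m"
    by (rule has_sector_expansion_real[OF assms(2)]) blast
  have "d j - d' j = 0"
  proof (rule asymptotic_coeffs_zero[where m = m and e = "\<lambda>j. d j - d' j"])
    fix x :: real assume x: "x \<ge> max R R'"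
    have "(\<Sum>j<m. (d j - d' j) / of_real x ^ j) = (f (of_real x) - (\<Sum>j<m. d' j / of_real x ^ j)) - (f (of_real x) - (\<Sum>j<m. d j / of_real x ^ j))"
      by (simp add: diff_divide_distrib sum_subtractf)
    also have "norm \<dots> \<le> B' / x ^ m + B / x ^ m"
      using 1(2)[of x] 2(2)[of x] x norm_triangle_ineq4[of "f (of_real x) - (\<Sum>j<m. d' j / of_real x ^ j)" "f (of_real x) - (\<Sum>j<m. d j / of_real x ^ j)"] by linarith
    finally show "norm (\<Sum>j<m. (d j - d' j) / of_real x ^ j) \<le> (B' + B) / x ^ m" by (simp add: add_divide_distrib)
  qed fact
  then show ?thesis by simp
qed

text \<open>\<open>stirling_coeff\<close> is a definite description over expansions on the positive
  real axis. Existence comes from the sector expansion, whose coefficients are real because the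
  scaled gamma function is; uniqueness then identifies the two families, so the real definition
  governs complex sectors.\<close>

lemma stirling_coeff_expansion:
  "has_sector_expansion cscaled_Gamma (\<lambda>j. (-1) ^ j * of_real (stirling_coeff j)) m"
proof -
  obtain D where D: "\<And>m. has_sector_expansion cscaled_Gamma (D m) m"
    using cscaled_Gamma_expansion unfolding has_sector_expansion_def by metis
  \<comment> \<open>A diagonal choice: by truncation and uniqueness, the j-th coefficient is the
    same in all expansions of length greater than j.\<close>
  define E where "E j = D (Suc j) j" for j
  have DE: "D m j = E j" if "j < m" for m j
    unfolding E_def by (rule has_sector_expansion_unique[where m = "Suc j"])
      (use D[of "Suc j"] has_sector_expansion_truncate[OF D[of m], of "Suc j"] that in auto)
  have E: "has_sector_expansion cscaled_Gamma E m" for m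
  proof -
    have "(\<Sum>j<m. D m j / z ^ j) = (\<Sum>j<m. E j / z ^ j)" for z by (intro sum.cong) (auto simp: DE)
    then show ?thesis using D[of m] unfolding has_sector_expansion_def by simp
  qed
  have Im0: "Im (E j) = 0" for j
  proof -
    obtain R B where R: "R \<ge> 1" "\<And>x::real. x \<ge> R \<Longrightarrow> norm (cscaled_Gamma (of_real x) - (\<Sum>i<Suc j. E i / of_real x ^ i)) \<le> B / x ^ Suc j"
      by (rule has_sector_expansion_real[OF E]) blast
    have "complex_of_real (Im (E j)) = 0"
    proof (rule asymptotic_coeffs_zero[where m = "Suc j" and e = "\<lambda>j. of_real (Im (E j))"])
      fix x :: real assume x: "x \<ge> R"
      have x0: "x > 0" using x R(1) by simp
      have "(\<Sum>i<Suc j. complex_of_real (Im (E i)) / of_real x ^ i) = of_real (Im (\<Sum>i<Suc j. E i / of_real x ^ i))"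
        by (simp flip: of_real_power)
      also have "\<dots> = of_real (- Im (cscaled_Gamma (of_real x) - (\<Sum>i<Suc j. E i / of_real x ^ i)))"
        using of_real_scaled_Gamma[OF x0] by (metis Im_complex_of_real diff_0 minus_complex.simps(2) minus_minus)
      also have "norm \<dots> \<le> B / x ^ Suc j" 
        using abs_Im_le_cmod[of "cscaled_Gamma (of_real x) - (\<Sum>i<Suc j. E i / of_real x ^ i)"] R(2)[OF x] by (simp only: norm_of_real abs_minus_cancel)
      finally show "norm (\<Sum>i<Suc j. complex_of_real (Im (E i)) / of_real x ^ i) \<le> B / x ^ Suc j" .
    qed simp
    then show ?thesis by simp
  qed
  define c where "c j = (-1) ^ j * Re (E j)" for j
  have cE: "(-1) ^ j * of_real (c j) = E j" for j
    using Im0[of j] by (simp add: c_def complex_eq_iff flip: power_mult_distrib mult.assoc)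
  define P where "P c \<longleftrightarrow> (\<forall>M::nat. (\<lambda>x::real. scaled_Gamma x - (\<Sum>n<M. (- 1) ^ n * c n / x ^ n)) \<in> O[at_top](\<lambda>x. 1 / x ^ M))" for c
  have Pc: "P c"
    unfolding P_def
  proof
    fix M
    obtain R B where R: "R \<ge> 1" "\<And>x::real. x \<ge> R \<Longrightarrow> norm (cscaled_Gamma (of_real x) - (\<Sum>i<M. E i / of_real x ^ i)) \<le> B / x ^ M"
      by (rule has_sector_expansion_real[OF E]) blast
    show "(\<lambda>x::real. scaled_Gamma x - (\<Sum>n<M. (- 1) ^ n * c n / x ^ n)) \<in> O[at_top](\<lambda>x. 1 / x ^ M)"
    proof (rule bigoI[of _ B])
      show "\<forall>\<^sub>F x in at_top. norm (scaled_Gamma x - (\<Sum>n<M. (- 1) ^ n * c n / x ^ n)) \<le> B * norm (1 / x ^ M)"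
        using eventually_ge_at_top[of R]
      proof eventually_elim
        case (elim x)
        then have x0: "x > 0" using R(1) by simp
        have "complex_of_real (scaled_Gamma x - (\<Sum>n<M. (- 1) ^ n * c n / x ^ n)) = cscaled_Gamma (of_real x) - (\<Sum>i<M. E i / of_real x ^ i)"
          unfolding cE[symmetric] of_real_scaled_Gamma[OF x0, symmetric] by simp
        then have "norm (scaled_Gamma x - (\<Sum>n<M. (- 1) ^ n * c n / x ^ n)) = norm (cscaled_Gamma (of_real x) - (\<Sum>i<M. E i / of_real x ^ i))"
          by (metis norm_of_real real_norm_def)
        then show ?case using R(2)[OF elim] x0 by simp
      qed
    qed
  qed
  have uniq: "c' = c" if "P c'" for c'
  proof
    fix j
    define g where "g b x = scaled_Gamma x - (\<Sum>n<Suc j. (- 1) ^ n * b n / x ^ n)" for b x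
    have "(\<lambda>x. g c x - g c' x) \<in> O[at_top](\<lambda>x. 1 / x ^ Suc j)"
    proof (rule sum_in_bigo)
      show "g c \<in> O[at_top](\<lambda>x. 1 / x ^ Suc j)" using Pc unfolding P_def g_def by blast
      show "g c' \<in> O[at_top](\<lambda>x. 1 / x ^ Suc j)" using that unfolding P_def g_def by blast
    qed
    then obtain B where "\<forall>\<^sub>F x in at_top. norm (g c x - g c' x) \<le> B * norm (1 / x ^ Suc j)"
      by (elim landau_o.bigE) blast
    then obtain R where R: "\<And>x. x \<ge> R \<Longrightarrow> norm (g c x - g c' x) \<le> B * norm (1 / x ^ Suc j)"
      unfolding eventually_at_top_linorder by blast
    have "complex_of_real ((-1) ^ j * (c' j - c j)) = 0"
    proof (rule asymptotic_coeffs_zero[where m = "Suc j" and e = "\<lambda>j. of_real ((-1) ^ j * (c' j - c j))"])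
      fix x :: real assume x: "x \<ge> max R 1"
      have "(\<Sum>i<Suc j. complex_of_real ((-1) ^ i * (c' i - c i)) / of_real x ^ i) = of_real (\<Sum>i<Suc j. (-1) ^ i * (c' i - c i) / x ^ i)"
        by simp
      also have "(\<Sum>i<Suc j. (-1) ^ i * (c' i - c i) / x ^ i) = g c x - g c' x"
        by (simp add: g_def right_diff_distrib diff_divide_distrib sum_subtractf del: sum.lessThan_Suc)
      finally show "norm (\<Sum>i<Suc j. complex_of_real ((-1) ^ i * (c' i - c i)) / of_real x ^ i) \<le> B / x ^ Suc j"
        using R[of x] x by (simp only: norm_of_real) simp
    qed simp
    then show "c' j = c j" by simp
  qed
  have "stirling_coeff = c"
    unfolding stirling_coeff_def P_def[symmetric] by (rule the_equality[of P, OF Pc uniq])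
  then show ?thesis using E[of m] cE by simp
qed

text \<open>The variable \<open>v\<close> is the logarithm of the argument of the scaled gamma function.\<close>

definition Stirling_remainder :: "nat \<Rightarrow> complex \<Rightarrow> complex" where
  "Stirling_remainder K v = Gamma (exp v) * exp (exp v - (exp v - 1/2) * v) / of_real (sqrt (2 * pi))
     - (\<Sum>k<K. (-1) ^ k * of_real (stirling_coeff k) * exp (- of_nat k * v))"

section \<open>The Stirling remainder in the logarithmic variable\<close>

lemma exp_notin_nonpos_Reals:
  assumes "\<bar>Im v\<bar> < pi" shows "exp v \<notin> \<real>\<^sub>\<le>\<^sub>0"
proof
  assume "exp v \<in> \<real>\<^sub>\<le>\<^sub>0"
  then have "Im (Ln (exp v)) = pi"
    using exp_not_eq_zero[of v] by (subst Im_Ln_eq_pi) (auto simp: complex_nonpos_Reals_iff less_le complex_eq_iff simp del: exp_not_eq_zero)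
  moreover have "Ln (exp v) = v" using assms by (intro Ln_exp) auto
  ultimately show False using assms by simp
qed

lemma Stirling_remainder_eq:
  assumes "\<bar>Im v\<bar> < pi"
  shows "Stirling_remainder K v = cscaled_Gamma (exp v) - (\<Sum>k<K. (-1) ^ k * of_real (stirling_coeff k) / exp v ^ k)"
proof -
  have "Ln (exp v) = v" using assms by (intro Ln_exp) auto
  moreover have "exp (- of_nat k * v) = 1 / exp v ^ k" for k by (simp add: exp_minus exp_of_nat_mult inverse_eq_divide)
  ultimately show ?thesis by (simp add: Stirling_remainder_def cscaled_Gamma_def)
qed

lemma holomorphic_Stirling_remainder:
  "Stirling_remainder K holomorphic_on {v. - pi < Im v \<and> Im v < pi}"
  unfolding Stirling_remainder_def
  by (intro holomorphic_intros holomorphic_Gamma')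
     (use exp_notin_nonpos_Reals nonpos_Ints_subset_nonpos_Reals in \<open>force\<close>)+

lemma cnj_Stirling_remainder: "Stirling_remainder K (cnj v) = cnj (Stirling_remainder K v)"
  by (simp add: Stirling_remainder_def exp_cnj cnj_Gamma)

lemma cos_sector:
  assumes "\<bar>Im v\<bar> \<le> pi - d" "0 \<le> d" 
  shows "Re (exp v) \<ge> - cos d * norm (exp v)"
proof -
  have "cos (Im v) = cos \<bar>Im v\<bar>" by simp
  also have "\<dots> \<ge> cos (pi - d)" using assms by (intro cos_monotone_0_pi_le) auto
  finally have "- cos d \<le> cos (Im v)" by simp
  then have "exp (Re v) * (- cos d) \<le> exp (Re v) * cos (Im v)" by (intro mult_left_mono) auto
  then show ?thesis by (simp add: Re_exp mult.commute)
qed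

text \<open>One bound for a whole horizontal line, including the end where z = exp v tends to 0.
  There Gamma(z) = Gamma(z+1)/z is of order 1/|z| and the subtracted terms have order below |z|^-K;
  the second exponential covers this. For large |z| the first one is Stirling's error.\<close>

lemma Stirling_remainder_bound:
  assumes "0 < d" "d \<le> pi/2"
  obtains C where "C > 0" "\<And>v. \<bar>Im v\<bar> \<le> pi - d \<Longrightarrow> norm (Stirling_remainder K v) \<le> C * (exp (- real K * Re v) + exp (- (real K + 1) * Re v))"
proof -
  define k where "k = cos d"
  have k: "0 \<le> k" "k < 1" unfolding k_def using assms cos_ge_zero[of d] cos_monotone_0_pi[of 0 d] pi_gt_zero by auto
  obtain R B where R: "R \<ge> 1" "\<And>z. Re z \<ge> - k * norm z \<Longrightarrow> norm z \<ge> R \<Longrightarrow>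
     norm (cscaled_Gamma z - (\<Sum>j<K. (-1) ^ j * of_real (stirling_coeff j) / z ^ j)) \<le> B / norm z ^ K"
    using stirling_coeff_expansion[of K] k unfolding has_sector_expansion_def by blast
  define S where "S = cball 0 R \<inter> {z. Re z \<ge> - k * norm z}"
  have "compact S" unfolding S_def by (intro compact_Int_closed closed_Collect_le continuous_intros) auto
  moreover have "continuous_on S (\<lambda>z. Gamma (z + 1))"
  proof (intro holomorphic_on_imp_continuous_on holomorphic_Gamma' holomorphic_intros)
    fix z assume z: "z \<in> S"
    have "z + 1 \<notin> \<real>\<^sub>\<le>\<^sub>0"
    proof (cases "z = 0")
      case False
      then show ?thesis using nonpos_Reals_add_nat[OF sector_not_nonpos[OF k, of z], of 1] z by (simp add: S_def)
    qed auto
    then show "z + 1 \<notin> \<int>\<^sub>\<le>\<^sub>0" using nonpos_Ints_subset_nonpos_Reals by blast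
  qed
  ultimately have "bounded ((\<lambda>z. Gamma (z + 1)) ` S)" by (intro compact_imp_bounded compact_continuous_image)
  then obtain G where G: "G > 0" "\<And>z. z \<in> S \<Longrightarrow> norm (Gamma (z + 1)) \<le> G" unfolding bounded_pos by auto
  \<comment> \<open>The exponential bounds exp(Re(z - (z - 1/2) v)) for |z| <= R apart from exp(Re v
    / 2); the power of \<open>R\<close> trades exp(Re v / 2)/|z| for |z|^-(K+1).\<close>
  define A where "A = G * exp (R + R * pi + (1 + R * R) + pi) * R ^ (K + 1)"
  have A: "A > 0" using G R by (simp add: A_def)
  define C2 where "C2 = (\<Sum>j<K. \<bar>stirling_coeff j\<bar> * R ^ K)"
  have C2: "C2 \<ge> 0" using R by (simp add: C2_def sum_nonneg)
  define C where "C = A + C2 + \<bar>B\<bar>"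
  have main: "norm (Stirling_remainder K v) \<le> C * (exp (- real K * Re v) + exp (- (real K + 1) * Re v))" if v: "\<bar>Im v\<bar> \<le> pi - d" for v
  proof -
    have v': "\<bar>Im v\<bar> < pi" using v assms by simp
    define z where "z = exp v"
    have zk: "Re z \<ge> - k * norm z" unfolding z_def k_def by (rule cos_sector) (use v assms in auto)
    have nz: "norm z = exp (Re v)" by (simp add: z_def)
    have eK: "exp (- real K * Re v) = 1 / norm z ^ K" unfolding nz by (simp add: exp_minus exp_of_nat_mult inverse_eq_divide)
    have eK1: "exp (- (real K + 1) * Re v) = 1 / norm z ^ (K + 1)" 
    proof -
      have "- (real K + 1) * Re v = - (of_nat (K + 1) * Re v)" by (simp add: algebra_simps)
      then show ?thesis unfolding nz by (simp only: exp_minus exp_of_nat_mult inverse_eq_divide)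
    qed
    have sr: "Stirling_remainder K v = cscaled_Gamma z - (\<Sum>j<K. (-1) ^ j * of_real (stirling_coeff j) / z ^ j)"
      unfolding z_def by (rule Stirling_remainder_eq[OF v'])
    show ?thesis
    proof (cases "norm z \<ge> R")
      case True
      have "norm (Stirling_remainder K v) \<le> B / norm z ^ K" unfolding sr by (rule R(2)[OF zk True])
      also have "\<dots> \<le> C * (1 / norm z ^ K)" using A C2 nz unfolding C_def times_divide_eq_right
        by (intro divide_right_mono) auto
      also have "\<dots> \<le> C * (exp (- real K * Re v) + exp (- (real K + 1) * Re v))"
        unfolding eK using A C2 by (intro mult_left_mono) (auto simp: C_def)
      finally show ?thesis .
    next
      case False
      then have zS: "z \<in> S" using zk by (simp add: S_def)
      have z0: "z \<noteq> 0" "0 < norm z" by (auto simp: z_def)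
      have zn: "z \<notin> \<int>\<^sub>\<le>\<^sub>0" using exp_notin_nonpos_Reals[OF v'] nonpos_Ints_subset_nonpos_Reals unfolding z_def by blast
      have Lnz: "Ln z = v" unfolding z_def using v' by (intro Ln_exp) auto
      \<comment> \<open>z log z stays bounded near 0: exp x |x| <= 1 for negative x.\<close>
      have xln: "exp x * \<bar>x\<bar> \<le> 1 + R * R" if "exp x \<le> R" for x
      proof (cases "x \<ge> 0")
        case True
        have "x \<le> exp x" using exp_ge_add_one_self[of x] by linarith
        then have "exp x * \<bar>x\<bar> \<le> R * R" using True that by (intro mult_mono) auto
        then show ?thesis by simp
      next
        case False
        have "- x \<le> exp (- x)" using exp_ge_add_one_self[of "- x"] by linarith
        then have "exp x * \<bar>x\<bar> \<le> exp x * exp (- x)" using False by (intro mult_left_mono) auto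
        also have "\<dots> = 1" by (simp flip: exp_add)
        finally show ?thesis using R by (smt (verit) mult_nonneg_nonneg)
      qed
      have "norm (cscaled_Gamma z) \<le> A / norm z ^ (K + 1)"
      proof -
        have "Gamma z = Gamma (z + 1) / z" using Gamma_plus1[OF zn] z0 by simp
        then have "norm (cscaled_Gamma z) = norm (Gamma (z + 1)) / norm z * exp (Re (z - (z - 1/2) * v)) / sqrt (2 * pi)"
          by (simp add: cscaled_Gamma_def Lnz norm_mult norm_divide)
        also have "\<dots> \<le> norm (Gamma (z + 1)) / norm z * exp (Re (z - (z - 1/2) * v)) / 1"
          using pi_gt3 by (intro divide_left_mono) auto
        also have "\<dots> \<le> G / norm z * exp (R + R * pi + (1 + R * R) + pi + Re v / 2)"
        proof (unfold div_by_1, intro mult_mono divide_right_mono G(2) zS)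
          have "Re (z - (z - 1/2) * v) = Re z - Re (z * v) + Re v / 2" by (simp add: algebra_simps)
          moreover have "Re z \<le> R" using False abs_Re_le_cmod[of z] by simp
          moreover have "- Re (z * v) \<le> norm z * norm v" using abs_Re_le_cmod[of "z * v"] by (simp add: norm_mult)
          moreover have "norm z * norm v \<le> norm z * (\<bar>Re v\<bar> + pi)" 
            using cmod_le[of v] v' by (intro mult_left_mono) auto
          moreover have "norm z * (\<bar>Re v\<bar> + pi) \<le> (1 + R * R) + R * pi" 
            using xln[of "Re v"] False nz by (simp add: distrib_left add_mono mult_right_mono)
          ultimately have "Re (z - (z - 1/2) * v) \<le> R + R * pi + (1 + R * R) + pi + Re v / 2" 
            using pi_gt_zero by linarith
          then show "exp (Re (z - (z - 1/2) * v)) \<le> exp (R + R * pi + (1 + R * R) + pi + Re v / 2)" by simp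
        qed (use G in auto)
        also have "\<dots> = G * exp (R + R * pi + (1 + R * R) + pi) * (exp (Re v / 2) / norm z)" by (simp add: exp_add)
        also have "\<dots> \<le> G * exp (R + R * pi + (1 + R * R) + pi) * (R ^ (K + 1) / norm z ^ (K + 1))"
        proof (intro mult_left_mono)
          have e1: "exp (Re v / 2) \<le> R"
          proof (cases "Re v \<ge> 0")
            case True
            then have "exp (Re v / 2) \<le> exp (Re v)" by simp
            then show ?thesis using False nz by linarith
          next
            case neg: False
            then have "exp (Re v / 2) \<le> 1" by simp
            then show ?thesis using R(1) by linarith
          qed
          have "norm z ^ K \<le> R ^ K" using False by (intro power_mono) auto
          then have "exp (Re v / 2) * norm z ^ K \<le> R * R ^ K" using e1 R by (intro mult_mono) auto
          then show "exp (Re v / 2) / norm z \<le> R ^ (K + 1) / norm z ^ (K + 1)" using z0 by (simp add: field_simps)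
        qed (use G in auto)
        finally show ?thesis by (simp add: A_def)
      qed
      moreover have "norm (\<Sum>j<K. (-1) ^ j * complex_of_real (stirling_coeff j) / z ^ j) \<le> C2 / norm z ^ K"
        unfolding C2_def sum_divide_distrib
      proof (rule sum_norm_le)
        fix j assume j: "j \<in> {..<K}"
        have "norm z ^ (K - j) \<le> R ^ (K - j)" using False by (intro power_mono) auto
        also have "\<dots> \<le> R ^ K" using R by (intro power_increasing) auto
        finally have "norm z ^ (K - j) \<le> R ^ K" .
        moreover have "norm z ^ (K - j) = norm z ^ K / norm z ^ j" using j z0 by (intro power_diff) auto
        ultimately have "1 / norm z ^ j \<le> R ^ K / norm z ^ K" using z0 by (simp add: field_simps)
        from mult_left_mono[OF this, of "\<bar>stirling_coeff j\<bar>"]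
        show "norm ((-1) ^ j * complex_of_real (stirling_coeff j) / z ^ j) \<le> \<bar>stirling_coeff j\<bar> * R ^ K / norm z ^ K"
          by (simp add: norm_mult norm_divide norm_power)
      qed
      ultimately have "norm (Stirling_remainder K v) \<le> A / norm z ^ (K + 1) + C2 / norm z ^ K"
        unfolding sr by (intro order_trans[OF norm_triangle_ineq4] add_mono)
      also have "\<dots> = A * exp (- (real K + 1) * Re v) + C2 * exp (- real K * Re v)" unfolding eK eK1 by simp
      also have "\<dots> \<le> C * exp (- (real K + 1) * Re v) + C * exp (- real K * Re v)"
        using A C2 by (intro add_mono mult_right_mono) (auto simp: C_def)
      finally show ?thesis by (simp add: algebra_simps)
    qed
  qed
  show ?thesis by (rule that[of C]) (use A C2 main in \<open>auto simp: C_def\<close>)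
qed

section \<open>Incomplete gamma function and terminants\<close>

lemma set_integrable_exp_half: "integrable lborel (\<lambda>t. indicator {0..} t * exp (- t / 2) :: real)"
proof -
  have "(\<lambda>t. exp (- (1/2) * t)) integrable_on {(0::real)..}"
    using integrable_on_exp_minus_to_infinity[of "1/2" 0] by simp
  then have "(\<lambda>t::real. exp (- t / 2)) absolutely_integrable_on {0..}"
    by (intro nonnegative_absolutely_integrable_1) (auto simp: mult.commute)
  then have "(\<lambda>t::real. indicator {0..} t * exp (- t / 2)) absolutely_integrable_on UNIV"
    by (simp add: set_integrable_def)
  then show ?thesis by (rule abs_integrable_lborel(1)) measurable
qed

definition upper_Gamma_integrand :: "complex \<Rightarrow> complex \<Rightarrow> real \<Rightarrow> complex" where
  "upper_Gamma_integrand p z t = (z + of_real t) powr (p - 1) * exp (- (z + of_real t))"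

lemma slit_add_nonneg:
  assumes "(z::complex) \<notin> \<real>\<^sub>\<le>\<^sub>0" "t \<ge> 0" shows "z + of_real t \<notin> \<real>\<^sub>\<le>\<^sub>0"
  using assms by (auto simp: complex_nonpos_Reals_iff)

lemma norm_Ln_bound: "z \<noteq> 0 \<Longrightarrow> norm (Ln z) \<le> \<bar>ln (norm z)\<bar> + pi"
proof -
  assume z: "z \<noteq> 0"
  then have "\<bar>Im (Ln z)\<bar> \<le> pi" using mpi_less_Im_Ln[of z] Im_Ln_le_pi[of z] by (intro abs_leI) auto
  then show "norm (Ln z) \<le> \<bar>ln (norm z)\<bar> + pi" using cmod_le[of "Ln z"] z by simp
qed

text \<open>Half of the decay exp(-t) is spent on the power, which grows at most polynomially; the
  other half dominates uniformly over a compact set of parameters.\<close>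

lemma upper_Gamma_integrand_bound:
  assumes "compact S" "continuous_on S p" "continuous_on S z" "\<And>s. s \<in> S \<Longrightarrow> z s \<notin> \<real>\<^sub>\<le>\<^sub>0"
  obtains C where "\<And>s t. s \<in> S \<Longrightarrow> t \<ge> 0 \<Longrightarrow> norm (upper_Gamma_integrand (p s) (z s) t) \<le> C * exp (- t / 2)"
proof -
  have "bounded ((\<lambda>s. p s - 1) ` S)" using assms by (intro compact_imp_bounded compact_continuous_image continuous_intros)
  then obtain A0 where A0: "\<And>s. s \<in> S \<Longrightarrow> norm (p s - 1) \<le> A0" unfolding bounded_iff by auto
  define A where "A = max 1 A0"
  have "bounded (z ` S)" using assms by (intro compact_imp_bounded compact_continuous_image)
  then obtain B where B: "B > 0" "\<And>s. s \<in> S \<Longrightarrow> norm (z s) \<le> B" unfolding bounded_pos by auto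
  \<comment> \<open>The distance of the ray from 0 is bounded below by compactness for t <= B + 1;
    for larger t the triangle inequality already gives at least 1.\<close>
  define T where "T = (\<lambda>(s, t). norm (z s + of_real t)) ` (S \<times> {0..B+1})"
  define m where "m = (if S = {} then 1 else min 1 (Inf T))"
  have m: "0 < m" "m \<le> 1" "\<And>s t. s \<in> S \<Longrightarrow> t \<ge> 0 \<Longrightarrow> m \<le> norm (z s + of_real t)"
  proof -
    have cT: "compact T" unfolding T_def case_prod_beta
      by (intro compact_continuous_image compact_Times assms(1) compact_Icc continuous_intros continuous_on_compose2[OF assms(3)]) auto
    show "m \<le> 1" by (simp add: m_def)
    have bT: "bdd_below T" unfolding T_def by (intro bdd_belowI2[of _ 0]) auto
    show "0 < m"
    proof (cases "S = {}")
      case False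
      have "T \<noteq> {}" unfolding T_def using False B by auto
      then have "Inf T \<in> T" using cT bT by (intro closed_contains_Inf compact_imp_closed)
      then obtain s t where st: "s \<in> S" "t \<ge> 0" "Inf T = norm (z s + of_real t)" unfolding T_def by auto
      have "z s + of_real t \<noteq> 0" using slit_add_nonneg[OF assms(4)[OF st(1)] st(2)] by auto
      then show ?thesis using st by (auto simp: m_def)
    next
      case True
      then show ?thesis by (simp add: m_def)
    qed
    fix s t assume st: "s \<in> S" "(t::real) \<ge> 0"
    show "m \<le> norm (z s + of_real t)"
    proof (cases "t \<le> B + 1")
      case True
      then have "norm (z s + of_real t) \<in> T" unfolding T_def using st by (auto intro!: image_eqI[of _ _ "(s, t)"])
      then have "Inf T \<le> norm (z s + of_real t)" by (rule cInf_lower[OF _ bT])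
      then show ?thesis using st by (auto simp: m_def)
    next
      case False
      have "norm (complex_of_real t) - norm (- z s) \<le> norm (complex_of_real t - - z s)" by (rule norm_triangle_ineq2)
      then have "1 \<le> norm (z s + of_real t)" using False B(2)[OF st(1)] st by (simp add: add.commute)
      then show ?thesis using \<open>m \<le> 1\<close> by simp
    qed
  qed
  define C where "C = exp (A * (\<bar>ln m\<bar> + pi) + (B + 1) / 2 + A * \<bar>ln (2 * A)\<bar> + B)"
  show ?thesis
  proof (rule that[of C])
    fix s t assume st: "s \<in> S" "(t::real) \<ge> 0"
    define w where "w = z s + of_real t"
    have w0: "w \<noteq> 0" "m \<le> norm w" "norm w > 0" using m st by (auto simp: w_def) fastforce+
    have wB: "norm w \<le> B + 1 + t" unfolding w_def using B(2)[OF st(1)] st norm_triangle_ineq[of "z s" "of_real t"] by simp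
    have A1: "A \<ge> 1" "norm (p s - 1) \<le> A" using A0[OF st(1)] by (auto simp: A_def)
    have "ln (norm w) \<ge> ln m" using w0 m by simp
    \<comment> \<open>The scale 2A is chosen so that multiplication by the exponent bound A leaves
      |w|/2, that is, at most t/2 plus a constant.\<close>
    moreover have "ln (norm w) \<le> (B + 1 + t) / (2 * A) + \<bar>ln (2 * A)\<bar>"
    proof -
      have "ln (norm w / (2 * A)) \<le> norm w / (2 * A)" using w0 A1 by (intro ln_bound divide_pos_pos) auto
      moreover have "ln (norm w / (2 * A)) = ln (norm w) - ln (2 * A)" using w0 A1 by (intro ln_divide_pos) auto
      ultimately have "ln (norm w) \<le> norm w / (2 * A) + ln (2 * A)" by linarith
      also have "norm w / (2 * A) \<le> (B + 1 + t) / (2 * A)" using wB A1 by (intro divide_right_mono) auto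
      finally show ?thesis by linarith
    qed
    moreover have "(B + 1 + t) / (2 * A) \<ge> 0" using B st A1 by simp
    ultimately have ln: "\<bar>ln (norm w)\<bar> \<le> \<bar>ln m\<bar> + ((B + 1 + t) / (2 * A) + \<bar>ln (2 * A)\<bar>)" by linarith
    have "Re ((p s - 1) * Ln w) \<le> norm ((p s - 1) * Ln w)" by (rule complex_Re_le_cmod)
    also have "\<dots> \<le> A * (\<bar>ln m\<bar> + ((B + 1 + t) / (2 * A) + \<bar>ln (2 * A)\<bar>) + pi)"
      unfolding norm_mult
    proof (rule mult_mono)
      show "norm (Ln w) \<le> \<bar>ln m\<bar> + ((B + 1 + t) / (2 * A) + \<bar>ln (2 * A)\<bar>) + pi" using norm_Ln_bound[OF w0(1)] ln by linarith
    qed (use A1 in auto)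
    also have "\<dots> = A * (\<bar>ln m\<bar> + pi) + (B + 1 + t) / 2 + A * \<bar>ln (2 * A)\<bar>"
    proof -
      have "A * ((B + 1 + t) / (2 * A)) = (B + 1 + t) / 2" using A1 by simp
      then show ?thesis by (simp only: distrib_left)
    qed
    finally have 1: "Re ((p s - 1) * Ln w) \<le> A * (\<bar>ln m\<bar> + pi) + (B + 1 + t) / 2 + A * \<bar>ln (2 * A)\<bar>" .
    have 2: "- Re w \<le> B - t" using B(2)[OF st(1)] abs_Re_le_cmod[of "z s"] by (simp add: w_def)
    have "norm (upper_Gamma_integrand (p s) (z s) t) = exp (Re ((p s - 1) * Ln w) + - Re w)"
      using w0(1) unfolding exp_add by (simp add: upper_Gamma_integrand_def w_def[symmetric] powr_def norm_mult)
    also have "\<dots> \<le> exp ((A * (\<bar>ln m\<bar> + pi) + (B + 1 + t) / 2 + A * \<bar>ln (2 * A)\<bar>) + (B - t))"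
      using add_mono[OF 1 2] by simp
    also have "\<dots> = C * exp (- t / 2)" unfolding C_def exp_add[symmetric] by (rule arg_cong[where f = exp]) (simp add: field_simps)
    finally show "norm (upper_Gamma_integrand (p s) (z s) t) \<le> C * exp (- t / 2)" .
  qed
qed

lemma continuous_on_upper_Gamma_integrand:
  assumes "z \<notin> \<real>\<^sub>\<le>\<^sub>0" shows "continuous_on {0..} (upper_Gamma_integrand p z)"
proof -
  have "\<not> (Im z = 0 \<and> Re z + t \<le> 0)" if "t \<ge> 0" for t
    using slit_add_nonneg[OF assms that] by (auto simp: complex_nonpos_Reals_iff)
  then show ?thesis unfolding upper_Gamma_integrand_def by (intro continuous_intros) (force simp: complex_eq_iff)+
qed

lemma upper_Gamma_integrable:
  assumes "z \<notin> \<real>\<^sub>\<le>\<^sub>0"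
  shows "set_integrable lborel {0..} (upper_Gamma_integrand p z)"
    and "upper_Gamma p z = (LBINT t:{0..}. upper_Gamma_integrand p z t)"
proof -
  obtain C where C: "\<And>s t. s \<in> {0::real} \<Longrightarrow> t \<ge> 0 \<Longrightarrow> norm (upper_Gamma_integrand p z t) \<le> C * exp (- t / 2)"
    by (rule upper_Gamma_integrand_bound[of "{0::real}" "\<lambda>_. p" "\<lambda>_. z"]) (use assms in auto)
  show 1: "set_integrable lborel {0..} (upper_Gamma_integrand p z)"
    unfolding set_integrable_def
  proof (rule Bochner_Integration.integrable_bound)
    show "integrable lborel (\<lambda>t. C * (indicator {0..} t * exp (- t / 2)) :: real)" by (intro integrable_mult_right set_integrable_exp_half)
    show "(\<lambda>t. indicator {0..} t *\<^sub>R upper_Gamma_integrand p z t) \<in> borel_measurable lborel"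
      using borel_measurable_continuous_on_indicator[OF _ continuous_on_upper_Gamma_integrand[OF assms]] by simp
    show "AE t in lborel. norm (indicator {0..} t *\<^sub>R upper_Gamma_integrand p z t) \<le> norm (C * (indicator {0..} t * exp (- t / 2)))"
      using order_trans[OF C abs_ge_self] by (auto simp: indicator_def abs_mult)
  qed
  show "upper_Gamma p z = (LBINT t:{0..}. upper_Gamma_integrand p z t)"
    unfolding set_borel_integral_eq_integral(2)[OF 1] by (simp only: upper_Gamma_def upper_Gamma_integrand_def[abs_def])
qed

lemma holomorphic_upper_Gamma:
  assumes "open U" "p holomorphic_on U" "z holomorphic_on U" "\<And>s. s \<in> U \<Longrightarrow> z s \<notin> \<real>\<^sub>\<le>\<^sub>0"
  shows "(\<lambda>s. upper_Gamma (p s) (z s)) holomorphic_on U"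
proof -
  have "(\<lambda>s. LBINT t. indicator {0..} t *\<^sub>R upper_Gamma_integrand (p s) (z s) t) holomorphic_on U"
  proof (rule holomorphic_parametric_integral[OF assms(1)])
    fix t :: real
    show "(\<lambda>s. indicator {0..} t *\<^sub>R upper_Gamma_integrand (p s) (z s) t) holomorphic_on U"
    proof (cases "t \<ge> 0")
      case True
      then have "(\<lambda>s. upper_Gamma_integrand (p s) (z s) t) holomorphic_on U"
        unfolding upper_Gamma_integrand_def using slit_add_nonneg[OF assms(4)]
        by (intro holomorphic_intros assms) auto
      then show ?thesis using True by simp
    qed simp
  next
    fix s assume "s \<in> U"
    then show "(\<lambda>t. indicator {0..} t *\<^sub>R upper_Gamma_integrand (p s) (z s) t) \<in> borel_measurable lborel"
      using borel_measurable_continuous_on_indicator[OF _ continuous_on_upper_Gamma_integrand[OF assms(4)]] by simp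
  next
    fix s0 assume "s0 \<in> U"
    then obtain r where r: "r > 0" "cball s0 r \<subseteq> U" using assms(1) open_contains_cball by blast
    obtain C where C: "\<And>s t. s \<in> cball s0 r \<Longrightarrow> t \<ge> 0 \<Longrightarrow> norm (upper_Gamma_integrand (p s) (z s) t) \<le> C * exp (- t / 2)"
      by (rule upper_Gamma_integrand_bound[of "cball s0 r" p z]) 
        (use r assms in \<open>auto intro: holomorphic_on_imp_continuous_on holomorphic_on_subset\<close>)
    show "\<exists>r>0. \<exists>w. integrable lborel w \<and> (\<forall>s\<in>ball s0 r \<inter> U. \<forall>t\<in>space lborel. 
         norm (indicator {0..} t *\<^sub>R upper_Gamma_integrand (p s) (z s) t) \<le> w t)"
      by (intro exI[of _ r] conjI r exI[of _ "\<lambda>t. C * (indicator {0..} t * exp (- t / 2))"] integrable_mult_right set_integrable_exp_half)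
        (use C in \<open>auto simp: indicator_def\<close>)
  qed
  then show ?thesis
    by (rule holomorphic_transform) (use upper_Gamma_integrable(2)[OF assms(4)] in \<open>auto simp: set_lebesgue_integral_def\<close>)
qed

lemma upper_Gamma_shift:
  assumes z: "z \<notin> \<real>\<^sub>\<le>\<^sub>0" and d: "d \<ge> 0"
  shows "upper_Gamma p (z + of_real d) = upper_Gamma p z - integral {0..d} (upper_Gamma_integrand p z)"
proof -
  define f where "f = upper_Gamma_integrand p z"
  have i0: "integrable lborel (\<lambda>t. indicator {0..} t *\<^sub>R f t)"
    using upper_Gamma_integrable(1)[OF z] by (simp add: set_integrable_def f_def)
  have sh: "indicator {0..} t *\<^sub>R upper_Gamma_integrand p (z + of_real d) t = indicator {d..} (t + d) *\<^sub>R f (t + d)" for t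
    using d by (auto simp: indicator_def f_def upper_Gamma_integrand_def add_ac)
  have 1: "upper_Gamma p (z + of_real d) = (LBINT t. indicator {d..} t *\<^sub>R f t)"
    unfolding upper_Gamma_integrable(2)[OF slit_add_nonneg[OF z d]] set_lebesgue_integral_def sh by (rule lborel_integral_shift)
  have id: "set_integrable lborel {0..d} f" "set_integrable lborel {d..} f"
    unfolding f_def by (rule set_integrable_subset[OF upper_Gamma_integrable(1)[OF z]]; use d in auto)+
  have "upper_Gamma p z = (LBINT t. indicator {0..} t *\<^sub>R f t)" unfolding upper_Gamma_integrable(2)[OF z] set_lebesgue_integral_def f_def ..
  also have "\<dots> = (LBINT t. indicator {0..d} t *\<^sub>R f t + indicator {d..} t *\<^sub>R f t)"
  proof (rule integral_cong_AE)
    have "AE t in lborel. t \<noteq> d" by (rule AE_lborel_singleton)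
    then show "AE t in lborel. indicator {0..} t *\<^sub>R f t = indicator {0..d} t *\<^sub>R f t + indicator {d..} t *\<^sub>R f t"
      by eventually_elim (use d in \<open>auto simp: indicator_def\<close>)
  qed (use i0 id in \<open>auto simp: set_integrable_def\<close>)
  also have "\<dots> = (LBINT t. indicator {0..d} t *\<^sub>R f t) + (LBINT t. indicator {d..} t *\<^sub>R f t)"
    using id by (intro Bochner_Integration.integral_add) (auto simp: set_integrable_def)
  also have "(LBINT t. indicator {0..d} t *\<^sub>R f t) = integral {0..d} f"
    using set_borel_integral_eq_integral(2)[OF id(1)] by (simp add: set_lebesgue_integral_def)
  finally show ?thesis using 1 by (simp add: f_def)
qed

text \<open>Holomorphy is already known, so the complex derivative equals the one-sided derivative
  in the horizontal direction. That one is read off from the overlap of horizontal rays in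
  \<open>upper_Gamma_shift\<close> by the fundamental theorem.\<close>

lemma upper_Gamma_has_field_derivative:
  assumes z: "z \<notin> \<real>\<^sub>\<le>\<^sub>0"
  shows "(upper_Gamma p has_field_derivative (- (z powr (p - 1) * exp (- z)))) (at z)"
proof -
  have op: "open (- \<real>\<^sub>\<le>\<^sub>0 :: complex set)" by (simp add: open_Compl)
  have "upper_Gamma p holomorphic_on - \<real>\<^sub>\<le>\<^sub>0"
    using holomorphic_upper_Gamma[OF op, of "\<lambda>_. p" "\<lambda>z. z"] by auto
  then have D: "(upper_Gamma p has_field_derivative deriv (upper_Gamma p) z) (at z)"
    using holomorphic_derivI[OF _ op] z by auto
  have "((\<lambda>d. z + of_real d) has_vector_derivative 1) (at (0::real) within {0..1})"
    by (auto intro!: derivative_eq_intros)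
  then have 1: "((\<lambda>d. upper_Gamma p (z + of_real d)) has_vector_derivative (1 * deriv (upper_Gamma p) z)) (at 0 within {0..1})"
    using field_vector_diff_chain_within[of "\<lambda>d. z + of_real d" 1 0 "{0..1}" "upper_Gamma p" "deriv (upper_Gamma p) z"] D
    by (simp add: o_def has_field_derivative_at_within)
  have "((\<lambda>d. integral {0..d} (upper_Gamma_integrand p z)) has_vector_derivative upper_Gamma_integrand p z 0) (at 0 within {0..1})"
    by (rule integral_has_vector_derivative) (auto intro: continuous_on_subset[OF continuous_on_upper_Gamma_integrand[OF z]])
  then have "((\<lambda>d. upper_Gamma p z - integral {0..d} (upper_Gamma_integrand p z)) has_vector_derivative (0 - upper_Gamma_integrand p z 0)) (at 0 within {0..1})"
    by (intro derivative_intros)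
  then have 2: "((\<lambda>d. upper_Gamma p (z + of_real d)) has_vector_derivative (0 - upper_Gamma_integrand p z 0)) (at 0 within {0..1})"
    by (rule has_vector_derivative_transform[rotated 2]) (auto simp: upper_Gamma_shift[OF z])
  have "1 * deriv (upper_Gamma p) z = 0 - upper_Gamma_integrand p z 0"
    by (rule vector_derivative_unique_within_closed_interval[of 0 1 0]) (use 1 2 in auto)
  then show ?thesis using D by (simp add: upper_Gamma_integrand_def)
qed

text \<open>The continuation of \<open>v \<mapsto> upper_Gamma p (exp v)\<close> from the principal strip; it is jointly entire.\<close>

definition lifted_Gamma :: "complex \<Rightarrow> complex \<Rightarrow> complex" where
  "lifted_Gamma p v = upper_Gamma p 1 - v * integral {0..1} (\<lambda>x. exp (p * (of_real x * v) - exp (of_real x * v)))"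

text \<open>On the strip both sides have derivative -exp(p v - exp v), and they agree at v = 0. The
  integral in \<open>lifted_Gamma\<close> is an entire primitive evaluated along the segment from 0
  to v.\<close>

lemma lifted_Gamma_eq:
  assumes "\<bar>Im v\<bar> < pi"
  shows "lifted_Gamma p v = upper_Gamma p (exp v)"
proof -
  define f where "f v = exp (p * v - exp v)" for v :: complex
  have "f holomorphic_on UNIV" unfolding f_def by (intro holomorphic_intros)
  then obtain F where F: "\<And>v. (F has_field_derivative f v) (at v)"
    using holomorphic_convex_primitive'[of UNIV f] by auto
  have I: "v * integral {0..1} (\<lambda>x. f (of_real x * v)) = F v - F 0" for v
  proof -
    have "((\<lambda>x. v * f (of_real x * v)) has_integral F (of_real 1 * v) - F (of_real 0 * v)) {0..1}"
    proof (rule fundamental_theorem_of_calculus)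
      fix x :: real
      have "((\<lambda>x. of_real x * v) has_vector_derivative v) (at x within {0..1})" by (auto intro!: derivative_eq_intros)
      then show "((\<lambda>x. F (of_real x * v)) has_vector_derivative v * f (of_real x * v)) (at x within {0..1})"
        using field_vector_diff_chain_within[of "\<lambda>x. of_real x * v" v x "{0..1}" F "f (of_real x * v)"] F
        by (simp add: o_def has_field_derivative_at_within)
    qed simp
    from integral_unique[OF this] show ?thesis by simp
  qed
  define S where "S = {v. - pi < Im v \<and> Im v < pi}"
  have "\<exists>c. \<forall>v\<in>S. upper_Gamma p (exp v) + F v = c"
  proof (rule has_field_derivative_zero_constant)
    show "convex S" unfolding S_def by (rule convex_strip)
    fix v assume "v \<in> S"
    then have v: "\<bar>Im v\<bar> < pi" by (auto simp: S_def)
    have Lnv: "Ln (exp v) = v" using v by (intro Ln_exp) auto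
    have "((\<lambda>v. upper_Gamma p (exp v)) has_field_derivative (- (exp v powr (p - 1) * exp (- exp v)) * exp v)) (at v)"
      by (rule DERIV_chain2[OF upper_Gamma_has_field_derivative[OF exp_notin_nonpos_Reals[OF v]] DERIV_exp])
    also have "- (exp v powr (p - 1) * exp (- exp v)) * exp v = - f v"
      using Lnv by (simp add: powr_def f_def exp_add[symmetric] algebra_simps)
    finally have "((\<lambda>v. upper_Gamma p (exp v) + F v) has_field_derivative (- f v + f v)) (at v)"
      by (intro DERIV_add F)
    then show "((\<lambda>v. upper_Gamma p (exp v) + F v) has_field_derivative 0) (at v within S)"
      by (simp add: has_field_derivative_at_within)
  qed
  then obtain c where c: "\<And>v. v \<in> S \<Longrightarrow> upper_Gamma p (exp v) + F v = c" by blast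
  have "upper_Gamma p (exp v) + F v = upper_Gamma p (exp 0) + F 0"
    using c[of v] c[of 0] assms by (simp add: S_def abs_less_iff)
  then show ?thesis unfolding lifted_Gamma_def f_def[symmetric] I by (simp add: diff_eq_eq add_diff_eq add.commute)
qed

text \<open>In the remainder both the index \<open>- exp s\<close> and the argument s + ln lam move
  with s, so holomorphy is required along a joint curve of parameters.\<close>

lemma holomorphic_lifted_Gamma:
  assumes "p holomorphic_on UNIV" "v holomorphic_on UNIV"
  shows "(\<lambda>s. lifted_Gamma (p s) (v s)) holomorphic_on UNIV"
proof -
  define f where "f s x = exp (p s * (of_real x * v s) - exp (of_real x * v s))" for s and x :: real
  define f' where "f' s x = f s x * ((deriv p s * (of_real x * v s) + p s * (of_real x * deriv v s)) - exp (of_real x * v s) * (of_real x * deriv v s))" for s x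
  have dp: "(p has_field_derivative deriv p s) (at s)" "(v has_field_derivative deriv v s) (at s)" for s
    using assms by (auto intro: holomorphic_derivI)
  have cp: "continuous_on UNIV p" "continuous_on UNIV v" "continuous_on UNIV (deriv p)" "continuous_on UNIV (deriv v)"
    using assms holomorphic_deriv[OF assms(1)] holomorphic_deriv[OF assms(2)] holomorphic_on_imp_continuous_on by auto
  have "(\<lambda>s. integral (cbox 0 1) (f s)) holomorphic_on UNIV"
  proof (rule leibniz_rule_holomorphic[where fx = f'])
    fix s and x :: real
    show "((\<lambda>s. f s x) has_field_derivative f' s x) (at s within UNIV)"
      unfolding f_def f'_def by (rule derivative_eq_intros dp refl | simp add: algebra_simps)+
  next
    fix s show "f s integrable_on cbox 0 1"
      unfolding f_def by (intro integrable_continuous continuous_intros)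
  next
    show "continuous_on (UNIV \<times> cbox 0 1) (\<lambda>(s, x). f' s x)"
      unfolding f_def f'_def case_prod_beta
      by (intro continuous_intros continuous_on_compose2[OF cp(1)] continuous_on_compose2[OF cp(2)] continuous_on_compose2[OF cp(3)] continuous_on_compose2[OF cp(4)]) auto
  qed auto
  then show ?thesis unfolding lifted_Gamma_def f_def
    by (intro holomorphic_intros assms holomorphic_upper_Gamma) auto
qed

lemma Ln_exp_strip: "\<bar>Im v\<bar> < pi \<Longrightarrow> Ln (exp v) = v"
  by (intro Ln_exp) auto

section \<open>Explicit entire continuations of the terminant and the remainder\<close>

lemma terminant_eq:
  "terminant p s = exp (of_real pi * \<i> * of_real p) * of_real (Gamma p) / (2 * of_real pi * \<i>) * lifted_Gamma (1 - of_real p) s"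
proof -
  have "terminant p = (\<lambda>s. exp (of_real pi * \<i> * of_real p) * of_real (Gamma p) / (2 * of_real pi * \<i>) * lifted_Gamma (1 - of_real p) s)"
    unfolding terminant_def
  proof (rule analytic_continuation_eqI)
    show "(\<lambda>s. exp (of_real pi * \<i> * of_real p) * of_real (Gamma p) / (2 * of_real pi * \<i>) * lifted_Gamma (1 - of_real p) s) holomorphic_on UNIV"
      by (intro holomorphic_intros holomorphic_lifted_Gamma)
  qed (auto simp: terminant_principal_def lifted_Gamma_eq)
  then show ?thesis by simp
qed

lemma holomorphic_terminant: "terminant p holomorphic_on UNIV"
  unfolding terminant_eq[abs_def] by (intro holomorphic_intros holomorphic_lifted_Gamma)

lemma omega_bounds: "0 < omega lam" "omega lam < pi"
proof -
  have "Im (xi lam) > 0" by (simp add: xi_def)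
  moreover from this have "xi lam \<noteq> 0" by force
  ultimately show "0 < omega lam" "omega lam < pi"
    using Im_Ln_pos_lt_imp[of "xi lam"] Arg_eq_Im_Ln[of "xi lam"] by (auto simp: omega_def) 
qed

text \<open>The right-hand side is entire in s. On the defining strip the phase of s is below pi, so
  \<open>Ln\<close> of z = lam * exp s is s + ln lam, the power becomes an exponential, and
  \<open>lifted_Gamma\<close> is the principal value.\<close>

lemma remainder_eq:
  assumes "lam > 0"
  shows "remainder N lam s = exp (exp s * (s + of_real (ln lam)) + of_real lam * exp s) * lifted_Gamma (- exp s) (s + of_real (ln lam))
     - (\<Sum>n<N. b_coeff n lam / (of_real (lam + 1) ^ (2 * n + 1) * exp (of_nat (n + 1) * s)))" (is "_ = ?R s")
proof -
  have "remainder N lam = ?R"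
    unfolding remainder_def
  proof (rule analytic_continuation_eqI)
    show "?R holomorphic_on UNIV"
      using assms by (intro holomorphic_intros holomorphic_lifted_Gamma) auto
    show "range complex_of_real \<subseteq> {s. \<bar>Im s\<bar> < - omega lam + pi}" using omega_bounds by auto
    fix s assume "s \<in> {s. \<bar>Im s\<bar> < - omega lam + pi}"
    then have s: "\<bar>Im s\<bar> < pi" using omega_bounds(1)[of lam] by simp
    define z where "z = of_real lam * exp s"
    have z: "z = exp (s + of_real (ln lam))" using assms by (simp add: z_def exp_add exp_of_real)
    have Lz: "Ln z = s + of_real (ln lam)" unfolding z using s by (intro Ln_exp_strip) auto
    have U: "upper_Gamma (- exp s) z = lifted_Gamma (- exp s) (s + of_real (ln lam))"
      unfolding z using s by (subst lifted_Gamma_eq) auto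
    have "z powr (- exp s) * exp (- z) = exp (- (exp s * (s + of_real (ln lam)) + z))"
      unfolding powr_def Lz by (simp add: z exp_add[symmetric] algebra_simps)
    then have 1: "upper_Gamma (- exp s) z / (z powr (- exp s) * exp (- z)) = 
       exp (exp s * (s + of_real (ln lam)) + of_real lam * exp s) * lifted_Gamma (- exp s) (s + of_real (ln lam))"
      unfolding U by (simp only: exp_minus z_def) (simp add: divide_inverse)
    have 2: "exp s ^ n * b_coeff n lam / (z + exp s) ^ (2 * n + 1) = b_coeff n lam / (of_real (lam + 1) ^ (2 * n + 1) * exp (of_nat (n + 1) * s))" for n
    proof -
      have "z + exp s = of_real (lam + 1) * exp s" by (simp add: z_def algebra_simps)
      then have "(z + exp s) ^ (2 * n + 1) = of_real (lam + 1) ^ (2 * n + 1) * (exp s ^ n * exp s ^ (n + 1))"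
        by (simp only: power_mult_distrib power_add[symmetric]) (simp add: mult_2)
      also have "exp s ^ (n + 1) = exp (of_nat (n + 1) * s)" by (simp only: exp_of_nat_mult)
      finally show ?thesis by simp
    qed
    show "?R s = remainder_principal N lam (exp s)"
      unfolding remainder_principal_def Let_def z_def[symmetric] 1 2 ..
  qed
  then show ?thesis by simp
qed

lemma holomorphic_remainder: 
  assumes "lam > 0" shows "remainder N lam holomorphic_on UNIV"
  unfolding remainder_eq[OF assms, abs_def] using assms by (intro holomorphic_intros holomorphic_lifted_Gamma) auto

section \<open>Mellin-Stieltjes transforms\<close>

text \<open>sin e is the distance of -1 from a ray making the angle e with the negative axis: 1 - 2r
  cos e + r^2 = (r - cos e)^2 + sin^2 e.\<close>

lemma norm_one_plus_exp_ge:
  assumes "cos (Im y) \<ge> - cos e" "0 \<le> e" "e \<le> pi/2"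
  shows "norm (1 + exp y) \<ge> sin e"
proof -
  define r where "r = exp (Re y)"
  have r: "r > 0" by (simp add: r_def)
  have c: "cos e \<ge> 0" "sin e \<ge> 0" using assms by (auto intro: cos_ge_zero sin_ge_zero)
  have "(sin e)\<^sup>2 = 1 - (cos e)\<^sup>2" by (simp add: sin_squared_eq)
  also have "\<dots> \<le> 1 - 2 * r * cos e + r\<^sup>2" using zero_le_power2[of "r - cos e"] by (simp add: power2_eq_square algebra_simps)
  also have "\<dots> \<le> 1 + 2 * r * cos (Im y) + r\<^sup>2" using mult_left_mono[OF assms(1), of "2 * r"] r by simp
  also have "\<dots> = (norm (1 + exp y))\<^sup>2"
  proof -
    have "(norm (1 + exp y))\<^sup>2 = (1 + r * cos (Im y))\<^sup>2 + (r * sin (Im y))\<^sup>2"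
      unfolding cmod_power2 by (simp add: Re_exp Im_exp r_def)
    also have "\<dots> = 1 + 2 * r * cos (Im y) + r\<^sup>2 * ((sin (Im y))\<^sup>2 + (cos (Im y))\<^sup>2)"
      by (simp only: power2_sum power_mult_distrib distrib_left) (simp add: algebra_simps)
    finally show ?thesis by simp
  qed
  finally show ?thesis using c by (simp add: power2_le_iff_abs_le)
qed

lemma cos_ge_of_abs_le:
  assumes "\<bar>b\<bar> \<le> pi - e" "0 \<le> e" shows "cos b \<ge> - cos e"
proof -
  have "cos (pi - e) \<le> cos \<bar>b\<bar>" using assms by (intro cos_monotone_0_pi_le) auto
  then show ?thesis by simp
qed

lemma one_plus_exp_nonzero: "\<bar>Im y\<bar> < pi \<Longrightarrow> 1 + exp y \<noteq> 0"
proof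
  assume y: "\<bar>Im y\<bar> < pi" "1 + exp y = 0"
  then have "exp y = -1" by (simp add: add_eq_0_iff)
  then show False using exp_notin_nonpos_Reals[OF y(1)] by simp
qed

text \<open>In the variable \<open>t = exp x\<close> this is a Mellin-Stieltjes transform; for \<open>D x = exp (- exp x)\<close>
  it is, up to an elementary factor, the terminant.\<close>

definition Stieltjes_transform :: "real \<Rightarrow> (real \<Rightarrow> complex) \<Rightarrow> complex \<Rightarrow> complex" where
  "Stieltjes_transform p D sg = (LBINT x. exp (of_real p * (of_real x - sg)) / (1 + exp (of_real x - sg)) * D x)"

lemma integrable_gamma_weight:
  assumes "c > 0" "q + 1 < p"
  shows "integrable lborel (\<lambda>x. exp (p * x) * (exp (- c * exp x) * (exp (- q * x) + exp (- (q + 1) * x))) :: real)"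
proof -
  have "integrable lborel (\<lambda>x. exp ((p - q) * x) * exp (- c * exp x) + exp ((p - (q + 1)) * x) * exp (- c * exp x))"
    using assms by (intro Bochner_Integration.integrable_add gamma_log_integral) auto
  then show ?thesis by (simp add: exp_add[symmetric] algebra_simps)
qed

lemma Stieltjes_transform_integrand_bound:
  assumes "\<bar>Im sg\<bar> \<le> pi - e" "0 < e" "e \<le> pi/2"
  shows "norm (exp (of_real p * (of_real x - sg)) / (1 + exp (of_real x - sg)) * d) \<le> exp (- p * Re sg) / sin e * exp (p * x) * norm d"
proof -
  have s: "sin e > 0" using assms by (intro sin_gt_zero) auto
  have "norm (1 + exp (of_real x - sg)) \<ge> sin e"
    using assms by (intro norm_one_plus_exp_ge cos_ge_of_abs_le) auto
  then have "norm (exp (of_real p * (of_real x - sg))) / norm (1 + exp (of_real x - sg)) \<le> exp (p * (x - Re sg)) / sin e"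
    using s by (intro frac_le) auto
  then have "norm (exp (of_real p * (of_real x - sg))) / norm (1 + exp (of_real x - sg)) * norm d \<le> exp (p * (x - Re sg)) / sin e * norm d"
    by (intro mult_right_mono) auto
  moreover have "exp (p * (x - Re sg)) = exp (- p * Re sg) * exp (p * x)" by (simp add: exp_add[symmetric] algebra_simps)
  ultimately show ?thesis by (simp only: norm_mult norm_divide times_divide_eq_left times_divide_eq_right)
qed

lemma strip_angle:
  assumes "\<bar>a\<bar> < pi" obtains e where "0 < e" "e \<le> pi/2" "\<bar>a\<bar> \<le> pi - e"
  by (rule that[of "min (pi/2) (pi - \<bar>a\<bar>)"]) (use assms in \<open>auto simp: min_def field_simps\<close>)

lemma Stieltjes_transform_integrable:
  assumes "\<bar>Im sg\<bar> < pi" "D \<in> borel_measurable lborel" "c > 0" "q + 1 < p"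
    and "\<And>x. norm (D x) \<le> C * (exp (- c * exp x) * (exp (- q * x) + exp (- (q + 1) * x)))"
  shows "integrable lborel (\<lambda>x. exp (of_real p * (of_real x - sg)) / (1 + exp (of_real x - sg)) * D x)"
proof -
  obtain e where e: "0 < e" "e \<le> pi/2" "\<bar>Im sg\<bar> \<le> pi - e" using strip_angle[OF assms(1)] .
  define A where "A = exp (- p * Re sg) / sin e"
  have A: "A \<ge> 0" using e unfolding A_def by (intro divide_nonneg_nonneg sin_ge_zero) auto
  show ?thesis
  proof (rule Bochner_Integration.integrable_bound)
    show "integrable lborel (\<lambda>x. A * C * (exp (p * x) * (exp (- c * exp x) * (exp (- q * x) + exp (- (q + 1) * x)))))"
      by (intro integrable_mult_right integrable_gamma_weight assms)
    show "AE x in lborel. norm (exp (of_real p * (of_real x - sg)) / (1 + exp (of_real x - sg)) * D x) \<le> 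
       norm (A * C * (exp (p * x) * (exp (- c * exp x) * (exp (- q * x) + exp (- (q + 1) * x)))))"
    proof (rule AE_I2)
      fix x
      have "norm (exp (of_real p * (of_real x - sg)) / (1 + exp (of_real x - sg)) * D x) \<le> A * exp (p * x) * norm (D x)"
        unfolding A_def by (rule Stieltjes_transform_integrand_bound[OF e(3,1,2)])
      also have "\<dots> \<le> A * exp (p * x) * (C * (exp (- c * exp x) * (exp (- q * x) + exp (- (q + 1) * x))))"
        using A by (intro mult_left_mono assms) auto
      also have "\<dots> = A * C * (exp (p * x) * (exp (- c * exp x) * (exp (- q * x) + exp (- (q + 1) * x))))" by simp
      finally show "norm (exp (of_real p * (of_real x - sg)) / (1 + exp (of_real x - sg)) * D x) \<le> 
       norm (A * C * (exp (p * x) * (exp (- c * exp x) * (exp (- q * x) + exp (- (q + 1) * x)))))"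
        by (rule order_trans) simp
    qed
    show "(\<lambda>x. exp (of_real p * (of_real x - sg)) / (1 + exp (of_real x - sg)) * D x) \<in> borel_measurable lborel"
    proof (intro borel_measurable_times assms)
      show "(\<lambda>x. exp (of_real p * (of_real x - sg)) / (1 + exp (of_real x - sg))) \<in> borel_measurable lborel"
      proof -
        have "continuous_on UNIV (\<lambda>x. exp (of_real p * (of_real x - sg)) / (1 + exp (of_real x - sg)))"
          using one_plus_exp_nonzero assms(1) by (intro continuous_intros) auto
        then show ?thesis by (simp add: borel_measurable_continuous_onI)
      qed
    qed
  qed
qed

text \<open>Location and density may both depend on the parameter. The dominating weight has the two
  exponentials of the Stirling bound, and \<open>q + 1 < p\<close> is what makes it integrable at
  minus infinity.\<close>

lemma holomorphic_Stieltjes_transform: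
  assumes "open U" "sg holomorphic_on U" "\<And>z. z \<in> U \<Longrightarrow> \<bar>Im (sg z)\<bar> < pi"
    and "\<And>x. (\<lambda>z. D z x) holomorphic_on U" "\<And>z. z \<in> U \<Longrightarrow> D z \<in> borel_measurable lborel"
    and c: "c > 0" "q + 1 < p"
    and dom: "\<And>z0. z0 \<in> U \<Longrightarrow> \<exists>r>0. \<exists>C. \<forall>z\<in>ball z0 r \<inter> U. \<forall>x. norm (D z x) \<le> C * (exp (- c * exp x) * (exp (- q * x) + exp (- (q + 1) * x)))"
  shows "(\<lambda>z. Stieltjes_transform p (D z) (sg z)) holomorphic_on U"
  unfolding Stieltjes_transform_def
proof (rule holomorphic_parametric_integral[OF assms(1)])
  fix x
  show "(\<lambda>z. exp (of_real p * (of_real x - sg z)) / (1 + exp (of_real x - sg z)) * D z x) holomorphic_on U"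
    using one_plus_exp_nonzero assms(3) by (intro holomorphic_intros assms) auto
next
  fix z assume z: "z \<in> U"
  obtain r C where "r > 0" "\<forall>w\<in>ball z r \<inter> U. \<forall>x. norm (D w x) \<le> C * (exp (- c * exp x) * (exp (- q * x) + exp (- (q + 1) * x)))"
    using dom[OF z] by blast
  then show "(\<lambda>x. exp (of_real p * (of_real x - sg z)) / (1 + exp (of_real x - sg z)) * D z x) \<in> borel_measurable lborel"
    using Stieltjes_transform_integrable[OF assms(3)[OF z] assms(5)[OF z] c, of C] z by auto
next
  fix z0 assume z0: "z0 \<in> U"
  obtain r C where r: "r > 0" "\<And>z x. z \<in> ball z0 r \<inter> U \<Longrightarrow> norm (D z x) \<le> C * (exp (- c * exp x) * (exp (- q * x) + exp (- (q + 1) * x)))"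
    using dom[OF z0] by blast
  obtain r' where r': "r' > 0" "cball z0 r' \<subseteq> U" using assms(1) z0 open_contains_cball by blast
  have cs: "continuous_on (cball z0 r') sg" using assms(2) r' holomorphic_on_imp_continuous_on holomorphic_on_subset by blast
  have comp: "compact (sg ` cball z0 r')" by (intro compact_continuous_image cs) simp
  have "continuous_on (cball z0 r') (\<lambda>z. \<bar>Im (sg z)\<bar>)" by (intro continuous_intros cs)
  \<comment> \<open>By compactness the locations keep a positive angle \<open>e\<close> from the
    singular phases, which bounds the denominator below by sin e.\<close>
  then obtain z1 where z1: "z1 \<in> cball z0 r'" "\<And>z. z \<in> cball z0 r' \<Longrightarrow> \<bar>Im (sg z)\<bar> \<le> \<bar>Im (sg z1)\<bar>"
    using continuous_attains_sup[of "cball z0 r'" "\<lambda>z. \<bar>Im (sg z)\<bar>"] r' by auto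
  define w0 where "w0 = sg z1"
  have w0: "w0 \<in> sg ` cball z0 r'" "\<And>w. w \<in> sg ` cball z0 r' \<Longrightarrow> \<bar>Im w\<bar> \<le> \<bar>Im w0\<bar>"
    using z1 by (auto simp: w0_def)
  have "\<bar>Im w0\<bar> < pi" using w0 r' assms(3) by auto
  then obtain e where e: "0 < e" "e \<le> pi/2" "\<bar>Im w0\<bar> \<le> pi - e" using strip_angle by blast
  obtain B where "\<forall>w\<in>sg ` cball z0 r'. norm w \<le> B" using compact_imp_bounded[OF comp] unfolding bounded_iff by blast
  then have B: "norm (sg z) \<le> B" if "z \<in> cball z0 r'" for z using that by blast
  define A where "A = exp (\<bar>p\<bar> * B) / sin e"
  have sine: "sin e > 0" using e by (intro sin_gt_zero) auto
  show "\<exists>r>0. \<exists>w. integrable lborel w \<and> (\<forall>z\<in>ball z0 r \<inter> U. \<forall>x\<in>space lborel. 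
       norm (exp (of_real p * (of_real x - sg z)) / (1 + exp (of_real x - sg z)) * D z x) \<le> w x)"
  proof (intro exI[of _ "min r r'"] conjI exI[of _ "\<lambda>x. A * C * (exp (p * x) * (exp (- c * exp x) * (exp (- q * x) + exp (- (q + 1) * x))))"] ballI)
    show "integrable lborel (\<lambda>x. A * C * (exp (p * x) * (exp (- c * exp x) * (exp (- q * x) + exp (- (q + 1) * x)))))"
      by (intro integrable_mult_right integrable_gamma_weight c)
    fix z x assume z: "z \<in> ball z0 (min r r') \<inter> U"
    then have zz: "z \<in> cball z0 r'" "z \<in> ball z0 r \<inter> U" by auto
    have im: "\<bar>Im (sg z)\<bar> \<le> pi - e" using w0(2)[of "sg z"] zz(1) e by fastforce
    have "- p * Re (sg z) \<le> \<bar>p\<bar> * B" 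
      using B[OF zz(1)] abs_Re_le_cmod[of "sg z"] mult_mono[of "\<bar>p\<bar>" "\<bar>p\<bar>" "\<bar>Re (sg z)\<bar>" B] by (simp add: abs_mult[symmetric]) 
    then have A: "exp (- p * Re (sg z)) / sin e \<le> A" unfolding A_def using sine by (intro divide_right_mono) auto
    have "norm (exp (of_real p * (of_real x - sg z)) / (1 + exp (of_real x - sg z)) * D z x) \<le> exp (- p * Re (sg z)) / sin e * exp (p * x) * norm (D z x)"
      by (rule Stieltjes_transform_integrand_bound[OF im e(1,2)])
    also have "\<dots> \<le> A * exp (p * x) * (C * (exp (- c * exp x) * (exp (- q * x) + exp (- (q + 1) * x))))"
      using A sine by (intro mult_mono r(2)[OF zz(2)] order_refl mult_nonneg_nonneg) (auto simp: A_def)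
    finally show "norm (exp (of_real p * (of_real x - sg z)) / (1 + exp (of_real x - sg z)) * D z x) \<le> 
        A * C * (exp (p * x) * (exp (- c * exp x) * (exp (- q * x) + exp (- (q + 1) * x))))" by (simp add: mult_ac)
  qed (use r r' in auto)
qed

lemma exp_log_integral:
  assumes "c > (0::real)"
  shows "integrable lborel (\<lambda>t. indicator {0..} t * exp (- c * t))" "(LBINT t. indicator {0..} t * exp (- c * t)) = 1 / c"
proof -
  have h: "((\<lambda>t. exp (- c * t)) has_integral (exp (- c * 0) / c)) {0..}"
    by (rule has_integral_exp_minus_to_infinity[OF assms])
  then have "(\<lambda>t::real. exp (- c * t)) absolutely_integrable_on {0..}"
    by (intro nonnegative_absolutely_integrable_1) auto
  then have a: "(\<lambda>t::real. indicator {0..} t * exp (- c * t)) absolutely_integrable_on UNIV"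
    by (simp add: set_integrable_def)
  show "integrable lborel (\<lambda>t. indicator {0..} t * exp (- c * t))"
    by (rule abs_integrable_lborel(1)[OF a]) measurable
  have "(LBINT t. indicator {0..} t * exp (- c * t)) = integral UNIV (\<lambda>t. indicator {0..} t * exp (- c * t))"
    by (rule abs_integrable_lborel(2)[OF a, symmetric]) measurable
  also have "\<dots> = integral UNIV (\<lambda>t. if t \<in> {0..} then exp (- c * t) else 0)"
    by (rule arg_cong[where f = "integral UNIV"]) (auto simp: indicator_def)
  also have "\<dots> = integral {0..} (\<lambda>t. exp (- c * t))" by (rule integral_restrict_UNIV)
  also have "\<dots> = 1 / c" using integral_unique[OF h] by simp
  finally show "(LBINT t. indicator {0..} t * exp (- c * t)) = 1 / c" .
qed

lemma Stieltjes_transform_of_real: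
  "Stieltjes_transform p (\<lambda>x. of_real (d x)) (of_real s) = of_real (LBINT y. exp (p * y) / (1 + exp y) * d (y + s))"
proof -
  have "Stieltjes_transform p (\<lambda>x. of_real (d x)) (of_real s) = (LBINT x. complex_of_real (exp (p * (x - s)) / (1 + exp (x - s)) * d x))"
    unfolding Stieltjes_transform_def by (intro Bochner_Integration.integral_cong) (auto simp: exp_of_real[symmetric])
  also have "\<dots> = (LBINT x. complex_of_real (exp (p * (x + s - s)) / (1 + exp (x + s - s)) * d (x + s)))"
    by (rule lborel_integral_shift[symmetric, of "\<lambda>x. complex_of_real (exp (p * (x - s)) / (1 + exp (x - s)) * d x)"])
  also have "\<dots> = (LBINT x. complex_of_real (exp (p * x) / (1 + exp x) * d (x + s)))" by simp
  also have "\<dots> = of_real (LBINT y. exp (p * y) / (1 + exp y) * d (y + s))"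
    by (rule integral_complex_of_real)
  finally show ?thesis .
qed

text \<open>Two evaluations of one double integral of exp(p y) exp(-(1 + exp y)(w + t)) over real y
  and t >= 0: integrating y first gives Gamma(p) times the incomplete gamma integrand, integrating t
  first gives the kernel 1/(1 + exp y).\<close>

lemma Gamma_mult_upper_Gamma_real:
  assumes "p > 0"
  shows "of_real (Gamma p) * upper_Gamma (1 - of_real p) (of_real (exp s)) = of_real (exp (- exp s)) * Stieltjes_transform p (\<lambda>x. of_real (exp (- exp x))) (of_real s)"
proof -
  define w where "w = exp s"
  have w: "w > 0" by (simp add: w_def)
  define f where "f t y = indicator {0..} t * (exp (p * y) * exp (- (1 + exp y) * (w + t)))" for t y :: real
  have f1: "f t y = indicator {0..} t * exp (- (w + t)) * (exp (p * y) * exp (- (w + t) * exp y))" for t y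
    by (simp add: f_def exp_add[symmetric] algebra_simps)
  have f2: "f t y = exp (p * y) * exp (- (1 + exp y) * w) * (indicator {0..} t * exp (- (1 + exp y) * t))" for t y
    by (simp add: f_def exp_add[symmetric] algebra_simps)
  have "(LBINT t. LBINT y. f t y) = (LBINT y. LBINT t. f t y)"
  proof (rule integral_swap_nonneg)
    show "(\<lambda>(t, y). f t y) \<in> borel_measurable (lborel \<Otimes>\<^sub>M lborel)" unfolding f_def by measurable
    show "f t y \<ge> 0" for t y by (simp add: f_def)
    show "integrable lborel (f t)" for t
    proof (cases "t \<ge> 0")
      case True
      then show ?thesis unfolding f1 using w assms by (intro integrable_mult_right gamma_log_integral) auto
    next
      case False
      then have "f t = (\<lambda>y. 0)" by (simp add: f_def fun_eq_iff)
      then show ?thesis by simp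
    qed
    show "integrable lborel (\<lambda>t. f t y)" for y unfolding f2
      by (intro integrable_mult_right exp_log_integral) (auto intro: add_pos_pos)
  qed
  moreover have "(LBINT y. f t y) = Gamma p * (indicator {0..} t * ((w + t) powr (- p) * exp (- (w + t))))" for t
  proof (cases "t \<ge> 0")
    case True
    then have "(LBINT y. exp (p * y) * exp (- (w + t) * exp y)) = Gamma p * (w + t) powr (- p)" using w assms by (intro gamma_log_integral) auto
    then show ?thesis unfolding f1 by simp
  qed (simp add: f_def)
  moreover have "(LBINT t. f t y) = exp (- w) * (exp (p * y) / (1 + exp y) * exp (- exp (y + s)))" for y
  proof -
    have "(LBINT t. indicator {0..} t * exp (- (1 + exp y) * t)) = 1 / (1 + exp y)" by (intro exp_log_integral) (auto intro: add_pos_pos)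
    moreover have "(LBINT t. f t y) = exp (p * y) * exp (- (1 + exp y) * w) * (LBINT t. indicator {0..} t * exp (- (1 + exp y) * t))"
      unfolding f2 by (rule integral_mult_right_zero)
    moreover have "exp (- (1 + exp y) * w) = exp (- w) * exp (- exp (y + s))"
      by (simp add: w_def exp_add[of y s] mult_exp_exp algebra_simps)
    ultimately show ?thesis by simp
  qed
  ultimately have main: "Gamma p * (LBINT t. indicator {0..} t * ((w + t) powr (- p) * exp (- (w + t)))) = 
      exp (- w) * (LBINT y. exp (p * y) / (1 + exp y) * exp (- exp (y + s)))" by (simp only: integral_mult_right_zero)
  have slit: "complex_of_real w \<notin> \<real>\<^sub>\<le>\<^sub>0" using w by simp
  have "upper_Gamma (1 - of_real p) (of_real w) = (LBINT t. complex_of_real (indicator {0..} t * ((w + t) powr (- p) * exp (- (w + t)))))"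
    unfolding upper_Gamma_integrable(2)[OF slit] set_lebesgue_integral_def
  proof (intro Bochner_Integration.integral_cong refl)
    fix t :: real
    show "indicator {0..} t *\<^sub>R upper_Gamma_integrand (1 - of_real p) (of_real w) t = complex_of_real (indicator {0..} t * ((w + t) powr (- p) * exp (- (w + t))))"
    proof (cases "t \<ge> 0")
      case True
      have "(complex_of_real w + of_real t) powr (1 - of_real p - 1) = of_real (w + t) powr of_real (- p)" by simp
      also have "\<dots> = of_real ((w + t) powr (- p))" using True w by (intro powr_of_real) auto
      finally show ?thesis using True by (simp add: upper_Gamma_integrand_def flip: exp_of_real)
    qed simp
  qed
  also have "\<dots> = of_real (LBINT t. indicator {0..} t * ((w + t) powr (- p) * exp (- (w + t))))" by (rule integral_complex_of_real)
  finally have U: "upper_Gamma (1 - of_real p) (of_real w) = of_real (LBINT t. indicator {0..} t * ((w + t) powr (- p) * exp (- (w + t))))" .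
  show ?thesis unfolding Stieltjes_transform_of_real w_def[symmetric] U
    unfolding of_real_mult[symmetric] main ..
qed

lemma exp_minus_exp_measurable: "(\<lambda>x. exp (- exp (complex_of_real x))) \<in> borel_measurable lborel"
proof -
  have "continuous_on UNIV (\<lambda>x. exp (- exp (complex_of_real x)))" by (intro continuous_intros)
  then show ?thesis by (simp add: borel_measurable_continuous_onI)
qed

lemma terminant_eq_Stieltjes_transform:
  assumes "p > 0" "\<bar>Im s\<bar> < pi"
  shows "terminant p s = exp (of_real pi * \<i> * of_real p) / (2 * of_real pi * \<i>) * exp (- exp s) * 
           Stieltjes_transform p (\<lambda>x. exp (- exp (of_real x))) s"
proof (rule holomorphic_eq_of_eq_on_reals[where f = "terminant p" and z = s and S = "{z. - pi < Im z \<and> Im z < pi}" and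
    g = "\<lambda>s. exp (of_real pi * \<i> * of_real p) / (2 * of_real pi * \<i>) * exp (- exp s) * 
           Stieltjes_transform p (\<lambda>x. exp (- exp (of_real x))) s"])
  show "terminant p holomorphic_on {z. - pi < Im z \<and> Im z < pi}" using holomorphic_terminant holomorphic_on_subset by blast
  have "(\<lambda>s. Stieltjes_transform p (\<lambda>x. exp (- exp (of_real x))) s) holomorphic_on {z. - pi < Im z \<and> Im z < pi}"
  \<comment> \<open>With q = -1 the weight contains exp x + 1 >= 1, so it dominates the bare density
    exp(-exp x), and integrability reduces to p > 0.\<close>
  proof (rule holomorphic_Stieltjes_transform[OF open_strip, where c = 1 and q = "-1"])
    fix z0 assume "z0 \<in> {z. - pi < Im z \<and> Im z < pi}"
    have "norm (exp (- exp (complex_of_real x))) \<le> 1 * (exp (- 1 * exp x) * (exp (- (- 1) * x) + exp (- (- 1 + 1) * x)))" for x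
      by (simp add: Re_exp)
    then show "\<exists>r>0. \<exists>C. \<forall>z\<in>ball z0 r \<inter> {z. - pi < Im z \<and> Im z < pi}. \<forall>x.
       norm (exp (- exp (complex_of_real x))) \<le> C * (exp (- 1 * exp x) * (exp (- (- 1) * x) + exp (- (- 1 + 1) * x)))"
      by (intro exI[of _ 1] conjI) auto
  qed (use assms exp_minus_exp_measurable in auto)
  then show "(\<lambda>s. exp (of_real pi * \<i> * of_real p) / (2 * of_real pi * \<i>) * exp (- exp s) * 
           Stieltjes_transform p (\<lambda>x. exp (- exp (of_real x))) s) holomorphic_on {z. - pi < Im z \<and> Im z < pi}"
    by (intro holomorphic_intros)
  fix x :: real
  have e: "(\<lambda>x. exp (- exp (complex_of_real x))) = (\<lambda>x. of_real (exp (- exp x)))" by (simp flip: exp_of_real)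
  have "terminant p (of_real x) = exp (of_real pi * \<i> * of_real p) / (2 * of_real pi * \<i>) * (of_real (Gamma p) * upper_Gamma (1 - of_real p) (of_real (exp x)))"
    unfolding terminant_eq by (subst lifted_Gamma_eq) (auto simp: exp_of_real)
  then show "terminant p (of_real x) = exp (of_real pi * \<i> * of_real p) / (2 * of_real pi * \<i>) * exp (- exp (of_real x)) * 
           Stieltjes_transform p (\<lambda>x. exp (- exp (of_real x))) (of_real x)"
    unfolding Gamma_mult_upper_Gamma_real[OF assms(1)] e by (simp flip: exp_of_real)
qed (use assms open_strip connected_strip in auto)

section \<open>Saddle points of the phase\<close>

text \<open>Substituting z exp v for the integration variable gives Gamma(-a, z) = z^(-a) exp(-z)
  times the integral of exp(-a phase(v)) over v > 0, where z = lam a. The critical points satisfy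
  lam exp v = -1.\<close>

definition phase :: "real \<Rightarrow> complex \<Rightarrow> complex" where
  "phase lam v = of_real lam * (exp v - 1) + v"

lemma Re_phase: "Re (phase lam (Complex x y)) = lam * (exp x * cos y - 1) + x"
  and Im_phase: "Im (phase lam (Complex x y)) = lam * (exp x * sin y) + y"
  by (simp_all add: phase_def Re_exp Im_exp)

lemma holomorphic_phase [holomorphic_intros]: "phase lam holomorphic_on S"
  unfolding phase_def by (intro holomorphic_intros)

lemma phase_deriv: "(phase lam has_field_derivative (of_real lam * exp v + 1)) (at v)"
  unfolding phase_def by (auto intro!: derivative_eq_intros)

lemma phase_of_real: "phase lam (of_real u) = of_real (lam * (exp u - 1) + u)"
  by (simp add: phase_def exp_of_real)

lemma phase_strict_mono:
  assumes "lam > 0" "u < v" shows "lam * (exp u - 1) + u < lam * (exp v - 1) + (v::real)"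
  using assms by (intro add_strict_mono mult_strict_left_mono) auto

lemma Im_phase_ge:
  assumes "lam > 0" "\<bar>y\<bar> \<le> pi" shows "\<bar>Im (phase lam (Complex x y))\<bar> \<ge> \<bar>y\<bar>"
proof (cases "y \<ge> 0")
  case True
  then have "sin y \<ge> 0" using assms by (intro sin_ge_zero) auto
  then have "lam * (exp x * sin y) \<ge> 0" using assms by simp
  then show ?thesis using True unfolding Im_phase by linarith
next
  case False
  then have "sin (- y) \<ge> 0" using assms by (intro sin_ge_zero) auto
  then have "lam * (exp x * sin y) \<le> 0" using assms by (simp add: mult_nonneg_nonpos)
  then show ?thesis using False unfolding Im_phase by linarith
qed

text \<open>In the closed strip sin y never has the sign opposite to y, so the phase is real only on
  the real axis, where it is strictly increasing. This locates all poles of the kernel in the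
  strip.\<close>

lemma phase_eq_real_iff:
  assumes "lam > 0" "\<bar>Im v\<bar> \<le> pi"
  shows "phase lam v = of_real (lam * (exp u - 1) + u) \<longleftrightarrow> v = of_real u"
proof
  assume *: "phase lam v = of_real (lam * (exp u - 1) + u)"
  then have "Im (phase lam (Complex (Re v) (Im v))) = 0" by (simp add: complex_surj)
  then have "Im v = 0" using Im_phase_ge[OF assms, of "Re v"] by simp
  then have v: "v = of_real (Re v)" by (simp add: complex_eq_iff)
  then have "lam * (exp (Re v) - 1) + Re v = lam * (exp u - 1) + u"
    using * phase_of_real[of lam "Re v"] by (metis of_real_eq_iff)
  then have "Re v = u" using phase_strict_mono[OF assms(1), of u "Re v"] phase_strict_mono[OF assms(1), of "Re v" u] by linarith
  then show "v = of_real u" using v by simp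
qed (simp add: phase_of_real)

text \<open>For x <= 0 the real part of the phase is at most x, for large x the exponential
  dominates, and for |y| >= 1 the imaginary part suffices. The values b = 0 and b = c are those
  where the kernel has its poles.\<close>

lemma norm_phase_ge:
  assumes "lam > 0" "c \<ge> 0"
  obtains X where "X \<ge> 1"
    "\<And>x y b. \<bar>y\<bar> \<le> pi \<Longrightarrow> x \<le> 0 \<or> x \<ge> X \<Longrightarrow> 0 \<le> b \<Longrightarrow> b \<le> c \<Longrightarrow> norm (phase lam (Complex x y) - of_real b) \<ge> \<bar>x\<bar>"
    "\<And>x y b. \<bar>y\<bar> \<le> pi \<Longrightarrow> \<bar>y\<bar> \<ge> 1 \<Longrightarrow> norm (phase lam (Complex x y) - of_real b) \<ge> 1"
proof -
  have "\<forall>\<^sub>F x in at_top. lam * exp x - lam - x - pi - c \<ge> x" using assms by real_asymp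
  then obtain X0 where X0: "\<And>x. x \<ge> X0 \<Longrightarrow> lam * exp x - lam - x - pi - c \<ge> x" unfolding eventually_at_top_linorder by blast
  show ?thesis
  proof (rule that[of "max 1 X0"])
    fix x y b :: real assume y: "\<bar>y\<bar> \<le> pi" and x: "x \<le> 0 \<or> x \<ge> max 1 X0" and b: "0 \<le> b" "b \<le> c"
    show "norm (phase lam (Complex x y) - of_real b) \<ge> \<bar>x\<bar>"
    proof (cases "x \<le> 0")
      case True
      have "exp x * cos y \<le> exp x * 1" by (intro mult_left_mono) auto
      also have "\<dots> \<le> 1" using True by simp
      finally have "exp x * cos y \<le> 1" .
      then have "lam * (exp x * cos y - 1) \<le> 0" using assms by (simp add: mult_nonneg_nonpos)
      then have "Re (phase lam (Complex x y) - of_real b) \<le> x" using b by (simp add: Re_phase)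
      then show ?thesis using True abs_Re_le_cmod[of "phase lam (Complex x y) - of_real b"] by linarith
    next
      case False
      then have x: "x \<ge> X0" "x > 0" using x by auto
      have "norm (of_real lam * exp (Complex x y)) \<le> norm (phase lam (Complex x y) - of_real b) + norm (of_real (lam + b) - Complex x y)"
        by (rule order_trans[OF _ norm_triangle_ineq]) (simp add: phase_def algebra_simps)
      moreover have "norm (of_real lam * exp (Complex x y)) = lam * exp x" using assms by (simp add: norm_mult)
      moreover have "norm (of_real (lam + b) - Complex x y) \<le> lam + b + (x + pi)"
      proof (rule order_trans[OF norm_triangle_ineq4])
        have "norm (complex_of_real (lam + b)) = lam + b" using assms b by (simp only: norm_of_real)
        then show "norm (complex_of_real (lam + b)) + norm (Complex x y) \<le> lam + b + (x + pi)"
          using cmod_le[of "Complex x y"] x y by simp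
      qed
      ultimately show ?thesis using X0[OF x(1)] b x by simp
    qed
  next
    fix x y b :: real assume "\<bar>y\<bar> \<le> pi" "\<bar>y\<bar> \<ge> 1"
    then show "norm (phase lam (Complex x y) - of_real b) \<ge> 1"
      using Im_phase_ge[OF assms(1), of y x] abs_Im_le_cmod[of "phase lam (Complex x y) - of_real b"] by simp
  qed simp
qed

section \<open>Cauchy's remainder formula for the inverse of the phase\<close>

text \<open>Multiplied by c^N this is 1/(phase - c) minus the sum over n < N of c^n / phase^(n+1):
  what the geometric series in c leaves in Cauchy's integral for the derivative of the inverse
  phase.\<close>

definition phase_kernel :: "real \<Rightarrow> nat \<Rightarrow> real \<Rightarrow> complex \<Rightarrow> complex" where
  "phase_kernel lam N c v = 1 / (phase lam v ^ N * (phase lam v - of_real c))"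

text \<open>At least two factors of the denominator grow like |x|, since N >= 1. The restriction to
  |y| >= 1 or |x| >= X keeps away from the poles 0 and u.\<close>

lemma phase_kernel_bound:
  assumes "lam > 0" "c \<ge> 0" "N \<ge> 1"
  obtains X C where "C \<ge> 0"
    "\<And>x y. \<bar>y\<bar> \<le> pi \<Longrightarrow> \<bar>y\<bar> \<ge> 1 \<or> \<bar>x\<bar> \<ge> X \<Longrightarrow> norm (phase_kernel lam N c (Complex x y)) \<le> C / (1 + x\<^sup>2)"
proof -
  obtain X where X: "X \<ge> 1"
    "\<And>x y b. \<bar>y\<bar> \<le> pi \<Longrightarrow> x \<le> 0 \<or> x \<ge> X \<Longrightarrow> 0 \<le> b \<Longrightarrow> b \<le> c \<Longrightarrow> norm (phase lam (Complex x y) - of_real b) \<ge> \<bar>x\<bar>"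
    "\<And>x y b. \<bar>y\<bar> \<le> pi \<Longrightarrow> \<bar>y\<bar> \<ge> 1 \<Longrightarrow> norm (phase lam (Complex x y) - of_real b) \<ge> 1"
    using norm_phase_ge[OF assms(1,2)] by metis
  define C where "C = 2 + X\<^sup>2"
  show ?thesis
  proof (rule that[of C X])
    show "C \<ge> 0" by (simp add: C_def)
    fix x y :: real assume y: "\<bar>y\<bar> \<le> pi" and d: "\<bar>y\<bar> \<ge> 1 \<or> \<bar>x\<bar> \<ge> X"
    define f where "f b = norm (phase lam (Complex x y) - of_real b)" for b
    have f1: "f b \<ge> 1" if "0 \<le> b" "b \<le> c" for b
    proof (cases "\<bar>y\<bar> \<ge> 1")
      case True then show ?thesis using X(3) y by (simp add: f_def)
    next
      case False
      then have "\<bar>x\<bar> \<ge> X" using d by simp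
      then have "x \<le> 0 \<or> x \<ge> X" by auto
      then have "f b \<ge> \<bar>x\<bar>" using X(2)[OF y _ that] by (simp add: f_def)
      then show ?thesis using \<open>\<bar>x\<bar> \<ge> X\<close> X(1) by simp
    qed
    have "(1 + x\<^sup>2) / C \<le> f 0 * f c"
    proof (cases "x \<le> 0 \<or> x \<ge> X")
      case True
      then have g: "f 0 \<ge> \<bar>x\<bar>" "f c \<ge> \<bar>x\<bar>" using X(2)[OF y True, of 0] X(2)[OF y True, of c] assms by (simp_all add: f_def)
      have "x\<^sup>2 \<le> f 0 * f c" using mult_mono[OF g] by (simp add: power2_eq_square abs_mult_self_eq f_def)
      moreover have "1 \<le> f 0 * f c" using mult_mono[OF f1[of 0] f1[of c]] f1[of 0] assms by simp
      ultimately have "1 + x\<^sup>2 \<le> 2 * (f 0 * f c)" by simp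
      also have "\<dots> \<le> C * (f 0 * f c)" using \<open>1 \<le> f 0 * f c\<close> by (intro mult_right_mono) (auto simp: C_def)
      finally show ?thesis by (simp add: C_def divide_le_eq mult.commute add_pos_nonneg)
    next
      case False
      then have "x\<^sup>2 \<le> X\<^sup>2" by (intro power_mono) auto
      then have "(1 + x\<^sup>2) / C \<le> 1" by (simp add: C_def divide_le_eq add_pos_nonneg)
      also have "1 \<le> f 0 * f c" using mult_mono[OF f1[of 0] f1[of c]] f1[of 0] assms by simp
      finally show ?thesis .
    qed
    also have "f 0 * f c \<le> f 0 ^ N * f c"
    proof (rule mult_right_mono)
      show "f 0 \<le> f 0 ^ N" using f1[of 0] assms power_increasing[of 1 N "f 0"] by simp
    qed (simp add: f_def)
    finally have "1 / (f 0 ^ N * f c) \<le> 1 / ((1 + x\<^sup>2) / C)"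
      by (intro divide_left_mono mult_pos_pos divide_pos_pos) (use f1[of 0] f1[of c] assms in \<open>auto simp: C_def add_pos_nonneg intro!: zero_less_power mult_pos_pos\<close>)
    then show "norm (phase_kernel lam N c (Complex x y)) \<le> C / (1 + x\<^sup>2)"
      by (simp add: phase_kernel_def norm_divide norm_mult norm_power f_def)
  qed
qed

text \<open>Lagrange inversion: the bracket in \<open>b_coeff\<close> is h^(n+1) with h v = (lam +
  1) v / phase v, and its n-th derivative at 0 is n! times the residue of h^(n+1) / v^(n+1).\<close>

lemma b_coeff_eq_residue:
  assumes "lam > 0"
  shows "b_coeff n lam / of_real (lam + 1) ^ (2 * n + 1) = fact n * residue (\<lambda>v. 1 / phase lam v ^ (n + 1)) 0"
proof -
  define g where "g z = (if z = 0 then deriv (phase lam) 0 else (phase lam z - phase lam 0) / (z - 0))" for z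
  have hg: "g holomorphic_on UNIV" unfolding g_def by (rule pole_lemma) (auto intro: holomorphic_intros)
  have g0: "g 0 = of_real (lam + 1)" using DERIV_imp_deriv[OF phase_deriv[of lam 0]] by (simp add: g_def)
  have p0: "phase lam 0 = 0" by (simp add: phase_def)
  have "open {z. g z \<noteq> 0}" by (intro open_Collect_neq holomorphic_on_imp_continuous_on hg continuous_intros)
  moreover have l0: "complex_of_real (lam + 1) \<noteq> 0" using assms unfolding of_real_eq_0_iff by simp
  ultimately have op: "open {z. g z \<noteq> 0}" "0 \<in> {z. g z \<noteq> 0}" by (simp_all add: g0 del: of_real_add)
  define h where "h z = of_real (lam + 1) / g z" for z
  have hh: "(\<lambda>z. h z ^ (n + 1)) holomorphic_on {z. g z \<noteq> 0}"
    unfolding h_def by (intro holomorphic_intros holomorphic_on_subset[OF hg]) auto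
  have fun_eq: "(\<lambda>t. (if t = 0 then 1 else of_real (lam + 1) * t / (of_real lam * exp t + t - of_real lam)) ^ (n + 1)) = (\<lambda>z. h z ^ (n + 1))"
  proof
    fix t :: complex
    have "(if t = 0 then 1 else of_real (lam + 1) * t / (of_real lam * exp t + t - of_real lam)) = h t"
    proof (cases "t = 0")
      case True then show ?thesis using l0 g0 by (simp add: h_def del: of_real_add)
    next
      case False
      then show ?thesis by (simp add: h_def g_def p0 phase_def algebra_simps)
    qed
    then show "(if t = 0 then 1 else of_real (lam + 1) * t / (of_real lam * exp t + t - of_real lam)) ^ (n + 1) = h t ^ (n + 1)" by simp
  qed
  have "residue (\<lambda>z. h z ^ (n + 1) / z ^ Suc n) 0 = (deriv ^^ n) (\<lambda>z. h z ^ (n + 1)) 0 / fact n"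
    by (rule residue_holomorphic_over_power'[OF op hh])
  moreover have "residue (\<lambda>z. h z ^ (n + 1) / z ^ Suc n) 0 = residue (\<lambda>z. of_real (lam + 1) ^ (n + 1) * (1 / phase lam z ^ (n + 1))) 0"
  proof (rule residue_cong)
    have "\<forall>\<^sub>F z in at 0. z \<noteq> (0::complex)" by (rule eventually_at_topological[THEN iffD2]) auto
    then show "\<forall>\<^sub>F z in at 0. h z ^ (n + 1) / z ^ Suc n = of_real (lam + 1) ^ (n + 1) * (1 / phase lam z ^ (n + 1))"
      by eventually_elim (simp add: h_def g_def p0 power_divide power_mult_distrib)
  qed simp
  moreover have "residue (\<lambda>z. of_real (lam + 1) ^ (n + 1) * (1 / phase lam z ^ (n + 1))) 0 = of_real (lam + 1) ^ (n + 1) * residue (\<lambda>z. 1 / phase lam z ^ (n + 1)) 0"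
  proof (rule residue_lmul[OF op])
    show "(\<lambda>z. 1 / phase lam z ^ (n + 1)) holomorphic_on {z. g z \<noteq> 0} - {0}"
    proof (intro holomorphic_intros)
      fix z assume "z \<in> {z. g z \<noteq> 0} - {0}"
      then show "phase lam z ^ (n + 1) \<noteq> 0" by (auto simp: g_def p0)
    qed
  qed
  ultimately have "(deriv ^^ n) (\<lambda>z. h z ^ (n + 1)) 0 = fact n * (of_real (lam + 1) ^ (n + 1) * residue (\<lambda>z. 1 / phase lam z ^ (n + 1)) 0)"
    by (simp add: field_simps)
  then have "b_coeff n lam = of_real (lam + 1) ^ (2 * n + 1) * (fact n * residue (\<lambda>z. 1 / phase lam z ^ (n + 1)) 0)"
  proof -
    have pw: "l ^ (2 * n + 1) = l ^ n * l ^ (n + 1)" for l :: complex by (simp only: power_add[symmetric]) (simp add: mult_2)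
    assume "(deriv ^^ n) (\<lambda>z. h z ^ (n + 1)) 0 = fact n * (of_real (lam + 1) ^ (n + 1) * residue (\<lambda>z. 1 / phase lam z ^ (n + 1)) 0)"
    then show ?thesis unfolding b_coeff_def fun_eq pw by (simp only: mult_ac)
  qed
  then show ?thesis using l0 by simp
qed

text \<open>At 0 by induction on N: the next kernel is 1/c times the difference of the previous
  kernel and 1/phase^(N+1), and for N = 0 there is no pole. At u the pole is simple, with phase'(u)
  = lam exp u + 1.\<close>

lemma phase_kernel_residues:
  assumes "lam > 0" "u > 0" and c: "c = lam * (exp u - 1) + u"
  shows "of_real c ^ N * residue (phase_kernel lam N c) 0 = - (\<Sum>n<N. of_real c ^ n * residue (\<lambda>v. 1 / phase lam v ^ (n + 1)) 0)"
    and "of_real c ^ N * residue (phase_kernel lam N c) (of_real u) = 1 / (of_real lam * exp (of_real u) + 1)"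
proof -
  have c0: "c > 0" using assms phase_strict_mono[OF assms(1,2)] by simp
  have p0: "phase lam 0 = 0" by (simp add: phase_def)
  have pu: "phase lam (of_real u) = of_real c" unfolding c by (rule phase_of_real)
  define B where "B = {v. \<bar>Im v\<bar> < pi \<and> v \<noteq> of_real u}"
  have oB: "open B" unfolding B_def by (intro open_Collect_conj open_Collect_less open_Collect_neq continuous_intros)
  have B0: "0 \<in> B" using assms by (auto simp: B_def)
  have nz: "phase lam v \<noteq> 0" if "v \<in> B - {0}" for v
    using phase_eq_real_iff[OF assms(1), of v 0] that by (auto simp: B_def)
  have nc: "phase lam v \<noteq> of_real c" if "v \<in> B" for v
    using phase_eq_real_iff[OF assms(1), of v u] that by (auto simp: B_def c)
  have hk: "phase_kernel lam N c holomorphic_on B - {0}" for N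
    unfolding phase_kernel_def using nz nc by (intro holomorphic_intros) auto
  have hp: "(\<lambda>v. 1 / phase lam v ^ (n + 1)) holomorphic_on B - {0}" for n
    using nz by (intro holomorphic_intros) auto
  show "of_real c ^ N * residue (phase_kernel lam N c) 0 = - (\<Sum>n<N. of_real c ^ n * residue (\<lambda>v. 1 / phase lam v ^ (n + 1)) 0)"
  proof (induction N)
    case 0
    have "phase_kernel lam 0 c holomorphic_on B" unfolding phase_kernel_def using nc by (intro holomorphic_intros) auto
    then show ?case using residue_holo[OF oB B0] by simp
  next
    case (Suc N)
    have "residue (phase_kernel lam (Suc N) c) 0 = residue (\<lambda>v. 1 / of_real c * (phase_kernel lam N c v - 1 / phase lam v ^ (N + 1))) 0"
    proof (rule residue_cong)
      have "\<forall>\<^sub>F v in at 0. v \<in> B - {0}" using eventually_at_in_open[OF oB B0] .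
      then show "\<forall>\<^sub>F v in at 0. phase_kernel lam (Suc N) c v = 1 / of_real c * (phase_kernel lam N c v - 1 / phase lam v ^ (N + 1))"
      proof eventually_elim
        case (elim v)
        define p where "p = phase lam v"
        have p: "p \<noteq> 0" "p - of_real c \<noteq> 0" using nz[OF elim] nc[of v] elim by (auto simp: p_def)
        have "1 / (p ^ N * (p - of_real c)) - 1 / p ^ (N + 1) = of_real c / (p ^ (N + 1) * (p - of_real c))"
          using p by (simp add: field_simps)
        then show ?case using c0 p by (simp add: phase_kernel_def p_def[symmetric])
      qed
    qed simp
    also have "\<dots> = 1 / of_real c * (residue (phase_kernel lam N c) 0 - residue (\<lambda>v. 1 / phase lam v ^ (N + 1)) 0)"
      using residue_lmul[OF oB B0 holomorphic_on_diff[OF hk[of N] hp[of N]], of "1 / of_real c"] residue_diff[OF oB B0 hk[of N] hp[of N]] by simp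
    finally have R: "residue (phase_kernel lam (Suc N) c) 0 = 1 / of_real c * (residue (phase_kernel lam N c) 0 - residue (\<lambda>v. 1 / phase lam v ^ (N + 1)) 0)" .
    have "of_real c ^ Suc N * residue (phase_kernel lam (Suc N) c) 0 = 
        of_real c ^ N * residue (phase_kernel lam N c) 0 - of_real c ^ N * residue (\<lambda>v. 1 / phase lam v ^ (N + 1)) 0"
      unfolding R using c0 by (simp add: right_diff_distrib)
    then show ?case unfolding Suc by simp
  qed
  define A where "A = {v. \<bar>Im v\<bar> < pi \<and> v \<noteq> 0}"
  have oA: "open A" unfolding A_def by (intro open_Collect_conj open_Collect_less open_Collect_neq continuous_intros)
  have Au: "of_real u \<in> A" using assms by (auto simp: A_def)
  have nzA: "phase lam v \<noteq> 0" if "v \<in> A" for v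
    using phase_eq_real_iff[OF assms(1), of v 0] that by (auto simp: A_def)
  have ncA: "phase lam v \<noteq> of_real c" if "v \<in> A - {of_real u}" for v
    using phase_eq_real_iff[OF assms(1), of v u] that by (auto simp: A_def c)
  define d where "d = complex_of_real lam * exp (of_real u) + 1"
  have d0: "d \<noteq> 0"
  proof -
    have "d = of_real (lam * exp u + 1)" by (simp add: d_def exp_of_real)
    moreover have "lam * exp u + 1 > 0" using assms by (intro add_pos_pos mult_pos_pos) auto
    ultimately show ?thesis by (metis of_real_eq_0_iff less_irrefl)
  qed
  have "residue (phase_kernel lam N c) (of_real u) = 1 / (of_real c ^ N * d)"
  proof (rule residue_simple'[OF oA Au])
    show "phase_kernel lam N c holomorphic_on A - {of_real u}"
      unfolding phase_kernel_def using nzA ncA by (intro holomorphic_intros) auto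
    have D: "((\<lambda>v. (phase lam v - phase lam (of_real u)) / (v - of_real u)) \<longlongrightarrow> d) (at (of_real u))"
      using phase_deriv[of lam "of_real u"] unfolding has_field_derivative_iff d_def .
    have "(phase lam \<longlongrightarrow> phase lam (of_real u)) (at (of_real u))" using phase_deriv[THEN DERIV_isCont] isContD by blast
    then have "((\<lambda>v. 1 / (phase lam v ^ N * ((phase lam v - phase lam (of_real u)) / (v - of_real u)))) \<longlongrightarrow> 1 / (phase lam (of_real u) ^ N * d)) (at (of_real u))"
      using d0 c0 by (intro tendsto_intros D) (auto simp: pu)
    then show "((\<lambda>w. phase_kernel lam N c w * (w - of_real u)) \<longlongrightarrow> 1 / (of_real c ^ N * d)) (at (of_real u))"
      unfolding pu by (rule Lim_transform_eventually) (auto simp: phase_kernel_def eventually_at_filter)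
  qed
  then show "of_real c ^ N * residue (phase_kernel lam N c) (of_real u) = 1 / (of_real lam * exp (of_real u) + 1)"
    using c0 by (simp add: d_def)
qed

lemma tendsto_const_over_square: "((\<lambda>x::real. C / (1 + x\<^sup>2)) \<longlongrightarrow> 0) at_top" "((\<lambda>x::real. C / (1 + x\<^sup>2)) \<longlongrightarrow> 0) at_bot"
  by real_asymp+

text \<open>The zeros of the phase are controlled only up to |Im| = pi, while
  \<open>strip_residue\<close> needs holomorphy beyond its two lines. The identity is therefore
  proved for lines with |Im| < pi and extended to pi by dominated convergence.\<close>

lemma phase_kernel_line_integrals:
  assumes "lam > 0" "u > 0" and c: "c = lam * (exp u - 1) + u" and N: "N \<ge> 1"
  shows "integrable lborel (\<lambda>x. phase_kernel lam N c (Complex x pi))" "integrable lborel (\<lambda>x. phase_kernel lam N c (Complex x (- pi)))"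
   and "(LBINT x. phase_kernel lam N c (Complex x (- pi))) - (LBINT x. phase_kernel lam N c (Complex x pi)) =
     2 * pi * \<i> * (residue (phase_kernel lam N c) 0 + residue (phase_kernel lam N c) (of_real u))"
proof -
  have c0: "c > 0" using assms phase_strict_mono[OF assms(1,2)] by simp
  obtain X C where C: "C \<ge> 0"
    "\<And>x y. \<bar>y\<bar> \<le> pi \<Longrightarrow> \<bar>y\<bar> \<ge> 1 \<or> \<bar>x\<bar> \<ge> X \<Longrightarrow> norm (phase_kernel lam N c (Complex x y)) \<le> C / (1 + x\<^sup>2)"
    by (rule phase_kernel_bound[OF assms(1) less_imp_le[OF c0] N]) blast
  have iC: "integrable lborel (\<lambda>x. C / (1 + x\<^sup>2))" using integrable_mult_right[OF integrable_inverse_square, of C] by simp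
  have nz: "phase lam v \<noteq> 0" if "\<bar>Im v\<bar> \<le> pi" "v \<noteq> 0" for v
    using phase_eq_real_iff[OF assms(1) that(1), of 0] that by auto
  have nc: "phase lam v \<noteq> of_real c" if "\<bar>Im v\<bar> \<le> pi" "v \<noteq> of_real u" for v
    using phase_eq_real_iff[OF assms(1) that(1), of u] that by (auto simp: c)
  have cont: "continuous_on {v. 1 \<le> \<bar>Im v\<bar> \<and> \<bar>Im v\<bar> \<le> pi} (phase_kernel lam N c)"
  proof -
    have "phase lam v \<noteq> 0 \<and> phase lam v \<noteq> of_real c" if "1 \<le> \<bar>Im v\<bar>" "\<bar>Im v\<bar> \<le> pi" for v
    proof -
      have "v \<noteq> 0" "v \<noteq> of_real u" using that by auto
      then show ?thesis using nz nc that by blast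
    qed
    then show ?thesis unfolding phase_kernel_def
      by (intro continuous_intros holomorphic_on_imp_continuous_on[OF holomorphic_phase]) auto
  qed
  have m: "(\<lambda>x. phase_kernel lam N c (Complex x y)) \<in> borel_measurable lborel" if "1 \<le> \<bar>y\<bar>" "\<bar>y\<bar> \<le> pi" for y
  proof -
    have "continuous_on UNIV (\<lambda>x. phase_kernel lam N c (Complex x y))"
      by (rule continuous_on_compose2[OF cont]) (use that in \<open>auto simp: Complex_eq intro!: continuous_intros\<close>)
    then show ?thesis by (simp add: borel_measurable_continuous_onI)
  qed
  have int: "integrable lborel (\<lambda>x. phase_kernel lam N c (Complex x y))" if y: "1 \<le> \<bar>y\<bar>" "\<bar>y\<bar> \<le> pi" for y

  proof (rule Bochner_Integration.integrable_bound[OF iC m[OF y]], rule AE_I2)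
    fix x
    have "norm (phase_kernel lam N c (Complex x y)) \<le> C / (1 + x\<^sup>2)" using C(2)[of y x] y by blast
    then show "norm (phase_kernel lam N c (Complex x y)) \<le> norm (C / (1 + x\<^sup>2))"
      unfolding real_norm_def by (rule order_trans[OF _ abs_ge_self])
  qed
  show "integrable lborel (\<lambda>x. phase_kernel lam N c (Complex x pi))" "integrable lborel (\<lambda>x. phase_kernel lam N c (Complex x (- pi)))"
    using int[of pi] int[of "- pi"] pi_gt3 by auto
  define R where "R = 2 * pi * \<i> * (residue (phase_kernel lam N c) 0 + residue (phase_kernel lam N c) (of_real u))"
  have inner: "(LBINT x. phase_kernel lam N c (Complex x (- y))) - (LBINT x. phase_kernel lam N c (Complex x y)) = R"
    if y: "1 \<le> y" "y < pi" for y
  proof -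
    have "(LBINT x. phase_kernel lam N c (Complex x (- y))) - (LBINT x. phase_kernel lam N c (Complex x y)) = 
        2 * pi * \<i> * (\<Sum>p\<in>{0, of_real u}. residue (phase_kernel lam N c) p)"
    proof (rule strip_residue[where a' = "- pi" and b' = pi and ?X0.0 = X and w = "\<lambda>x. C / (1 + x\<^sup>2)"])
      show "phase_kernel lam N c holomorphic_on {z. - pi < Im z \<and> Im z < pi} - {0, of_real u}"
        unfolding phase_kernel_def using nz nc by (intro holomorphic_intros) auto
      show "integrable lborel (\<lambda>x. phase_kernel lam N c (Complex x (- y)))" "integrable lborel (\<lambda>x. phase_kernel lam N c (Complex x y))"
        using int y by auto
      fix x t :: real assume "- y \<le> t" "t \<le> y" "\<bar>x\<bar> \<ge> X"
      then show "norm (phase_kernel lam N c (Complex x t)) \<le> C / (1 + x\<^sup>2)" using C(2)[of t x] y by auto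
    qed (use y assms tendsto_const_over_square in auto)
    then show ?thesis using assms by (simp add: R_def)
  qed
  \<comment> \<open>All heights stay above 1, so the bound C/(1 + x^2) dominates uniformly.\<close>
  define Y where "Y n = pi - 1 / (real n + 1)" for n
  have Y: "1 \<le> Y n" "Y n < pi" for n
  proof -
    have "1 / (real n + 1) \<le> 1" by simp
    then show "1 \<le> Y n" using pi_gt3 unfolding Y_def by linarith
  qed (simp add: Y_def)
  have Ylim: "Y \<longlonglongrightarrow> pi" unfolding Y_def by real_asymp
  have lim: "(\<lambda>n. LBINT x. phase_kernel lam N c (Complex x (sg * Y n))) \<longlonglongrightarrow> (LBINT x. phase_kernel lam N c (Complex x (sg * pi)))" if sg: "\<bar>sg\<bar> = 1" for sg
  proof (rule integral_dominated_convergence[where w = "\<lambda>x. C / (1 + x\<^sup>2)"])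
    have a: "\<bar>sg * Y n\<bar> = Y n" for n using sg Y(1)[of n] by (simp add: abs_mult)
    have a': "\<bar>sg * pi\<bar> = pi" using sg by (simp add: abs_mult)
    show "(\<lambda>x. phase_kernel lam N c (Complex x (sg * pi))) \<in> borel_measurable lborel" by (rule m) (use a' pi_gt3 in auto)
    show "(\<lambda>x. phase_kernel lam N c (Complex x (sg * Y n))) \<in> borel_measurable lborel" for n by (rule m) (use a Y[of n] in auto)
    show "AE x in lborel. norm (phase_kernel lam N c (Complex x (sg * Y n))) \<le> C / (1 + x\<^sup>2)" for n
      using C(2)[of "sg * Y n"] a Y[of n] by auto
    show "AE x in lborel. (\<lambda>n. phase_kernel lam N c (Complex x (sg * Y n))) \<longlonglongrightarrow> phase_kernel lam N c (Complex x (sg * pi))"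
    proof (rule AE_I2)
      fix x
      show "(\<lambda>n. phase_kernel lam N c (Complex x (sg * Y n))) \<longlonglongrightarrow> phase_kernel lam N c (Complex x (sg * pi))"
        by (rule continuous_on_tendsto_compose[OF cont]) 
          (use a a' Y pi_gt3 in \<open>auto simp: less_imp_le Complex_eq intro!: tendsto_intros Ylim always_eventually\<close>)
    qed
  qed (rule iC)
  have "(\<lambda>n. (LBINT x. phase_kernel lam N c (Complex x (- 1 * Y n))) - (LBINT x. phase_kernel lam N c (Complex x (1 * Y n)))) \<longlonglongrightarrow>
     (LBINT x. phase_kernel lam N c (Complex x (- 1 * pi))) - (LBINT x. phase_kernel lam N c (Complex x (1 * pi)))"
    by (intro tendsto_diff lim) auto
  moreover have "(LBINT x. phase_kernel lam N c (Complex x (- 1 * Y n))) - (LBINT x. phase_kernel lam N c (Complex x (1 * Y n))) = R" for n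
    using inner[OF Y] by simp
  ultimately have "R = (LBINT x. phase_kernel lam N c (Complex x (- 1 * pi))) - (LBINT x. phase_kernel lam N c (Complex x (1 * pi)))"
    by (simp add: LIMSEQ_const_iff)
  then show "(LBINT x. phase_kernel lam N c (Complex x (- pi))) - (LBINT x. phase_kernel lam N c (Complex x pi)) =
     2 * pi * \<i> * (residue (phase_kernel lam N c) 0 + residue (phase_kernel lam N c) (of_real u))"
    by (simp add: R_def)
qed

text \<open>On the steepest descent lines \<open>v = x - ln lam \<plusminus> pi * \<i>\<close> through the saddle points, \<open>phase lam v\<close> is
  \<open>- descent x\<close> minus \<open>cnj (xi lam)\<close>, respectively minus \<open>xi lam\<close>.\<close>

definition descent :: "real \<Rightarrow> real" where
  "descent x = exp x - x - 1"

lemma descent_nonneg: "descent x \<ge> 0"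
  using exp_ge_add_one_self[of x] unfolding descent_def by linarith

text \<open>Linear growth on the left and at least quadratic growth on the right suffice: two
  factors of size 1 + descent already dominate 1/(1 + x^2).\<close>

lemma descent_growth: "(1 + x\<^sup>2) / 2 \<le> (1 + descent x)\<^sup>2"
proof (cases "x \<le> 0")
  case True
  have "1 + descent x \<ge> 1" "1 + descent x \<ge> - x" using descent_nonneg[of x] by (auto simp: descent_def)
  then have "1 \<le> (1 + descent x)\<^sup>2" "(- x)\<^sup>2 \<le> (1 + descent x)\<^sup>2" 
    using True by (simp add: one_le_power) (rule power_mono, use \<open>1 + descent x \<ge> - x\<close> True in auto)
  then show ?thesis by simp
next
  case False
  then have "1 + descent x \<ge> 1 + x\<^sup>2 / 2" using exp_lower_Taylor_quadratic[of x] by (simp add: descent_def)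
  then have "(1 + x\<^sup>2 / 2)\<^sup>2 \<le> (1 + descent x)\<^sup>2" by (intro power_mono) auto
  moreover have "(1 + x\<^sup>2 / 2)\<^sup>2 \<ge> (1 + x\<^sup>2) / 2" 
  proof -
    have "1 + x\<^sup>2 / 2 \<le> (1 + x\<^sup>2 / 2)\<^sup>2" using power_increasing[of 1 2 "1 + x\<^sup>2 / 2"] by simp
    then show ?thesis by simp
  qed
  ultimately show ?thesis by linarith
qed

section \<open>Integrals over the steepest descent lines and their Laplace transforms\<close>

text \<open>The saddle value enters as exp L with a free complex L. For real L the integrand is
  positive, which the later exchange of integrals needs; the values used are L = Ln (xi lam) and L =
  Ln (cnj (xi lam)).\<close>

definition saddle_integral :: "nat \<Rightarrow> real \<Rightarrow> complex \<Rightarrow> complex" where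
  "saddle_integral N t L = (LBINT x. 1 / ((exp L + of_real (descent x)) ^ N * (exp L + of_real (descent x) + of_real t)))"

text \<open>A shift by ln lam puts the saddle at x = 0, where lam exp v = -exp x. The sign collects
  the N + 1 factors of the denominator, each of which changes sign.\<close>

lemma saddle_integral_line:
  assumes "lam > 0" and L: "exp L = of_real (lam + ln lam + 1) - sg * of_real pi * \<i>" and sg: "sg = 1 \<or> sg = -1"
  shows "(LBINT x. phase_kernel lam N c (Complex x (Re sg * pi))) = (-1) ^ (N + 1) * saddle_integral N c L"
proof -
  have ph: "phase lam (Complex (x - ln lam) (Re sg * pi)) = - (exp L + of_real (descent x))" for x
  proof -
    have "exp (Complex (x - ln lam) (Re sg * pi)) = - of_real (exp x / lam)"
      using sg assms by (auto simp: complex_eq_iff Re_exp Im_exp exp_diff)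
    then show ?thesis unfolding phase_def L using assms sg
      by (auto simp: complex_eq_iff descent_def algebra_simps)
  qed
  have "(LBINT x. phase_kernel lam N c (Complex x (Re sg * pi))) = (LBINT x. phase_kernel lam N c (Complex (x + - ln lam) (Re sg * pi)))"
    by (rule lborel_integral_shift[symmetric])
  also have "(\<lambda>x. phase_kernel lam N c (Complex (x + - ln lam) (Re sg * pi))) = 
    (\<lambda>x. (-1) ^ (N + 1) * (1 / ((exp L + of_real (descent x)) ^ N * (exp L + of_real (descent x) + of_real c))))"
  proof
    fix x
    define h where "h = exp L + complex_of_real (descent x)"
    have "phase_kernel lam N c (Complex (x + - ln lam) (Re sg * pi)) = 1 / ((- h) ^ N * (- h - of_real c))"
      using ph[of x] by (simp add: phase_kernel_def h_def)
    also have "(- h) ^ N * (- h - of_real c) = (-1) ^ (N + 1) * (h ^ N * (h + of_real c))"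
      by (subst power_minus) (simp add: algebra_simps)
    also have "1 / ((-1) ^ (N + 1) * (h ^ N * (h + of_real c))) = (-1) ^ (N + 1) * (1 / (h ^ N * (h + of_real c)))"
      by (cases "even N") auto
    finally show "phase_kernel lam N c (Complex (x + - ln lam) (Re sg * pi)) = (-1) ^ (N + 1) * (1 / ((exp L + of_real (descent x)) ^ N * (exp L + of_real (descent x) + of_real c)))"
      by (simp only: h_def)
  qed
  also have "(LBINT x. (-1) ^ (N + 1) * (1 / ((exp L + of_real (descent x)) ^ N * (exp L + of_real (descent x) + of_real c)))) = (-1) ^ (N + 1) * saddle_integral N c L"
    unfolding saddle_integral_def by (rule integral_mult_right_zero)
  finally show ?thesis .
qed

text \<open>Taylor's formula with remainder for the derivative of the inverse function of \<open>phase lam\<close>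
  on the positive real axis.\<close>

lemma inverse_phase_expansion:
  assumes "lam > 0" "u > 0" and c: "c = lam * (exp u - 1) + u" and N: "N \<ge> 1"
  shows "1 / (of_real (lam * exp u + 1)) = (\<Sum>n<N. b_coeff n lam / (fact n * of_real (lam + 1) ^ (2 * n + 1)) * of_real c ^ n)
     + (-1) ^ (N + 1) * of_real c ^ N / (2 * pi * \<i>) * (saddle_integral N c (Ln (xi lam)) - saddle_integral N c (Ln (cnj (xi lam))))"
proof -
  have xi0: "xi lam \<noteq> 0" by (auto simp: xi_def complex_eq_iff)
  have "exp (Ln (xi lam)) = xi lam" "exp (Ln (cnj (xi lam))) = cnj (xi lam)" using xi0 by (auto intro!: exp_Ln)
  then have e: "exp (Ln (xi lam)) = of_real (lam + ln lam + 1) - (- 1) * of_real pi * \<i>" 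
    "exp (Ln (cnj (xi lam))) = of_real (lam + ln lam + 1) - 1 * of_real pi * \<i>" by (simp_all add: xi_def)
  define V where "V = saddle_integral N c (Ln (xi lam)) - saddle_integral N c (Ln (cnj (xi lam)))"
  \<comment> \<open>The lower line Im = -pi carries \<open>xi lam\<close> and the upper one its
    conjugate, since the phase there is minus the saddle value minus \<open>descent\<close>.\<close>
  have "(LBINT x. phase_kernel lam N c (Complex x (Re (-1) * pi))) = (-1) ^ (N + 1) * saddle_integral N c (Ln (xi lam))"
    by (rule saddle_integral_line[OF assms(1)]) (use e in \<open>simp_all\<close>)
  moreover have "(LBINT x. phase_kernel lam N c (Complex x (Re 1 * pi))) = (-1) ^ (N + 1) * saddle_integral N c (Ln (cnj (xi lam)))"
    by (rule saddle_integral_line[OF assms(1)]) (use e in \<open>simp_all\<close>)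
  ultimately have I: "2 * pi * \<i> * (residue (phase_kernel lam N c) 0 + residue (phase_kernel lam N c) (of_real u)) = (-1) ^ (N + 1) * V"
    using phase_kernel_line_integrals(3)[OF assms] by (simp add: V_def right_diff_distrib)
  have "1 / (of_real (lam * exp u + 1)) = of_real c ^ N * residue (phase_kernel lam N c) (of_real u)"
    unfolding phase_kernel_residues(2)[OF assms(1,2) c] by (simp add: exp_of_real)
  also have "\<dots> = of_real c ^ N * (residue (phase_kernel lam N c) 0 + residue (phase_kernel lam N c) (of_real u)) - of_real c ^ N * residue (phase_kernel lam N c) 0"
    by (simp add: distrib_left)
  also have "residue (phase_kernel lam N c) 0 + residue (phase_kernel lam N c) (of_real u) = (-1) ^ (N + 1) * V / (2 * pi * \<i>)"
    unfolding I[symmetric] by simp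
  also have "of_real c ^ N * residue (phase_kernel lam N c) 0 = - (\<Sum>n<N. b_coeff n lam / (fact n * of_real (lam + 1) ^ (2 * n + 1)) * of_real c ^ n)"
    unfolding phase_kernel_residues(1)[OF assms(1,2) c]
  proof (intro arg_cong[where f = uminus] sum.cong refl)
    fix n
    have "residue (\<lambda>v. 1 / phase lam v ^ (n + 1)) 0 = (b_coeff n lam / of_real (lam + 1) ^ (2 * n + 1)) / fact n"
      unfolding b_coeff_eq_residue[OF assms(1)] by simp
    then show "of_real c ^ n * residue (\<lambda>v. 1 / phase lam v ^ (n + 1)) 0 = b_coeff n lam / (fact n * of_real (lam + 1) ^ (2 * n + 1)) * of_real c ^ n"
      by (simp add: mult_ac)
  qed
  finally show ?thesis by (simp add: V_def mult_ac)
qed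

text \<open>\<open>sector_norm_bound\<close> applies because exp L stays an angle d away from the
  negative axis. The minimum with 1 turns |exp L| + descent into a multiple of 1 + descent.\<close>

lemma shifted_descent_bound:
  assumes "\<bar>Im L\<bar> \<le> pi - d" "0 < d" "d \<le> pi/2" "B \<le> Re L" "t \<ge> 0" "N \<ge> 1"
  shows "norm (1 / ((exp L + of_real (descent x)) ^ N * (exp L + of_real (descent x) + of_real t))) \<le> 
     2 / (sqrt ((1 - cos d) / 2) * min 1 (exp B)) ^ (N + 1) * (1 / (1 + x\<^sup>2))"
proof -
  define k where "k = sqrt ((1 - cos d) / 2)"
  define m where "m = min 1 (exp B)"
  have cd: "0 \<le> cos d" "cos d < 1" using assms cos_ge_zero[of d] cos_monotone_0_pi[of 0 d] pi_gt_zero by auto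
  have k: "k > 0" using cd by (simp add: k_def)
  have m: "m > 0" "m \<le> 1" by (auto simp: m_def)
  have g: "1 + descent x \<ge> 1" using descent_nonneg[of x] by simp
  have ge: "norm (exp L + of_real b) \<ge> k * m * (1 + descent x)" if "b \<ge> descent x" for b
  proof -
    have "m * (1 + descent x) \<le> exp (Re L) + b"
    proof -
      have "m \<le> exp (Re L)" using assms(4) by (simp add: m_def min.coboundedI2)
      moreover have "m * descent x \<le> 1 * descent x" using m descent_nonneg by (intro mult_right_mono) auto
      ultimately show ?thesis using that by (simp add: distrib_left)
    qed
    then have "k * (m * (1 + descent x)) \<le> k * (norm (exp L) + b)" using k by (intro mult_left_mono) auto
    also have "\<dots> \<le> norm (exp L + of_real b)" unfolding k_def
      by (rule sector_norm_bound[OF cd cos_sector]) (use assms that descent_nonneg[of x] in auto)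
    finally show ?thesis by (simp add: mult.assoc)
  qed
  define q where "q = k * m * (1 + descent x)"
  have q: "q > 0" using k m g by (simp add: q_def)
  have "(k * m) ^ (N + 1) * ((1 + x\<^sup>2) / 2) \<le> (k * m) ^ (N + 1) * (1 + descent x) ^ (N + 1)"
  proof (rule mult_left_mono)
    have "(1 + x\<^sup>2) / 2 \<le> (1 + descent x)\<^sup>2" by (rule descent_growth)
    also have "\<dots> \<le> (1 + descent x) ^ (N + 1)" using g assms(6) by (intro power_increasing) auto
    finally show "(1 + x\<^sup>2) / 2 \<le> (1 + descent x) ^ (N + 1)" .
  qed (use k m in auto)
  also have "\<dots> = q ^ N * q" by (simp add: q_def power_mult_distrib)
  also have "\<dots> \<le> norm (exp L + of_real (descent x)) ^ N * norm (exp L + of_real (descent x + t))"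
    using ge[of "descent x"] ge[of "descent x + t"] q assms by (intro mult_mono power_mono) (auto simp: q_def)
  finally have "1 / (norm (exp L + of_real (descent x)) ^ N * norm (exp L + of_real (descent x + t))) \<le> 1 / ((k * m) ^ (N + 1) * ((1 + x\<^sup>2) / 2))"
  proof (intro frac_le)
    show "0 < (k * m) ^ (N + 1) * ((1 + x\<^sup>2) / 2)" using k m by (intro mult_pos_pos) (auto intro: add_pos_nonneg)
  qed auto
  then show ?thesis by (simp add: norm_divide norm_mult norm_power k_def m_def add.assoc)
qed

lemma cball_strip_angle:
  assumes "\<bar>Im z0\<bar> < pi" 
  obtains r d where "r > 0" "0 < d" "d \<le> pi/2" "\<And>z. z \<in> ball z0 r \<Longrightarrow> \<bar>Im z\<bar> \<le> pi - d" "r \<le> 1"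
proof -
  define r where "r = min 1 ((pi - \<bar>Im z0\<bar>) / 2)"
  have r: "r > 0" "r \<le> (pi - \<bar>Im z0\<bar>) / 2" "r \<le> 1"
    unfolding r_def by (use assms in simp) (rule min.cobounded2, rule min.cobounded1)
  show ?thesis
  proof (rule that[of r "(pi - \<bar>Im z0\<bar>) / 2"])
    fix z assume "z \<in> ball z0 r"
    then have "\<bar>Im (z - z0)\<bar> < r" using abs_Im_le_cmod[of "z - z0"] by (simp add: dist_norm norm_minus_commute)
    moreover have "\<bar>Im z\<bar> \<le> \<bar>Im z0\<bar> + \<bar>Im (z - z0)\<bar>" by simp
    moreover have "pi - (pi - \<bar>Im z0\<bar>) / 2 = \<bar>Im z0\<bar> + (pi - \<bar>Im z0\<bar>) / 2" by (simp add: field_simps)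
    ultimately show "\<bar>Im z\<bar> \<le> pi - (pi - \<bar>Im z0\<bar>) / 2" using r(2) by linarith
  qed (use assms r in auto)
qed

lemma saddle_integrand_measurable:
  "(\<lambda>x. 1 / ((exp L + complex_of_real (descent x)) ^ N * (exp L + of_real (descent x) + of_real t))) \<in> borel_measurable lborel"
  unfolding descent_def by measurable

lemma shifted_descent_nonzero:
  assumes "\<bar>Im L\<bar> < pi" "b \<ge> 0" shows "exp L + of_real b \<noteq> 0"
  using slit_add_nonneg[OF exp_notin_nonpos_Reals[OF assms(1)] assms(2)] by auto

lemma saddle_integral_bound:
  assumes "\<bar>Im L0\<bar> < pi" "N \<ge> 1"
  obtains r C where "r > 0" "\<And>L t. L \<in> ball L0 r \<Longrightarrow> t \<ge> 0 \<Longrightarrow> 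
     integrable lborel (\<lambda>x. 1 / ((exp L + complex_of_real (descent x)) ^ N * (exp L + of_real (descent x) + of_real t)))"
    "\<And>L t x. L \<in> ball L0 r \<Longrightarrow> t \<ge> 0 \<Longrightarrow> norm (1 / ((exp L + of_real (descent x)) ^ N * (exp L + of_real (descent x) + of_real t))) \<le> C / (1 + x\<^sup>2)"
    "\<And>L t. L \<in> ball L0 r \<Longrightarrow> t \<ge> 0 \<Longrightarrow> norm (saddle_integral N t L) \<le> C * pi"
proof -
  obtain r d where rd: "r > 0" "0 < d" "d \<le> pi/2" "\<And>z. z \<in> ball L0 r \<Longrightarrow> \<bar>Im z\<bar> \<le> pi - d" "r \<le> 1"
    using cball_strip_angle[OF assms(1)] by metis
  define C where "C = 2 / (sqrt ((1 - cos d) / 2) * min 1 (exp (Re L0 - 1))) ^ (N + 1)"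
  have bd: "norm (1 / ((exp L + of_real (descent x)) ^ N * (exp L + of_real (descent x) + of_real t))) \<le> C / (1 + x\<^sup>2)"
    if L: "L \<in> ball L0 r" and t: "t \<ge> 0" for L t x
  proof -
    have "\<bar>Re (L - L0)\<bar> < 1" using abs_Re_le_cmod[of "L - L0"] L rd(5) by (simp add: dist_norm norm_minus_commute)
    then have "Re L0 - 1 \<le> Re L" by (simp add: abs_if split: if_splits)
    from shifted_descent_bound[OF rd(4)[OF L] rd(2,3) this t assms(2), of x] show ?thesis by (simp add: C_def)
  qed
  have iC: "integrable lborel (\<lambda>x. C / (1 + x\<^sup>2))" using integrable_mult_right[OF integrable_inverse_square, of C] by simp
  have int: "integrable lborel (\<lambda>x. 1 / ((exp L + complex_of_real (descent x)) ^ N * (exp L + of_real (descent x) + of_real t)))"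
    if L: "L \<in> ball L0 r" and t: "t \<ge> 0" for L t
    by (rule Bochner_Integration.integrable_bound[OF iC saddle_integrand_measurable], rule AE_I2)
       (rule order_trans[OF bd[OF L t]], unfold real_norm_def, rule abs_ge_self)
  define P where "P = (LBINT x::real. 1 / (1 + x\<^sup>2))"
  have P: "P \<ge> 0" by (simp add: P_def)
  show ?thesis
  \<comment> \<open>The maximum lets one constant serve both the pointwise and the integrated
    estimate.\<close>
  proof (rule that[of r "max C (C * P / pi)"])
    fix L t assume L: "L \<in> ball L0 r" "(t::real) \<ge> 0"
    have "norm (saddle_integral N t L) \<le> (LBINT x. C / (1 + x\<^sup>2))"
      unfolding saddle_integral_def by (rule Bochner_Integration.integral_norm_bound_integral[OF int[OF L] iC]) (rule bd[OF L])
    also have "\<dots> = C * P" unfolding P_def using integral_mult_right_zero[of lborel C "\<lambda>x. 1 / (1 + x\<^sup>2)"] by simp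
    also have "\<dots> \<le> max C (C * P / pi) * pi" using pi_gt_zero by (simp add: max_def field_simps)
    finally show "norm (saddle_integral N t L) \<le> max C (C * P / pi) * pi" .
    fix x show "norm (1 / ((exp L + of_real (descent x)) ^ N * (exp L + of_real (descent x) + of_real t))) \<le> max C (C * P / pi) / (1 + x\<^sup>2)"
      by (rule order_trans[OF bd[OF L]]) (intro divide_right_mono, auto)
  qed (use rd int in auto)
qed

lemma saddle_integral_measurable: "(\<lambda>y. saddle_integral N (exp y) L) \<in> borel_measurable lborel"
  unfolding saddle_integral_def
  by (rule lborel.borel_measurable_lebesgue_integral) (simp add: descent_def case_prod_beta, measurable)

lemma holomorphic_saddle_integral:
  assumes "N \<ge> 1" "t \<ge> 0"
  shows "saddle_integral N t holomorphic_on {L. - pi < Im L \<and> Im L < pi}"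
  unfolding saddle_integral_def
proof (rule holomorphic_parametric_integral[OF open_strip])
  fix x
  have "exp L + complex_of_real (descent x) \<noteq> 0 \<and> exp L + complex_of_real (descent x) + of_real t \<noteq> 0" if "L \<in> {L. - pi < Im L \<and> Im L < pi}" for L
  proof -
    have "\<bar>Im L\<bar> < pi" using that by auto
    then show ?thesis
      using shifted_descent_nonzero[of L "descent x"] shifted_descent_nonzero[of L "descent x + t"] descent_nonneg[of x] assms(2)
      by (simp add: add.assoc)
  qed
  then show "(\<lambda>L. 1 / ((exp L + complex_of_real (descent x)) ^ N * (exp L + of_real (descent x) + of_real t))) holomorphic_on {L. - pi < Im L \<and> Im L < pi}"
    by (intro holomorphic_intros) auto
next
  fix L0 assume "L0 \<in> {L. - pi < Im L \<and> Im L < pi}"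
  then have "\<bar>Im L0\<bar> < pi" by auto
  then obtain r C where rC: "r > 0" "\<And>L t x. L \<in> ball L0 r \<Longrightarrow> t \<ge> 0 \<Longrightarrow> norm (1 / ((exp L + of_real (descent x)) ^ N * (exp L + of_real (descent x) + of_real t))) \<le> C / (1 + x\<^sup>2)"
    by (rule saddle_integral_bound[OF _ assms(1), of L0]) blast+
  have iC: "integrable lborel (\<lambda>x. C / (1 + x\<^sup>2))" using integrable_mult_right[OF integrable_inverse_square, of C] by simp
  show "\<exists>r>0. \<exists>w. integrable lborel w \<and> (\<forall>L\<in>ball L0 r \<inter> {L. - pi < Im L \<and> Im L < pi}. \<forall>x\<in>space lborel.
     norm (1 / ((exp L + complex_of_real (descent x)) ^ N * (exp L + of_real (descent x) + of_real t))) \<le> w x)"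
    using rC assms(2) by (intro exI[of _ r] conjI exI[of _ "\<lambda>x. C / (1 + x\<^sup>2)"] iC) auto
qed (rule saddle_integrand_measurable)

text \<open>With t = exp y this is the Laplace transform at a of t^N times
  \<open>saddle_integral N t L\<close>; the additional exp y in the weight is dt.\<close>

definition saddle_transform :: "nat \<Rightarrow> real \<Rightarrow> complex \<Rightarrow> complex" where
  "saddle_transform N a L = (LBINT y. of_real (exp (real (N + 1) * y) * exp (- a * exp y)) * saddle_integral N (exp y) L)"

lemma norm_weight_mult: "norm (of_real (exp A * exp B) * (z :: complex)) = exp A * exp B * norm z"
  by (simp add: norm_mult)

lemma saddle_transform_integrable:
  assumes "\<bar>Im L\<bar> < pi" "N \<ge> 1" "a > 0"
  shows "integrable lborel (\<lambda>y. of_real (exp (real (N + 1) * y) * exp (- a * exp y)) * saddle_integral N (exp y) L)"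
proof -
  obtain r C where rC: "r > 0" "\<And>K t. K \<in> ball L r \<Longrightarrow> t \<ge> 0 \<Longrightarrow> norm (saddle_integral N t K) \<le> C * pi"
    by (rule saddle_integral_bound[OF assms(1,2)]) blast
  show ?thesis
  proof (rule Bochner_Integration.integrable_bound)
    show "integrable lborel (\<lambda>y. (exp (real (N + 1) * y) * exp (- a * exp y)) * (C * pi))"
      using assms by (intro integrable_mult_left gamma_log_integral) auto
    show "AE y in lborel. norm (of_real (exp (real (N + 1) * y) * exp (- a * exp y)) * saddle_integral N (exp y) L) \<le> norm ((exp (real (N + 1) * y) * exp (- a * exp y)) * (C * pi))"
      unfolding norm_weight_mult real_norm_def using rC(2)[of L] rC(1)
      by (intro AE_I2 order_trans[OF _ abs_ge_self] mult_left_mono) auto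
    show "(\<lambda>y. of_real (exp (real (N + 1) * y) * exp (- a * exp y)) * saddle_integral N (exp y) L) \<in> borel_measurable lborel"
      by (intro borel_measurable_times saddle_integral_measurable) measurable
  qed
qed

lemma holomorphic_saddle_transform:
  assumes "N \<ge> 1" "a > 0"
  shows "saddle_transform N a holomorphic_on {L. - pi < Im L \<and> Im L < pi}"
  unfolding saddle_transform_def
proof (rule holomorphic_parametric_integral[OF open_strip])
  fix y
  have "saddle_integral N (exp y) holomorphic_on {L. - pi < Im L \<and> Im L < pi}"
    by (rule holomorphic_saddle_integral[OF assms(1)]) simp
  then show "(\<lambda>L. of_real (exp (real (N + 1) * y) * exp (- a * exp y)) * saddle_integral N (exp y) L) holomorphic_on {L. - pi < Im L \<and> Im L < pi}"
    by (intro holomorphic_intros)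
next
  fix L assume "L \<in> {L. - pi < Im L \<and> Im L < pi}"
  then show "(\<lambda>y. of_real (exp (real (N + 1) * y) * exp (- a * exp y)) * saddle_integral N (exp y) L) \<in> borel_measurable lborel"
    using saddle_transform_integrable[of L N a] assms by auto
next
  fix L0 assume "L0 \<in> {L. - pi < Im L \<and> Im L < pi}"
  then have "\<bar>Im L0\<bar> < pi" by auto
  then obtain r C where rC: "r > 0" "\<And>K t. K \<in> ball L0 r \<Longrightarrow> t \<ge> 0 \<Longrightarrow> norm (saddle_integral N t K) \<le> C * pi"
    by (rule saddle_integral_bound[OF _ assms(1), of L0]) blast+
  show "\<exists>r>0. \<exists>w. integrable lborel w \<and> (\<forall>L\<in>ball L0 r \<inter> {L. - pi < Im L \<and> Im L < pi}. \<forall>y\<in>space lborel.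
     norm (of_real (exp (real (N + 1) * y) * exp (- a * exp y)) * saddle_integral N (exp y) L) \<le> w y)"
  proof (intro exI[of _ r] conjI exI[of _ "\<lambda>y. (exp (real (N + 1) * y) * exp (- a * exp y)) * (C * pi)"] ballI rC(1))
    show "integrable lborel (\<lambda>y. (exp (real (N + 1) * y) * exp (- a * exp y)) * (C * pi))"
      using assms by (intro integrable_mult_left gamma_log_integral) auto
    fix L y assume "L \<in> ball L0 r \<inter> {L. - pi < Im L \<and> Im L < pi}"
    then show "norm (of_real (exp (real (N + 1) * y) * exp (- a * exp y)) * saddle_integral N (exp y) L) \<le> (exp (real (N + 1) * y) * exp (- a * exp y)) * (C * pi)"
      unfolding norm_weight_mult using rC(2)[of L "exp y"] by (intro mult_left_mono) auto
  qed
qed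

text \<open>\<open>Gamma z * exp z * z powr - z\<close> at \<open>z = exp v\<close>; it is the Laplace integral of \<open>descent\<close>.\<close>

definition Laplace_Gamma :: "complex \<Rightarrow> complex" where
  "Laplace_Gamma v = of_real (sqrt (2 * pi)) * exp (- v / 2) * Stirling_remainder 0 v"

lemma Laplace_Gamma_of_real:
  shows "integrable lborel (\<lambda>x. exp (- exp v * descent x))"
    and "Laplace_Gamma (of_real v) = of_real (LBINT x. exp (- exp v * descent x))"
proof -
  define z where "z = exp v"
  have z: "z > 0" by (simp add: z_def)
  have e: "exp (- exp v * descent x) = exp z * (exp (z * x) * exp (- z * exp x))" for x
    by (simp add: descent_def z_def exp_add[symmetric] algebra_simps)
  show "integrable lborel (\<lambda>x. exp (- exp v * descent x))" unfolding e
    using z by (intro integrable_mult_right gamma_log_integral)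
  have "(LBINT x. exp (- exp v * descent x)) = exp z * (Gamma z * z powr (- z))"
    unfolding e using gamma_log_integral(2)[OF z z] by simp
  also have "z powr (- z) = exp (- z * v)" by (simp add: powr_def z_def)
  finally have 1: "(LBINT x. exp (- exp v * descent x)) = Gamma z * exp (z - z * v)"
    by (simp add: exp_diff exp_minus field_simps)
  have s: "complex_of_real (sqrt (2 * pi)) \<noteq> 0" by simp
  have "Laplace_Gamma (of_real v) = exp (- of_real v / 2) * (Gamma (of_real z) * exp (of_real z - (of_real z - 1/2) * of_real v))"
    using s unfolding Laplace_Gamma_def Stirling_remainder_def by (simp add: z_def exp_of_real)
  also have "\<dots> = Gamma (of_real z) * (exp (- of_real v / 2) * exp (of_real z - (of_real z - 1/2) * of_real v))" by simp
  also have "exp (- of_real v / 2) * exp (of_real z - (of_real z - 1/2) * of_real v) = exp (complex_of_real (z - z * v))"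
    unfolding exp_add[symmetric] by (rule arg_cong[where f = exp]) (simp add: field_simps)
  finally have 2: "Laplace_Gamma (of_real v) = of_real (Gamma z * exp (z - z * v))"
    by (simp only: of_real_mult exp_of_real Gamma_complex_of_real)
  show "Laplace_Gamma (of_real v) = of_real (LBINT x. exp (- exp v * descent x))" unfolding 1 2 ..
qed

text \<open>For fixed x, the scaling t = h(x) tau turns t^N exp(-a t)/(h^N (h + t)) dt into tau^N
  exp(-a h tau)/(1 + tau) dtau. Exchanging the integrals, scaling, and exchanging back leaves the
  x-integral of exp(-a tau descent x), which is the gamma function in its Laplace form.\<close>

lemma saddle_transform_of_real:
  assumes "N \<ge> 1"
  shows "saddle_transform N (exp s) (of_real L) = Stieltjes_transform (real (N + 1)) (\<lambda>x. exp (- exp (of_real x)) * Laplace_Gamma (of_real x - of_real L)) (of_real s + of_real L)"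
proof -
  define a where "a = exp s"
  have a: "a > 0" by (simp add: a_def)
  define h where "h x = exp L + descent x" for x
  have h: "h x > 0" for x using descent_nonneg[of x] by (simp add: h_def add_pos_nonneg)
  have hm[measurable]: "h \<in> borel_measurable borel" unfolding h_def descent_def by measurable
  define p where "p = real (N + 1)"
  have p: "p > 0" by (simp add: p_def)
  \<comment> \<open>\<open>m\<close> is the integrand before the scaling by h(x) and
    \<open>f\<close> the one after it, both in logarithmic variables.\<close>
  define f where "f y x = exp (p * y) / (1 + exp y) * exp (- a * h x * exp y)" for y x
  define m where "m y x = exp (p * y) * exp (- a * exp y) * (1 / (h x ^ N * (h x + exp y)))" for y x
  have fle: "f y x \<le> exp (p * y) * exp (- (a * h x) * exp y)" for y x
  proof -
    have "exp (p * y) / (1 + exp y) \<le> exp (p * y) / 1" by (intro divide_left_mono) (auto simp: add_pos_pos)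
    then have "exp (p * y) / (1 + exp y) * exp (- a * h x * exp y) \<le> exp (p * y) / 1 * exp (- a * h x * exp y)"
      by (intro mult_right_mono) auto
    then show ?thesis unfolding f_def by simp
  qed
  have f_int1: "integrable lborel (\<lambda>y. f y x)" for x
  proof (rule Bochner_Integration.integrable_bound)
    show "integrable lborel (\<lambda>y. exp (p * y) * exp (- (a * h x) * exp y))" using a h p by (intro gamma_log_integral) auto
    show "(\<lambda>y. f y x) \<in> borel_measurable lborel" unfolding f_def by measurable
    show "AE y in lborel. norm (f y x) \<le> norm (exp (p * y) * exp (- (a * h x) * exp y))"
    proof (rule AE_I2)
      fix y
      have "norm (f y x) = f y x" by (simp add: f_def add_nonneg_nonneg)
      then show "norm (f y x) \<le> norm (exp (p * y) * exp (- (a * h x) * exp y))"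
        using fle[of y x] by (simp only: real_norm_def)
    qed
  qed
  have fe: "f y x = exp (p * y) / (1 + exp y) * exp (- exp (y + s + L)) * exp (- exp (y + s) * descent x)" for y x
  proof -
    have "- a * h x * exp y = - exp (y + s + L) + - exp (y + s) * descent x"
      by (simp add: h_def a_def exp_add algebra_simps)
    then show ?thesis unfolding f_def by (simp only: exp_add[of "- exp (y + s + L)"] mult.assoc)
  qed
  have f_int2: "integrable lborel (f y)" for y
    unfolding fe by (intro integrable_mult_right Laplace_Gamma_of_real)
  have mx: "(LBINT y. f y x) = (LBINT y. m y x)" for x
  proof -
    have "f (- ln (h x) + 1 * y) x = m y x" for y
    proof -
      define H where "H = h x"
      have H: "H > 0" "exp (ln H) = H" using h by (auto simp: H_def)
      have e: "exp (- ln H + y) = exp y / H" using H by (simp add: exp_diff)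
      have "exp (p * (- ln H + y)) = exp (- ln H + y) ^ (N + 1)" by (simp only: p_def exp_of_nat_mult)
      also have "\<dots> = exp (p * y) / H ^ (N + 1)" unfolding e power_divide by (simp only: p_def exp_of_nat_mult)
      finally have e2: "exp (p * (- ln H + y)) = exp (p * y) / H ^ (N + 1)" .
      have e3: "- a * H * (exp y / H) = - a * exp y" using H by simp
      have K: "X / H ^ (N + 1) / (1 + E / H) * Z = X * Z * (1 / (H ^ N * (H + E)))" if "E > 0" for X Z E :: real
      proof -
        have "H + E > 0" using H that by simp
        then show ?thesis using H that by (simp add: field_simps)
      qed
      show ?thesis unfolding f_def m_def H_def[symmetric] mult_1 e e2 e3 by (rule K) simp
    qed
    then show ?thesis
      using lborel_integral_real_affine[of 1 "\<lambda>y. f y x" "- ln (h x)"] by simp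
  qed
  have m_int1: "integrable lborel (\<lambda>y. m y x)" for x
  proof (rule Bochner_Integration.integrable_bound)
    show "integrable lborel (\<lambda>y. exp (p * y) * exp (- a * exp y) * (1 / (h x ^ N * h x)))" using a p by (intro integrable_mult_left gamma_log_integral) auto
    show "(\<lambda>y. m y x) \<in> borel_measurable lborel" unfolding m_def by measurable
    show "AE y in lborel. norm (m y x) \<le> norm (exp (p * y) * exp (- a * exp y) * (1 / (h x ^ N * h x)))"
    proof (rule AE_I2)
      fix y
      have "1 / (h x ^ N * (h x + exp y)) \<le> 1 / (h x ^ N * h x)" using h[of x]
        by (intro divide_left_mono mult_left_mono mult_pos_pos) (auto simp: add_pos_pos)
      then have "m y x \<le> exp (p * y) * exp (- a * exp y) * (1 / (h x ^ N * h x))" unfolding m_def by (intro mult_left_mono) auto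
      moreover have "m y x \<ge> 0" unfolding m_def using h[of x] by (intro mult_nonneg_nonneg divide_nonneg_nonneg) (auto simp: add_nonneg_nonneg)
      ultimately show "norm (m y x) \<le> norm (exp (p * y) * exp (- a * exp y) * (1 / (h x ^ N * h x)))"
        unfolding real_norm_def by (metis abs_ge_self abs_of_nonneg order_trans)
    qed
  qed
  have cm: "1 / ((exp (of_real L) + complex_of_real (descent x)) ^ N * (exp (of_real L) + of_real (descent x) + of_real (exp y))) = complex_of_real (1 / (h x ^ N * (h x + exp y)))" for x y
    by (simp add: h_def flip: exp_of_real)
  obtain r C where "r > 0" "\<And>K t. K \<in> ball (of_real L) r \<Longrightarrow> t \<ge> 0 \<Longrightarrow> 
     integrable lborel (\<lambda>x. 1 / ((exp K + complex_of_real (descent x)) ^ N * (exp K + of_real (descent x) + of_real t)))"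
    by (rule saddle_integral_bound[of "of_real L" N]) (use assms in auto)
  then have "integrable lborel (\<lambda>x. 1 / ((exp (of_real L) + complex_of_real (descent x)) ^ N * (exp (of_real L) + of_real (descent x) + of_real (exp y))))" for y by simp
  then have "integrable lborel (\<lambda>x. complex_of_real (1 / (h x ^ N * (h x + exp y))))" for y unfolding cm .
  then have "integrable lborel (\<lambda>x. 1 / (h x ^ N * (h x + exp y)))" for y using complex_of_real_integrable_eq by blast
  then have m_int2: "integrable lborel (m y)" for y unfolding m_def by (intro integrable_mult_right)
  have sw1: "(LBINT y. LBINT x. f y x) = (LBINT x. LBINT y. f y x)"
  proof (rule integral_swap_nonneg[OF _ _ f_int2 f_int1])
    show "(\<lambda>(y, x). f y x) \<in> borel_measurable (lborel \<Otimes>\<^sub>M lborel)" unfolding f_def by measurable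
    show "f y x \<ge> 0" for y x by (simp add: f_def add_nonneg_nonneg)
  qed
  have sw2: "(LBINT y. LBINT x. m y x) = (LBINT x. LBINT y. m y x)"
  proof (rule integral_swap_nonneg[OF _ _ m_int2 m_int1])
    show "(\<lambda>(y, x). m y x) \<in> borel_measurable (lborel \<Otimes>\<^sub>M lborel)" unfolding m_def by measurable
    show "m y x \<ge> 0" for y x unfolding m_def using h[of x] by (intro mult_nonneg_nonneg divide_nonneg_nonneg) (auto simp: add_nonneg_nonneg)
  qed
  have "saddle_transform N (exp s) (of_real L) = (LBINT y. complex_of_real (LBINT x. m y x))"
    unfolding saddle_transform_def
  proof (intro Bochner_Integration.integral_cong refl)
    fix y
    have "saddle_integral N (exp y) (of_real L) = of_real (LBINT x. 1 / (h x ^ N * (h x + exp y)))"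
      unfolding saddle_integral_def cm by (rule integral_complex_of_real)
    then show "of_real (exp (real (N + 1) * y) * exp (- exp s * exp y)) * saddle_integral N (exp y) (of_real L) = complex_of_real (LBINT x. m y x)"
      unfolding m_def p_def a_def by (simp only: integral_mult_right_zero of_real_mult)
  qed
  also have "\<dots> = of_real (LBINT y. LBINT x. m y x)" by (rule integral_complex_of_real)
  also have "(LBINT y. LBINT x. m y x) = (LBINT y. LBINT x. f y x)" unfolding sw1 sw2 mx ..
  also have "(LBINT y. LBINT x. f y x) = (LBINT y. exp (p * y) / (1 + exp y) * (exp (- exp (y + (s + L))) * (LBINT x. exp (- exp ((y + (s + L)) - L) * descent x))))"
    unfolding fe integral_mult_right_zero by (simp add: add_ac mult.assoc)
  also have "complex_of_real \<dots> = Stieltjes_transform p (\<lambda>x. of_real (exp (- exp x) * (LBINT u. exp (- exp (x - L) * descent u)))) (of_real (s + L))"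
    by (rule Stieltjes_transform_of_real[symmetric])
  also have "(\<lambda>x. complex_of_real (exp (- exp x) * (LBINT u. exp (- exp (x - L) * descent u)))) = (\<lambda>x. exp (- exp (of_real x)) * Laplace_Gamma (of_real x - of_real L))"
    using Laplace_Gamma_of_real(2) by (simp flip: exp_of_real of_real_diff)
  finally show ?thesis by (simp add: p_def)
qed

lemma Stirling_remainder_line_bound:
  assumes "\<bar>Im L0\<bar> < pi"
  obtains r C where "r > 0" "\<And>L x. L \<in> ball L0 r \<Longrightarrow> norm (Stirling_remainder K (of_real x - L)) \<le> C * (exp (- real K * x) + exp (- (real K + 1) * x))"
proof -
  obtain r d where rd: "r > 0" "0 < d" "d \<le> pi/2" "\<And>z. z \<in> ball L0 r \<Longrightarrow> \<bar>Im z\<bar> \<le> pi - d" "r \<le> 1"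
    using cball_strip_angle[OF assms(1)] by metis
  obtain C where C: "C > 0" "\<And>v. \<bar>Im v\<bar> \<le> pi - d \<Longrightarrow> norm (Stirling_remainder K v) \<le> C * (exp (- real K * Re v) + exp (- (real K + 1) * Re v))"
    using Stirling_remainder_bound[OF rd(2,3)] by metis
  define B where "B = \<bar>Re L0\<bar> + 1"
  show ?thesis
  proof (rule that[OF rd(1)])
    fix L and x :: real assume L: "L \<in> ball L0 r"
    have "\<bar>Re (L - L0)\<bar> < 1" using abs_Re_le_cmod[of "L - L0"] L rd(5) by (simp add: dist_norm norm_minus_commute)
    then have RL: "Re L \<le> B" by (simp add: B_def)
    have e: "exp (- q * (x - Re L)) \<le> exp ((real K + 1) * B) * exp (- q * x)" if q: "0 \<le> q" "q \<le> real K + 1" for q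
    proof -
      have "q * Re L \<le> q * B" using q RL by (intro mult_left_mono) auto
      also have "\<dots> \<le> (real K + 1) * B" using q by (intro mult_right_mono) (auto simp: B_def)
      finally show ?thesis unfolding exp_add[symmetric] by (simp add: algebra_simps)
    qed
    have "norm (Stirling_remainder K (of_real x - L)) \<le> C * (exp (- real K * (x - Re L)) + exp (- (real K + 1) * (x - Re L)))"
      using C(2)[of "of_real x - L"] rd(4)[OF L] by simp
    also have "\<dots> \<le> C * (exp ((real K + 1) * B) * exp (- real K * x) + exp ((real K + 1) * B) * exp (- (real K + 1) * x))"
      using C(1) by (intro mult_left_mono add_mono e) auto
    finally show "norm (Stirling_remainder K (of_real x - L)) \<le> C * exp ((real K + 1) * B) * (exp (- real K * x) + exp (- (real K + 1) * x))"
      by (simp add: algebra_simps)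
  qed
qed

lemma Stirling_remainder_line_measurable:
  assumes "\<bar>Im L\<bar> < pi"
  shows "(\<lambda>x. Stirling_remainder K (of_real x - L)) \<in> borel_measurable lborel"
proof -
  have "continuous_on UNIV (\<lambda>x. Stirling_remainder K (of_real x - L))"
    by (rule continuous_on_compose2[OF holomorphic_on_imp_continuous_on[OF holomorphic_Stirling_remainder]])
       (use assms in \<open>auto intro!: continuous_intros simp: abs_less_iff\<close>)
  then show ?thesis by (simp add: borel_measurable_continuous_onI)
qed

text \<open>The identity theorem in \<open>L\<close> with s fixed and real; this is where the saddle
  value leaves the positive axis.\<close>

lemma saddle_transform_eq:
  assumes "N \<ge> 1" "\<bar>Im L\<bar> < pi"
  shows "saddle_transform N (exp s) L = Stieltjes_transform (real (N + 1)) (\<lambda>x. exp (- exp (of_real x)) * Laplace_Gamma (of_real x - L)) (of_real s + L)"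
proof (rule holomorphic_eq_of_eq_on_reals[where f = "saddle_transform N (exp s)" and z = L and S = "{z. - pi < Im z \<and> Im z < pi}" and
    g = "\<lambda>L. Stieltjes_transform (real (N + 1)) (\<lambda>x. exp (- exp (of_real x)) * Laplace_Gamma (of_real x - L)) (of_real s + L)"])
  let ?S = "{z. - pi < Im z \<and> Im z < pi}"
  show "saddle_transform N (exp s) holomorphic_on ?S" by (rule holomorphic_saddle_transform[OF assms(1)]) simp
  show "(\<lambda>L. Stieltjes_transform (real (N + 1)) (\<lambda>x. exp (- exp (of_real x)) * Laplace_Gamma (of_real x - L)) (of_real s + L)) holomorphic_on ?S"
  \<comment> \<open>q = 1/2 because \<open>Laplace_Gamma\<close> carries exp(-v/2) besides the
    Stirling bound with exponents 0 and 1; N >= 1 gives 3/2 < N + 1.\<close>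
  proof (rule holomorphic_Stieltjes_transform[OF open_strip, where c = 1 and q = "1/2"])
    fix x :: real
    have "(\<lambda>L. Stirling_remainder 0 (of_real x - L)) holomorphic_on ?S"
      by (rule holomorphic_on_compose_gen[OF _ holomorphic_Stirling_remainder, unfolded o_def]) (auto intro!: holomorphic_intros)
    then show "(\<lambda>L. exp (- exp (of_real x)) * Laplace_Gamma (of_real x - L)) holomorphic_on ?S"
      unfolding Laplace_Gamma_def by (intro holomorphic_intros) auto
  next
    fix L assume "L \<in> ?S"
    then have "\<bar>Im L\<bar> < pi" by auto
    moreover have "continuous_on UNIV (\<lambda>x. exp (- (complex_of_real x - L) / 2))" by (intro continuous_intros) auto
    ultimately show "(\<lambda>x. exp (- exp (of_real x)) * Laplace_Gamma (of_real x - L)) \<in> borel_measurable lborel"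
      unfolding Laplace_Gamma_def
      by (intro borel_measurable_times exp_minus_exp_measurable Stirling_remainder_line_measurable) (auto intro: borel_measurable_continuous_onI)
  next
    fix L0 assume "L0 \<in> ?S"
    then have "\<bar>Im L0\<bar> < pi" by auto
    then obtain r C where rC: "r > 0" "\<And>L x. L \<in> ball L0 r \<Longrightarrow> norm (Stirling_remainder 0 (of_real x - L)) \<le> C * (exp (- real 0 * x) + exp (- (real 0 + 1) * x))"
      by (rule Stirling_remainder_line_bound[of L0 0]) blast
    define C' where "C' = sqrt (2 * pi) * exp ((\<bar>Re L0\<bar> + r) / 2) * C"
    show "\<exists>r>0. \<exists>C. \<forall>L\<in>ball L0 r \<inter> ?S. \<forall>x. norm (exp (- exp (complex_of_real x)) * Laplace_Gamma (of_real x - L)) \<le>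
         C * (exp (- 1 * exp x) * (exp (- (1/2) * x) + exp (- (1/2 + 1) * x)))"
    proof (rule exI[of _ r], intro conjI rC(1), rule exI[of _ C'], intro ballI allI)
      fix L x assume "L \<in> ball L0 r \<inter> ?S"
      then have L: "L \<in> ball L0 r" by simp
      have "\<bar>Re (L - L0)\<bar> < r" using abs_Re_le_cmod[of "L - L0"] L by (simp add: dist_norm norm_minus_commute)
      then have "Re L / 2 \<le> (\<bar>Re L0\<bar> + r) / 2" by simp
      then have e: "exp (- (x - Re L) / 2) \<le> exp ((\<bar>Re L0\<bar> + r) / 2) * exp (- (1/2) * x)"
        unfolding exp_add[symmetric] by (simp add: field_simps)
      have "norm (exp (- exp (complex_of_real x)) * Laplace_Gamma (of_real x - L)) = 
          exp (- 1 * exp x) * (sqrt (2 * pi) * exp (- (x - Re L) / 2) * norm (Stirling_remainder 0 (of_real x - L)))"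
        by (simp add: Laplace_Gamma_def norm_mult Re_exp)
      also have "\<dots> \<le> exp (- 1 * exp x) * (sqrt (2 * pi) * (exp ((\<bar>Re L0\<bar> + r) / 2) * exp (- (1/2) * x)) * (C * (exp (- real 0 * x) + exp (- (real 0 + 1) * x))))"
        by (intro mult_left_mono mult_mono e rC(2)[OF L]) auto
      also have "\<dots> = C' * (exp (- 1 * exp x) * (exp (- (1/2) * x) * (exp (- real 0 * x) + exp (- (real 0 + 1) * x))))"
        by (simp add: C'_def)
      also have "exp (- (1/2) * x) * (exp (- real 0 * x) + exp (- (real 0 + 1) * x)) = exp (- (1/2) * x) + exp (- (1/2 + 1) * x)"
        unfolding distrib_left exp_add[symmetric] by (simp add: field_simps)
      finally show "norm (exp (- exp (complex_of_real x)) * Laplace_Gamma (of_real x - L)) \<le>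
         C' * (exp (- 1 * exp x) * (exp (- (1/2) * x) + exp (- (1/2 + 1) * x)))" .
    qed
  qed (use assms in \<open>auto intro!: holomorphic_intros\<close>)
  show "saddle_transform N (exp s) (of_real x) = Stieltjes_transform (real (N + 1)) (\<lambda>u. exp (- exp (of_real u)) * Laplace_Gamma (of_real u - of_real x)) (of_real s + of_real x)" for x
    by (rule saddle_transform_of_real[OF assms(1)])
qed (use assms open_strip connected_strip in auto)

section \<open>The incomplete gamma function as a Laplace integral of the inverse phase\<close>

lemma has_integral_open_half_line:
  fixes f :: "real \<Rightarrow> real"
  assumes "(f has_integral I) {0..}" shows "(f has_integral I) {0<..}"
proof -
  have "negligible {x \<in> {0..} - {0<..}. f x \<noteq> 0}" by (rule negligible_subset[of "{0}"]) auto
  moreover have "{x \<in> {0<..} - {0..}. f x \<noteq> 0} = {}" by auto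
  then have "negligible {x \<in> {0<..} - {0..}. f x \<noteq> 0}" by (metis negligible_empty)
  ultimately show ?thesis using assms has_integral_spike_set_eq by blast
qed

text \<open>The new variable is the logarithm of the phase. The Jacobian of the inverse phase
  contributes 1/(lam exp u + 1), the function to be expanded by the Taylor formula.\<close>

lemma incomplete_gamma_substitution:
  assumes "lam > 0" "a > 0" 
  obtains u where "\<And>y. u y > 0" "\<And>y. lam * (exp (u y) - 1) + u y = exp y"
    "((\<lambda>y. complex_of_real (exp y * exp (- a * exp y) / (lam * exp (u y) + 1))) has_integral
       exp (of_real a * of_real (ln (lam * a)) + of_real (lam * a)) * upper_Gamma (- of_real a) (of_real (lam * a))) UNIV"
proof -
  define z where "z = lam * a"
  have z: "z > 0" using assms by (simp add: z_def)
  have slit: "complex_of_real z \<notin> \<real>\<^sub>\<le>\<^sub>0" using z by simp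
  define r where "r t = (z + t) powr (- a - 1) * exp (- (z + t))" for t
  have rc: "upper_Gamma_integrand (- of_real a) (of_real z) t = of_real (r t)" if "t \<ge> 0" for t
  proof -
    have "(complex_of_real z + of_real t) powr (- of_real a - 1) = of_real (z + t) powr of_real (- a - 1)" by simp
    also have "\<dots> = of_real ((z + t) powr (- a - 1))" using that z by (intro powr_of_real) auto
    finally show ?thesis by (simp add: upper_Gamma_integrand_def r_def flip: exp_of_real)
  qed
  have "set_integrable lborel {0..} (\<lambda>t. complex_of_real (r t))"
    using upper_Gamma_integrable(1)[OF slit, of "- of_real a"] rc by (subst (asm) set_integrable_cong[OF refl refl]) auto
  then have "integrable lborel (\<lambda>t. complex_of_real (indicator {0..} t * r t))"
    by (simp add: set_integrable_def scaleR_conv_of_real)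
  then have "integrable lborel (\<lambda>t. indicator {0..} t * r t)" using complex_of_real_integrable_eq by blast
  then have ai0: "r absolutely_integrable_on {0..}"
    by (simp add: set_integrable_def integrable_completion borel_measurable_integrable)
  then have ai: "r absolutely_integrable_on {0<..}" by (rule set_integrable_subset) auto
  have hi: "(r has_integral integral {0..} r) {0..}" using ai0 set_lebesgue_integral_eq_integral(1) by blast
  have U: "upper_Gamma (- of_real a) (of_real z) = of_real (integral {0..} r)"
  proof -
    have "((\<lambda>t. complex_of_real (r t)) has_integral of_real (integral {0..} r)) {0..}" using hi by (rule has_integral_of_real)
    then have "((\<lambda>t. upper_Gamma_integrand (- of_real a) (of_real z) t) has_integral of_real (integral {0..} r)) {0..}"
      by (rule has_integral_eq[rotated]) (simp add: rc)
    then show ?thesis unfolding upper_Gamma_def upper_Gamma_integrand_def[abs_def] by (rule integral_unique)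
  qed
  have ho: "(r has_integral integral {0..} r) {0<..}" by (rule has_integral_open_half_line[OF hi])
  \<comment> \<open>The reciprocal of z^(-a) exp(-z), the normalization in the definition of the
    remainder.\<close>
  define E where "E = exp (a * ln z + z)"
  \<comment> \<open>This is lam (exp u - 1) + u at u = ln(1 + t/z), because lam/z = 1/a.\<close>
  define G where "G t = t / a + ln (1 + t / z)" for t
  have G_mono: "G t < G t'" if "0 \<le> t" "t < t'" for t t'
    using that assms z unfolding G_def by (intro add_strict_mono) (auto simp: divide_strict_right_mono add_pos_nonneg)
  have G0: "G 0 = 0" by (simp add: G_def)
  have Gpos: "G t > 0" if "t > 0" for t using G_mono[of 0 t] that G0 by simp
  have dG: "(G has_field_derivative (1 / a + 1 / (z + t))) (at t)" if "t \<ge> 0" for t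
  proof -
    have "1 + t / z > 0" using that z by (simp add: add_pos_nonneg)
    then have "(G has_field_derivative (1 / a + (1 / z) / (1 + t / z))) (at t)"
      unfolding G_def using assms z by (auto intro!: derivative_eq_intros)
    moreover have "(1 / z) / (1 + t / z) = 1 / (z + t)" using z that by (simp add: field_simps)
    ultimately show ?thesis by simp
  qed
  have "\<exists>t>0. G t = exp y" for y
  proof -
    \<comment> \<open>The bracket for the intermediate value theorem comes from G t >= t/a.\<close>
    have "\<exists>t\<ge>0. t \<le> a * exp y \<and> G t = exp y"
    proof (rule IVT')
      show "G 0 \<le> exp y" by (simp add: G0)
      show "exp y \<le> G (a * exp y)" using assms z by (simp add: G_def)
      show "continuous_on {0..a * exp y} G"
        by (intro continuous_at_imp_continuous_on ballI DERIV_isCont[OF dG]) auto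
    qed (use assms in auto)
    then obtain t where t: "t \<ge> 0" "G t = exp y" by blast
    then have "t \<noteq> 0" using G0 by (metis exp_not_eq_zero)
    then show ?thesis using t by (metis less_le)
  qed
  then obtain T where T: "\<And>y. T y > 0" "\<And>y. G (T y) = exp y" by metis
  have Tln: "T (ln (G t)) = t" if "t > 0" for t
  proof -
    have "G (T (ln (G t))) = G t" using T(2) Gpos[OF that] by simp
    then show ?thesis using G_mono[of "T (ln (G t))" t] G_mono[of t "T (ln (G t))"] T(1)[of "ln (G t)"] that
      by (metis less_irrefl less_le linorder_neqE_linordered_idom)
  qed
  define u where "u y = ln (1 + T y / z)" for y
  have up: "u y > 0" for y unfolding u_def using T(1)[of y] z by (intro ln_gt_zero) simp
  have eu: "exp (u y) = 1 + T y / z" for y unfolding u_def using T(1)[of y] z by (simp add: add_pos_pos)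
  have ue: "lam * (exp (u y) - 1) + u y = exp y" for y
  proof -
    have "exp y = T y / a + u y" using T(2)[of y] by (simp add: G_def u_def)
    moreover have "lam * (exp (u y) - 1) = T y / a" unfolding eu using assms by (simp add: z_def)
    ultimately show ?thesis by simp
  qed
  define ph where "ph y = exp y * exp (- a * exp y) / (lam * exp (u y) + 1)" for y
  define g where "g t = ln (G t)" for t
  define g' where "g' t = (1 / a + 1 / (z + t)) / G t" for t
  have key: "\<bar>g' t\<bar> * ph (g t) = E * r t" if t: "t > 0" for t
  proof -
    have eg: "exp (g t) = G t" using Gpos[OF t] by (simp add: g_def)
    have Tg: "T (g t) = t" using Tln[OF t] by (simp add: g_def)
    have den: "lam * exp (u (g t)) + 1 = (z + t + a) / a"
      unfolding eu Tg using assms by (simp add: z_def field_simps)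
    have g'p: "g' t = (z + t + a) / (a * (z + t)) / G t" unfolding g'_def using assms z t by (simp add: field_simps)
    have g'n: "\<bar>g' t\<bar> = g' t" unfolding g'p using assms z t Gpos[OF t] by (intro abs_of_nonneg) auto
    have "X / (a * W) / H * (H * e / (X / a)) = e / W" if "X > 0" "W > 0" "H > 0" for X W H e :: real
      using that assms by (simp add: field_simps)
    then have "\<bar>g' t\<bar> * ph (g t) = exp (- a * G t) / (z + t)"
      unfolding g'n ph_def den eg unfolding g'p using assms z t Gpos[OF t] by simp
    also have "\<dots> = E * r t"
    proof -
      have l: "ln (1 + t / z) = ln (z + t) - ln z"
      proof -
        have "1 + t / z = (z + t) / z" using z by (simp add: field_simps)
        then show ?thesis using z t by (simp add: ln_divide_pos)
      qed
      have "- a * G t = - t - a * (ln (z + t) - ln z)" unfolding G_def l using assms by (simp add: algebra_simps)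
      moreover have "1 / (z + t) = exp (- ln (z + t))" using z t by (simp add: exp_minus inverse_eq_divide)
      ultimately have "exp (- a * G t) / (z + t) = exp ((- t - a * (ln (z + t) - ln z)) + (- ln (z + t)))"
        unfolding exp_add by (simp add: divide_inverse)
      moreover have "r t = exp ((- a - 1) * ln (z + t) + - (z + t))" unfolding r_def exp_add using z t by (simp add: powr_def)
      ultimately show ?thesis unfolding E_def by (simp add: exp_add[symmetric] algebra_simps)
    qed
    finally show ?thesis .
  qed
  have im: "g ` {0<..} = UNIV"
  proof safe
    fix y :: real
    have "g (T y) = y" by (simp add: g_def T(2))
    then show "y \<in> g ` {0<..}" using T(1)[of y] by (metis greaterThan_iff imageI)
  qed auto
  have inj: "inj_on g {0<..}"
    by (rule inj_on_inverseI[of _ T]) (use Tln in \<open>auto simp: g_def\<close>)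
  have dg: "(g has_field_derivative g' t) (at t within {0<..})" if "t \<in> {0<..}" for t
  proof -
    have "((\<lambda>t. ln (G t)) has_field_derivative (1 / G t * (1 / a + 1 / (z + t)))) (at t)"
      using that by (intro DERIV_chain2[OF DERIV_ln_divide dG] Gpos) auto
    then show ?thesis unfolding g_def g'_def by (simp add: has_field_derivative_at_within)
  qed
  have "(\<lambda>t. E * r t) absolutely_integrable_on {0<..}" by (intro set_integrable_mult_right ai)
  then have "(\<lambda>t. \<bar>g' t\<bar> * ph (g t)) absolutely_integrable_on {0<..}"
    by (rule set_integrable_cong[THEN iffD1, rotated -1]) (auto simp: key)
  moreover have "integral {0<..} (\<lambda>t. \<bar>g' t\<bar> * ph (g t)) = E * integral {0..} r"
  proof -
    have "integral {0<..} (\<lambda>t. \<bar>g' t\<bar> * ph (g t)) = integral {0<..} (\<lambda>t. E * r t)" by (rule integral_cong) (simp add: key)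
    also have "\<dots> = E * integral {0..} r" using integral_unique[OF ho] by simp
    finally show ?thesis .
  qed
  ultimately have "ph absolutely_integrable_on g ` {0<..}" "integral (g ` {0<..}) ph = E * integral {0..} r"
    using has_absolute_integral_change_of_variables_1'[OF _ dg inj, of ph "E * integral {0..} r"] by auto
  then have "(ph has_integral E * integral {0..} r) UNIV"
    unfolding im using set_lebesgue_integral_eq_integral(1) by (metis integrable_integral)
  then have "((\<lambda>y. complex_of_real (ph y)) has_integral of_real (E * integral {0..} r)) UNIV" by (rule has_integral_of_real)
  moreover have "of_real (E * integral {0..} r) = exp (of_real a * of_real (ln (lam * a)) + of_real (lam * a)) * upper_Gamma (- of_real a) (of_real (lam * a))"
    unfolding z_def[symmetric] U E_def by (simp add: exp_of_real[symmetric])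
  ultimately show ?thesis using that[OF up ue] by (simp add: ph_def)
qed

lemma xi_notin_nonpos_Reals: "xi lam \<notin> \<real>\<^sub>\<le>\<^sub>0"
  by (simp add: complex_nonpos_Reals_iff xi_def)

lemma Im_Ln_xi: "Im (Ln (xi lam)) = omega lam" "Im (Ln (cnj (xi lam))) = - omega lam" "Ln (cnj (xi lam)) = cnj (Ln (xi lam))"
proof -
  have "xi lam \<noteq> 0" using xi_notin_nonpos_Reals[of lam] by auto
  then show 1: "Im (Ln (xi lam)) = omega lam" by (simp add: omega_def Arg_eq_Im_Ln)
  show 2: "Ln (cnj (xi lam)) = cnj (Ln (xi lam))" using cnj_Ln[OF xi_notin_nonpos_Reals] by simp
  show "Im (Ln (cnj (xi lam))) = - omega lam" unfolding 2 using 1 by simp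
qed

text \<open>In the Laplace integral the term c^n contributes n!/a^(n+1) and so reproduces the n-th
  term of the expansion in the definition. What is left are the Laplace transforms of the two saddle
  integrals.\<close>

lemma remainder_of_real:
  assumes lam: "lam > 0" and N: "N \<ge> 1"
  shows "remainder N lam (of_real s) = (-1) ^ (N + 1) / (2 * pi * \<i>) *
     (saddle_transform N (exp s) (Ln (xi lam)) - saddle_transform N (exp s) (Ln (cnj (xi lam))))"
proof -
  define a where "a = exp s"
  have a: "a > 0" by (simp add: a_def)
  obtain u where u: "\<And>y. u y > 0" "\<And>y. lam * (exp (u y) - 1) + u y = exp y"
    "((\<lambda>y. complex_of_real (exp y * exp (- a * exp y) / (lam * exp (u y) + 1))) has_integral
       exp (of_real a * of_real (ln (lam * a)) + of_real (lam * a)) * upper_Gamma (- of_real a) (of_real (lam * a))) UNIV"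
    using incomplete_gamma_substitution[OF lam a] by blast
  define w where "w n y = exp (real (n + 1) * y) * exp (- a * exp y)" for n y
  define b where "b n = b_coeff n lam / (fact n * of_real (lam + 1) ^ (2 * n + 1))" for n
  define k where "k = (-1) ^ (N + 1) / (2 * pi * \<i>)"
  have im: "\<bar>Im (Ln (xi lam))\<bar> < pi" "\<bar>Im (Ln (cnj (xi lam)))\<bar> < pi"
    using omega_bounds[of lam] by (simp_all add: Im_Ln_xi)
  define V where "V L y = complex_of_real (w N y) * saddle_integral N (exp y) L" for L y
  have wi: "integrable lborel (w n)" "integral\<^sup>L lborel (w n) = fact n * a powr (- real (n + 1))" for n
    using gamma_log_integral[of "real (n + 1)" a] a Gamma_fact[of n, where 'a = real] unfolding w_def[abs_def] by (simp_all add: add.commute)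
  have Vi: "integrable lborel (V (Ln (xi lam)))" "integrable lborel (V (Ln (cnj (xi lam))))"
    using saddle_transform_integrable[OF im(1) N a] saddle_transform_integrable[OF im(2) N a] unfolding V_def w_def by simp_all
  define ps where "ps y = (\<Sum>n<N. b n * of_real (w n y)) + k * (V (Ln (xi lam)) y - V (Ln (cnj (xi lam))) y)" for y
  have ps: "complex_of_real (exp y * exp (- a * exp y) / (lam * exp (u y) + 1)) = ps y" for y
  proof -
    have "1 / (of_real (lam * exp (u y) + 1)) = (\<Sum>n<N. b n * of_real (exp y) ^ n)
       + (-1) ^ (N + 1) * of_real (exp y) ^ N / (2 * pi * \<i>) * (saddle_integral N (exp y) (Ln (xi lam)) - saddle_integral N (exp y) (Ln (cnj (xi lam))))"
      unfolding b_def by (rule inverse_phase_expansion[OF lam u(1) u(2)[symmetric] N])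
    then have "complex_of_real (exp y * exp (- a * exp y)) * (1 / (of_real (lam * exp (u y) + 1))) = 
        complex_of_real (exp y * exp (- a * exp y)) * ((\<Sum>n<N. b n * of_real (exp y) ^ n)
       + (-1) ^ (N + 1) * of_real (exp y) ^ N / (2 * pi * \<i>) * (saddle_integral N (exp y) (Ln (xi lam)) - saddle_integral N (exp y) (Ln (cnj (xi lam)))))"
      by simp
    moreover have wn: "complex_of_real (exp y * exp (- a * exp y)) * of_real (exp y) ^ n = of_real (w n y)" for n
    proof -
      have "exp (real (n + 1) * y) = exp y ^ (n + 1)" by (simp only: exp_of_nat_mult)
      then show ?thesis by (simp add: w_def)
    qed
    moreover have "e * (S + c * T / d * (D1 - D2)) = e * S + c / d * (e * T * D1 - e * T * D2)" for e S c T d D1 D2 :: complex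
      by (simp add: algebra_simps diff_divide_distrib)
    moreover have "complex_of_real (exp y * exp (- a * exp y)) * (\<Sum>n<N. b n * of_real (exp y) ^ n) = (\<Sum>n<N. b n * of_real (w n y))"
      unfolding sum_distrib_left wn[symmetric] by (intro sum.cong refl) (simp only: mult_ac)
    ultimately have "complex_of_real (exp y * exp (- a * exp y)) * (1 / (of_real (lam * exp (u y) + 1))) = ps y"
      unfolding ps_def V_def k_def wn[symmetric] by (simp only:)
    then show ?thesis by simp
  qed
  have psi: "integrable lborel ps" unfolding ps_def[abs_def] using wi(1) Vi
    by (intro Bochner_Integration.integrable_add Bochner_Integration.integrable_sum integrable_mult_right Bochner_Integration.integrable_diff) auto
  have "(ps has_integral integral\<^sup>L lborel ps) UNIV" using has_integral_integral_lborel[OF psi] .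
  then have I: "exp (of_real a * of_real (ln (lam * a)) + of_real (lam * a)) * upper_Gamma (- of_real a) (of_real (lam * a)) = integral\<^sup>L lborel ps"
    using u(3) unfolding ps by (rule has_integral_unique[rotated])
  have "integral\<^sup>L lborel ps = (\<Sum>n<N. b n * of_real (integral\<^sup>L lborel (w n))) + k * (integral\<^sup>L lborel (V (Ln (xi lam))) - integral\<^sup>L lborel (V (Ln (cnj (xi lam)))))"
    unfolding ps_def[abs_def] using wi(1) Vi
    by (subst Bochner_Integration.integral_add Bochner_Integration.integral_sum Bochner_Integration.integral_diff integral_mult_right_zero; simp)+
  also have "(\<Sum>n<N. b n * of_real (integral\<^sup>L lborel (w n))) = (\<Sum>n<N. b_coeff n lam / (of_real (lam + 1) ^ (2 * n + 1) * exp (of_nat (n + 1) * of_real s)))"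
  proof (intro sum.cong refl)
    fix n
    have "a powr (- real (n + 1)) = exp (- (real (n + 1) * s))" by (simp add: powr_def a_def algebra_simps)
    then have "complex_of_real (a powr (- real (n + 1))) = 1 / exp (of_nat (n + 1) * of_real s)"
      by (simp add: exp_minus inverse_eq_divide flip: exp_of_real)
    then show "b n * of_real (integral\<^sup>L lborel (w n)) = b_coeff n lam / (of_real (lam + 1) ^ (2 * n + 1) * exp (of_nat (n + 1) * of_real s))"
      unfolding wi(2) b_def by simp
  qed
  also have "k * (integral\<^sup>L lborel (V (Ln (xi lam))) - integral\<^sup>L lborel (V (Ln (cnj (xi lam))))) = k * (saddle_transform N (exp s) (Ln (xi lam)) - saddle_transform N (exp s) (Ln (cnj (xi lam))))"
    unfolding saddle_transform_def V_def[abs_def] w_def a_def ..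
  finally have J: "integral\<^sup>L lborel ps = (\<Sum>n<N. b_coeff n lam / (of_real (lam + 1) ^ (2 * n + 1) * exp (of_nat (n + 1) * of_real s))) + k * (saddle_transform N (exp s) (Ln (xi lam)) - saddle_transform N (exp s) (Ln (cnj (xi lam))))" .
  have ln: "ln (lam * a) = s + ln lam" using lam by (simp add: a_def ln_mult)
  have "lifted_Gamma (- exp (of_real s)) (of_real s + of_real (ln lam)) = upper_Gamma (- of_real a) (of_real (lam * a))"
  proof -
    have "exp (complex_of_real s + of_real (ln lam)) = of_real (lam * a)" using lam by (simp add: exp_add exp_of_real a_def)
    then show ?thesis by (subst lifted_Gamma_eq) (auto simp: a_def exp_of_real)
  qed
  then have "exp (exp (of_real s) * (of_real s + of_real (ln lam)) + of_real lam * exp (of_real s)) * lifted_Gamma (- exp (of_real s)) (of_real s + of_real (ln lam)) = integral\<^sup>L lborel ps"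
    unfolding I[symmetric] ln by (simp add: a_def exp_of_real)
  then show ?thesis unfolding remainder_eq[OF lam] J k_def by simp
qed

section \<open>Rotation of the path of integration\<close>

lemma exp_gamma_weight_tendsto:
  assumes "\<alpha> > 0" "c > 0"
  shows "((\<lambda>x::real. exp (\<alpha> * x) * exp (- c * exp x)) \<longlongrightarrow> 0) at_top" "((\<lambda>x::real. exp (\<alpha> * x) * exp (- c * exp x)) \<longlongrightarrow> 0) at_bot"
  using assms by real_asymp+

lemma exp_shift_factor: "exp (p * (x - r)) = exp (- p * r) * exp (p * (x :: real))"
  unfolding exp_add[symmetric] by (simp add: algebra_simps)

lemma norm_one_plus_exp_ge_half:
  assumes "\<bar>Re y\<bar> \<ge> 1" shows "norm (1 + exp y) \<ge> 1/2"
proof (cases "Re y \<ge> 0")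
  case True
  have "2 \<le> exp (1::real)" using exp_ge_add_one_self[of 1] by simp
  also have "\<dots> \<le> exp (Re y)" using assms True by simp
  finally show ?thesis using norm_triangle_ineq2[of "exp y" "-1"] by (simp add: add.commute)
next
  case False
  have "2 \<le> exp (1::real)" using exp_ge_add_one_self[of 1] by simp
  also have "\<dots> \<le> exp (- Re y)" using assms False by simp
  finally have "exp (Re y) \<le> 1/2" by (simp add: exp_minus field_simps)
  then show ?thesis using norm_triangle_ineq2[of 1 "- exp y"] by simp
qed

text \<open>The denominator has period 2 pi i, while the numerator gains exp(2 pi i (N + 1/2)) = -1.
  This relation expresses values beyond phase pi through the principal strip.\<close>

lemma Stieltjes_transform_period:
  "Stieltjes_transform (real N + 1/2) D (s - 2 * of_real pi * \<i>) = - Stieltjes_transform (real N + 1/2) D s"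
proof -
  have p: "exp (of_real (real N + 1/2) * (of_real x - (s - 2 * of_real pi * \<i>))) / (1 + exp (of_real x - (s - 2 * of_real pi * \<i>))) * D x = 
     - (exp (of_real (real N + 1/2) * (of_real x - s)) / (1 + exp (of_real x - s)) * D x)" for x
  proof -
    have "exp (of_real x - (s - 2 * of_real pi * \<i>)) = exp (of_real x - s)"
      using exp_plus_2pin[of "of_real x - s" 1] by (simp add: algebra_simps)
    moreover have "exp (of_real (real N + 1/2) * (of_real x - (s - 2 * of_real pi * \<i>))) = - exp (of_real (real N + 1/2) * (of_real x - s))"
    proof -
      have "p * (X - (s - t)) = p * (X - s) + p * t" for p X s t :: complex by (simp add: algebra_simps)
      moreover have "of_real (real N + 1/2) * (2 * of_real pi * \<i>) = of_real pi * \<i> + 2 * of_int (int N) * of_real pi * \<i>"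
        by (simp add: field_simps)
      ultimately have "of_real (real N + 1/2) * (of_real x - (s - 2 * of_real pi * \<i>)) = (of_real (real N + 1/2) * (of_real x - s) + of_real pi * \<i>) + 2 * of_int (int N) * of_real pi * \<i>"
        by (simp only: add.assoc)
      then show ?thesis using exp_plus_2pin[of "of_real (real N + 1/2) * (of_real x - s) + of_real pi * \<i>" "int N"]
        by (simp add: exp_add mult_ac)
    qed
    ultimately show ?thesis by simp
  qed
  show ?thesis unfolding Stieltjes_transform_def p by simp
qed

text \<open>The density left after K Stirling terms, as a function of a complex variable so that its
  line can be moved.\<close>

definition residual_density :: "nat \<Rightarrow> complex \<Rightarrow> complex \<Rightarrow> complex" where
  "residual_density K L z = exp (- exp z) * Stirling_remainder K (z - L)"

text \<open>Integration along Im = b, that is, along the ray of argument b in the Mellin variable.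
  Subtracting b i from \<open>sg\<close> keeps the kernel unchanged as a function of the complex
  variable.\<close>

definition rotated_transform :: "nat \<Rightarrow> nat \<Rightarrow> complex \<Rightarrow> real \<Rightarrow> complex \<Rightarrow> complex" where
  "rotated_transform N K L b sg = Stieltjes_transform (real N + 1/2) (\<lambda>x. residual_density K L (Complex x b)) (sg - of_real b * \<i>)"

definition rotated_kernel :: "nat \<Rightarrow> nat \<Rightarrow> complex \<Rightarrow> complex \<Rightarrow> complex \<Rightarrow> complex" where
  "rotated_kernel N K L sg z = exp (of_real (real N + 1/2) * (z - sg)) / (1 + exp (z - sg)) * residual_density K L z"

lemma rotated_transform_eq: "rotated_transform N K L b sg = (LBINT x. rotated_kernel N K L sg (Complex x b))"
proof -
  have "Complex x b - sg = of_real x - (sg - of_real b * \<i>)" for x by (simp add: complex_eq_iff)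
  then show ?thesis unfolding rotated_transform_def Stieltjes_transform_def rotated_kernel_def by (simp only:)
qed

text \<open>The bound pi/4 keeps cos b positive, so exp(-exp z) decays on all rotated lines; half of
  the gap pi - |Im L| keeps z - L inside a Stirling sector.\<close>

lemma residual_density_bound:
  assumes "\<bar>Im L\<bar> < pi"
  obtains b0 C where "0 < b0" "b0 \<le> pi/4" "\<bar>Im L\<bar> + b0 < pi" "C > 0"
    "\<And>b x. \<bar>b\<bar> \<le> b0 \<Longrightarrow> norm (residual_density K L (Complex x b)) \<le> C * (exp (- cos b * exp x) * (exp (- real K * x) + exp (- (real K + 1) * x)))"
proof -
  define b0 where "b0 = min (pi/4) ((pi - \<bar>Im L\<bar>) / 2)"
  have b0: "0 < b0" "b0 \<le> pi/4" "b0 \<le> (pi - \<bar>Im L\<bar>) / 2"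
    unfolding b0_def by (use assms in simp) (rule min.cobounded1, rule min.cobounded2)
  define d where "d = (pi - \<bar>Im L\<bar>) / 2"
  have d: "0 < d" "d \<le> pi/2" using assms by (auto simp: d_def)
  obtain C where C: "C > 0" "\<And>v. \<bar>Im v\<bar> \<le> pi - d \<Longrightarrow> norm (Stirling_remainder K v) \<le> C * (exp (- real K * Re v) + exp (- (real K + 1) * Re v))"
    using Stirling_remainder_bound[OF d] by metis
  define E where "E = exp ((real K + 1) * \<bar>Re L\<bar>)"
  show ?thesis
  proof (rule that[of b0 "C * E"])
    show "\<bar>Im L\<bar> + b0 < pi" using b0(3) assms by (simp add: field_simps)
    show "C * E > 0" using C by (simp add: E_def)
    fix b x :: real assume b: "\<bar>b\<bar> \<le> b0"
    have e: "exp (- q * (x - Re L)) \<le> E * exp (- q * x)" if q: "0 \<le> q" "q \<le> real K + 1" for q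
    proof -
      have "q * Re L \<le> q * \<bar>Re L\<bar>" using q by (intro mult_left_mono) auto
      also have "\<dots> \<le> (real K + 1) * \<bar>Re L\<bar>" using q by (intro mult_right_mono) auto
      finally show ?thesis unfolding E_def exp_add[symmetric] by (simp add: algebra_simps)
    qed
    have "\<bar>Im (Complex x b - L)\<bar> \<le> \<bar>b\<bar> + \<bar>Im L\<bar>" by simp
    also have "\<dots> \<le> pi - d" using b b0(3) by (simp add: d_def field_simps)
    finally have "norm (Stirling_remainder K (Complex x b - L)) \<le> C * (exp (- real K * (x - Re L)) + exp (- (real K + 1) * (x - Re L)))"
      using C(2)[of "Complex x b - L"] by simp
    also have "\<dots> \<le> C * (E * exp (- real K * x) + E * exp (- (real K + 1) * x))"
      using C(1) by (intro mult_left_mono add_mono e) auto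
    finally have "exp (- cos b * exp x) * norm (Stirling_remainder K (Complex x b - L)) \<le> exp (- cos b * exp x) * (C * (E * exp (- real K * x) + E * exp (- (real K + 1) * x)))"
      by (intro mult_left_mono) auto
    then show "norm (residual_density K L (Complex x b)) \<le> C * E * (exp (- cos b * exp x) * (exp (- real K * x) + exp (- (real K + 1) * x)))"
      by (simp add: residual_density_def norm_mult Re_exp algebra_simps)
  qed (use b0 in auto)
qed

text \<open>Fixes admissible angles and the density bound once. The locale is instantiated for both
  saddle values, with separate constants.\<close>

locale rotation =
  fixes K :: nat and L :: complex and b0 C :: real
  assumes b0: "0 < b0" "b0 \<le> pi/4" "\<bar>Im L\<bar> + b0 < pi" and C: "C > 0"
    and density_bound: "\<And>b x. \<bar>b\<bar> \<le> b0 \<Longrightarrow> norm (residual_density K L (Complex x b)) \<le> C * (exp (- cos b * exp x) * (exp (- real K * x) + exp (- (real K + 1) * x)))"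
begin

lemma holomorphic_density: "residual_density K L holomorphic_on {z. - pi < Im (z - L) \<and> Im (z - L) < pi}"
proof -
  have "(\<lambda>z. Stirling_remainder K (z - L)) holomorphic_on {z. - pi < Im (z - L) \<and> Im (z - L) < pi}"
    by (rule holomorphic_on_compose_gen[OF _ holomorphic_Stirling_remainder, unfolded o_def]) (auto intro!: holomorphic_intros)
  then show ?thesis unfolding residual_density_def by (intro holomorphic_intros)
qed

lemma cos_pos: "\<bar>b\<bar> \<le> b0 \<Longrightarrow> cos b > 0"
  using b0(1,2) by (intro cos_gt_zero_pi) auto

lemma density_measurable:
  assumes "\<bar>b\<bar> \<le> b0"
  shows "(\<lambda>x. residual_density K L (Complex x b)) \<in> borel_measurable lborel"
proof -
  have "continuous_on UNIV (\<lambda>x. residual_density K L (Complex x b))"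
    by (rule continuous_on_compose2[OF holomorphic_on_imp_continuous_on[OF holomorphic_density]])
       (use assms b0 in \<open>auto simp: Complex_eq intro!: continuous_intros\<close>)
  then show ?thesis by (simp add: borel_measurable_continuous_onI)
qed

lemma holomorphic_rotated_transform:
  assumes "N \<ge> K + 1" "\<bar>b\<bar> \<le> b0"
  shows "rotated_transform N K L b holomorphic_on {sg. b - pi < Im sg \<and> Im sg < b + pi}"
  unfolding rotated_transform_def
proof (rule holomorphic_Stieltjes_transform[OF open_strip, where c = "cos b" and q = "real K"])
  fix z0 assume "z0 \<in> {sg. b - pi < Im sg \<and> Im sg < b + pi}"
  show "\<exists>r>0. \<exists>C. \<forall>z\<in>ball z0 r \<inter> {sg. b - pi < Im sg \<and> Im sg < b + pi}. \<forall>x. norm (residual_density K L (Complex x b)) \<le>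
      C * (exp (- cos b * exp x) * (exp (- real K * x) + exp (- (real K + 1) * x)))"
    by (rule exI[of _ 1], intro conjI, simp, rule exI[of _ C]) (intro ballI allI density_bound[OF assms(2)])
qed (use assms cos_pos density_measurable in \<open>auto intro!: holomorphic_intros\<close>)

lemma rotated_kernel_bound:
  assumes "cos (b - Im sg) \<ge> - cos e" "0 < e" "e \<le> pi/2" "\<bar>b\<bar> \<le> b0"
  shows "norm (rotated_kernel N K L sg (Complex x b)) \<le> 
     C * exp (- (real N + 1/2) * Re sg) / sin e * (exp ((real N + 1/2) * x) * (exp (- cos b * exp x) * (exp (- real K * x) + exp (- (real K + 1) * x))))"
proof -
  have s: "sin e > 0" using assms by (intro sin_gt_zero) auto
  have "norm (1 + exp (Complex x b - sg)) \<ge> sin e"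
    using assms by (intro norm_one_plus_exp_ge) auto
  then have "norm (exp (of_real (real N + 1/2) * (Complex x b - sg))) / norm (1 + exp (Complex x b - sg)) \<le> exp ((real N + 1/2) * (x - Re sg)) / sin e"
    using s by (intro frac_le) auto
  then have "norm (exp (of_real (real N + 1/2) * (Complex x b - sg))) / norm (1 + exp (Complex x b - sg)) * norm (residual_density K L (Complex x b)) 
    \<le> exp ((real N + 1/2) * (x - Re sg)) / sin e * (C * (exp (- cos b * exp x) * (exp (- real K * x) + exp (- (real K + 1) * x))))"
    using s density_bound[OF assms(4)] by (intro mult_mono) auto
  moreover note exp_shift_factor[of "real N + 1/2" x "Re sg"]
  ultimately show ?thesis by (simp only: rotated_kernel_def norm_mult norm_divide) (simp add: mult_ac)
qed

lemma rotated_kernel_integrable: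
  assumes "cos (b - Im sg) \<ge> - cos e" "0 < e" "e \<le> pi/2" "\<bar>b\<bar> \<le> b0" "N \<ge> K + 1"
  shows "integrable lborel (\<lambda>x. rotated_kernel N K L sg (Complex x b))"
proof (rule Bochner_Integration.integrable_bound)
  define g where "g x = C * exp (- (real N + 1/2) * Re sg) / sin e * (exp ((real N + 1/2) * x) * (exp (- cos b * exp x) * (exp (- real K * x) + exp (- (real K + 1) * x))))" for x
  show "integrable lborel g" unfolding g_def
    using assms cos_pos by (intro integrable_mult_right integrable_gamma_weight) auto
  show "AE x in lborel. norm (rotated_kernel N K L sg (Complex x b)) \<le> norm (g x)"
    using rotated_kernel_bound[OF assms(1-4)] unfolding g_def by (intro AE_I2) (rule order_trans, assumption, unfold real_norm_def, rule abs_ge_self)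
  have s: "sin e > 0" using assms by (intro sin_gt_zero) auto
  have "1 + exp (Complex x b - sg) \<noteq> 0" for x
  proof
    assume "1 + exp (Complex x b - sg) = 0"
    then show False using norm_one_plus_exp_ge[where y = "Complex x b - sg" and e = e] assms s by simp
  qed
  then have "continuous_on UNIV (\<lambda>x. exp (of_real (real N + 1/2) * (Complex x b - sg)) / (1 + exp (Complex x b - sg)))"
    by (intro continuous_intros) (auto simp: Complex_eq intro!: continuous_intros)
  then show "(\<lambda>x. rotated_kernel N K L sg (Complex x b)) \<in> borel_measurable lborel"
    unfolding rotated_kernel_def using density_measurable[OF assms(4)]
    by (intro borel_measurable_times) (auto intro: borel_measurable_continuous_onI)
qed

text \<open>Absolute values under the integral: sin e bounds the denominator, and the two
  exponentials of the weight give one gamma value each with scale cos b. The cosine hypothesis,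
  unlike a bound on |Im sg|, also admits locations beyond the principal strip.\<close>

lemma rotated_transform_bound:
  assumes "cos (b - Im sg) \<ge> - cos e" "0 < e" "e \<le> pi/2" "\<bar>b\<bar> \<le> b0" "N \<ge> K + 1"
  shows "norm (rotated_transform N K L b sg) \<le> C * exp (- (real N + 1/2) * Re sg) / sin e *
     (Gamma (real N + 1/2 - real K) * cos b powr (- (real N + 1/2 - real K)) + Gamma (real N - 1/2 - real K) * cos b powr (- (real N - 1/2 - real K)))"
proof -
  define A where "A = C * exp (- (real N + 1/2) * Re sg) / sin e"
  define f1 where "f1 x = exp ((real N + 1/2 - real K) * x) * exp (- cos b * exp x)" for x
  define f2 where "f2 x = exp ((real N - 1/2 - real K) * x) * exp (- cos b * exp x)" for x
  have i1: "integrable lborel f1" "integral\<^sup>L lborel f1 = Gamma (real N + 1/2 - real K) * cos b powr (- (real N + 1/2 - real K))"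
    unfolding f1_def[abs_def] using assms cos_pos by (intro gamma_log_integral; simp)+
  have i2: "integrable lborel f2" "integral\<^sup>L lborel f2 = Gamma (real N - 1/2 - real K) * cos b powr (- (real N - 1/2 - real K))"
    unfolding f2_def[abs_def] using assms cos_pos by (intro gamma_log_integral; simp)+
  have e: "exp ((real N + 1/2) * x) * (exp (- cos b * exp x) * (exp (- real K * x) + exp (- (real K + 1) * x))) = f1 x + f2 x" for x
    unfolding f1_def f2_def distrib_left exp_add[symmetric] by (simp add: algebra_simps)
  have "norm (rotated_transform N K L b sg) \<le> (LBINT x. A * (f1 x + f2 x))"
    unfolding rotated_transform_eq
  proof (rule Bochner_Integration.integral_norm_bound_integral[OF rotated_kernel_integrable[OF assms]])
    show "integrable lborel (\<lambda>x. A * (f1 x + f2 x))" using i1 i2 by (intro integrable_mult_right Bochner_Integration.integrable_add)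
    show "norm (rotated_kernel N K L sg (Complex x b)) \<le> A * (f1 x + f2 x)" for x
      using rotated_kernel_bound[OF assms(1-4), of N x] unfolding A_def e .
  qed
  also have "\<dots> = A * (integral\<^sup>L lborel f1 + integral\<^sup>L lborel f2)"
    using i1(1) i2(1) by simp
  finally show ?thesis unfolding i1(2) i2(2) A_def .
qed

text \<open>\<open>strip_residue\<close> applied to the kernel; \<open>pts\<close> has to list the
  zeros of 1 + exp(z - sg) in a slightly wider strip.\<close>

lemma line_difference:
  assumes "N \<ge> K + 1" "a < b" "\<bar>a\<bar> \<le> b0" "\<bar>b\<bar> \<le> b0"
    and ea: "cos (a - Im sg) \<ge> - cos e" "cos (b - Im sg) \<ge> - cos e" "0 < e" "e \<le> pi/2"
    and pts: "finite pts" "pts \<subseteq> {z. a < Im z \<and> Im z < b}" "r > 0"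
    and nz: "\<And>z. a - r < Im z \<Longrightarrow> Im z < b + r \<Longrightarrow> 1 + exp (z - sg) = 0 \<Longrightarrow> z \<in> pts"
  shows "rotated_transform N K L a sg - rotated_transform N K L b sg = 2 * pi * \<i> * (\<Sum>p\<in>pts. residue (rotated_kernel N K L sg) p)"
  unfolding rotated_transform_eq
proof -
  \<comment> \<open>The widened strip must stay inside the region where the density is
    holomorphic.\<close>
  define r' where "r' = min r (pi - \<bar>Im L\<bar> - b0)"
  have r': "r' > 0" "r' \<le> r" "r' \<le> pi - \<bar>Im L\<bar> - b0" using assms b0(3) by (auto simp: r'_def)
  have cb: "cos b0 > 0" "cos b0 \<le> cos y" if "a \<le> y" "y \<le> b" for y
  proof -
    have "\<bar>y\<bar> \<le> b0" using that assms by auto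
    then have "cos b0 \<le> cos \<bar>y\<bar>" using b0(1,2) by (intro cos_monotone_0_pi_le) auto
    then show "cos b0 \<le> cos y" by simp
    show "cos b0 > 0" using cos_pos[of b0] b0 by simp
  qed
  \<comment> \<open>The 2 is the bound for the reciprocal of the denominator once x is at distance 1
    from Re sg; the decay is taken at \<open>b0\<close>, where the cosine is smallest.\<close>
  define A where "A = 2 * C * exp (- (real N + 1/2) * Re sg)"
  define w where "w x = A * (exp ((real N + 1/2 - real K) * x) * exp (- cos b0 * exp x) + exp ((real N - 1/2 - real K) * x) * exp (- cos b0 * exp x))" for x
  have "cos b0 > 0" using cos_pos[of b0] b0 by simp
  then have "(w \<longlongrightarrow> A * (0 + 0)) at_top" "(w \<longlongrightarrow> A * (0 + 0)) at_bot"
    unfolding w_def using assms(1) by (intro tendsto_mult tendsto_add tendsto_const exp_gamma_weight_tendsto; simp)+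
  then have w: "(w \<longlongrightarrow> 0) at_top" "(w \<longlongrightarrow> 0) at_bot" by auto
  show "(LBINT x. rotated_kernel N K L sg (Complex x a)) - (LBINT x. rotated_kernel N K L sg (Complex x b)) = 2 * pi * \<i> * (\<Sum>p\<in>pts. residue (rotated_kernel N K L sg) p)"
  proof (rule strip_residue[where a' = "a - r'" and b' = "b + r'" and ?X0.0 = "\<bar>Re sg\<bar> + 1" and w = w])
    have "residual_density K L holomorphic_on {z. a - r' < Im z \<and> Im z < b + r'}"
      by (rule holomorphic_on_subset[OF holomorphic_density]) (use assms(3,4) r'(3) in auto)
    then have "residual_density K L holomorphic_on {z. a - r' < Im z \<and> Im z < b + r'} - pts" by (rule holomorphic_on_subset) auto
    then show "rotated_kernel N K L sg holomorphic_on {z. a - r' < Im z \<and> Im z < b + r'} - pts"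
      unfolding rotated_kernel_def using nz r'(2) by (intro holomorphic_intros) force+
    show "integrable lborel (\<lambda>x. rotated_kernel N K L sg (Complex x a))" "integrable lborel (\<lambda>x. rotated_kernel N K L sg (Complex x b))"
      by (rule rotated_kernel_integrable[OF ea(1,3,4) assms(3,1)], rule rotated_kernel_integrable[OF ea(2,3,4) assms(4,1)])
    fix x y assume y: "a \<le> y" "y \<le> b" and x: "\<bar>x\<bar> \<ge> \<bar>Re sg\<bar> + 1"
    have yb: "\<bar>y\<bar> \<le> b0" using y assms by auto
    have "norm (1 + exp (Complex x y - sg)) \<ge> 1/2" using x by (intro norm_one_plus_exp_ge_half) auto
    then have "norm (exp (of_real (real N + 1/2) * (Complex x y - sg))) / norm (1 + exp (Complex x y - sg)) \<le> exp ((real N + 1/2) * (x - Re sg)) / (1/2)"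
      by (intro frac_le) auto
    then have "norm (exp (of_real (real N + 1/2) * (Complex x y - sg))) / norm (1 + exp (Complex x y - sg)) * norm (residual_density K L (Complex x y)) 
      \<le> exp ((real N + 1/2) * (x - Re sg)) / (1/2) * (C * (exp (- cos y * exp x) * (exp (- real K * x) + exp (- (real K + 1) * x))))"
      using density_bound[OF yb] by (intro mult_mono) auto
    also have "\<dots> \<le> exp ((real N + 1/2) * (x - Re sg)) / (1/2) * (C * (exp (- cos b0 * exp x) * (exp (- real K * x) + exp (- (real K + 1) * x))))"
      using cb[OF y] C by (intro mult_left_mono mult_right_mono) auto
    also have "\<dots> = w x"
    proof -
      have g: "E * P / (1/2) * (C * Q) = 2 * C * E * (P * Q)" for E P Q :: real by simp
      have h: "exp ((real N + 1/2) * x) * (exp (- cos b0 * exp x) * (exp (- real K * x) + exp (- (real K + 1) * x))) = 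
        exp ((real N + 1/2 - real K) * x) * exp (- cos b0 * exp x) + exp ((real N - 1/2 - real K) * x) * exp (- cos b0 * exp x)"
        unfolding distrib_left exp_add[symmetric] by (simp add: algebra_simps)
      show ?thesis unfolding w_def A_def exp_shift_factor[of "real N + 1/2" x "Re sg"] g h ..
    qed
    finally show "norm (rotated_kernel N K L sg (Complex x y)) \<le> w x" by (simp only: rotated_kernel_def norm_mult norm_divide)
  qed (use r' assms w in auto)
qed

end

lemma one_plus_exp_eq_0_strip:
  assumes "1 + exp y = 0" "\<bar>Im y\<bar> < 3 * pi" shows "y = of_real pi * \<i> \<or> y = - of_real pi * \<i>"
proof -
  have "exp y = exp (of_real pi * \<i>)" using assms(1) by (simp add: add_eq_0_iff)
  then obtain n where n: "y = of_real pi * \<i> + (of_int (2 * n) * pi) * \<i>" unfolding exp_eq by blast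
  then have "Im y = (2 * of_int n + 1) * pi" by (simp add: algebra_simps)
  then have "\<bar>2 * of_int n + 1\<bar> * pi < 3 * pi" using assms(2) by (simp add: abs_mult)
  then have "\<bar>2 * of_int n + 1 :: real\<bar> < 3" using pi_gt_zero by simp
  then have "\<bar>2 * n + 1\<bar> < 3" by linarith
  then have "n = 0 \<or> n = -1" by linarith
  then show ?thesis using n by auto
qed

text \<open>The numerator exp((N + 1/2)(z - sg)) at the pole z - sg = -pi i, divided by the
  derivative -1 of 1 + exp(z - sg).\<close>

definition residue_factor :: "nat \<Rightarrow> complex" where
  "residue_factor N = - exp (- (of_real (real N + 1/2) * of_real pi * \<i>))"

lemma norm_residue_factor: "norm (residue_factor N) = 1"
  by (simp add: residue_factor_def)

context rotation
begin

text \<open>Both lines are within pi of Im sg, hence so is everything between them, and no pole is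
  crossed.\<close>

lemma rotated_transform_shift:
  assumes "N \<ge> K + 1" "\<bar>b\<bar> \<le> b0" "\<bar>Im sg\<bar> < pi" "\<bar>Im sg - b\<bar> < pi"
  shows "rotated_transform N K L b sg = rotated_transform N K L 0 sg"
proof -
  have main: "rotated_transform N K L c sg = rotated_transform N K L d sg" 
    if cd: "c < d" "\<bar>c\<bar> \<le> b0" "\<bar>d\<bar> \<le> b0" "\<bar>Im sg - c\<bar> < pi" "\<bar>Im sg - d\<bar> < pi" for c d
  proof -
    define m where "m = max \<bar>Im sg - c\<bar> \<bar>Im sg - d\<bar>"
    have m: "\<bar>Im sg - c\<bar> \<le> m" "\<bar>Im sg - d\<bar> \<le> m" "m < pi" using cd by (auto simp: m_def)
    define e where "e = min (pi/2) (pi - m)"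
    have "e \<le> pi - m" "e \<le> pi/2" unfolding e_def by (rule min.cobounded2, rule min.cobounded1)
    moreover have "0 < e" unfolding e_def using m by simp
    ultimately have e: "0 < e" "e \<le> pi/2" "\<bar>Im sg - c\<bar> \<le> pi - e" "\<bar>Im sg - d\<bar> \<le> pi - e" using m by auto
    have "rotated_transform N K L c sg - rotated_transform N K L d sg = 2 * pi * \<i> * (\<Sum>p\<in>{}. residue (rotated_kernel N K L sg) p)"
    proof (rule line_difference[OF assms(1) cd(1-3) _ _ e(1,2)])
      show "- cos e \<le> cos (c - Im sg)" "- cos e \<le> cos (d - Im sg)" using e by (intro cos_ge_of_abs_le; simp add: abs_minus_commute)+
      show "e > 0" by fact
      fix z assume z: "c - e < Im z" "Im z < d + e" "1 + exp (z - sg) = 0"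
      have "\<bar>Im (z - sg)\<bar> < pi" using z(1,2) e(3,4) by (simp add: abs_if split: if_splits)
      then show "z \<in> {}" using one_plus_exp_nonzero z(3) by blast
    qed auto
    then show ?thesis by simp
  qed
  show ?thesis
  proof (cases "b = 0")
    case False
    then consider "b < 0" | "0 < b" by linarith
    then show ?thesis using main[of b 0] main[of 0 b] assms b0(1) by cases auto
  qed simp
qed

text \<open>For Im sg slightly above pi the pole sg - pi i lies between the lines at heights -b0 and
  b0. The upper line gives the analytic continuation from below pi; the lower one reduces to the
  principal strip by periodicity, and the residue is their difference.\<close>

lemma rotated_transform_crossing:
  assumes "N \<ge> K + 1" "pi < Im sg" "Im sg < pi + b0"
  shows "rotated_transform N K L b0 sg = - rotated_transform N K L 0 (sg - 2 * of_real pi * \<i>) - 2 * pi * \<i> * residue_factor N * residual_density K L (sg - of_real pi * \<i>)"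
proof -
  define t where "t = Im sg - pi"
  have t: "0 < t" "t < b0" using assms by (auto simp: t_def)
  \<comment> \<open>The minimum is the angular distance of the pole from the nearer of the two
    lines; this is defined below as \<open>e\<close>, while \<open>p\<close> is the pole
    itself.\<close>
  define p where "p = sg - of_real pi * \<i>"
  have p: "Im p = t" by (simp add: p_def t_def)
  define e where "e = min (b0 - t) (b0 + t)"
  have e: "0 < e" "e \<le> pi/2" "e \<le> b0 - t" "e \<le> b0 + t" using t b0 by (auto simp: e_def min_def)
  have "rotated_transform N K L (- b0) sg - rotated_transform N K L b0 sg = 2 * pi * \<i> * (\<Sum>p\<in>{p}. residue (rotated_kernel N K L sg) p)"
  proof (rule line_difference[where e = e and r = e])
    have c: "cos (x - Im sg) = - cos (x - t)" for x
    proof -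
      have "cos (x - Im sg) = cos ((x - t) - pi)" by (simp add: t_def algebra_simps)
      then show ?thesis by (simp add: cos_diff)
    qed
    have "cos (- b0 - t) \<le> cos e"
    proof -
      have "cos (b0 + t) \<le> cos e" using e t b0 pi_gt_zero by (intro cos_monotone_0_pi_le) auto
      moreover have "cos (- b0 - t) = cos (b0 + t)" using cos_minus[of "b0 + t"] by (simp add: algebra_simps)
      ultimately show ?thesis by simp
    qed
    then show "- cos e \<le> cos (- b0 - Im sg)" unfolding c by simp
    have "cos (b0 - t) \<le> cos e" using e t b0 by (intro cos_monotone_0_pi_le) auto
    then show "- cos e \<le> cos (b0 - Im sg)" unfolding c by simp
    show "{p} \<subseteq> {z. - b0 < Im z \<and> Im z < b0}" using p t by auto
    fix z assume z: "- b0 - e < Im z" "Im z < b0 + e" "1 + exp (z - sg) = 0"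
    have "\<bar>Im (z - sg)\<bar> < 3 * pi" "Im (z - sg) < pi" using z(1,2) e t b0 pi_gt_zero unfolding t_def by (auto simp: abs_if split: if_splits)
    moreover from this have "z - sg \<noteq> of_real pi * \<i>" using pi_gt_zero by (auto simp: complex_eq_iff)
    ultimately have "z - sg = - of_real pi * \<i>" using one_plus_exp_eq_0_strip[OF z(3)] by auto
    then show "z \<in> {p}" by (simp add: p_def algebra_simps)
  qed (use assms e b0 in auto)
  then have 1: "rotated_transform N K L (- b0) sg - rotated_transform N K L b0 sg = 2 * pi * \<i> * residue (rotated_kernel N K L sg) p" by simp
  define A where "A = {z. - b0 < Im z \<and> Im z < b0}"
  have A: "open A" "p \<in> A" unfolding A_def using open_strip p t by auto
  have hd: "residual_density K L holomorphic_on A"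
    by (rule holomorphic_on_subset[OF holomorphic_density]) (use b0(3) in \<open>auto simp: A_def\<close>)
  have res: "residue (rotated_kernel N K L sg) p = residue_factor N * residual_density K L p"
  proof (rule residue_simple'[OF A])
    have nz: "1 + exp (z - sg) \<noteq> 0" if "z \<in> A - {p}" for z
    proof
      assume 0: "1 + exp (z - sg) = 0"
      have "\<bar>Im (z - sg)\<bar> < 3 * pi" "Im (z - sg) < pi" using that t b0 pi_gt_zero unfolding t_def A_def by (auto simp: abs_if split: if_splits)
      moreover from this have "z - sg \<noteq> of_real pi * \<i>" using pi_gt_zero by (auto simp: complex_eq_iff)
    ultimately have "z - sg = - of_real pi * \<i>" using one_plus_exp_eq_0_strip[OF 0] by auto
      then show False using that by (simp add: p_def algebra_simps)
    qed
    have hd': "residual_density K L holomorphic_on A - {p}" using hd holomorphic_on_subset by blast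
    show "rotated_kernel N K L sg holomorphic_on A - {p}"
      unfolding rotated_kernel_def using nz by (intro holomorphic_intros hd') auto
    have ep: "exp (p - sg) = -1" unfolding p_def by (simp add: exp_minus)
    have "((\<lambda>z. 1 + exp (z - sg)) has_field_derivative exp (p - sg)) (at p)" by (auto intro!: derivative_eq_intros)
    then have d: "((\<lambda>z. (1 + exp (z - sg) - (1 + exp (p - sg))) / (z - p)) \<longlongrightarrow> -1) (at p)"
      unfolding has_field_derivative_iff ep .
    have c: "((\<lambda>z. residual_density K L z) \<longlongrightarrow> residual_density K L p) (at p)"
      using holomorphic_on_imp_continuous_on[OF hd] A by (simp add: continuous_on_eq_continuous_at isCont_def)
    have "((\<lambda>z. exp (of_real (real N + 1/2) * (z - sg)) * residual_density K L z / ((1 + exp (z - sg) - (1 + exp (p - sg))) / (z - p))) \<longlongrightarrow>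
       exp (of_real (real N + 1/2) * (p - sg)) * residual_density K L p / (- 1)) (at p)"
      by (intro tendsto_intros c d) auto
    also have "exp (of_real (real N + 1/2) * (p - sg)) * residual_density K L p / (- 1) = residue_factor N * residual_density K L p"
      unfolding residue_factor_def p_def by (simp add: mult.assoc)
    finally show "((\<lambda>w. rotated_kernel N K L sg w * (w - p)) \<longlongrightarrow> residue_factor N * residual_density K L p) (at p)"
      unfolding ep by (rule Lim_transform_eventually) (auto simp: rotated_kernel_def eventually_at_filter)
  qed
  \<comment> \<open>After subtracting 2 pi i the location is inside the principal strip, and the
    line at -b0 can be raised to the real axis because the pole lies above both.\<close>
  have "rotated_transform N K L (- b0) sg = - rotated_transform N K L (- b0) (sg - 2 * of_real pi * \<i>)"
  proof -
    have "sg - 2 * of_real pi * \<i> - of_real (- b0) * \<i> = (sg - of_real (- b0) * \<i>) - 2 * of_real pi * \<i>" by simp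
    then show ?thesis unfolding rotated_transform_def by (simp only: Stieltjes_transform_period minus_minus)
  qed
  also have "rotated_transform N K L (- b0) (sg - 2 * of_real pi * \<i>) = rotated_transform N K L 0 (sg - 2 * of_real pi * \<i>)"
    by (rule rotated_transform_shift) (use assms b0 pi_gt_zero in \<open>auto simp: abs_if\<close>)
  finally show ?thesis using 1 unfolding res unfolding p_def by (simp add: algebra_simps)
qed

text \<open>The residual density enters when the pole of the kernel crosses the path of integration, at \<open>Im sg = pi\<close>.\<close>

definition continued_transform :: "nat \<Rightarrow> complex \<Rightarrow> complex" where
  "continued_transform N sg = (if Im sg < pi then rotated_transform N K L 0 sg
     else if Im sg = pi then rotated_transform N K L b0 sg
     else - rotated_transform N K L 0 (sg - 2 * of_real pi * \<i>) - 2 * pi * \<i> * residue_factor N * residual_density K L (sg - of_real pi * \<i>))"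

text \<open>Three overlapping strips: on the middle one, around phase pi, all branches of the
  definition equal the transform along the line at b0. The upper end 2 pi + Im L is where the
  Stirling argument sg - pi i - L reaches phase pi.\<close>

lemma holomorphic_continued_transform:
  assumes N: "N \<ge> K + 1"
  shows "continued_transform N holomorphic_on {sg. - pi < Im sg \<and> Im sg < 2 * pi + Im L}"
proof -
  define U1 where "U1 = {sg. - pi < Im sg \<and> Im sg < pi}"
  define U2 where "U2 = {sg. pi - b0 < Im sg \<and> Im sg < pi + b0}"
  define U3 where "U3 = {sg. pi < Im sg \<and> Im sg < 2 * pi + Im L}"
  have op: "open U1" "open U2" "open U3" unfolding U1_def U2_def U3_def by (rule open_strip)+
  have h0: "rotated_transform N K L 0 holomorphic_on U1" using holomorphic_rotated_transform[OF N, of 0] b0 by (simp add: U1_def)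
  then have 1: "continued_transform N holomorphic_on U1" by (rule holomorphic_transform) (auto simp: U1_def continued_transform_def)
  have "rotated_transform N K L b0 holomorphic_on U2"
    by (rule holomorphic_on_subset[OF holomorphic_rotated_transform[OF N]]) (use b0 in \<open>auto simp: U2_def\<close>)
  then have 2: "continued_transform N holomorphic_on U2"
  proof (rule holomorphic_transform)
    fix sg assume sg: "sg \<in> U2"
    consider "Im sg < pi" | "Im sg = pi" | "Im sg > pi" by linarith
    then show "rotated_transform N K L b0 sg = continued_transform N sg"
    proof cases
      case 1
      then have "rotated_transform N K L b0 sg = rotated_transform N K L 0 sg"
        by (intro rotated_transform_shift[OF N]) (use sg b0 in \<open>auto simp: U2_def\<close>)
      then show ?thesis using 1 by (simp add: continued_transform_def)
    next
      case 3
      then show ?thesis using rotated_transform_crossing[OF N, of sg] sg by (simp add: continued_transform_def U2_def)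
    qed (simp add: continued_transform_def)
  qed
  have "(\<lambda>sg. - rotated_transform N K L 0 (sg - 2 * of_real pi * \<i>) - 2 * pi * \<i> * residue_factor N * residual_density K L (sg - of_real pi * \<i>)) holomorphic_on U3"
  proof (intro holomorphic_intros)
    show "(\<lambda>sg. rotated_transform N K L 0 (sg - 2 * of_real pi * \<i>)) holomorphic_on U3"
      by (rule holomorphic_on_compose_gen[OF _ h0, unfolded o_def]) (use b0 in \<open>auto simp: U1_def U3_def intro!: holomorphic_intros\<close>)
    show "(\<lambda>sg. residual_density K L (sg - of_real pi * \<i>)) holomorphic_on U3"
      by (rule holomorphic_on_compose_gen[OF _ holomorphic_density, unfolded o_def]) (use b0 in \<open>auto simp: U3_def intro!: holomorphic_intros\<close>)
  qed
  then have 3: "continued_transform N holomorphic_on U3" by (rule holomorphic_transform) (auto simp: U3_def continued_transform_def)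
  have "continued_transform N holomorphic_on (U1 \<union> U2) \<union> U3" by (intro holomorphic_on_Un 1 2 3 op open_Un)
  moreover have "{sg. - pi < Im sg \<and> Im sg < 2 * pi + Im L} \<subseteq> (U1 \<union> U2) \<union> U3" using b0 by (auto simp: U1_def U2_def U3_def)
  ultimately show ?thesis using holomorphic_on_subset by blast
qed

text \<open>Rotating by \<open>e\<close> towards sg keeps the distance between the line and Im sg at
  most pi - e, even at the edge of the strip. The angle stays free so that it may later depend on
  N.\<close>

lemma continued_transform_bound_strip:
  assumes N: "N \<ge> K + 1" and sg: "- pi < Im sg" "Im sg \<le> pi" and e: "0 < e" "e \<le> b0"
  shows "norm (continued_transform N sg) \<le> C * exp (- (real N + 1/2) * Re sg) / sin e *
     (Gamma (real N + 1/2 - real K) * cos e powr (- (real N + 1/2 - real K)) + Gamma (real N - 1/2 - real K) * cos e powr (- (real N - 1/2 - real K)))"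
proof -
  have e2: "e \<le> pi/2" using e b0 by simp
  define b where "b = (if Im sg \<ge> 0 then e else - e)"
  have b: "\<bar>b\<bar> \<le> b0" "cos b = cos e" using e by (auto simp: b_def)
  have ab: "\<bar>b - Im sg\<bar> \<le> pi - e" using sg e e2 by (auto simp: b_def abs_if)
  have eq: "continued_transform N sg = rotated_transform N K L b sg"
  proof (cases "Im sg = pi")
    case True
    \<comment> \<open>On the edge the definition uses the line at b0. The pole then has height 0,
      below both lines, so the path can be lowered to \<open>e\<close>.\<close>
    have "rotated_transform N K L e sg = rotated_transform N K L b0 sg"
    proof (cases "e = b0")
      case False
      then have "e < b0" using e by simp
      define d where "d = min e (pi - b0)"
      have d: "0 < d" "d \<le> e" using e b0 by (auto simp: d_def)
      have "rotated_transform N K L e sg - rotated_transform N K L b0 sg = 2 * pi * \<i> * (\<Sum>p\<in>{}. residue (rotated_kernel N K L sg) p)"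
      proof (rule line_difference[OF N \<open>e < b0\<close>, where e = e and r = d])
        show "- cos e \<le> cos (e - Im sg)" "- cos e \<le> cos (b0 - Im sg)"
          using True e b0 by (intro cos_ge_of_abs_le; simp)+
        fix z assume z: "e - d < Im z" "Im z < b0 + d" "1 + exp (z - sg) = 0"
        have "\<bar>Im (z - sg)\<bar> < pi" using z True d b0 pi_gt_zero unfolding d_def by (auto simp: abs_if min_def split: if_splits)
        then show "z \<in> {}" using one_plus_exp_nonzero z(3) by blast
      qed (use e e2 b0 d in auto)
      then show ?thesis by simp
    qed simp
    then show ?thesis using True by (simp add: continued_transform_def b_def)
  next
    case False
    then have "rotated_transform N K L b sg = rotated_transform N K L 0 sg"
      by (intro rotated_transform_shift[OF N b(1)]) (use sg ab e in auto)
    then show ?thesis using False sg by (simp add: continued_transform_def)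
  qed
  have "norm (rotated_transform N K L b sg) \<le> C * exp (- (real N + 1/2) * Re sg) / sin e *
     (Gamma (real N + 1/2 - real K) * cos b powr (- (real N + 1/2 - real K)) + Gamma (real N - 1/2 - real K) * cos b powr (- (real N - 1/2 - real K)))"
    by (rule rotated_transform_bound[OF cos_ge_of_abs_le[OF ab] e(1) e2 b(1) N]) (use e in auto)
  then show ?thesis unfolding eq b(2) .
qed

text \<open>Above phase pi the period relation returns to the strip with the same Re sg, so the same
  bound applies and only the residue is added.\<close>

lemma continued_transform_bound:
  assumes N: "N \<ge> K + 1" and sg: "- pi < Im sg" "Im sg < 3 * pi" and e: "0 < e" "e \<le> b0"
  shows "norm (continued_transform N sg) \<le> C * exp (- (real N + 1/2) * Re sg) / sin e *
     (Gamma (real N + 1/2 - real K) * cos e powr (- (real N + 1/2 - real K)) + Gamma (real N - 1/2 - real K) * cos e powr (- (real N - 1/2 - real K)))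
     + (if Im sg \<le> pi then 0 else 2 * pi * norm (residual_density K L (sg - of_real pi * \<i>)))"
proof (cases "Im sg \<le> pi")
  case True
  then show ?thesis using continued_transform_bound_strip[OF N sg(1) True e] by simp
next
  case False
  define s' where "s' = sg - 2 * of_real pi * \<i>"
  have s': "- pi < Im s'" "Im s' < pi" "Re s' = Re sg" using sg False by (auto simp: s'_def)
  have "norm (continued_transform N sg) \<le> norm (rotated_transform N K L 0 s') + norm (2 * pi * \<i> * residue_factor N * residual_density K L (sg - of_real pi * \<i>))"
    using False norm_triangle_ineq4[of "- rotated_transform N K L 0 s'"] by (simp add: continued_transform_def s'_def)
  also have "norm (2 * pi * \<i> * residue_factor N * residual_density K L (sg - of_real pi * \<i>)) = 2 * pi * norm (residual_density K L (sg - of_real pi * \<i>))"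
    by (simp add: norm_mult norm_residue_factor)
  also have "rotated_transform N K L 0 s' = continued_transform N s'" using s' by (simp add: continued_transform_def)
  also have "norm (continued_transform N s') \<le> C * exp (- (real N + 1/2) * Re sg) / sin e *
     (Gamma (real N + 1/2 - real K) * cos e powr (- (real N + 1/2 - real K)) + Gamma (real N - 1/2 - real K) * cos e powr (- (real N - 1/2 - real K)))"
    using continued_transform_bound_strip[OF N s'(1) less_imp_le[OF s'(2)] e] s'(3) by simp
  finally show ?thesis using False by simp
qed

end

section \<open>Re-expansion of the remainder\<close>

context rotation
begin

text \<open>\<open>Laplace_Gamma\<close> contains exp(-v/2), which lowers the index from N + 1 to N
  + 1/2, and the k-th Stirling term lowers it by k more: this is the origin of the index N - k + 1/2
  of the terminants.\<close>

lemma saddle_transform_expansion: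
  assumes N: "N \<ge> K + 1"
  shows "saddle_transform N (exp s) L = of_real (sqrt (2 * pi)) * exp (- of_real s / 2) *
    (rotated_transform N K L 0 (of_real s + L) + 2 * of_real pi * (-1) ^ N * exp (exp (of_real s + L)) *
       (\<Sum>k<K. of_real (stirling_coeff k) / exp (of_real s) ^ k * terminant (real N - real k + 1/2) (of_real s + L)))"
proof -
  define sg where "sg = of_real s + L"
  have im: "\<bar>Im L\<bar> < pi" "\<bar>Im sg\<bar> < pi" using b0 by (auto simp: sg_def)
  define F where "F p x = exp (of_real p * (of_real x - sg)) / (1 + exp (of_real x - sg))" for p x
  define E where "E x = exp (- exp (complex_of_real x))" for x
  define d :: "nat \<Rightarrow> complex" where "d k = (-1) ^ k * of_real (stirling_coeff k) * exp (- (of_nat k * of_real s))" for k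
  define c where "c = of_real (sqrt (2 * pi)) * exp (- complex_of_real s / 2)"
  have Fi: "integrable lborel (\<lambda>x. F (real N + 1/2) x * residual_density K L (of_real x))"
    unfolding F_def
    by (rule Stieltjes_transform_integrable[OF im(2), where c = 1 and q = "real K" and C = C])
       (use density_measurable[of 0] density_bound[of 0] b0 N in \<open>simp_all add: complex_of_real_def\<close>)
  have Ei: "integrable lborel (\<lambda>x. F (real N - real k + 1/2) x * E x)" if "k < K" for k
    unfolding F_def E_def
  proof (rule Stieltjes_transform_integrable[OF im(2) exp_minus_exp_measurable, where c = 1 and q = "-1" and C = 1])
    show "norm (exp (- exp (complex_of_real x))) \<le> 1 * (exp (- 1 * exp x) * (exp (- (- 1) * x) + exp (- (- 1 + 1) * x)))" for x
    proof -
      have "exp (- exp x) * 1 \<le> exp (- exp x) * (exp x + 1)" by (intro mult_left_mono) auto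
      then show ?thesis by (simp add: Re_exp)
    qed
  qed (use N that in auto)
  have pt: "F (real (N + 1)) x * (E x * Laplace_Gamma (of_real x - L)) = 
      c * (F (real N + 1/2) x * residual_density K L (of_real x) + (\<Sum>k<K. d k * (F (real N - real k + 1/2) x * E x)))" for x
  proof -
    define y where "y = of_real x - sg"
    \<comment> \<open>Splits off the dependence on s, which becomes the prefactor exp(-s/2) and the
      powers exp(s)^-k; only y enters the kernel.\<close>
    have xL: "of_real x - L = y + of_real s" by (simp add: y_def sg_def)
    have S0: "Stirling_remainder 0 (of_real x - L) = Stirling_remainder K (of_real x - L) + (\<Sum>k<K. d k * exp (- (of_nat k * y)))"
    proof -
      have "(-1) ^ k * of_real (stirling_coeff k) * exp (- of_nat k * (of_real x - L)) = d k * exp (- (of_nat k * y))" for k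
      proof -
        have "- of_nat k * (of_real x - L) = - (of_nat k * of_real s) + - (of_nat k * y)" unfolding xL by (simp add: algebra_simps)
        then show ?thesis unfolding d_def by (simp only: exp_add mult.assoc)
      qed
      then show ?thesis by (simp add: Stirling_remainder_def)
    qed
    have e1: "exp (of_real (real (N + 1)) * y) * exp (- (of_real x - L) / 2) = exp (- of_real s / 2) * exp (of_real (real N + 1/2) * y)"
      unfolding xL exp_add[symmetric] by (rule arg_cong[where f = exp]) (simp add: field_simps)
    have e2: "exp (of_real (real N + 1/2) * y) * exp (- (of_nat k * y)) = exp (of_real (real N - real k + 1/2) * y)" for k
      unfolding exp_add[symmetric] by (simp add: algebra_simps)
    have "F (real (N + 1)) x * (E x * Laplace_Gamma (of_real x - L)) = 
      (exp (of_real (real (N + 1)) * y) * exp (- (of_real x - L) / 2)) / (1 + exp y) * E x * of_real (sqrt (2 * pi)) * Stirling_remainder 0 (of_real x - L)"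
      unfolding F_def Laplace_Gamma_def y_def[symmetric] by (simp add: mult_ac)
    also have "\<dots> = c * (exp (of_real (real N + 1/2) * y) / (1 + exp y) * E x * Stirling_remainder 0 (of_real x - L))"
      unfolding e1 c_def by (simp add: mult_ac)
    also have "exp (of_real (real N + 1/2) * y) / (1 + exp y) * E x * Stirling_remainder 0 (of_real x - L) =
       F (real N + 1/2) x * residual_density K L (of_real x) + (\<Sum>k<K. d k * (exp (of_real (real N + 1/2) * y) * exp (- (of_nat k * y)) / (1 + exp y) * E x))"
      unfolding S0 distrib_left sum_distrib_left F_def residual_density_def y_def[symmetric] E_def by (simp add: mult_ac)
    finally show ?thesis unfolding e2 unfolding F_def y_def .
  qed
  have "saddle_transform N (exp s) L = (LBINT x. F (real (N + 1)) x * (E x * Laplace_Gamma (of_real x - L)))"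
    using saddle_transform_eq[of N L s] N im unfolding Stieltjes_transform_def F_def E_def sg_def by simp
  also have "\<dots> = c * ((LBINT x. F (real N + 1/2) x * residual_density K L (of_real x)) + (\<Sum>k<K. d k * (LBINT x. F (real N - real k + 1/2) x * E x)))"
  proof -
    have di: "integrable lborel (\<lambda>x. d k * (F (real N - real k + 1/2) x * E x))" if "k < K" for k
      using Ei[OF that] by (rule integrable_mult_right)
    then have si: "integrable lborel (\<lambda>x. \<Sum>k<K. d k * (F (real N - real k + 1/2) x * E x))" by (intro Bochner_Integration.integrable_sum) auto
    have "(LBINT x. \<Sum>k<K. d k * (F (real N - real k + 1/2) x * E x)) = (\<Sum>k<K. d k * (LBINT x. F (real N - real k + 1/2) x * E x))"
      by (subst Bochner_Integration.integral_sum) (use di in auto)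
    then show ?thesis unfolding pt integral_mult_right_zero Bochner_Integration.integral_add[OF Fi si] by simp
  qed
  also have "(LBINT x. F (real N + 1/2) x * residual_density K L (of_real x)) = rotated_transform N K L 0 sg"
    unfolding rotated_transform_def Stieltjes_transform_def F_def by (simp add: complex_of_real_def[symmetric])
  also have "(\<Sum>k<K. d k * (LBINT x. F (real N - real k + 1/2) x * E x)) = 2 * of_real pi * (-1) ^ N * exp (exp sg) *
       (\<Sum>k<K. of_real (stirling_coeff k) / exp (of_real s) ^ k * terminant (real N - real k + 1/2) sg)"
    unfolding sum_distrib_left
  proof (intro sum.cong refl)
    fix k assume "k \<in> {..<K}"
    then have k: "k < N" using N by auto
    \<comment> \<open>The half-integer index makes the terminant's phase factor i (-1)^(N-k);
      together with (-1)^N this cancels the alternating sign of Stirling's series.\<close>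
    have "exp (of_real pi * \<i> * of_real (real N - real k + 1/2)) = exp (of_nat (N - k) * (of_real pi * \<i>)) * exp (\<i> * of_real (pi / 2))"
      unfolding exp_add[symmetric] using k by (simp add: of_nat_diff algebra_simps)
    also have "\<dots> = (-1) ^ (N - k) * \<i>"
      unfolding exp_of_nat_mult cis_conv_exp[symmetric] by simp
    finally have t: "terminant (real N - real k + 1/2) sg = (-1) ^ (N - k) * \<i> / (2 * of_real pi * \<i>) * exp (- exp sg) * (LBINT x. F (real N - real k + 1/2) x * E x)"
      using terminant_eq_Stieltjes_transform[of "real N - real k + 1/2" sg] im k unfolding Stieltjes_transform_def F_def E_def by simp
    have n: "(-1::complex) ^ N * (-1) ^ (N - k) = (-1) ^ k"
    proof -
      have "(-1::complex) ^ N = (-1) ^ k * (-1) ^ (N - k)" using k by (simp flip: power_add)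
      then show ?thesis by (simp flip: power_mult_distrib mult.assoc)
    qed
    have q: "exp (- (of_nat k * complex_of_real s)) = 1 / exp (of_real s) ^ k"
      by (simp add: exp_minus inverse_eq_divide exp_of_nat_mult)
    have e: "exp (exp sg) * exp (- exp sg) = 1" by (simp flip: exp_add)
    have alg: "m * g * (1 / q) * I = 2 * p * n * e * (g / q * (n' * \<i> / (2 * p * \<i>) * e' * I))"
      if "n * n' = m" "e * e' = 1" "p \<noteq> 0" for m g q I p n e n' e' :: complex
    proof -
      have "2 * p * n * e * (g / q * (n' * \<i> / (2 * p * \<i>) * e' * I)) = (n * n') * (e * e') * g * (1/q) * I * (2 * p * \<i> / (2 * p * \<i>))"
        by (simp add: mult_ac)
      also have "\<dots> = m * g * (1 / q) * I" unfolding that(1,2) using that(3) by simp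
      finally show ?thesis by (rule sym)
    qed
    show "d k * (LBINT x. F (real N - real k + 1/2) x * E x) = 2 * of_real pi * (-1) ^ N * exp (exp sg) * (of_real (stirling_coeff k) / exp (of_real s) ^ k * terminant (real N - real k + 1/2) sg)"
      unfolding d_def t q by (rule alg[OF n e]) simp
  qed
  finally show ?thesis unfolding c_def sg_def by simp
qed

end

lemma exp_Ln_xi_shift:
  "exp (s + Ln (xi lam)) = exp s * xi lam" "exp (s + Ln (cnj (xi lam))) = exp s * cnj (xi lam)"
proof -
  have "xi lam \<noteq> 0" using xi_notin_nonpos_Reals[of lam] by auto
  then show "exp (s + Ln (xi lam)) = exp s * xi lam" "exp (s + Ln (cnj (xi lam))) = exp s * cnj (xi lam)" by (simp_all add: exp_add)
qed

text \<open>The terminants produced by the two expansions are exactly those subtracted in the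
  definition, so only the transforms of the Stirling remainder survive.\<close>

lemma reexp_remainder_of_real:
  assumes "lam > 0" "N \<ge> K + 1" "rotation K (Ln (xi lam)) b1 C1" "rotation K (Ln (cnj (xi lam))) b2 C2"
  shows "reexp_remainder N K lam (of_real s) = (-1) ^ (N + 1) * of_real (sqrt (2 * pi)) / (2 * of_real pi * \<i>) * exp (- of_real s / 2) *
    (rotated_transform N K (Ln (xi lam)) 0 (of_real s + Ln (xi lam)) - rotated_transform N K (Ln (cnj (xi lam))) 0 (of_real s + Ln (cnj (xi lam))))"
proof -
  have alg: "m * - 1 / (2 * p * \<i>) * (c * (A + 2 * p * m * e * S) - c * (B + 2 * p * m * f * T)) - (- \<i> * f * c * T + \<i> * e * c * S) = m * - 1 * q / (2 * p * \<i>) * r * (A - B)"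
    if "m * m = 1" "c = q * r" "p \<noteq> 0" for m p c A B e f S T q r :: complex
  proof -
    have "m * - 1 / (2 * p * \<i>) * (c * (A + 2 * p * m * e * S) - c * (B + 2 * p * m * f * T)) = m * - 1 * c / (2 * p * \<i>) * (A - B) + (- (m * m) * (2 * p) / (2 * p * \<i>)) * c * (e * S - f * T)"
      by (simp add: algebra_simps diff_divide_distrib add_divide_distrib)
    \<comment> \<open>The sign (-1)^N occurs twice and disappears, leaving -2 pi/(2 pi i) = i, the
      factor in front of the terminant sums.\<close>
    also have "- (m * m) * (2 * p) / (2 * p * \<i>) = \<i>" using that by (simp add: field_simps)
    finally show ?thesis using that by (simp add: algebra_simps)
  qed
  have m: "(-1::complex) ^ N * (-1) ^ N = 1" by (simp flip: power_mult_distrib)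
  have "N \<ge> 1" using assms by simp
  note r = remainder_of_real[OF assms(1) this, of s, unfolded rotation.saddle_transform_expansion[OF assms(3,2)] rotation.saddle_transform_expansion[OF assms(4,2)] exp_Ln_xi_shift]
  show ?thesis
    unfolding reexp_remainder_def Let_def r of_real_mult of_real_numeral power_add power_one_right by (rule alg[OF m refl]) simp
qed

lemma holomorphic_reexp_remainder:
  assumes "lam > 0" shows "reexp_remainder N K lam holomorphic_on A"
proof -
  have t: "(\<lambda>s. terminant p (s + L)) holomorphic_on A" for p L
    by (rule holomorphic_on_compose_gen[OF _ holomorphic_terminant, unfolded o_def]) (auto intro!: holomorphic_intros)
  have r: "remainder N lam holomorphic_on A" using holomorphic_remainder[OF assms] holomorphic_on_subset by blast
  show ?thesis unfolding reexp_remainder_def Let_def by (intro holomorphic_intros r t) auto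
qed

text \<open>The identity theorem on a strip. Its lower edge is where Im s - omega reaches -pi, its
  upper edge where both continued transforms stop being holomorphic; phases below the strip are
  reached by reflection.\<close>

lemma reexp_remainder_eq:
  assumes "lam > 0" "N \<ge> K + 1" "rotation K (Ln (xi lam)) b1 C1" "rotation K (Ln (cnj (xi lam))) b2 C2"
    and s: "omega lam - pi < Im s" "Im s < 2 * pi"
  shows "reexp_remainder N K lam s = (-1) ^ (N + 1) * of_real (sqrt (2 * pi)) / (2 * of_real pi * \<i>) * exp (- s / 2) *
    (rotation.continued_transform K (Ln (xi lam)) b1 N (s + Ln (xi lam)) - rotation.continued_transform K (Ln (cnj (xi lam))) b2 N (s + Ln (cnj (xi lam))))"
proof -
  interpret p: rotation K "Ln (xi lam)" b1 C1 by fact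
  interpret m: rotation K "Ln (cnj (xi lam))" b2 C2 by fact
  define S where "S = {z. omega lam - pi < Im z \<and> Im z < 2 * pi}"
  have hp: "(\<lambda>s. p.continued_transform N (s + Ln (xi lam))) holomorphic_on S"
    by (rule holomorphic_on_compose_gen[OF _ p.holomorphic_continued_transform[OF assms(2)], unfolded o_def])
       (use omega_bounds[of lam] in \<open>auto simp: S_def Im_Ln_xi(1,2) intro!: holomorphic_intros\<close>)
  have hm: "(\<lambda>s. m.continued_transform N (s + Ln (cnj (xi lam)))) holomorphic_on S"
    by (rule holomorphic_on_compose_gen[OF _ m.holomorphic_continued_transform[OF assms(2)], unfolded o_def])
       (use omega_bounds[of lam] in \<open>auto simp: S_def Im_Ln_xi(1,2) intro!: holomorphic_intros\<close>)
  show ?thesis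
  proof (rule holomorphic_eq_of_eq_on_reals[where f = "reexp_remainder N K lam" and z = s and S = S and
      g = "\<lambda>s. (-1) ^ (N + 1) * of_real (sqrt (2 * pi)) / (2 * of_real pi * \<i>) * exp (- s / 2) *
    (p.continued_transform N (s + Ln (xi lam)) - m.continued_transform N (s + Ln (cnj (xi lam))))"])
    show "reexp_remainder N K lam holomorphic_on S" by (rule holomorphic_reexp_remainder[OF assms(1)])
    show "(\<lambda>s. (-1) ^ (N + 1) * of_real (sqrt (2 * pi)) / (2 * of_real pi * \<i>) * exp (- s / 2) *
      (p.continued_transform N (s + Ln (xi lam)) - m.continued_transform N (s + Ln (cnj (xi lam))))) holomorphic_on S"
      by (intro holomorphic_intros hp hm) auto
    show "open S" "connected S" unfolding S_def by (rule open_strip, rule connected_strip)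
    show "s \<in> S" "range complex_of_real \<subseteq> S" using s omega_bounds[of lam] by (auto simp: S_def)
    fix x :: real
    have "p.continued_transform N (of_real x + Ln (xi lam)) = rotated_transform N K (Ln (xi lam)) 0 (of_real x + Ln (xi lam))"
      "m.continued_transform N (of_real x + Ln (cnj (xi lam))) = rotated_transform N K (Ln (cnj (xi lam))) 0 (of_real x + Ln (cnj (xi lam)))"
      using omega_bounds[of lam] by (simp_all add: p.continued_transform_def m.continued_transform_def Im_Ln_xi(1,2))
    then show "reexp_remainder N K lam (of_real x) = (-1) ^ (N + 1) * of_real (sqrt (2 * pi)) / (2 * of_real pi * \<i>) * exp (- of_real x / 2) *
      (p.continued_transform N (of_real x + Ln (xi lam)) - m.continued_transform N (of_real x + Ln (cnj (xi lam))))"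
      unfolding reexp_remainder_of_real[OF assms(1-4)] by simp
  qed
qed

lemma cnj_rotated_transform:
  "rotated_transform N K (cnj L) 0 (cnj sg) = cnj (rotated_transform N K L 0 sg)"
  unfolding rotated_transform_def Stieltjes_transform_def Bochner_Integration.integral_cnj[symmetric]
proof (rule Bochner_Integration.integral_cong[OF refl])
  fix x
  have r: "residual_density K (cnj L) (of_real x) = cnj (residual_density K L (of_real x))"
    using cnj_Stirling_remainder[of K "of_real x - L"] by (simp add: residual_density_def exp_cnj)
  show "exp (of_real (real N + 1/2) * (of_real x - (cnj sg - of_real 0 * \<i>))) / (1 + exp (of_real x - (cnj sg - of_real 0 * \<i>))) * residual_density K (cnj L) (Complex x 0)
     = cnj (exp (of_real (real N + 1/2) * (of_real x - (sg - of_real 0 * \<i>))) / (1 + exp (of_real x - (sg - of_real 0 * \<i>))) * residual_density K L (Complex x 0))"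
    using r by (simp add: complex_of_real_def[symmetric] exp_cnj)
qed

text \<open>For real s the two transforms are conjugate and the prefactor is purely imaginary, so
  the remainder is real on the real axis; Schwarz reflection gives the symmetry for all s.\<close>

lemma cnj_reexp_remainder:
  assumes "lam > 0" "N \<ge> K + 1" "rotation K (Ln (xi lam)) b1 C1" "rotation K (Ln (cnj (xi lam))) b2 C2"
  shows "reexp_remainder N K lam (cnj s) = cnj (reexp_remainder N K lam s)"
proof -
  have "(cnj \<circ> reexp_remainder N K lam \<circ> cnj) s = reexp_remainder N K lam s"
  proof (rule holomorphic_eq_of_eq_on_reals[where f = "cnj \<circ> reexp_remainder N K lam \<circ> cnj" and g = "reexp_remainder N K lam" and S = UNIV])
    show "cnj \<circ> reexp_remainder N K lam \<circ> cnj holomorphic_on UNIV"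
      by (rule holomorphic_on_compose_cnj_cnj[OF holomorphic_reexp_remainder[OF assms(1)]]) simp
    show "reexp_remainder N K lam holomorphic_on UNIV" by (rule holomorphic_reexp_remainder[OF assms(1)])
    fix x :: real
    define A where "A = rotated_transform N K (Ln (xi lam)) 0 (of_real x + Ln (xi lam))"
    have cA: "rotated_transform N K (Ln (cnj (xi lam))) 0 (of_real x + Ln (cnj (xi lam))) = cnj A"
      using cnj_rotated_transform[of N K "Ln (xi lam)" "of_real x + Ln (xi lam)"] by (simp add: A_def Im_Ln_xi(3))
    have "cnj (exp (- of_real x / 2)) = exp (- complex_of_real x / 2)" by (simp add: exp_cnj)
    then show "(cnj \<circ> reexp_remainder N K lam \<circ> cnj) (of_real x) = reexp_remainder N K lam (of_real x)"
      unfolding o_def complex_cnj_complex_of_real reexp_remainder_of_real[OF assms] cA A_def[symmetric]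
      by (simp add: algebra_simps diff_divide_distrib)
  qed auto
  then have "cnj (cnj (reexp_remainder N K lam (cnj s))) = cnj (reexp_remainder N K lam s)" by simp
  then show ?thesis by simp
qed

section \<open>Estimates uniform in the number of terms\<close>

lemma Gamma_real_bound:
  obtains G where "G > 0" "\<And>q::real. q \<ge> 1/2 \<Longrightarrow> Gamma q \<le> G * exp ((q - 1/2) * ln q - q)"
proof -
  have "0 < pi/2" "pi/2 \<le> pi/2" by simp_all
  from Stirling_remainder_bound[OF this, of 0] obtain C where C: "C > 0"
    "\<And>v. \<bar>Im v\<bar> \<le> pi - pi/2 \<Longrightarrow> norm (Stirling_remainder 0 v) \<le> C * (exp (- real 0 * Re v) + exp (- (real 0 + 1) * Re v))"
    by metis
  show ?thesis
  proof (rule that[of "sqrt (2 * pi) * (C * 3)"])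
    show "sqrt (2 * pi) * (C * 3) > 0" using C by simp
    fix q :: real assume q: "q \<ge> 1/2"
    define E where "E = exp ((q - 1/2) * ln q - q)"
    have "exp (complex_of_real (ln q)) = of_real q" using q by (simp add: exp_of_real)
    moreover have "exp (of_real q - (of_real q - 1/2) * of_real (ln q)) = complex_of_real (exp (q - (q - 1/2) * ln q))"
      by (simp add: exp_of_real[symmetric])
    ultimately have "Stirling_remainder 0 (of_real (ln q)) = of_real (Gamma q * exp (q - (q - 1/2) * ln q) / sqrt (2 * pi))"
      by (simp add: Stirling_remainder_def Gamma_complex_of_real)
    moreover have "exp (- (real 0 + 1) * Re (complex_of_real (ln q))) \<le> 2" using q by (simp add: exp_minus field_simps)
    then have "norm (Stirling_remainder 0 (of_real (ln q))) \<le> C * 3"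
      using C(1) by (intro order_trans[OF C(2)] mult_left_mono) auto
    moreover have "Gamma q > 0" using q by (intro Gamma_real_pos) auto
    then have "0 \<le> Gamma q * exp (q - (q - 1/2) * ln q) / sqrt (2 * pi)" by simp
    ultimately have "Gamma q * exp (q - (q - 1/2) * ln q) / sqrt (2 * pi) \<le> C * 3" by (simp only: norm_of_real abs_of_nonneg)
    moreover have "exp (q - (q - 1/2) * ln q) = 1 / E" unfolding E_def by (simp add: exp_diff)
    ultimately have "Gamma q / E / sqrt (2 * pi) \<le> C * 3" by simp
    then have "Gamma q / E \<le> C * 3 * sqrt (2 * pi)" by (subst (asm) pos_divide_le_eq) auto
    then show "Gamma q \<le> sqrt (2 * pi) * (C * 3) * E"
      by (subst (asm) pos_divide_le_eq) (auto simp: E_def mult_ac)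
  qed
qed

text \<open>With W = exp l and N within P of W, Stirling's formula gives W^-(N+1/2) Gamma(N + 1/2 -
  j) = O(exp(-W) W^-(j+1/2)): near-optimal truncation turns the factorial into exponential
  smallness.\<close>

lemma Gamma_decay:
  assumes P: "P \<ge> 0" and j: "(j::real) \<ge> 0"
  obtains M where "M > 0"
    "\<And>N l. l \<ge> 0 \<Longrightarrow> real N \<ge> j \<Longrightarrow> \<bar>real N - exp l\<bar> \<le> P \<Longrightarrow>
       exp (- (real N + 1/2) * l) * Gamma (real N + 1/2 - j) \<le> M * exp (- exp l - (j + 1/2) * l)"
proof -
  obtain G where G: "G > 0" "\<And>q::real. q \<ge> 1/2 \<Longrightarrow> Gamma q \<le> G * exp ((q - 1/2) * ln q - q)" using Gamma_real_bound by blast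
  define B where "B = (1 + P) * (P + 1/2 + j) + P + j"
  show ?thesis
  proof (rule that[of "G * exp B"])
    show "G * exp B > 0" using G by simp
    fix N :: nat and l :: real assume l: "l \<ge> 0" and N: "real N \<ge> j" "\<bar>real N - exp l\<bar> \<le> P"
    define W where "W = exp l"
    define q where "q = real N + 1/2 - j"
    have W: "W \<ge> 1" "ln W = l" using l by (auto simp: W_def)
    have q: "q \<ge> 1/2" using N by (simp add: q_def)
    have NW: "real N \<le> (1 + P) * W" 
    proof -
      have "P * 1 \<le> P * W" using W P by (intro mult_left_mono) auto
      then show ?thesis using N(2) by (simp add: W_def distrib_right)
    qed
    \<comment> \<open>Concavity of the logarithm at W. Since q - W is at most a constant, the
      correction multiplied by q - 1/2 remains bounded.\<close>
    have "ln q \<le> l + (q / W - 1)"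
      using ln_le_minus_one[of "q / W"] q W by (simp add: ln_divide_pos)
    also have "q / W - 1 = (q - W) / W" using W by (simp add: field_simps)
    also have "\<dots> \<le> (P + 1/2 + j) / W" using N(2) W j by (intro divide_right_mono) (auto simp: q_def W_def)
    finally have "(q - 1/2) * ln q \<le> (q - 1/2) * (l + (P + 1/2 + j) / W)" using q by (intro mult_left_mono) auto
    also have "\<dots> = (real N - j) * l + (real N - j) * ((P + 1/2 + j) / W)" by (simp add: q_def distrib_left)
    also have "(real N - j) * ((P + 1/2 + j) / W) \<le> (1 + P) * W * ((P + 1/2 + j) / W)"
      using NW j P W by (intro mult_right_mono) auto
    also have "\<dots> = (1 + P) * (P + 1/2 + j)" using W by simp
    finally have "(q - 1/2) * ln q - q \<le> (real N - j) * l - W + B"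
      using N(2) unfolding q_def B_def W_def by linarith
    then have "Gamma q \<le> G * exp ((real N - j) * l - W + B)"
      using G(1) by (intro order_trans[OF G(2)[OF q]] mult_left_mono) auto
    then have "exp (- (real N + 1/2) * l) * Gamma q \<le> exp (- (real N + 1/2) * l) * (G * exp ((real N - j) * l - W + B))"
      by (intro mult_left_mono) auto
    also have "\<dots> = G * exp (- (real N + 1/2) * l + ((real N - j) * l - W + B))" by (simp only: exp_add mult_ac)
    also have "- (real N + 1/2) * l + ((real N - j) * l - W + B) = B + (- W - (j + 1/2) * l)" by (simp add: algebra_simps)
    also have "G * exp (B + (- W - (j + 1/2) * l)) = G * exp B * exp (- W - (j + 1/2) * l)" by (simp only: exp_add mult_ac)
    finally show "exp (- (real N + 1/2) * l) * Gamma (real N + 1/2 - j) \<le> G * exp B * exp (- exp l - (j + 1/2) * l)"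
      by (simp only: q_def W_def)
  qed
qed

text \<open>Since 1/(1-x) - 1 <= 2x for x <= 1/2, minus ln(cos e) is at most sin^2 e, and the
  exponent q is at most 2n while sin^2 e <= 1/(2n).\<close>

lemma cos_powr_bound:
  fixes q n e :: real
  assumes "0 \<le> q" "q \<le> 2 * n" "cos e > 0" "(sin e)\<^sup>2 \<le> 1 / (2 * n)" "n \<ge> 1"
  shows "cos e powr - q \<le> exp 2"
proof -
  define x where "x = (sin e)\<^sup>2"
  have "1 / (2 * n) \<le> 1/2" using assms(5) by (simp add: field_simps)
  then have x: "0 \<le> x" "x \<le> 1/2" "x \<le> 1 / (2 * n)" using assms(4) by (auto simp: x_def)
  have "2 * ln (cos e) = ln ((cos e)\<^sup>2)" using assms(3) by (simp add: ln_realpow)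
  also have "\<dots> = ln (1 - x)" by (simp add: x_def cos_squared_eq)
  finally have c: "2 * ln (cos e) = ln (1 - x)" .
  have "- ln (1 - x) = ln (1 / (1 - x))" using x by (simp add: ln_divide_pos)
  also have "\<dots> \<le> 1 / (1 - x) - 1" using x by (intro ln_le_minus_one) auto
  also have "\<dots> = x / (1 - x)" using x by (simp add: field_simps)
  also have "\<dots> \<le> x / (1/2)" using x by (intro divide_left_mono) auto
  finally have "- ln (cos e) \<le> x" using c by simp
  then have "q * (- ln (cos e)) \<le> q * x" using assms(1) by (intro mult_left_mono) auto
  also have "\<dots> \<le> (2 * n) * (1 / (2 * n))" using assms x by (intro mult_mono) auto
  also have "\<dots> \<le> 2" using assms by simp
  finally show ?thesis using assms(3) by (simp add: powr_def)
qed

context rotation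
begin

text \<open>The line is rotated by an angle of order \<open>1 / sqrt N\<close>: large enough to stay away from the pole,
  small enough for \<open>cos e powr - N\<close> to remain bounded.\<close>

lemma continued_transform_decay:
  assumes P: "P \<ge> 0"
  obtains M where "M > 0"
    "\<And>N sg. N \<ge> K + 1 \<Longrightarrow> Re sg \<ge> 0 \<Longrightarrow> \<bar>real N - exp (Re sg)\<bar> \<le> P \<Longrightarrow> - pi < Im sg \<Longrightarrow> Im sg < 3 * pi \<Longrightarrow>
       norm (continued_transform N sg) \<le> M * exp (- exp (Re sg) - real K * Re sg)
         + (if Im sg \<le> pi then 0 else 2 * pi * norm (residual_density K L (sg - of_real pi * \<i>)))"
proof -
  obtain M0 where M0: "M0 > 0" "\<And>N l. l \<ge> 0 \<Longrightarrow> real N \<ge> real K \<Longrightarrow> \<bar>real N - exp l\<bar> \<le> P \<Longrightarrow>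
       exp (- (real N + 1/2) * l) * Gamma (real N + 1/2 - real K) \<le> M0 * exp (- exp l - (real K + 1/2) * l)"
    using Gamma_decay[OF P, of "real K"] by auto
  obtain M1 where M1: "M1 > 0" "\<And>N l. l \<ge> 0 \<Longrightarrow> real N \<ge> real K + 1 \<Longrightarrow> \<bar>real N - exp l\<bar> \<le> P \<Longrightarrow>
       exp (- (real N + 1/2) * l) * Gamma (real N + 1/2 - (real K + 1)) \<le> M1 * exp (- exp l - (real K + 1 + 1/2) * l)"
    using Gamma_decay[OF P, of "real K + 1"] by auto
  define e1 where "e1 = sin b0"
  have "b0 < pi" using b0(1,2) pi_gt_zero by linarith
  then have e1: "0 < e1" using b0 by (auto simp: e1_def intro!: sin_gt_zero)
  have "sin b0 \<le> sin (pi/4)" using b0 by (intro sin_monotone_2pi_le) auto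
  then have "e1\<^sup>2 \<le> (sin (pi/4))\<^sup>2" unfolding e1_def using e1 by (intro power_mono) (auto simp: e1_def)
  then have e12: "e1\<^sup>2 \<le> 1/2" by (simp add: sin_45 power_divide)
  \<comment> \<open>Comes from C/sin e = C sqrt(N)/e1 together with N <= (1 + P) exp(Re sg).\<close>
  define A where "A = C * sqrt (1 + P) / e1"
  have A: "A > 0" using C e1 P by (simp add: A_def)
  show ?thesis
  proof (rule that[of "A * (M0 + M1) * exp 2"])
    show "A * (M0 + M1) * exp 2 > 0" using A M0 M1 by simp
    fix N sg assume N: "N \<ge> K + 1" and l: "Re sg \<ge> 0" and NP: "\<bar>real N - exp (Re sg)\<bar> \<le> P" and im: "- pi < Im sg" "Im sg < 3 * pi"
    define l where "l = Re sg"
    have n: "real N \<ge> 1" using N by simp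
    have lt: "0 < e1 / sqrt N" "e1 / sqrt N \<le> e1" using e1 n by (auto simp: field_simps)
    have e11: "e1 \<le> 1" by (simp add: e1_def)
    \<comment> \<open>The numerator sin b0 ensures e <= b0, and its square is at most 1/2 because b0
      <= pi/4; this gives sin^2 e <= 1/(2N).\<close>
    define e where "e = arcsin (e1 / sqrt N)"
    have se: "sin e = e1 / sqrt N" unfolding e_def using lt e11 by (intro sin_arcsin) auto
    have ab: "arcsin e1 = b0" unfolding e1_def using b0 by (intro arcsin_sin) auto
    have e: "0 < e" "e \<le> b0"
      unfolding e_def using lt e11 arcsin_le_arcsin[of "e1 / sqrt N" e1] arcsin_less_arcsin[of 0 "e1 / sqrt N"] by (auto simp: ab)
    have ce: "cos e > 0" using e b0 by (intro cos_pos) auto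
    have "(sin e)\<^sup>2 = e1\<^sup>2 / real N" unfolding se by (simp add: power_divide)
    also have "\<dots> \<le> (1/2) / real N" using e12 by (intro divide_right_mono) auto
    finally have s2: "(sin e)\<^sup>2 \<le> 1 / (2 * real N)" by simp
    have c: "cos e powr - (real N + 1/2 - real K) \<le> exp 2" "cos e powr - (real N - 1/2 - real K) \<le> exp 2"
      using N n by (intro cos_powr_bound[OF _ _ ce s2 n]; simp)+
    define X where "X = exp (- exp l - (real K + 1/2) * l)"
    \<comment> \<open>The second gamma term has one more factor exp(-l) <= 1 and is absorbed into
      the first.\<close>
    have "exp (- exp l - (real K + 1 + 1/2) * l) \<le> X" unfolding X_def using l by (simp add: l_def algebra_simps)
    then have X1: "M1 * exp (- exp l - (real K + 1 + 1/2) * l) \<le> M1 * X" using M1 by (intro mult_left_mono) auto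
    have eq: "real N - 1/2 - real K = real N + 1/2 - (real K + 1)" by simp
    have g1: "exp (- (real N + 1/2) * l) * Gamma (real N - 1/2 - real K) \<le> M1 * X"
      unfolding eq by (rule order_trans[OF M1(2) X1]) (use l N NP in \<open>auto simp: l_def\<close>)
    have g0: "exp (- (real N + 1/2) * l) * Gamma (real N + 1/2 - real K) \<le> M0 * X"
      unfolding X_def using M0(2)[of l N] l N NP by (simp add: l_def)
    have Np: "real N \<le> (1 + P) * exp l"
    proof -
      have "P * 1 \<le> P * exp l" using l P by (intro mult_left_mono) (auto simp: l_def)
      then show ?thesis using NP by (simp add: l_def distrib_right)
    qed
    then have "sqrt (real N) \<le> sqrt ((1 + P) * (exp (l/2))\<^sup>2)" by (simp add: power2_eq_square flip: exp_add)
    also have "\<dots> = sqrt (1 + P) * exp (l/2)" by (simp add: real_sqrt_mult)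
    finally have sN: "C / sin e \<le> A * exp (l/2)"
      unfolding se A_def using C e1 by (simp add: divide_right_mono mult_left_mono)
    have Gp: "Gamma (real N + 1/2 - real K) > 0" "Gamma (real N - 1/2 - real K) > 0" using N by (intro Gamma_real_pos; simp)+
    have "C * exp (- (real N + 1/2) * l) / sin e * (Gamma (real N + 1/2 - real K) * cos e powr (- (real N + 1/2 - real K)) + Gamma (real N - 1/2 - real K) * cos e powr (- (real N - 1/2 - real K)))
      = C / sin e * (exp (- (real N + 1/2) * l) * Gamma (real N + 1/2 - real K) * cos e powr (- (real N + 1/2 - real K)) + exp (- (real N + 1/2) * l) * Gamma (real N - 1/2 - real K) * cos e powr (- (real N - 1/2 - real K)))"
      by (simp add: algebra_simps add_divide_distrib)
    also have "\<dots> \<le> A * exp (l/2) * (M0 * X * exp 2 + M1 * X * exp 2)"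
      by (rule mult_mono[OF sN add_mono[OF mult_mono[OF g0 c(1)] mult_mono[OF g1 c(2)]]])
         (use A M0(1) M1(1) Gp in \<open>auto simp: X_def intro!: add_nonneg_nonneg mult_nonneg_nonneg\<close>)
    also have "\<dots> = A * (M0 + M1) * exp 2 * (exp (l/2) * X)" by (simp add: algebra_simps)
    also have "exp (l/2) * X = exp (- exp l - real K * l)" unfolding X_def exp_add[symmetric] by (simp add: algebra_simps)
    finally have "C * exp (- (real N + 1/2) * l) / sin e * (Gamma (real N + 1/2 - real K) * cos e powr (- (real N + 1/2 - real K)) + Gamma (real N - 1/2 - real K) * cos e powr (- (real N - 1/2 - real K)))
      \<le> A * (M0 + M1) * exp 2 * exp (- exp l - real K * l)" .
    then show "norm (continued_transform N sg) \<le> A * (M0 + M1) * exp 2 * exp (- exp (Re sg) - real K * Re sg)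
         + (if Im sg \<le> pi then 0 else 2 * pi * norm (residual_density K L (sg - of_real pi * \<i>)))"
      using continued_transform_bound[OF N im e] unfolding l_def by linarith
  qed
qed

end

text \<open>Subtracting L leaves the Stirling remainder at s - pi i, so the condition concerns Im s
  alone: bounding |Im s - pi| by a number below pi keeps it in a sector. The factor exp(-exp(z)) at
  z = s + L - pi i produces the cosine, because the shift by pi changes its sign.\<close>

lemma residual_density_decay:
  assumes "\<theta> < pi"
  obtains M where "M > 0"
    "\<And>s L. Re s \<ge> 0 \<Longrightarrow> \<bar>Im s - pi\<bar> \<le> \<theta> \<Longrightarrow>
       norm (residual_density K L (s + L - of_real pi * \<i>)) \<le> M * exp (exp (Re (s + L)) * cos (Im (s + L)) - real K * Re s)"
proof -
  define d where "d = min (pi/2) (pi - \<theta>)"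
  have d: "0 < d" "d \<le> pi/2" "\<theta> \<le> pi - d" using assms by (auto simp: d_def min_def)
  obtain C where C: "C > 0" "\<And>v. \<bar>Im v\<bar> \<le> pi - d \<Longrightarrow> norm (Stirling_remainder K v) \<le> C * (exp (- real K * Re v) + exp (- (real K + 1) * Re v))"
    using Stirling_remainder_bound[OF d(1,2)] by metis
  show ?thesis
  proof (rule that[of "2 * C"])
    fix s L assume s: "Re s \<ge> 0" "\<bar>Im s - pi\<bar> \<le> \<theta>"
    define v where "v = s - of_real pi * \<i>"
    have v: "\<bar>Im v\<bar> \<le> pi - d" "Re v = Re s" using s d by (auto simp: v_def)
    have "exp (- (real K + 1) * Re s) \<le> exp (- real K * Re s)" using s by (simp add: algebra_simps)
    then have "C * (exp (- real K * Re s) + exp (- (real K + 1) * Re s)) \<le> C * (2 * exp (- real K * Re s))"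
      using C(1) by (intro mult_left_mono) auto
    then have 1: "norm (Stirling_remainder K v) \<le> 2 * C * exp (- real K * Re s)"
      using C(2)[OF v(1)] unfolding v(2) by linarith
    have "norm (exp (- exp (s + L - of_real pi * \<i>))) = exp (exp (Re (s + L)) * cos (Im (s + L)))"
      by (simp add: Re_exp cos_diff)
    then have "norm (residual_density K L (s + L - of_real pi * \<i>)) \<le> exp (exp (Re (s + L)) * cos (Im (s + L))) * (2 * C * exp (- real K * Re s))"
      unfolding residual_density_def using 1 by (simp add: norm_mult v_def algebra_simps)
    also have "\<dots> = 2 * C * exp (exp (Re (s + L)) * cos (Im (s + L)) + (- real K * Re s))"
      by (simp only: exp_add mult_ac)
    finally show "norm (residual_density K L (s + L - of_real pi * \<i>)) \<le> 2 * C * exp (exp (Re (s + L)) * cos (Im (s + L)) - real K * Re s)"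
      by simp
  qed (use C in simp)
qed

section \<open>Assembly of the bounds in the two sectors\<close>

lemma norm_xi_ge_1: "norm (xi lam) \<ge> 1"
proof -
  have "pi \<le> norm (xi lam)" using abs_Im_le_cmod[of "xi lam"] by (simp add: xi_def)
  then show ?thesis using pi_gt3 by simp
qed

text \<open>Combines the decay of both continued transforms with their residues for phases from 0 up
  to B. The conjugation symmetry is exported as well, since its locale instances are constructed
  inside this proof.\<close>

lemma reexp_remainder_upper_bound:
  assumes lam: "lam > 0" and P: "P \<ge> 0" and B: "B < 2 * pi"
  obtains M where "M > 0"
    "\<And>s N. Re s \<ge> 0 \<Longrightarrow> N \<ge> K + 1 \<Longrightarrow> \<bar>real N - norm (exp s * xi lam)\<bar> \<le> P \<Longrightarrow> 0 \<le> Im s \<Longrightarrow> Im s \<le> B \<Longrightarrow>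
       norm (reexp_remainder N K lam s) \<le> M * exp (- (real K + 1/2) * Re s) *
         (exp (- norm (exp s * xi lam)) + (if Im s + omega lam \<le> pi then 0 else exp (norm (exp s * xi lam) * cos (Im s + omega lam))))"
    "\<And>s N. N \<ge> K + 1 \<Longrightarrow> reexp_remainder N K lam (cnj s) = cnj (reexp_remainder N K lam s)"
proof -
  define w where "w = omega lam"
  have w: "0 < w" "w < pi" using omega_bounds[of lam] by (auto simp: w_def)
  define Lp where "Lp = Ln (xi lam)"
  define Lm where "Lm = Ln (cnj (xi lam))"
  have im: "Im Lp = w" "Im Lm = - w" by (simp_all add: Lp_def Lm_def w_def Im_Ln_xi(1,2))
  have xi0: "xi lam \<noteq> 0" using norm_xi_ge_1[of lam] by auto
  have re: "Re Lp = ln (norm (xi lam))" "Re Lm = ln (norm (xi lam))" using xi0 by (simp_all add: Lp_def Lm_def)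
  obtain b1 C1 where "0 < b1" "b1 \<le> pi/4" "\<bar>Im Lp\<bar> + b1 < pi" "C1 > 0"
    "\<And>b x. \<bar>b\<bar> \<le> b1 \<Longrightarrow> norm (residual_density K Lp (Complex x b)) \<le> C1 * (exp (- cos b * exp x) * (exp (- real K * x) + exp (- (real K + 1) * x)))"
    using residual_density_bound[of Lp K] w im by auto
  then interpret p: rotation K Lp b1 C1 by unfold_locales
  obtain b2 C2 where "0 < b2" "b2 \<le> pi/4" "\<bar>Im Lm\<bar> + b2 < pi" "C2 > 0"
    "\<And>b x. \<bar>b\<bar> \<le> b2 \<Longrightarrow> norm (residual_density K Lm (Complex x b)) \<le> C2 * (exp (- cos b * exp x) * (exp (- real K * x) + exp (- (real K + 1) * x)))"
    using residual_density_bound[of Lm K] w im by auto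
  then interpret m: rotation K Lm b2 C2 by unfold_locales
  have rot: "rotation K (Ln (xi lam)) b1 C1" "rotation K (Ln (cnj (xi lam))) b2 C2"
    using p.rotation_axioms m.rotation_axioms by (simp_all add: Lp_def Lm_def)
  obtain Mp where Mp: "Mp > 0" "\<And>N sg. N \<ge> K + 1 \<Longrightarrow> Re sg \<ge> 0 \<Longrightarrow> \<bar>real N - exp (Re sg)\<bar> \<le> P \<Longrightarrow> - pi < Im sg \<Longrightarrow> Im sg < 3 * pi \<Longrightarrow>
       norm (p.continued_transform N sg) \<le> Mp * exp (- exp (Re sg) - real K * Re sg)
         + (if Im sg \<le> pi then 0 else 2 * pi * norm (residual_density K Lp (sg - of_real pi * \<i>)))"
    using p.continued_transform_decay[OF P] by blast
  obtain Mm where Mm: "Mm > 0" "\<And>N sg. N \<ge> K + 1 \<Longrightarrow> Re sg \<ge> 0 \<Longrightarrow> \<bar>real N - exp (Re sg)\<bar> \<le> P \<Longrightarrow> - pi < Im sg \<Longrightarrow> Im sg < 3 * pi \<Longrightarrow>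
       norm (m.continued_transform N sg) \<le> Mm * exp (- exp (Re sg) - real K * Re sg)
         + (if Im sg \<le> pi then 0 else 2 * pi * norm (residual_density K Lm (sg - of_real pi * \<i>)))"
    using m.continued_transform_decay[OF P] by blast
  \<comment> \<open>A residue appears only when Im(s + L) > pi, which forces Im s > pi - w; together
    with Im s <= B this bounds |Im s - pi|.\<close>
  define \<theta> where "\<theta> = max w (B - pi)"
  have "\<theta> < pi" using w B by (simp add: \<theta>_def)
  then obtain Mr where Mr: "Mr > 0" "\<And>s L. Re s \<ge> 0 \<Longrightarrow> \<bar>Im s - pi\<bar> \<le> \<theta> \<Longrightarrow>
       norm (residual_density K (L :: complex) (s + L - of_real pi * \<i>)) \<le> Mr * exp (exp (Re (s + L)) * cos (Im (s + L)) - real K * Re s)"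
    using residual_density_decay[of \<theta> K] by blast
  define c where "c = sqrt (2 * pi) / (2 * pi)"
  have c: "c > 0" by (simp add: c_def)
  define M where "M = c * (Mp + Mm + 4 * pi * Mr)"
  show ?thesis
  proof (rule that[of M])
    show "M > 0" using c Mp Mm Mr by (simp add: M_def add_pos_pos)
    show "reexp_remainder N K lam (cnj s) = cnj (reexp_remainder N K lam s)" if "N \<ge> K + 1" for s N
      by (rule cnj_reexp_remainder[OF lam that rot])
    fix s N assume s: "Re s \<ge> 0" "0 \<le> Im s" "Im s \<le> B" and N: "N \<ge> K + 1" "\<bar>real N - norm (exp s * xi lam)\<bar> \<le> P"
    define W where "W = norm (exp s * xi lam)"
    define D where "D = (if Im s + w \<le> pi then 0 else exp (W * cos (Im s + w)))"
    have D0: "D \<ge> 0" by (simp add: D_def)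
    define E where "E = exp (- real K * Re s)"
    have E0: "E > 0" by (simp add: E_def)
    have ln0: "ln (norm (xi lam)) \<ge> 0" using norm_xi_ge_1[of lam] by simp
    have eW: "exp (Re (s + Lp)) = W" "exp (Re (s + Lm)) = W"
      using xi0 by (simp_all add: re exp_add W_def norm_mult)
    \<comment> \<open>The modulus of xi is at least 1, so its power to the -K may be
      dropped.\<close>
    have main: "exp (- W - real K * Re (s + L)) \<le> exp (- W) * E" if "L = Lp \<or> L = Lm" for L
    proof -
      have "real K * ln (norm (xi lam)) \<ge> 0" using ln0 by simp
      then have "- W - real K * Re (s + L) \<le> - W + - real K * Re s" using that by (auto simp: re distrib_left)
      then show ?thesis unfolding E_def exp_add[symmetric] by simp
    qed
    have resid: "norm (residual_density K L (s + L - of_real pi * \<i>)) \<le> Mr * (D * E)"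
      if L: "L = Lp \<or> L = Lm" "Im (s + L) > pi" for L
    proof -
      have th: "\<bar>Im s - pi\<bar> \<le> \<theta>" and big: "Im s + w > pi" using L w s im unfolding \<theta>_def by (auto simp: max_def abs_if)
      \<comment> \<open>The second saddle contributes a residue only when Im s > pi + w. There
        sin(Im s) <= 0, so cos(Im s - w) <= cos(Im s + w), and the first saddle dominates.\<close>
      have "cos (Im (s + L)) \<le> cos (Im s + w)"
      proof (cases "L = Lp")
        case False
        then have "L = Lm" "Im s - w > pi" using L im by auto
        then have "sin (Im s) \<le> 0" using w s B by (intro sin_le_zero) auto
        then have "sin (Im s) * sin w \<le> 0" using sin_gt_zero[OF w] by (simp add: mult_nonpos_nonneg)
        then show ?thesis using \<open>L = Lm\<close> im by (simp add: cos_add cos_diff)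
      qed (use im in simp)
      moreover have "W \<ge> 0" by (simp add: W_def)
      ultimately have "exp (Re (s + L)) * cos (Im (s + L)) - real K * Re s \<le> W * cos (Im s + w) + - real K * Re s"
        using L eW mult_left_mono by fastforce
      then have "exp (exp (Re (s + L)) * cos (Im (s + L)) - real K * Re s) \<le> D * E"
        unfolding D_def E_def using big by (simp flip: exp_add)
      then show ?thesis using Mr(1) by (intro order_trans[OF Mr(2)[OF s(1) th]] mult_left_mono) auto
    qed
    have res: "(if Im (s + L) \<le> pi then 0 else 2 * pi * norm (residual_density K L (s + L - of_real pi * \<i>))) \<le> 2 * pi * (Mr * (D * E))"
      if "L = Lp \<or> L = Lm" for L
      using resid[OF that] Mr(1) D0 E0 by (auto intro!: mult_nonneg_nonneg)
    have ranges: "Re (s + Lp) \<ge> 0" "Re (s + Lm) \<ge> 0" "- pi < Im (s + Lp)" "Im (s + Lp) < 3 * pi" "- pi < Im (s + Lm)" "Im (s + Lm) < 3 * pi"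
      using s w ln0 B by (simp_all add: re im)
    have NW: "\<bar>real N - W\<bar> \<le> P" using N(2) by (simp add: W_def)
    have bp: "norm (p.continued_transform N (s + Lp)) \<le> Mp * (exp (- W) * E) + 2 * pi * (Mr * (D * E))"
    proof -
      have "norm (p.continued_transform N (s + Lp)) \<le> Mp * exp (- W - real K * Re (s + Lp)) + (if Im (s + Lp) \<le> pi then 0 else 2 * pi * norm (residual_density K Lp (s + Lp - of_real pi * \<i>)))"
        using Mp(2)[of N "s + Lp"] N(1) NW ranges unfolding eW by simp
      also have "\<dots> \<le> Mp * (exp (- W) * E) + 2 * pi * (Mr * (D * E))"
        using Mp(1) by (intro add_mono mult_left_mono main res) auto
      finally show ?thesis .
    qed
    have bm: "norm (m.continued_transform N (s + Lm)) \<le> Mm * (exp (- W) * E) + 2 * pi * (Mr * (D * E))"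
    proof -
      have "norm (m.continued_transform N (s + Lm)) \<le> Mm * exp (- W - real K * Re (s + Lm)) + (if Im (s + Lm) \<le> pi then 0 else 2 * pi * norm (residual_density K Lm (s + Lm - of_real pi * \<i>)))"
        using Mm(2)[of N "s + Lm"] N(1) NW ranges unfolding eW by simp
      also have "\<dots> \<le> Mm * (exp (- W) * E) + 2 * pi * (Mr * (D * E))"
        using Mm(1) by (intro add_mono mult_left_mono main res) auto
      finally show ?thesis .
    qed
    have "reexp_remainder N K lam s = (-1) ^ (N + 1) * of_real (sqrt (2 * pi)) / (2 * of_real pi * \<i>) * exp (- s / 2) *
        (p.continued_transform N (s + Lp) - m.continued_transform N (s + Lm))"
      unfolding Lp_def Lm_def by (rule reexp_remainder_eq[OF lam N(1) rot]) (use s w B in \<open>auto simp: w_def\<close>)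
    then have "norm (reexp_remainder N K lam s) = c * exp (- Re s / 2) * norm (p.continued_transform N (s + Lp) - m.continued_transform N (s + Lm))"
      by (simp add: norm_mult norm_divide norm_power c_def)
    also have "\<dots> \<le> c * exp (- Re s / 2) * ((Mp * (exp (- W) * E) + 2 * pi * (Mr * (D * E))) + (Mm * (exp (- W) * E) + 2 * pi * (Mr * (D * E))))"
      using bp bm c by (intro mult_left_mono norm_triangle_le_diff add_mono) auto
    also have "\<dots> = c * ((Mp + Mm) * exp (- W) + 4 * pi * Mr * D) * (E * exp (- Re s / 2))" by (simp add: algebra_simps)
    also have "E * exp (- Re s / 2) = exp (- (real K + 1/2) * Re s)" unfolding E_def exp_add[symmetric] by (simp add: algebra_simps)
    also have "c * ((Mp + Mm) * exp (- W) + 4 * pi * Mr * D) \<le> M * (exp (- W) + D)"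
    proof -
      define Q where "Q = Mp + Mm + 4 * pi * Mr"
      have "(Mp + Mm) * exp (- W) + 4 * pi * Mr * D \<le> Q * exp (- W) + Q * D"
        unfolding Q_def by (rule add_mono; rule mult_right_mono) (use Mp(1) Mm(1) Mr(1) D0 in auto)
      then have "c * ((Mp + Mm) * exp (- W) + 4 * pi * Mr * D) \<le> c * (Q * exp (- W) + Q * D)" using c by (intro mult_left_mono) auto
      also have "\<dots> = c * Q * (exp (- W) + D)" by (simp add: algebra_simps)
      finally show ?thesis unfolding M_def Q_def .
    qed
    finally show "norm (reexp_remainder N K lam s) \<le> M * exp (- (real K + 1/2) * Re s) *
         (exp (- norm (exp s * xi lam)) + (if Im s + omega lam \<le> pi then 0 else exp (norm (exp s * xi lam) * cos (Im s + omega lam))))"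
      unfolding D_def W_def w_def by (simp add: mult_ac)
  qed
qed

text \<open>Separates the two-term bound according to the phase and replaces the conditions on Re s
  and N by largeness of |exp s|.\<close>

lemma reexp_remainder_sector_bounds:
  assumes lam: "lam > 0" and B: "B < 2 * pi"
  obtains C r0 where "\<And>s N \<rho>. norm (exp s) \<ge> r0 \<Longrightarrow> real N = norm (exp s * xi lam) + \<rho> \<Longrightarrow> \<bar>\<rho>\<bar> \<le> P \<Longrightarrow>
        0 \<le> Im s \<Longrightarrow> Im s \<le> - omega lam + pi \<Longrightarrow>
        norm (reexp_remainder N K lam s) \<le> C * (exp (- norm (exp s * xi lam)) / norm (exp s) powr (real K + 1 / 2))"
    "\<And>s N \<rho>. norm (exp s) \<ge> r0 \<Longrightarrow> real N = norm (exp s * xi lam) + \<rho> \<Longrightarrow> \<bar>\<rho>\<bar> \<le> P \<Longrightarrow>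
        - omega lam + pi \<le> Im s \<Longrightarrow> Im s \<le> B \<Longrightarrow>
        norm (reexp_remainder N K lam s) \<le> C * (exp (norm (exp s * xi lam) * cos (Im s + omega lam)) / norm (exp s) powr (real K + 1 / 2))"
    "\<And>s N \<rho>. norm (exp s) \<ge> r0 \<Longrightarrow> real N = norm (exp s * xi lam) + \<rho> \<Longrightarrow> \<bar>\<rho>\<bar> \<le> P \<Longrightarrow>
        norm (reexp_remainder N K lam (cnj s)) = norm (reexp_remainder N K lam s)"
proof -
  \<comment> \<open>Enlarging B to at least pi covers the first sector, which ends below pi.\<close>
  define B' where "B' = max B pi"
  have B': "B' < 2 * pi" "B \<le> B'" "pi \<le> B'" using B pi_gt_zero by (auto simp: B'_def)
  have w: "0 < omega lam" "omega lam < pi" by (rule omega_bounds)+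
  obtain M where M: "M > 0" and bound: "\<And>s N. Re s \<ge> 0 \<Longrightarrow> N \<ge> K + 1 \<Longrightarrow> \<bar>real N - norm (exp s * xi lam)\<bar> \<le> \<bar>P\<bar> \<Longrightarrow> 0 \<le> Im s \<Longrightarrow> Im s \<le> B' \<Longrightarrow>
       norm (reexp_remainder N K lam s) \<le> M * exp (- (real K + 1/2) * Re s) *
         (exp (- norm (exp s * xi lam)) + (if Im s + omega lam \<le> pi then 0 else exp (norm (exp s * xi lam) * cos (Im s + omega lam))))"
    and sym: "\<And>s N. N \<ge> K + 1 \<Longrightarrow> reexp_remainder N K lam (cnj s) = cnj (reexp_remainder N K lam s)"
    using reexp_remainder_upper_bound[OF lam _ B'(1), of "\<bar>P\<bar>" K] by auto
  \<comment> \<open>As the modulus of xi is at least 1, N >= |exp s| - |P| >= K + 1; also |exp s| >=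
    1, hence Re s >= 0.\<close>
  define r0 where "r0 = real K + 1 + \<bar>P\<bar>"
  have large: "Re s \<ge> 0" "N \<ge> K + 1" "\<bar>real N - norm (exp s * xi lam)\<bar> \<le> \<bar>P\<bar>"
    if "norm (exp s) \<ge> r0" "real N = norm (exp s * xi lam) + \<rho>" "\<bar>\<rho>\<bar> \<le> P" for s N \<rho>
  proof -
    have "exp (Re s) \<ge> 1" using that(1) unfolding r0_def norm_exp_eq_Re by linarith
    then show "Re s \<ge> 0" by simp
    have "norm (exp s) * 1 \<le> norm (exp s * xi lam)" unfolding norm_mult using norm_xi_ge_1 by (intro mult_left_mono) auto
    then have "real N \<ge> real K + 1" using that unfolding r0_def by linarith
    then show "N \<ge> K + 1" by linarith
    show "\<bar>real N - norm (exp s * xi lam)\<bar> \<le> \<bar>P\<bar>" using that by simp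
  qed
  have pw: "exp (- (real K + 1/2) * Re s) * X = X / norm (exp s) powr (real K + 1/2)" for s X
  proof -
    have "norm (exp s) powr (real K + 1/2) = exp ((real K + 1/2) * Re s)" by (simp add: powr_def)
    moreover have "exp (- (real K + 1/2) * Re s) = inverse (exp ((real K + 1/2) * Re s))"
      unfolding mult_minus_left by (rule exp_minus)
    ultimately show ?thesis by (simp only: divide_inverse mult.commute)
  qed
  show ?thesis
  proof (rule that[of r0 "2 * M"])
    fix s N \<rho> assume a: "norm (exp s) \<ge> r0" "real N = norm (exp s * xi lam) + \<rho>" "\<bar>\<rho>\<bar> \<le> P"
    note l = large[OF a]
    define W where "W = norm (exp s * xi lam)"
    show "norm (reexp_remainder N K lam (cnj s)) = norm (reexp_remainder N K lam s)" using sym[OF l(2)] by simp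
    show "norm (reexp_remainder N K lam s) \<le> 2 * M * (exp (- norm (exp s * xi lam)) / norm (exp s) powr (real K + 1 / 2))"
      if "0 \<le> Im s" "Im s \<le> - omega lam + pi"
    proof -
      have "Im s \<le> B'" using that w B' by simp
      then have "norm (reexp_remainder N K lam s) \<le> M * (exp (- (real K + 1/2) * Re s) * exp (- W))"
        using bound[OF l(1,2,3) that(1)] that(2) by (simp add: W_def mult.assoc)
      also have "\<dots> \<le> 2 * M * (exp (- (real K + 1/2) * Re s) * exp (- W))" using M by (intro mult_right_mono) auto
      finally show ?thesis unfolding pw W_def .
    qed
    show "norm (reexp_remainder N K lam s) \<le> 2 * M * (exp (norm (exp s * xi lam) * cos (Im s + omega lam)) / norm (exp s) powr (real K + 1 / 2))"
      if "- omega lam + pi \<le> Im s" "Im s \<le> B"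
    proof -
      \<comment> \<open>A cosine is at least -1, so exp(-W) is at most the residue's bound and both
        terms merge into twice the latter.\<close>
      have dominated: "x + (if b then 0 else y) \<le> 2 * y" if "x \<le> y" "0 \<le> y" for x y :: real and b using that by simp
      have "W * (- 1) \<le> W * cos (Im s + omega lam)" by (intro mult_left_mono) (auto simp: W_def)
      then have "exp (- W) + (if Im s + omega lam \<le> pi then 0 else exp (W * cos (Im s + omega lam))) \<le> 2 * exp (W * cos (Im s + omega lam))"
        by (intro dominated) auto
      then have "M * exp (- (real K + 1/2) * Re s) * (exp (- W) + (if Im s + omega lam \<le> pi then 0 else exp (W * cos (Im s + omega lam))))
          \<le> M * exp (- (real K + 1/2) * Re s) * (2 * exp (W * cos (Im s + omega lam)))" using M by (intro mult_left_mono) auto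
      moreover have "norm (reexp_remainder N K lam s) \<le> M * exp (- (real K + 1/2) * Re s) * (exp (- W) + (if Im s + omega lam \<le> pi then 0 else exp (W * cos (Im s + omega lam))))"
        unfolding W_def by (rule bound[OF l(1,2,3)]) (use that w B' in auto)
      moreover have "M * exp (- (real K + 1/2) * Re s) * (2 * exp (W * cos (Im s + omega lam))) = 2 * M * (exp (- (real K + 1/2) * Re s) * exp (W * cos (Im s + omega lam)))" by (simp only: mult_ac)
      ultimately show ?thesis unfolding pw W_def by linarith
    qed
  qed
qed

theorem theorem5p1:
  fixes K :: nat and lam P :: real
  assumes "lam > 0"
  shows
    "(\<exists>C r0. \<forall>(s::complex) (N::nat) (\<rho>::real).
        norm (exp s) \<ge> r0 \<longrightarrow> N > 0 \<longrightarrow> real N = norm (exp s * xi lam) + \<rho> \<longrightarrow> \<bar>\<rho>\<bar> \<le> P \<longrightarrow>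
        \<bar>Im s\<bar> \<le> - omega lam + pi \<longrightarrow>
          norm (reexp_remainder N K lam s)
            \<le> C * (exp (- norm (exp s * xi lam)) / norm (exp s) powr (real K + 1 / 2)))
     \<and>
     (\<forall>\<delta>>0. max (omega lam + pi) (2 * pi - \<delta>) < 2 * pi \<longrightarrow>
       (\<exists>C r0. \<forall>(s::complex) (N::nat) (\<rho>::real).
          norm (exp s) \<ge> r0 \<longrightarrow> N > 0 \<longrightarrow> real N = norm (exp s * xi lam) + \<rho> \<longrightarrow> \<bar>\<rho>\<bar> \<le> P \<longrightarrow>
          (- omega lam + pi \<le> Im s \<and> Im s \<le> max (omega lam + pi) (2 * pi - \<delta>) \<longrightarrow>
            norm (reexp_remainder N K lam s)
              \<le> C * (exp (norm (exp s * xi lam) * cos (Im s + omega lam))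
                      / norm (exp s) powr (real K + 1 / 2))) \<and>
          (- omega lam + pi \<le> - Im s \<and> - Im s \<le> max (omega lam + pi) (2 * pi - \<delta>) \<longrightarrow>
            norm (reexp_remainder N K lam s)
              \<le> C * (exp (norm (exp s * xi lam) * cos (Im s - omega lam))
                      / norm (exp s) powr (real K + 1 / 2)))))"
proof -
  have W: "norm (exp (cnj s) * xi lam) = norm (exp s * xi lam)" "norm (exp (cnj s)) = norm (exp s)" for s
    by (simp_all add: norm_mult)
  show ?thesis
  proof (intro conjI allI impI)
    \<comment> \<open>The first estimate involves no delta, so the fixed bound B = pi serves as the
      instance.\<close>
    have "pi < 2 * pi" by simp
    from reexp_remainder_sector_bounds[OF assms this, of P K] obtain C r0 where
      b: "\<And>s N \<rho>. norm (exp s) \<ge> r0 \<Longrightarrow> real N = norm (exp s * xi lam) + \<rho> \<Longrightarrow> \<bar>\<rho>\<bar> \<le> P \<Longrightarrow>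
        0 \<le> Im s \<Longrightarrow> Im s \<le> - omega lam + pi \<Longrightarrow>
        norm (reexp_remainder N K lam s) \<le> C * (exp (- norm (exp s * xi lam)) / norm (exp s) powr (real K + 1 / 2))"
      and c: "\<And>s N \<rho>. norm (exp s) \<ge> r0 \<Longrightarrow> real N = norm (exp s * xi lam) + \<rho> \<Longrightarrow> \<bar>\<rho>\<bar> \<le> P \<Longrightarrow>
        norm (reexp_remainder N K lam (cnj s)) = norm (reexp_remainder N K lam s)" by metis
    show "\<exists>C r0. \<forall>(s::complex) (N::nat) (\<rho>::real).
        norm (exp s) \<ge> r0 \<longrightarrow> N > 0 \<longrightarrow> real N = norm (exp s * xi lam) + \<rho> \<longrightarrow> \<bar>\<rho>\<bar> \<le> P \<longrightarrow>
        \<bar>Im s\<bar> \<le> - omega lam + pi \<longrightarrow>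
          norm (reexp_remainder N K lam s)
            \<le> C * (exp (- norm (exp s * xi lam)) / norm (exp s) powr (real K + 1 / 2))"
    proof (intro exI allI impI)
      fix s :: complex and N :: nat and \<rho> :: real
      assume a: "norm (exp s) \<ge> r0" "real N = norm (exp s * xi lam) + \<rho>" "\<bar>\<rho>\<bar> \<le> P" "\<bar>Im s\<bar> \<le> - omega lam + pi"
      show "norm (reexp_remainder N K lam s) \<le> C * (exp (- norm (exp s * xi lam)) / norm (exp s) powr (real K + 1 / 2))"
        using b[of s N \<rho>] b[of "cnj s" N \<rho>] c[of s N \<rho>] a unfolding W by (cases "0 \<le> Im s") auto
    qed
  next
    fix \<delta> :: real assume B: "max (omega lam + pi) (2 * pi - \<delta>) < 2 * pi"
    define B where "B = max (omega lam + pi) (2 * pi - \<delta>)"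
    have "B < 2 * pi" using B by (simp add: B_def)
    from reexp_remainder_sector_bounds[OF assms this, of P K] obtain C r0 where
      b: "\<And>s N \<rho>. norm (exp s) \<ge> r0 \<Longrightarrow> real N = norm (exp s * xi lam) + \<rho> \<Longrightarrow> \<bar>\<rho>\<bar> \<le> P \<Longrightarrow>
        - omega lam + pi \<le> Im s \<Longrightarrow> Im s \<le> B \<Longrightarrow>
        norm (reexp_remainder N K lam s) \<le> C * (exp (norm (exp s * xi lam) * cos (Im s + omega lam)) / norm (exp s) powr (real K + 1 / 2))"
      and c: "\<And>s N \<rho>. norm (exp s) \<ge> r0 \<Longrightarrow> real N = norm (exp s * xi lam) + \<rho> \<Longrightarrow> \<bar>\<rho>\<bar> \<le> P \<Longrightarrow>
        norm (reexp_remainder N K lam (cnj s)) = norm (reexp_remainder N K lam s)" by metis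
    show "\<exists>C r0. \<forall>(s::complex) (N::nat) (\<rho>::real).
          norm (exp s) \<ge> r0 \<longrightarrow> N > 0 \<longrightarrow> real N = norm (exp s * xi lam) + \<rho> \<longrightarrow> \<bar>\<rho>\<bar> \<le> P \<longrightarrow>
          (- omega lam + pi \<le> Im s \<and> Im s \<le> max (omega lam + pi) (2 * pi - \<delta>) \<longrightarrow>
            norm (reexp_remainder N K lam s)
              \<le> C * (exp (norm (exp s * xi lam) * cos (Im s + omega lam))
                      / norm (exp s) powr (real K + 1 / 2))) \<and>
          (- omega lam + pi \<le> - Im s \<and> - Im s \<le> max (omega lam + pi) (2 * pi - \<delta>) \<longrightarrow>
            norm (reexp_remainder N K lam s)
              \<le> C * (exp (norm (exp s * xi lam) * cos (Im s - omega lam))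
                      / norm (exp s) powr (real K + 1 / 2)))"
      unfolding B_def[symmetric]
    proof (intro exI allI impI conjI; elim conjE)
      fix s :: complex and N :: nat and \<rho> :: real
      assume a: "norm (exp s) \<ge> r0" "real N = norm (exp s * xi lam) + \<rho>" "\<bar>\<rho>\<bar> \<le> P"
      show "norm (reexp_remainder N K lam s) \<le> C * (exp (norm (exp s * xi lam) * cos (Im s + omega lam)) / norm (exp s) powr (real K + 1 / 2))"
        if "- omega lam + pi \<le> Im s" "Im s \<le> B" using b[OF a that] .
      have "cos (- Im s + omega lam) = cos (Im s - omega lam)" using cos_minus[of "Im s - omega lam"] by simp
      then show "norm (reexp_remainder N K lam s) \<le> C * (exp (norm (exp s * xi lam) * cos (Im s - omega lam)) / norm (exp s) powr (real K + 1 / 2))"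
        if "- omega lam + pi \<le> - Im s" "- Im s \<le> B" using b[of "cnj s" N \<rho>] c[OF a] a that unfolding W by simp
    qed
  qed
qed

end
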